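(* Let $G=\mathrm{SO}(2,n)$ with $n\ge 3$, realized as in the context, with $N$ the group of unipotent upper-triangular matrices in $G$. Elements of the Lie algebra $\mathfrak n$ of $N$ are written $(\phi,x,y,\eta)$ with $\phi,\eta\in\mathbb{R}$, $x,y\in\mathbb{R}^{n-2}$. (A) If $n\ge 5$, then there are exactly 6 non-conjugate minimal Cartan-decomposition subgroups of $G$ contained in $N$ (that is, exactly 6 conjugacy classes). Each such subgroup $H$ is conjugate to a subgroup of $\mathrm{SO}(2,5)$ and, as a subalgebra of $\mathfrak{so}(2,5)$ (so that $x,y\in\mathbb{R}^3$), the Lie algebra of $H$ is conjugate to one of the following six subalgebras: (1) $\{(\phi,x,y,\eta) : \phi,\eta\in\mathbb{R},\ x=0,\ y=(\epsilon_1\phi,0,0)\}$, where $\epsilon_1\in\{0,1\}$; (2) $\{(\phi,x,y,\eta) : \phi,s\in\mathbb{R},\ x=(s,0,0),\ y=(0,\epsilon_2\phi,0),\ \eta=0\}$, where $\epsilon_2\in\{0,1\}$; (3) $\{(\phi,x,y,\eta) : s,r\in\mathbb{R},\ \phi=0,\ x=(s,0,\epsilon_3 r),\ y=(0,r,0),\ \eta=0\}$, where $\epsilon_3\in\{0,1\}$. (B) There are exactly 5 non-conjugate minimal Cartan-decomposition subgroups of $\mathrm{SO}(2,4)$ contained in $N$. The Lie algebra of any such subgroup is conjugate either to one of the two subalgebras of type (1), or to one of the two subalgebras of type (2), or to the subalgebra of type (3) with $\epsilon_3=0$ (in each case dropping the third coordinate of $x$ and $y$, which is identically $0$, so that the subalgebra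 lies in $\mathfrak{so}(2,4)$). (C) There are exactly 3 non-conjugate minimal Cartan-decomposition subgroups of $\mathrm{SO}(2,3)$ contained in $N$. The Lie algebra of any such subgroup is conjugate either to one of the two subalgebras of type (1), or to the subalgebra of type (2) with $\epsilon_2=0$ (in each case dropping the second and third coordinates of $x$ and $y$, which are identically $0$, so that the subalgebra lies in $\mathfrak{so}(2,3)$).
   Context: A closed subgroup $H$ of $G$ is a Cartan-decomposition subgroup of $G$ if $H$ is connected and there is a compact subset $C$ of $G$ (not necessarily a subgroup) with $CHC=G$. It is minimal if it does not properly contain another Cartan-decomposition subgroup of $G$. $\mathrm{SO}(2,n)$ is the group of determinant-one linear isometries of the quadratic form $\langle v\mid v\rangle=2v_1v_{n+2}+2v_2v_{n+1}+\sum_{i=3}^n v_i^2$ on $\mathbb{R}^{n+2}$. $N$ is the group of upper-triangular matrices in $\mathrm{SO}(2,n)$ with all diagonal entries $1$. Its Lie algebra $\mathfrak n$ consists of the matrices (block sizes $1,1,n-2,1,1$) $$(\phi,x,y,\eta):=\begin{pmatrix}0&\phi&x&\eta&0\\0&0&y&0&-\eta\\0&0&0&-y^T&-x^T\\0&0&0&0&-\phi\\0&0&0&0&0\end{pmatrix},\qquad \phi,\eta\in\mathbb{R},\ x,y\in\mathbb{R}^{n-2}\text{ (row vectors)}.$$ For $m<n$, $\mathrm{SO}(2,m)$ is regarded as a subgroup of $\mathrm{SO}(2,n)$ via the embedding induced by the inclusion $\mathbb{R}^{m+2}\hookrightarrow\mathbb{R}^{n+2}$; on nilpotent Lie algebras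 this sends $(\phi,x,y,\eta)$ with $x,y\in\mathbb{R}^{m-2}$ to the element with the same $\phi,\eta$ and with $x,y$ extended by zeros to $\mathbb{R}^{n-2}$. *)

theory Defs
  imports
    "HOL-Analysis.Function_Topology"
    "HOL-Algebra.Coset"
    "Jordan_Normal_Form.Determinant"
begin

text \<open>
  Rows, columns and vector entries are numbered from \<open>0\<close>, so that the basis vectors
  \<open>e_1, \<dots>, e_{n+2}\<close> of the usual notation have the indices \<open>0, \<dots>, n + 1\<close>.
\<close>

definition qform :: "nat \<Rightarrow> real vec \<Rightarrow> real" where
  "qform n v = 2 * v $ 0 * v $ (n + 1) + 2 * v $ 1 * v $ n + (\<Sum>i\<in>{2..<n}. (v $ i)\<^sup>2)"

definition SO2 :: "nat \<Rightarrow> real mat monoid" where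
  "SO2 n =
     \<lparr> carrier = {A \<in> carrier_mat (n + 2) (n + 2).
                    det A = 1 \<and> (\<forall>v\<in>carrier_vec (n + 2). qform n (A *\<^sub>v v) = qform n v)},
       monoid.mult = (*),
       monoid.one = 1\<^sub>m (n + 2) \<rparr>"

text \<open>
  The Euclidean topology of the space of \<open>m \<times> m\<close> matrices, i.e. the topology of
  entrywise convergence.
\<close>

definition mat_topology :: "nat \<Rightarrow> real mat topology" where
  "mat_topology m =
     pullback_topology (carrier_mat m m)
       (\<lambda>A. restrict (\<lambda>p. A $$ p) ({..<m} \<times> {..<m}))
       (product_topology (\<lambda>_. euclideanreal) ({..<m} \<times> {..<m}))"

definition SO2_topology :: "nat \<Rightarrow> real mat topology" where
  "SO2_topology n = subtopology (mat_topology (n + 2)) (carrier (SO2 n))"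

definition unipotent_N :: "nat \<Rightarrow> real mat set" where
  "unipotent_N n =
     {A \<in> carrier (SO2 n). upper_triangular A \<and> (\<forall>i<n + 2. A $$ (i, i) = 1)}"

definition cartan_decomposition_subgroup :: "nat \<Rightarrow> real mat set \<Rightarrow> bool" where
  "cartan_decomposition_subgroup n H \<longleftrightarrow>
     subgroup H (SO2 n) \<and> closedin (SO2_topology n) H \<and> connectedin (SO2_topology n) H \<and>
     (\<exists>C. compactin (SO2_topology n) C \<and>
          C <#>\<^bsub>SO2 n\<^esub> H <#>\<^bsub>SO2 n\<^esub> C = carrier (SO2 n))"

definition minimal_cds :: "nat \<Rightarrow> real mat set \<Rightarrow> bool" where
  "minimal_cds n H \<longleftrightarrow>
     cartan_decomposition_subgroup n H \<and>
     \<not> (\<exists>H'. cartan_decomposition_subgroup n H' \<and> H' \<subset> H)"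

definition minimal_cds_in_N :: "nat \<Rightarrow> real mat set set" where
  "minimal_cds_in_N n = {H. minimal_cds n H \<and> H \<subseteq> unipotent_N n}"

definition conj_subgroups :: "nat \<Rightarrow> real mat set \<Rightarrow> real mat set \<Rightarrow> bool" where
  "conj_subgroups n H K \<longleftrightarrow>
     (\<exists>g\<in>carrier (SO2 n). K = g <#\<^bsub>SO2 n\<^esub> (H #>\<^bsub>SO2 n\<^esub> inv\<^bsub>SO2 n\<^esub> g))"

definition minimal_cds_classes :: "nat \<Rightarrow> real mat set set set" where
  "minimal_cds_classes n =
     minimal_cds_in_N n //
       {(H, K). H \<in> minimal_cds_in_N n \<and> K \<in> minimal_cds_in_N n \<and> conj_subgroups n H K}"

definition mat_exp :: "real mat \<Rightarrow> real mat" where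
  "mat_exp A = mat (dim_row A) (dim_col A) (\<lambda>p. \<Sum>k. (A ^\<^sub>m k) $$ p / fact k)"

definition lie_algebra :: "nat \<Rightarrow> real mat set \<Rightarrow> real mat set" where
  "lie_algebra n H = {X \<in> carrier_mat (n + 2) (n + 2). \<forall>t. mat_exp (t \<cdot>\<^sub>m X) \<in> H}"

definition conj_subalgebras :: "nat \<Rightarrow> real mat set \<Rightarrow> real mat set \<Rightarrow> bool" where
  "conj_subalgebras n U V \<longleftrightarrow>
     (\<exists>g\<in>carrier (SO2 n). V = (\<lambda>X. g * X * inv\<^bsub>SO2 n\<^esub> g) ` U)"

text \<open>
  The matrix \<open>(\<phi>, x, y, \<eta>)\<close> of the Lie algebra of \<open>unipotent_N n\<close>, for
  \<open>x, y \<in> carrier_vec (n - 2)\<close>.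
\<close>

definition nil_mat :: "nat \<Rightarrow> real \<Rightarrow> real vec \<Rightarrow> real vec \<Rightarrow> real \<Rightarrow> real mat" where
  "nil_mat n \<phi> x y \<eta> = mat (n + 2) (n + 2) (\<lambda>(i, j).
     if i = 0 then
       (if j = 0 then 0 else if j = 1 then \<phi> else if j < n then x $ (j - 2)
        else if j = n then \<eta> else 0)
     else if i = 1 then
       (if j < 2 then 0 else if j < n then y $ (j - 2) else if j = n then 0 else - \<eta>)
     else if i < n then
       (if j < n then 0 else if j = n then - y $ (i - 2) else - x $ (i - 2))
     else if i = n then
       (if j = n + 1 then - \<phi> else 0)
     else 0)"

text \<open>
  The vector \<open>(a, b, c)\<close> of \<open>\<real>\<^sup>3\<close>, regarded as a vector of
  \<open>\<real>\<^bsup>n - 2\<^esup>\<close>: for \<open>n > 5\<close> zeros are appended, for \<open>n = 4\<close> and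
  \<open>n = 3\<close> the last one and the last two coordinates are dropped, respectively.
\<close>

definition coords :: "nat \<Rightarrow> real \<Rightarrow> real \<Rightarrow> real \<Rightarrow> real vec" where
  "coords n a b c = vec (n - 2) (\<lambda>i. if i < 3 then [a, b, c] ! i else 0)"

definition type1 :: "nat \<Rightarrow> real \<Rightarrow> real mat set" where
  "type1 n \<epsilon> = {nil_mat n \<phi> (coords n 0 0 0) (coords n (\<epsilon> * \<phi>) 0 0) \<eta> | \<phi> \<eta>. True}"

definition type2 :: "nat \<Rightarrow> real \<Rightarrow> real mat set" where
  "type2 n \<epsilon> = {nil_mat n \<phi> (coords n s 0 0) (coords n 0 (\<epsilon> * \<phi>) 0) 0 | \<phi> s. True}"

definition type3 :: "nat \<Rightarrow> real \<Rightarrow> real mat set" where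
  "type3 n \<epsilon> = {nil_mat n 0 (coords n s 0 (\<epsilon> * r)) (coords n 0 r 0) 0 | s r. True}"

text \<open>
  The embedding of \<open>SO2 m\<close> into \<open>SO2 n\<close> (\<open>m \<le> n\<close>) induced by the isometric inclusion of
  \<open>\<real>\<^bsup>m + 2\<^esup>\<close> into \<open>\<real>\<^bsup>n + 2\<^esup>\<close> that keeps the first \<open>m\<close> basis vectors
  and sends the last two to the last two. The basis vectors with indices in \<open>{m..<n}\<close> span the
  orthogonal complement of the image and are fixed; \<open>shrink_index m n\<close> inverts the inclusion on
  the remaining indices.
\<close>

definition shrink_index :: "nat \<Rightarrow> nat \<Rightarrow> nat \<Rightarrow> nat" where
  "shrink_index m n i = (if i < m then i else i - (n - m))"

definition SO2_embed :: "nat \<Rightarrow> nat \<Rightarrow> real mat \<Rightarrow> real mat" where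
  "SO2_embed m n A = mat (n + 2) (n + 2) (\<lambda>(i, j).
     if i \<in> {m..<n} \<or> j \<in> {m..<n} then (if i = j then 1 else 0)
     else A $$ (shrink_index m n i, shrink_index m n j))"

end

theory Submission
  imports Defs "HOL-Analysis.Euclidean_Space" "HOL-Analysis.Elementary_Metric_Spaces"
begin

text \<open>
  Elements of \<open>N\<close> are written in exponential coordinates, so that closed connected subgroups become subalgebras.
  By a coarse Cartan decomposition, a subgroup meets all double cosets of a compact set as soon as the pairs
  (matrix norm, norm of the second compound matrix) of its elements are coarsely dense in the region between the
  two walls \<open>N2 = N1\<close> and \<open>N2 = N1 * N1\<close>; conversely a Cartan-decomposition subgroup comes close to both walls
  arbitrarily far out. A path in each of the six standard planes sweeps from one wall to the other. Conversely the two
  wall conditions force any subalgebra to contain a conjugate of a standard plane, by elimination of the coordinates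
  with unipotent elements, reflections and the Levi factor. The standard planes are told apart by the
  nilpotency degree and the ranks of their elements; the same invariants show that they are minimal.
\<close>

section \<open>The nilpotent group in exponential coordinates\<close>

text \<open>The group has real rank 2: up to bounded factors each element is some
  \<open>dg d a b\<close> with 1 <= b <= a, whose entries have size a and whose 2 x 2 minors have
  size a * b. So the two norms recover (a, b) up to bounded ratios, and the walls b = 1 and b = a of
  the chamber become N2 ~ N1 and N2 ~ N1 * N1. Bounded outer factors suffice, hence the
  decomposition is obtained by Gaussian elimination with pivoting inside the isometry group. The
  paths in the planes are found by holding the top right corner entry of the exponential comparable
  to t, so that N1 stays comparable to t while N2 moves; the intermediate value theorem does the
  rest. Minimality follows from the containment theorem itself: a smaller Cartan-decomposition
  subgroup of a standard plane would lie in a line and still contain a conjugate of some standard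
  plane. All reductions conjugate by the full group O(2, n). Determinants are repaired twice: by a
  reflection that commutes with the diagonal elements, and by one that preserves a given standard
  plane.\<close>

type_synonym 'v nilp = "real \<times> 'v \<times> 'v \<times> real"

text \<open>The Baker-Campbell-Hausdorff product for the bracket \<open>nbr\<close>. Triple brackets
  lie in the last coordinate and fourfold brackets vanish, so the series ends with the terms of
  coefficient 1/12; \<open>nmul_eq_nbr\<close> makes this explicit.\<close>

definition nmul :: "('v::real_inner) nilp => 'v nilp => 'v nilp" where
 "nmul u v = (case (u, v) of ((p, x, y, e), (p', x', y', e')) =>
   (p + p', x + x' + (1/2) *\<^sub>R (p *\<^sub>R y' - p' *\<^sub>R y), y + y',
   e + e' + (inner x' y - inner x y') / 2 + inner (p *\<^sub>R y' - p' *\<^sub>R y) (y - y') / 12))"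

definition nbr :: "('v::real_inner) nilp => 'v nilp => 'v nilp" where
 "nbr u v = (case (u, v) of ((p, x, y, e), (p', x', y', e')) =>
   (0, p *\<^sub>R y' - p' *\<^sub>R y, 0, inner x' y - inner x y'))"

lemma nmul_simps [simp]:
 "nmul (p, x, y, e) (p', x', y', e') =
   (p + p', x + x' + (1/2) *\<^sub>R (p *\<^sub>R y' - p' *\<^sub>R y), y + y',
   e + e' + (inner x' y - inner x y') / 2 + inner (p *\<^sub>R y' - p' *\<^sub>R y) (y - y') / 12)"
 by (simp add: nmul_def)

lemma nbr_simps [simp]:
 "nbr (p, x, y, e) (p', x', y', e') = (0, p *\<^sub>R y' - p' *\<^sub>R y, 0, inner x' y - inner x y')"
 by (simp add: nbr_def)

lemma nmul_0 [simp]: "nmul u 0 = u" "nmul 0 u = u"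
 by (cases u; simp add: zero_prod_def)+

lemma nmul_scaleR: "nmul (s *\<^sub>R u) (t *\<^sub>R u) = (s + t) *\<^sub>R u"
 by (cases u) (simp add: algebra_simps inner_simps inner_commute)

lemma nmul_uminus [simp]: "nmul u (- u) = 0" "nmul (- u) u = 0"
 using nmul_scaleR[of 1 u "-1"] nmul_scaleR[of "-1" u "1"] by auto

lemma inner_lin_simps:
 fixes x y z :: "'v::real_inner"
 shows "inner (x + y) z = inner x z + inner y z" "inner z (x + y) = inner z x + inner z y"
  "inner (x - y) z = inner x z - inner y z" "inner z (x - y) = inner z x - inner z y"
  "inner (r *\<^sub>R x) z = r * inner x z" "inner z (r *\<^sub>R x) = r * inner z x"
 by (simp_all add: inner_simps)

text \<open>Testing against every z reduces vector identities to real arithmetic.\<close>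

lemma inner_ext: "(!!z. inner z x = inner z y) ==> x = (y::'v::real_inner)"
 by (metis inner_diff_right inner_eq_zero_iff right_minus_eq)

lemma nmul_assoc: "nmul (nmul u v) w = nmul u (nmul v w)"
proof -
 obtain p x y e where u: "u = (p, x, y, e)" by (cases u)
 obtain p' x' y' e' where v: "v = (p', x', y', e')" by (cases v)
 obtain q z t f where w: "w = (q, z, t, f)" by (cases w)
 have c: "inner y' y = inner y y'" "inner t y = inner y t" "inner t y' = inner y' t"
  by (rule inner_commute)+
 show ?thesis
  unfolding u v w nmul_simps prod.inject
 proof (intro conjI, goal_cases)
  case 2
  show ?case by (rule inner_ext, unfold inner_lin_simps, argo)
 next
  case 4
  show ?case by (unfold inner_lin_simps c) (simp add: field_simps)
 qed simp_all
qed

lemma nmul_cancel [simp]: "nmul (- u) (nmul u v) = v" "nmul u (nmul (- u) v) = v"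
 by (simp_all add: nmul_assoc[symmetric])

lemma nbr_add_right: "nbr w (u + v) = nbr w u + nbr w v"
 by (cases u; cases v; cases w) (simp add: inner_lin_simps algebra_simps)

lemma nbr_scaleR_right: "nbr w (t *\<^sub>R u) = t *\<^sub>R nbr w u"
 by (cases u; cases w) (simp add: inner_lin_simps algebra_simps)

lemma nbr_uminus_left: "nbr (- w) u = - nbr w u"
 by (cases u; cases w) simp

text \<open>Conjugation is the exponential of ad w, and the cube of ad w is 0.\<close>

lemma nmul_conj: "nmul (nmul w u) (- w) = u + nbr w u + (1/2) *\<^sub>R nbr w (nbr w u)"
proof -
 obtain p x y e where u: "u = (p, x, y, e)" by (cases u)
 obtain q z t f where w: "w = (q, z, t, f)" by (cases w)
 have c: "inner t y = inner y t" by (rule inner_commute)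
 show ?thesis
  unfolding u w nmul_simps nbr_simps uminus_Pair add_Pair scaleR_Pair prod.inject
 proof (intro conjI, goal_cases)
  case 2
  show ?case by (rule inner_ext, unfold inner_lin_simps inner_minus_left inner_minus_right)
   (simp add: field_simps)
 next
  case 4
  show ?case by (unfold inner_lin_simps inner_minus_left inner_minus_right c)
   (simp add: field_simps c)
 qed simp_all
qed

lemma nmul_conj_scaleR:
 "nmul (nmul w (t *\<^sub>R u)) (- w) = t *\<^sub>R nmul (nmul w u) (- w)"
 unfolding nmul_conj nbr_scaleR_right scaleR_add_right by simp

text \<open>In exp(ad u) - exp(-ad u) only odd powers survive, and the cube of ad u is 0. Thus two
  conjugations give the bracket exactly, without a limit of commutators.\<close>

lemma nmul_conj_odd_part:
 "nmul (nmul u v) (- u) - nmul (nmul (- u) v) u = 2 *\<^sub>R nbr u v"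
proof -
 have "nbr u (- w) = - nbr u w" for w
  using nbr_scaleR_right[of u "-1" w] by simp
 then show ?thesis
  using nmul_conj[of "- u" v] by (simp add: nmul_conj nbr_uminus_left scaleR_2)
qed

lemma nmul_eq_nbr:
 "nmul u v = u + v + (1/2) *\<^sub>R nbr u v + (1/12) *\<^sub>R (nbr u (nbr u v) - nbr v (nbr u v))"
proof -
 obtain p x y e where u: "u = (p, x, y, e)" by (cases u)
 obtain q z t f where w: "v = (q, z, t, f)" by (cases v)
 show ?thesis
  unfolding u w nmul_simps nbr_simps diff_Pair add_Pair scaleR_Pair prod.inject
  by (intro conjI; (unfold inner_lin_simps)?; simp add: field_simps)
qed

lemma norm_nilp_components:
 fixes p e :: real
 shows "\<bar>p\<bar> <= norm (p, x, y, e)" "norm x <= norm (p, x, y, e)"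
  "norm y <= norm (p, x, y, e)" "\<bar>e\<bar> <= norm (p, x, y, e)"
proof -
 show "\<bar>p\<bar> <= norm (p, x, y, e)" using norm_fst_le[of p "(x, y, e)"] by simp
 have 1: "norm (x, y, e) <= norm (p, x, y, e)" using norm_snd_le[of "(x,y,e)" p] by simp
 have 2: "norm (y, e) <= norm (x, y, e)" using norm_snd_le[of "(y,e)" x] by simp
 show "norm x <= norm (p, x, y, e)" using norm_fst_le[of x "(y,e)"] 1 by simp
 show "norm y <= norm (p, x, y, e)" using norm_fst_le[of y "e"] 1 2 by simp
 show "\<bar>e\<bar> <= norm (p, x, y, e)" using norm_snd_le[of e y] 1 2 by simp
qed

lemma norm_nilp_le: "norm (p::real, x, y, e::real) <= \<bar>p\<bar> + norm x + norm y + \<bar>e\<bar>"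
 using norm_Pair_le[of p "(x,y,e)"] norm_Pair_le[of x "(y,e)"] norm_Pair_le[of y e] by simp

text \<open>Every correction term is bilinear up to a bounded factor. The half bracket in the second
  coordinate contributes 1, the one in the last coordinate 1, the cubic term 1/3; the sum is rounded
  up to 3.\<close>

lemma nmul_approx:
 assumes u: "norm u <= 1" and v: "norm v <= 1"
 shows "norm (nmul u v - (u + v)) <= 3 * norm u * norm v"
proof -
 obtain p x y e where U: "u = (p,x,y,e)" by (cases u)
 obtain p' x' y' e' where V: "v = (p',x',y',e')" by (cases v)
 note cu = norm_nilp_components[where p=p and x=x and y=y and e=e, folded U]
 note cv = norm_nilp_components[where p=p' and x=x' and y=y' and e=e', folded V]
 let ?z = "p *\<^sub>R y' - p' *\<^sub>R y"
 have m: "a * b <= norm u * norm v" if "a <= norm u" "b <= norm v" "0 <= a" "0 <= b" for a b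
  using that by (intro mult_mono) auto
 have z: "norm ?z <= 2 * (norm u * norm v)"
  using norm_triangle_ineq4[of "p *\<^sub>R y'" "p' *\<^sub>R y"] m[of "\<bar>p\<bar>" "norm y'"] m[of "norm y" "\<bar>p'\<bar>"] cu cv
  by (simp add: mult.commute)
 have i: "\<bar>inner x' y\<bar> <= norm u * norm v" "\<bar>inner x y'\<bar> <= norm u * norm v"
  using Cauchy_Schwarz_ineq2[of x' y] Cauchy_Schwarz_ineq2[of x y']
   m[of "norm y" "norm x'"] m[of "norm x" "norm y'"] cu cv by (simp_all add: mult.commute)
 have yy: "norm (y - y') <= 2" using norm_triangle_ineq4[of y y'] cu cv u v by simp
 have "\<bar>inner ?z (y - y')\<bar> <= norm ?z * norm (y - y')" by (rule Cauchy_Schwarz_ineq2)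
 also have "\<dots> <= (2 * (norm u * norm v)) * 2" using z yy by (intro mult_mono) auto
 finally have j: "\<bar>inner ?z (y - y')\<bar> <= 4 * (norm u * norm v)" by simp
 have "nmul u v - (u + v) = (0, (1/2) *\<^sub>R ?z, 0, (inner x' y - inner x y') / 2 + inner ?z (y - y') / 12)"
  by (simp add: U V)
 then have "norm (nmul u v - (u + v)) <= norm ((1/2) *\<^sub>R ?z) + \<bar>(inner x' y - inner x y') / 2 + inner ?z (y - y') / 12\<bar>"
  using norm_nilp_le[of 0 "(1/2) *\<^sub>R ?z" "0" "(inner x' y - inner x y') / 2 + inner ?z (y - y') / 12"] by simp
 also have "\<dots> <= norm u * norm v + (norm u * norm v + norm u * norm v / 3)"
 proof (rule add_mono)
  show "norm ((1/2) *\<^sub>R ?z) <= norm u * norm v" using z by simp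
  show "\<bar>(inner x' y - inner x y') / 2 + inner ?z (y - y') / 12\<bar> <= norm u * norm v + norm u * norm v / 3"
  proof -
   have "\<bar>(a - b) / 2 + c / 12\<bar> <= r + r / 3"
    if "\<bar>a\<bar> <= r" "\<bar>b\<bar> <= r" "\<bar>c\<bar> <= 4 * r" for a b c r :: real
    using that by argo
   from this[OF i j] show ?thesis by (simp only:)
  qed
 qed
 also have "\<dots> <= 3 * norm u * norm v" by simp
 finally show ?thesis .
qed

lemma nmul_alt:
 "nmul u v = (fst u + fst v,
   fst (snd u) + fst (snd v) + (1/2) *\<^sub>R (fst u *\<^sub>R fst (snd (snd v)) - fst v *\<^sub>R fst (snd (snd u))),
   fst (snd (snd u)) + fst (snd (snd v)),
   snd (snd (snd u)) + snd (snd (snd v))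
    + (inner (fst (snd v)) (fst (snd (snd u))) - inner (fst (snd u)) (fst (snd (snd v)))) / 2
    + inner (fst u *\<^sub>R fst (snd (snd v)) - fst v *\<^sub>R fst (snd (snd u)))
      (fst (snd (snd u)) - fst (snd (snd v))) / 12)"
 by (cases u; cases v) simp

lemma tendsto_nmul:
 assumes "(f \<longlongrightarrow> a) F" "(g \<longlongrightarrow> b) F"
 shows "((%k. nmul (f k) (g k)) \<longlongrightarrow> nmul a b) F"
 unfolding nmul_alt by (intro tendsto_intros assms) auto

lemma continuous_on_nmul:
 assumes "continuous_on A f" "continuous_on A g"
 shows "continuous_on A (%k. nmul (f k) (g k))"
 using assms unfolding continuous_on_def by (auto intro: tendsto_nmul)

section \<open>Closed subgroups in exponential coordinates\<close>

lemma null_comparison: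
 fixes f :: "'a => 'b::real_normed_vector"
 assumes "eventually (%x. norm (f x) <= g x) F" "(g \<longlongrightarrow> 0) F"
 shows "(f \<longlongrightarrow> 0) F"
 using assms(2) by (rule metric_tendsto_imp_tendsto) (use assms(1) in \<open>auto elim: eventually_mono\<close>)

text \<open>The type may be infinite-dimensional; \<open>S\<close> with its compact unit sphere
  plays the role of a finite-dimensional ambient space.\<close>

locale closed_nil_subgroup =
 fixes V S :: "('v::real_inner) nilp set"
 assumes closed: "closed V" and zero: "0 : V"
  and mul: "u : V ==> v : V ==> nmul u v : V" and inv: "u : V ==> - u : V"
  and sub: "V \<subseteq> S" and S: "subspace S" and compact: "compact (S \<inter> sphere 0 1)"
begin

text \<open>The Lie algebra of \<open>V\<close>: scalar multiples are powers in these coordinates,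
  so these are the directions of the one-parameter subgroups inside \<open>V\<close>.\<close>

definition lin :: "'v nilp set" where
 "lin = {u. \<forall>t::real. t *\<^sub>R u : V}"

lemma lin_sub: "lin \<subseteq> V"
 unfolding lin_def by (metis (mono_tags, lifting) mem_Collect_eq scaleR_one subsetI)

lemma nat_multiple: "u : V ==> real k *\<^sub>R u : V"
proof (induction k)
 case (Suc k)
 then show ?case using mul[of u "real k *\<^sub>R u"] nmul_scaleR[of 1 u "real k"] by simp
qed (simp add: zero)

lemma int_multiple: "u : V ==> real_of_int k *\<^sub>R u : V"
 using nat_multiple[of u "nat \<bar>k\<bar>"] inv[of "real (nat \<bar>k\<bar>) *\<^sub>R u"]
 by (cases "k \<ge> 0") auto

text \<open>Integer multiples of \<open>h k\<close> are its powers and stay in \<open>V\<close>.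
  Taking floor (t / norm (h k)) of them misses length t by at most one step, and the steps shrink to
  0.\<close>

lemma lin_limit:
 assumes h: "!!k. h k : V" "!!k. h k ~= 0" "h \<longlonglongrightarrow> 0"
  and u: "(%k. (1 / norm (h k)) *\<^sub>R h k) \<longlonglongrightarrow> u"
 shows "u : lin"
 unfolding lin_def
proof safe
 fix t :: real
 define m where "m k = \<lfloor>t / norm (h k)\<rfloor>" for k
 have nz: "norm (h k) > 0" for k using h by simp
 have bd: "\<bar>real_of_int (m k) * norm (h k) - t\<bar> <= norm (h k)" for k
 proof -
  have a: "real_of_int (m k) <= t / norm (h k)" "t / norm (h k) < real_of_int (m k) + 1"
   unfolding m_def by linarith+
  have "real_of_int (m k) * norm (h k) <= t" "t < (real_of_int (m k) + 1) * norm (h k)"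
   using a nz[of k] by (simp_all add: field_simps)
  then show ?thesis by (simp add: algebra_simps)
 qed
 have "(%k. norm (h k)) \<longlonglongrightarrow> 0" using tendsto_norm[OF h(3)] by simp
 then have "(%k. real_of_int (m k) * norm (h k) - t) \<longlonglongrightarrow> 0"
  by (rule null_comparison[rotated]) (use bd in auto)
 then have "(%k. real_of_int (m k) * norm (h k)) \<longlonglongrightarrow> t" by (simp add: LIM_zero_iff)
 then have "(%k. (real_of_int (m k) * norm (h k)) *\<^sub>R ((1 / norm (h k)) *\<^sub>R h k)) \<longlonglongrightarrow> t *\<^sub>R u"
  by (intro tendsto_scaleR u)
 moreover have "(real_of_int (m k) * norm (h k)) *\<^sub>R ((1 / norm (h k)) *\<^sub>R h k) = real_of_int (m k) *\<^sub>R h k" for k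
  using nz[of k] by simp
 ultimately have "(%k. real_of_int (m k) *\<^sub>R h k) \<longlonglongrightarrow> t *\<^sub>R u" by (simp only:)
 then show "t *\<^sub>R u : V"
  by (rule closed_sequentially[OF closed, rotated]) (use int_multiple h in auto)
qed

text \<open>Lie product formula: the k-th power of the product of u / k and v / k tends to u + v,
  since by \<open>nmul_approx\<close> the product differs from the sum by a multiple of 1 /
  k^2.\<close>

lemma lin_add_aux:
 assumes u: "u : lin" and v: "v : lin"
 shows "u + v : V"
proof -
 define w where "w k = nmul ((1 / real (Suc k)) *\<^sub>R u) ((1 / real (Suc k)) *\<^sub>R v)" for k
 have w: "real (Suc k) *\<^sub>R w k : V" for k
  using u v unfolding w_def lin_def by (intro nat_multiple mul) auto
 \<comment> \<open>From \<open>K\<close> on both scaled vectors have norm at most 1, as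
   \<open>nmul_approx\<close> requires.\<close>
 obtain K :: nat where K: "norm u + norm v <= real K" using real_arch_simple by blast
 have bd: "norm (real (Suc k) *\<^sub>R w k - (u + v)) <= 3 * norm u * norm v * (1 / real (Suc k))" if "k \<ge> K" for k
 proof -
  have k: "norm u <= real (Suc k)" "norm v <= real (Suc k)"
   using K that norm_ge_zero[of u] norm_ge_zero[of v] by linarith+
  let ?c = "1 / real (Suc k)"
  have "norm (w k - (?c *\<^sub>R u + ?c *\<^sub>R v)) <= 3 * norm (?c *\<^sub>R u) * norm (?c *\<^sub>R v)"
   unfolding w_def by (rule nmul_approx) (use k in \<open>auto simp: field_simps\<close>)
  then have "real (Suc k) * norm (w k - (?c *\<^sub>R u + ?c *\<^sub>R v)) <= real (Suc k) * (3 * norm (?c *\<^sub>R u) * norm (?c *\<^sub>R v))"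
   by (intro mult_left_mono) auto
  moreover have "real (Suc k) *\<^sub>R w k - (u + v) = real (Suc k) *\<^sub>R (w k - (?c *\<^sub>R u + ?c *\<^sub>R v))"
   by (simp add: scaleR_diff_right scaleR_add_right)
  moreover have "real (Suc k) * (3 * norm (?c *\<^sub>R u) * norm (?c *\<^sub>R v)) = 3 * norm u * norm v * ?c"
   by (simp add: field_simps del: of_nat_Suc)
  ultimately show ?thesis by (simp del: of_nat_Suc)
 qed
 have "(%k. 3 * norm u * norm v * (1 / real (Suc k))) \<longlonglongrightarrow> 3 * norm u * norm v * 0"
  by (intro tendsto_mult tendsto_const) (use LIMSEQ_inverse_real_of_nat in \<open>simp add: inverse_eq_divide\<close>)
 then have lim: "(%k. 3 * norm u * norm v * (1 / real (Suc k))) \<longlonglongrightarrow> 0"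
  by (simp only: mult_zero_right)
 have "\<forall>\<^sub>F k in sequentially. norm (real (Suc k) *\<^sub>R w k - (u + v)) <= 3 * norm u * norm v * (1 / real (Suc k))"
  using bd by (rule eventually_sequentiallyI)
 from null_comparison[OF this lim] have "(%k. real (Suc k) *\<^sub>R w k - (u + v)) \<longlonglongrightarrow> 0" .
 then have "(%k. real (Suc k) *\<^sub>R w k) \<longlonglongrightarrow> u + v" by (simp add: LIM_zero_iff del: of_nat_Suc)
 then show ?thesis
  by (rule closed_sequentially[OF closed, rotated]) (use w in auto)
qed

lemma lin_scaleR: "u : lin ==> t *\<^sub>R u : lin"
 unfolding lin_def by auto

lemma subspace_lin: "subspace lin"
 unfolding subspace_def
proof safe
 show "0 : lin" unfolding lin_def by (simp add: zero)
 fix u v assume "u : lin" "v : lin"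
 then have "t *\<^sub>R u + t *\<^sub>R v : V" for t by (intro lin_add_aux lin_scaleR)
 then show "u + v : lin" unfolding lin_def by (simp add: scaleR_add_right)
qed (rule lin_scaleR)

lemma closed_lin: "closed lin"
 unfolding closed_sequential_limits
proof safe
 fix f u assume f: "\<forall>k. f k : lin" and l: "f \<longlonglongrightarrow> u"
 have "t *\<^sub>R u : V" for t
 proof -
  have "(%k. t *\<^sub>R f k) \<longlonglongrightarrow> t *\<^sub>R u" by (intro tendsto_intros l)
  moreover have "!!k. t *\<^sub>R f k : V" using f unfolding lin_def by auto
  ultimately show ?thesis using closed_sequentially[OF closed, of "%k. t *\<^sub>R f k"] by blast
 qed
 then show "u : lin" unfolding lin_def by auto
qed

lemma lin_nbr:
 assumes "u : lin" "v : lin"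
 shows "nbr u v : lin"
proof -
 have c: "nmul (nmul w v) (- w) : lin" if "w : lin" for w
 proof -
  have "t *\<^sub>R nmul (nmul w v) (- w) : V" for t
   unfolding nmul_conj_scaleR[symmetric] using that assms(2) lin_sub
   by (intro mul inv) (auto simp: lin_def)
  then show ?thesis unfolding lin_def by auto
 qed
 have "nmul (nmul u v) (- u) - nmul (nmul (- u) v) (- (- u)) : lin"
  using c[of u] c[of "-u"] assms subspace_lin
  by (intro subspace_diff) (auto intro: subspace_neg)
 then have "2 *\<^sub>R nbr u v : lin" by (simp add: nmul_conj_odd_part)
 then have "(1/2) *\<^sub>R (2 *\<^sub>R nbr u v) : lin" by (rule lin_scaleR)
 then show ?thesis by simp
qed

lemma lin_nmul: "u : lin ==> v : lin ==> nmul u v : lin"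
 unfolding nmul_eq_nbr
 by (intro subspace_add[OF subspace_lin] subspace_diff[OF subspace_lin] subspace_scale[OF subspace_lin]
   lin_nbr)

text \<open>An element of \<open>V\<close> outside \<open>lin\<close> can be moved by \<open>lin\<close> so that it nearly minimises the norm
 in its coset; a sequence of such elements tending to \<open>0\<close> has a limiting direction in \<open>lin\<close>,
 along which it could be shortened.\<close>

lemma lin_local: "\<exists>\<epsilon>>0. \<forall>u\<in>V. norm u < \<epsilon> --> u : lin"
proof (rule ccontr)
 assume "\<not> ?thesis"
 then have "\<exists>u\<in>V. norm u < 1 / real (Suc k) & u \<notin> lin" for k
  using zero_less_divide_1_iff of_nat_0_less_iff zero_less_Suc by blast
 then obtain h where h: "!!k. h k : V" "!!k. norm (h k) < 1 / real (Suc k)" "!!k. h k \<notin> lin"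
  by metis
 define D where "D k = (%a. norm (nmul a (h k))) ` lin" for k
 have bdd: "bdd_below (D k)" for k unfolding D_def by (auto intro!: bdd_belowI[of _ 0])
 have hD: "norm (h k) : D k" for k unfolding D_def
  using subspace_0[OF subspace_lin] by (force intro!: image_eqI[where x=0])
 have ne: "D k ~= {}" for k using hD[of k] by blast
 \<comment> \<open>If the infimum vanished, - h k would be a limit of elements of the closed set
   \<open>lin\<close>.\<close>
 have pos: "Inf (D k) > 0" for k
 proof (rule ccontr)
  assume "\<not> ?thesis"
  then have "Inf (D k) < 1 / real (Suc j)" for j
   by (meson less_le_trans linorder_not_less of_nat_0_less_iff zero_less_Suc zero_less_divide_1_iff le_less_trans)
  then have "\<exists>a\<in>lin. norm (nmul a (h k)) < 1 / real (Suc j)" for j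
   using cInf_lessD[OF ne, of k "1 / real (Suc j)"] unfolding D_def by blast
  then obtain a where a: "!!j. a j : lin" "!!j. norm (nmul (a j) (h k)) < 1 / real (Suc j)" by metis
  have "(%j. nmul (a j) (h k)) \<longlonglongrightarrow> 0"
   by (rule LIMSEQ_norm_0) (use a in auto)
  then have "(%j. nmul (nmul (a j) (h k)) (- h k)) \<longlonglongrightarrow> nmul 0 (- h k)"
   by (intro tendsto_nmul tendsto_const)
  then have "a \<longlonglongrightarrow> - h k" by (simp add: nmul_assoc)
  then have "- h k : lin" using closed_sequentially[OF closed_lin] a(1) by blast
  then have "h k : lin" using subspace_neg[OF subspace_lin] by fastforce
  then show False using h by simp
 qed
 have "\<exists>a\<in>lin. norm (nmul a (h k)) < 2 * Inf (D k)" for k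
  using cInf_lessD[OF ne, of k "2 * Inf (D k)"] pos[of k] unfolding D_def by fastforce
 then obtain a where a: "!!k. a k : lin" "!!k. norm (nmul (a k) (h k)) < 2 * Inf (D k)" by metis
 define b where "b k = nmul (a k) (h k)" for k
 have bV: "b k : V" for k unfolding b_def by (rule mul) (use a(1) lin_sub h(1) in blast)+
 have ble: "Inf (D k) <= norm (nmul c (b k))" if "c : lin" for c k
  unfolding b_def nmul_assoc[symmetric]
  by (rule cInf_lower[OF _ bdd]) (use a that lin_nmul in \<open>auto simp: D_def\<close>)
 have bnz: "b k ~= 0" for k
  using ble[of 0 k] pos[of k] subspace_0[OF subspace_lin] by auto
 have bsm: "norm (b k) < 2 / real (Suc k)" for k
  using a(2)[of k] cInf_lower[OF hD bdd, of k] h(2)[of k] unfolding b_def by simp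
 have b0: "b \<longlonglongrightarrow> 0"
 proof (rule null_comparison)
  show "\<forall>\<^sub>F k in sequentially. norm (b k) <= 2 * (1 / real (Suc k))"
   using bsm by (auto intro!: always_eventually less_imp_le)
  have "(%k. 2 * (1 / real (Suc k))) \<longlonglongrightarrow> 2 * 0"
   by (intro tendsto_mult tendsto_const) (use LIMSEQ_inverse_real_of_nat in \<open>simp add: inverse_eq_divide\<close>)
  then show "(%k. 2 * (1 / real (Suc k))) \<longlonglongrightarrow> 0" by simp
 qed
 define n where "n k = (1 / norm (b k)) *\<^sub>R b k" for k
 have "n k : S \<inter> sphere 0 1" for k
  using bV[of k] sub bnz[of k] subspace_scale[OF S, of "b k"] by (auto simp: n_def)
 then obtain u r where u: "strict_mono (r :: nat => nat)" "(n \<circ> r) \<longlonglongrightarrow> u"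
  using compact unfolding compact_eq_seq_compact_metric seq_compact_def by metis
 have b0r: "(%k. b (r k)) \<longlonglongrightarrow> 0" using LIMSEQ_subseq_LIMSEQ[OF b0 u(1)] by (simp add: o_def)
 have ul: "u : lin"
  by (rule lin_limit[of "b \<circ> r"]) (use bV bnz b0r u(2) in \<open>auto simp: n_def o_def\<close>)
 have nu: "norm u = 1"
 proof -
  have "(%k. norm ((n \<circ> r) k)) \<longlonglongrightarrow> norm u" by (intro tendsto_intros u)
  moreover have "norm ((n \<circ> r) k) = 1" for k using bnz by (simp add: n_def)
  ultimately show ?thesis by (simp add: LIMSEQ_const_iff)
 qed
 have "\<forall>\<^sub>F k in sequentially. norm ((n \<circ> r) k - u) < 1/4"
  using tendstoD[OF u(2), of "1/4"] by (simp add: dist_norm)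
 moreover have "\<forall>\<^sub>F k in sequentially. norm (b (r k)) < 1/12"
  using tendstoD[OF b0r, of "1/12"] by simp
 ultimately have "\<forall>\<^sub>F k in sequentially. norm ((n \<circ> r) k - u) < 1/4 & norm (b (r k)) < 1/12"
  by eventually_elim auto
 then obtain k where k: "norm ((n \<circ> r) k - u) < 1/4" "norm (b (r k)) < 1/12"
  by (auto simp: eventually_sequentially)
 let ?b = "b (r k)"
 \<comment> \<open>Shortening \<open>?b\<close> along the limiting direction: the bound 1/4 on the
   direction error leaves at most norm ?b / 4 in the sum, and the bound 1/12 makes the deviation of
   the product from the sum at most norm ?b / 4. The total norm ?b / 2 lies below the infimum
   because norm ?b < 2 * Inf.\<close>
 let ?c = "(- norm ?b) *\<^sub>R u"
 have "norm (nmul ?c ?b - (?c + ?b)) <= 3 * norm ?c * norm ?b"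
  by (rule nmul_approx) (use k nu in auto)
 also have "\<dots> = 3 * norm ?b * norm ?b" by (simp add: nu)
 also have "\<dots> <= (1/4) * norm ?b" using k by (intro mult_right_mono) auto
 finally have 1: "norm (nmul ?c ?b - (?c + ?b)) <= norm ?b / 4" by simp
 have "?c + ?b = norm ?b *\<^sub>R ((n \<circ> r) k - u)" using bnz by (simp add: n_def scaleR_diff_right)
 then have "norm (?c + ?b) = norm ?b * norm ((n \<circ> r) k - u)" by simp
 also have "\<dots> <= norm ?b * (1/4)" using k by (intro mult_left_mono) auto
 finally have 2: "norm (?c + ?b) <= norm ?b / 4" by simp
 have "norm (nmul ?c ?b) <= norm ?b / 2"
  using norm_triangle_ineq[of "nmul ?c ?b - (?c + ?b)" "?c + ?b"] 1 2 by simp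
 also have "\<dots> < Inf (D (r k))" using a(2)[of "r k"] by (simp add: b_def)
 finally show False using ble[OF lin_scaleR[OF ul, of "- norm ?b"], of "r k"] by linarith
qed

text \<open>Left translation carries \<open>lin_local\<close> to every point of \<open>lin\<close>,
  so \<open>lin\<close> is open in \<open>V\<close>; it is also closed and contains 0.\<close>

lemma connected_imp_linear:
 assumes "connected V"
 shows "V = lin"
proof -
 obtain \<epsilon> where e: "\<epsilon> > 0" "!!u. u : V ==> norm u < \<epsilon> ==> u : lin" using lin_local by blast
 have "openin (top_of_set V) lin"
  unfolding openin_euclidean_subtopology_iff
 proof (intro conjI ballI lin_sub)
  fix a assume a: "a : lin"
  have "continuous_on UNIV (nmul (- a))" by (intro continuous_on_nmul continuous_on_const continuous_on_id)
  then have "isCont (nmul (- a)) a" by (rule continuous_on_interior) simp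
  then obtain d where d: "d > 0" "!!u. dist u a < d ==> dist (nmul (- a) u) (nmul (- a) a) < \<epsilon>"
   using e(1) unfolding continuous_at_eps_delta by blast
  have "\<forall>u\<in>V. dist u a < d --> u : lin"
  proof (intro ballI impI)
   fix u assume that: "u : V" "dist u a < d"
   show "u : lin"
  proof -
   have "a : V" using a lin_sub by blast
   then have "nmul (- a) u : V" by (intro mul inv that(1))
   then have "nmul (- a) u : lin" by (rule e(2)) (use d(2)[OF that(2)] in simp)
   from lin_nmul[OF a this] show ?thesis by simp
  qed
  qed
  with d(1) show "\<exists>e>0. \<forall>x'\<in>V. dist x' a < e --> x' : lin" by (intro exI[of _ d] conjI)
 qed
 moreover have "closedin (top_of_set V) lin"
  using closed_lin lin_sub by (simp add: closed_subset)
 ultimately have "lin = {} | lin = V" using assms unfolding connected_clopen by (elim allE[of _ lin]) simp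
 then show ?thesis using subspace_0[OF subspace_lin] by auto
qed

end

theorem closed_connected_nil_subgroup:
 fixes V S :: "('v::real_inner) nilp set"
 assumes "closed V" "0 : V" "!!u v. u : V ==> v : V ==> nmul u v : V" "!!u. u : V ==> - u : V"
  and "V \<subseteq> S" "subspace S" "compact (S \<inter> sphere 0 1)" and "connected V"
 shows "subspace V" and "u : V ==> v : V ==> nbr u v : V"
proof -
 interpret closed_nil_subgroup V S by unfold_locales (use assms in auto)
 show "subspace V" "u : V ==> v : V ==> nbr u v : V"
  using connected_imp_linear[OF assms(8)] subspace_lin lin_nbr by auto
qed

section \<open>Finitely supported sequences\<close>

text \<open>One type containing every R^d, since d = n - 2 varies and a type cannot depend on it.
  Finite-dimensional arguments take place in the subspaces \<open>Rd d\<close>.\<close>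

typedef fsv = "{f :: nat => real. finite {i. f i ~= 0}}"
 morphisms fcoord Abs_fsv
 by (rule exI[of _ "%_. 0"]) simp

setup_lifting type_definition_fsv

instantiation fsv :: real_vector
begin

lift_definition zero_fsv :: fsv is "%_. 0" by simp

lift_definition plus_fsv :: "fsv => fsv => fsv" is "%f g i. f i + g i"
proof -
 fix f g :: "nat => real" assume "finite {i. f i ~= 0}" "finite {i. g i ~= 0}"
 then show "finite {i. f i + g i ~= 0}"
  by (rule finite_subset[rotated, OF finite_UnI]) auto
qed

lift_definition minus_fsv :: "fsv => fsv => fsv" is "%f g i. f i - g i"
proof -
 fix f g :: "nat => real" assume "finite {i. f i ~= 0}" "finite {i. g i ~= 0}"
 then show "finite {i. f i - g i ~= 0}"
  by (rule finite_subset[rotated, OF finite_UnI]) auto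
qed

lift_definition uminus_fsv :: "fsv => fsv" is "%f i. - f i" by simp

lift_definition scaleR_fsv :: "real => fsv => fsv" is "%c f i. c * f i"
 by (erule finite_subset[rotated]) auto

instance
 by intro_classes (transfer; simp add: fun_eq_iff algebra_simps)+

end

lemma fcoord_simps [simp]:
 "fcoord 0 i = 0" "fcoord (x + y) i = fcoord x i + fcoord y i"
 "fcoord (x - y) i = fcoord x i - fcoord y i" "fcoord (- x) i = - fcoord x i"
 "fcoord (c *\<^sub>R x) i = c * fcoord x i"
 by (transfer; simp)+

lemma fsv_eqI: "(!!i. fcoord x i = fcoord y i) ==> x = y"
 by transfer auto

lemma finite_fcoord: "finite {i. fcoord x i ~= 0}"
 by transfer

lemma fcoord_sum [simp]: "fcoord (sum f A) i = (\<Sum>a\<in>A. fcoord (f a) i)"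
 by (induction A rule: infinite_finite_induct) auto

instantiation fsv :: real_inner
begin

definition inner_fsv :: "fsv => fsv => real" where
 "inner_fsv x y = (\<Sum>i | fcoord x i ~= 0. fcoord x i * fcoord y i)"

definition norm_fsv :: "fsv => real" where "norm_fsv x = sqrt (inner x x)"

definition dist_fsv :: "fsv => fsv => real" where "dist_fsv x y = norm (x - y)"

definition sgn_fsv :: "fsv => fsv" where "sgn_fsv x = x /\<^sub>R norm x"

definition uniformity_fsv :: "(fsv \<times> fsv) filter" where
 "uniformity_fsv = (INF e\<in>{0<..}. principal {(x, y). dist x y < e})"

definition open_fsv :: "fsv set => bool" where
 "open_fsv U \<longleftrightarrow> (\<forall>x\<in>U. \<forall>\<^sub>F (x', y) in uniformity. x' = x --> y : U)"

lemma inner_fsv_superset: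
 assumes "finite A" "{i. fcoord x i ~= 0} \<subseteq> A"
 shows "inner x y = (\<Sum>i\<in>A. fcoord x i * fcoord y i)"
 unfolding inner_fsv_def by (rule sum.mono_neutral_left) (use assms in auto)

instance
proof
 fix x y z :: fsv and c :: real
 let ?A = "{i. fcoord x i ~= 0} \<union> {i. fcoord y i ~= 0}"
 have f: "finite ?A" by (simp add: finite_fcoord)
 show "inner x y = inner y x"
  using inner_fsv_superset[OF f, of x y] inner_fsv_superset[OF f, of y x] by (auto simp: mult.commute)
 have "{i. fcoord (x + y) i ~= 0} \<subseteq> ?A" by auto
 from inner_fsv_superset[OF f this] show "inner (x + y) z = inner x z + inner y z"
  using inner_fsv_superset[OF f, of x z] inner_fsv_superset[OF f, of y z]
  by (simp add: sum.distrib algebra_simps)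
 show "inner (c *\<^sub>R x) y = c * inner x y"
  using inner_fsv_superset[OF f, of x y] inner_fsv_superset[OF f, of "c *\<^sub>R x" y]
  by (auto simp: sum_distrib_left algebra_simps)
 show "0 <= inner x x" unfolding inner_fsv_def by (rule sum_nonneg) auto
 show "(inner x x = 0) = (x = 0)"
 proof
  assume "inner x x = 0"
  then have "\<forall>i\<in>{i. fcoord x i ~= 0}. fcoord x i * fcoord x i = 0"
   unfolding inner_fsv_def by (subst (asm) sum_nonneg_eq_0_iff) (auto simp: finite_fcoord)
  then show "x = 0" by (intro fsv_eqI) auto
 qed (simp add: inner_fsv_def)
qed (simp_all add: norm_fsv_def dist_fsv_def sgn_fsv_def uniformity_fsv_def open_fsv_def)

end

section \<open>The subspaces R^d of the sequence space\<close>

definition Rd :: "nat => fsv set" where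
 "Rd d = {x. \<forall>i\<ge>d. fcoord x i = 0}"

lemma Rd_D: "x : Rd d ==> d <= i ==> fcoord x i = 0"
 by (simp add: Rd_def)

lemma inner_Rd: "x : Rd d ==> inner x y = (\<Sum>i<d. fcoord x i * fcoord y i)"
 by (rule inner_fsv_superset) (auto simp: Rd_def not_less[symmetric])

lemma subspace_Rd [simp]: "subspace (Rd d)"
 by (auto simp: subspace_def Rd_def)

lemma Rd_intros [simp]:
 "0 : Rd d" "x : Rd d ==> y : Rd d ==> x + y : Rd d" "x : Rd d ==> y : Rd d ==> x - y : Rd d"
 "x : Rd d ==> - x : Rd d" "x : Rd d ==> c *\<^sub>R x : Rd d"
 by (auto simp: Rd_def)

lift_definition fvec :: "nat => (nat => real) => fsv" is "%d f i. if i < d then f i else 0"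
 by (rule finite_subset[of _ "{..<_}"]) auto

lemma fcoord_fvec [simp]: "fcoord (fvec d f) i = (if i < d then f i else 0)"
 by transfer simp

lemma fvec_Rd [simp]: "fvec d f : Rd d"
 by (simp add: Rd_def)

definition ax :: "nat => fsv" where "ax k = fvec (Suc k) (%i. if i = k then 1 else 0)"

lemma fcoord_ax [simp]: "fcoord (ax k) i = (if i = k then 1 else 0)"
 by (simp add: ax_def)

lemma ax_Rd [simp]: "k < d ==> ax k : Rd d"
 by (auto simp: Rd_def)

lemma inner_ax [simp]: "inner x (ax k) = fcoord x k" "inner (ax k) x = fcoord x k"
proof -
 have "inner (ax k) x = (\<Sum>i<Suc k. fcoord (ax k) i * fcoord x i)"
  by (rule inner_Rd) simp
 also have "\<dots> = fcoord x k" by simp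
 finally show "inner (ax k) x = fcoord x k" .
 then show "inner x (ax k) = fcoord x k" by (simp add: inner_commute)
qed

lemma norm_ax [simp]: "norm (ax k) = 1"
 by (simp add: norm_eq_sqrt_inner)

lemma ax_nz [simp]: "ax k ~= 0"
 using norm_ax[of k] by fastforce

lemma abs_fcoord_le: "\<bar>fcoord x i\<bar> <= norm x"
 using Cauchy_Schwarz_ineq2[of x "ax i"] by simp

lemma Rd_expansion:
 assumes "x : Rd d" shows "x = (\<Sum>k<d. fcoord x k *\<^sub>R ax k)"
proof (rule fsv_eqI)
 fix i
 have "fcoord (\<Sum>k<d. fcoord x k *\<^sub>R ax k) i = (\<Sum>k<d. if k = i then fcoord x k else 0)"
  unfolding fcoord_sum by (intro sum.cong) auto
 also have "\<dots> = (if i < d then fcoord x i else 0)" by simp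
 finally show "fcoord x i = fcoord (\<Sum>k<d. fcoord x k *\<^sub>R ax k) i" using assms by (simp add: Rd_D)
qed

lemma norm_Rd_le:
 assumes "x : Rd d" shows "norm x <= (\<Sum>k<d. \<bar>fcoord x k\<bar>)"
proof -
 have "norm x = norm (\<Sum>k<d. fcoord x k *\<^sub>R ax k)" using Rd_expansion[OF assms] by simp
 also have "\<dots> <= (\<Sum>k<d. norm (fcoord x k *\<^sub>R ax k))" by (rule norm_sum)
 finally show ?thesis by simp
qed

lemma tendsto_fcoord [tendsto_intros]:
 assumes "(f \<longlongrightarrow> a) F" shows "((%x. fcoord (f x) i) \<longlongrightarrow> fcoord a i) F"
 using tendsto_inner[OF assms tendsto_const[of "ax i"]] by simp

lemma continuous_on_fcoord [continuous_intros]: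
 assumes "continuous_on A f" shows "continuous_on A (%x. fcoord (f x) i)"
 using assms unfolding continuous_on_def by (auto intro: tendsto_fcoord)

lemma closed_Rd: "closed (Rd d)"
proof -
 have "Rd d = (\<Inter>i\<in>{d..}. (%x. fcoord x i) -` {0})" by (auto simp: Rd_def)
 also have "closed \<dots>"
  by (intro closed_INT ballI closed_vimage closed_singleton)
    (intro continuous_on_fcoord continuous_on_id)
 finally show ?thesis .
qed

lemma Rd_convergent_subsequence:
 fixes f :: "nat => fsv"
 assumes f: "!!k. f k : Rd d" and b: "!!k. norm (f k) <= B"
 shows "\<exists>l\<in>Rd d. \<exists>r. strict_mono (r :: nat => nat) & (f \<circ> r) \<longlonglongrightarrow> l"
proof -
 \<comment> \<open>The general compactness lemma asks for an inverse of \<open>fcoord\<close> that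
   is also right on the coordinates below \<open>d\<close> for an arbitrary function
   \<open>g\<close>. When \<open>g\<close> has infinite support, truncation to these coordinates
   serves as default.\<close>
 define unproj where "unproj g = (if finite {i. g i ~= 0} then Abs_fsv g else fvec d g)" for g :: "nat => real"
 have "\<exists>l r. strict_mono (r :: nat => nat) &
   (\<forall>e>0. \<forall>\<^sub>F k in sequentially. \<forall>i\<in>{..<d}. dist (fcoord (f (r k)) i) (fcoord l i) < e)"
 proof -
  have 1: "bounded ((%x. fcoord x k) ` range f)" for k
   unfolding bounded_iff using abs_fcoord_le b by (auto intro!: exI[of _ B] intro: order_trans)
  have 2: "fcoord (unproj g) k = g k" if "k : {..<d}" for g k
   using that by (auto simp: unproj_def Abs_fsv_inverse)
  have 3: "unproj (fcoord x) = x" for x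
   unfolding unproj_def using finite_fcoord[of x] by (simp add: fcoord_inverse)
  show ?thesis
   using compact_lemma_general[of "{..<d}" fcoord f unproj, OF _ 1 2 3] by blast
 qed
 then obtain l r where r: "strict_mono (r :: nat => nat)"
  and l: "!!e. e > 0 ==> \<forall>\<^sub>F k in sequentially. \<forall>i\<in>{..<d}. dist (fcoord (f (r k)) i) (fcoord l i) < e"
  by blast
 have "(%k. fcoord (f (r k)) i) \<longlonglongrightarrow> fcoord l i" if "i < d" for i
  unfolding tendsto_iff
 proof (intro allI impI)
  fix e :: real assume "e > 0"
  from l[OF this] show "\<forall>\<^sub>F k in sequentially. dist (fcoord (f (r k)) i) (fcoord l i) < e"
   by (rule eventually_mono) (use that in auto)
 qed
 then have "(%k. \<Sum>i<d. fcoord (f (r k)) i *\<^sub>R ax i) \<longlonglongrightarrow> (\<Sum>i<d. fcoord l i *\<^sub>R ax i)"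
  by (intro tendsto_sum tendsto_scaleR tendsto_const) auto
 then have "(f \<circ> r) \<longlonglongrightarrow> (\<Sum>i<d. fcoord l i *\<^sub>R ax i)"
  using Rd_expansion[OF f] by (simp add: o_def)
 moreover have "(\<Sum>i<d. fcoord l i *\<^sub>R ax i) : Rd d"
  by (auto intro!: subspace_sum)
 ultimately show ?thesis using r by blast
qed

type_synonym nil = "fsv nilp"

definition Nd :: "nat => nil set" where
 "Nd d = UNIV \<times> Rd d \<times> Rd d \<times> UNIV"

lemma Nd_iff [simp]: "(p, x, y, e) : Nd d \<longleftrightarrow> x : Rd d & y : Rd d"
 by (simp add: Nd_def)

lemma subspace_Nd [simp]: "subspace (Nd d)"
 unfolding subspace_def by (auto simp: Nd_def zero_prod_def)

lemma closed_Nd: "closed (Nd d)"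
 unfolding Nd_def by (intro closed_Times closed_UNIV closed_Rd)

lemma nmul_Nd: "u : Nd d ==> v : Nd d ==> nmul u v : Nd d"
 by (cases u; cases v) simp

text \<open>One subsequence per component, each taken from the previous one.\<close>

lemma compact_Nd_sphere: "compact (Nd d \<inter> sphere 0 1)"
 unfolding compact_eq_seq_compact_metric seq_compact_def
proof (intro allI impI)
 fix f :: "nat => nil" assume f: "\<forall>k. f k : Nd d \<inter> sphere 0 1"
 define p where "p k = fst (f k)" for k
 define x where "x k = fst (snd (f k))" for k
 define y where "y k = fst (snd (snd (f k)))" for k
 define e where "e k = snd (snd (snd (f k)))" for k
 have fk: "f k = (p k, x k, y k, e k)" for k by (simp add: p_def x_def y_def e_def)
 have n: "norm (p k, x k, y k, e k) = 1" for k using f fk[of k] by (metis Int_iff mem_sphere dist_0_norm)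
 have R: "x k : Rd d" "y k : Rd d" for k using f fk[of k] by (metis Int_iff Nd_iff)+
 have b: "\<bar>p k\<bar> <= 1" "norm (x k) <= 1" "norm (y k) <= 1" "\<bar>e k\<bar> <= 1" for k
  using norm_nilp_components[where p="p k" and x="x k" and y="y k" and e="e k"] n[of k] by auto
 obtain lx r1 where 1: "strict_mono (r1 :: nat => nat)" "(x \<circ> r1) \<longlonglongrightarrow> lx"
  using Rd_convergent_subsequence[of x d 1, OF R(1) b(2)] by blast
 obtain ly r2 where 2: "strict_mono (r2 :: nat => nat)" "((y \<circ> r1) \<circ> r2) \<longlonglongrightarrow> ly"
  using Rd_convergent_subsequence[of "y \<circ> r1" d 1] R(2) b(3) by (auto simp: o_def)
 have sub: "\<exists>l r. strict_mono (r :: nat => nat) & (g \<circ> r) \<longlonglongrightarrow> l"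
  if "!!k. \<bar>g k\<bar> <= 1" for g :: "nat => real"
 proof -
  have "bounded (range g)" unfolding bounded_iff using that by (intro exI[of _ 1]) auto
  from bounded_imp_convergent_subsequence[OF this] show ?thesis by blast
 qed
 obtain lp r3 where 3: "strict_mono (r3 :: nat => nat)" "((p \<circ> (r1 \<circ> r2)) \<circ> r3) \<longlonglongrightarrow> lp"
  using sub[of "p \<circ> (r1 \<circ> r2)"] b(1) unfolding o_apply by blast
 obtain le r4 where 4: "strict_mono (r4 :: nat => nat)" "((e \<circ> (r1 \<circ> r2 \<circ> r3)) \<circ> r4) \<longlonglongrightarrow> le"
  using sub[of "e \<circ> (r1 \<circ> r2 \<circ> r3)"] b(4) unfolding o_apply by blast
 let ?r = "r1 \<circ> r2 \<circ> r3 \<circ> r4"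
 have m: "strict_mono ?r" using 1 2 3 4 by (intro strict_mono_o)
 have "(p \<circ> ?r) \<longlonglongrightarrow> lp" using LIMSEQ_subseq_LIMSEQ[OF 3(2) 4(1)] by (simp add: o_assoc)
 moreover have "(y \<circ> ?r) \<longlonglongrightarrow> ly"
  using LIMSEQ_subseq_LIMSEQ[OF 2(2) strict_mono_o[OF 3(1) 4(1)]] by (simp add: o_assoc)
 moreover have "(x \<circ> ?r) \<longlonglongrightarrow> lx"
  using LIMSEQ_subseq_LIMSEQ[OF 1(2) strict_mono_o[OF 2(1) strict_mono_o[OF 3(1) 4(1)]]] by (simp add: o_assoc)
 moreover have "(e \<circ> ?r) \<longlonglongrightarrow> le" using 4(2) by (simp add: o_assoc)
 ultimately have "(%k. ((p \<circ> ?r) k, (x \<circ> ?r) k, (y \<circ> ?r) k, (e \<circ> ?r) k)) \<longlonglongrightarrow> (lp, lx, ly, le)"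
  by (intro tendsto_Pair)
 moreover have "(%k. ((p \<circ> ?r) k, (x \<circ> ?r) k, (y \<circ> ?r) k, (e \<circ> ?r) k)) = f \<circ> ?r"
  by (rule ext) (simp only: o_apply fk)
 ultimately have l: "(f \<circ> ?r) \<longlonglongrightarrow> (lp, lx, ly, le)" by (simp only:)
 have "sphere (0 :: nil) 1 = norm -` {1}" by auto
 then have "closed (sphere (0 :: nil) 1)"
  by (simp only:) (intro closed_vimage closed_singleton continuous_on_norm continuous_on_id)
 then have cl: "closed (Nd d \<inter> sphere (0 :: nil) 1)" by (intro closed_Int closed_Nd)
 have "(lp, lx, ly, le) : Nd d \<inter> sphere 0 1"
  by (rule closed_sequentially[OF cl _ l]) (simp only: o_apply f)
 with m l show "\<exists>l\<in>Nd d \<inter> sphere 0 1. \<exists>r. strict_mono r & (f \<circ> r) \<longlonglongrightarrow> l"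
  by blast
qed

section \<open>The orthogonal group of signature (2, n)\<close>

text \<open>From here on \<open>d\<close> is n - 2, the size of the definite block. Matrices have
  size d + 4, and the isotropic basis vectors have the indices 0, 1, d + 2, d + 3.\<close>

abbreviation Mat :: "nat => real mat set" where
  "Mat d == carrier_mat (d + 4) (d + 4)"

abbreviation SO :: "nat => real mat monoid" where
  "SO d == SO2 (d + 2)"

abbreviation SO_top :: "nat => real mat topology" where
  "SO_top d == SO2_topology (d + 2)"

abbreviation cds :: "nat => real mat set => bool" where
  "cds d == cartan_decomposition_subgroup (d + 2)"

text \<open>Keeps indices such as \<open>k + 2\<close> and \<open>d + 3\<close> in the shape in
  which \<open>index_cases\<close> and the index rules produce them.\<close>

declare add_2_eq_Suc [simp del] add_2_eq_Suc' [simp del] One_nat_def [simp del]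

text \<open>Pairs each isotropic basis vector with its dual one and fixes the orthonormal middle
  ones; the Gram matrix of the form is the permutation matrix of this involution.\<close>

definition flip :: "nat => nat => nat" where
 "flip d i = (if i = 0 then d + 3 else if i = 1 then d + 2 else if i = d + 2 then 1
   else if i = d + 3 then 0 else i)"

lemma flip_simps [simp]:
 "flip d 0 = d + 3" "flip d 1 = d + 2" "flip d (Suc 0) = d + 2" "k < d ==> flip d (k + 2) = k + 2"
 "flip d (d + 2) = 1" "flip d (d + 3) = 0"
 by (auto simp: flip_def)

lemma flip_flip [simp]: "flip d (flip d i) = i"
 by (auto simp: flip_def)

lemma flip_less [simp]: "flip d i < d + 4 \<longleftrightarrow> i < d + 4"
 by (auto simp: flip_def)

lemma flip_eq_iff [simp]: "flip d i = flip d j \<longleftrightarrow> i = j"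
 by (metis flip_flip)

lemma sum_flip: "(\<Sum>k<d + 4. f (flip d k)) = (\<Sum>k<d + 4. f k)"
 by (rule sum.reindex_bij_witness[where i = "flip d" and j = "flip d"]) auto

text \<open>The five blocks of sizes 1, 1, d, 1, 1. Together with \<open>sum_split\<close> this is
  the standard way below to verify a matrix identity.\<close>

lemma index_cases:
 fixes i d :: nat
 assumes "i < d + 4"
 obtains "i = 0" | "i = 1" | k where "k < d" "i = k + 2" | "i = d + 2" | "i = d + 3"
proof -
 have "i = 0 | i = 1 | i = (i - 2) + 2 & i - 2 < d | i = d + 2 | i = d + 3" using assms by arith
 then show ?thesis using that(1,2,4,5) that(3)[of "i - 2"] by blast
qed

lemma sum_split:
 fixes f :: "nat => 'a::comm_monoid_add"
 shows "(\<Sum>k<d + 4. f k) = f 0 + (f 1 + ((\<Sum>k<d. f (k + 2)) + (f (d + 2) + f (d + 3))))"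
proof -
 have "(\<Sum>k<d + 4. f k) = (\<Sum>k<Suc (Suc (Suc (Suc d))). f k)" by (simp add: numeral_eq_Suc)
 also have "\<dots> = (\<Sum>k<Suc (Suc d). f k) + (f (d + 2) + f (d + 3))"
  by (simp add: add.assoc numeral_eq_Suc)
 also have "(\<Sum>k<Suc (Suc d). f k) = f 0 + (f 1 + (\<Sum>k<d. f (k + 2)))"
  by (simp only: sum.lessThan_Suc_shift) (simp add: add_2_eq_Suc' One_nat_def)
 finally show ?thesis by (simp add: add.assoc)
qed

section \<open>The bilinear form, its adjoint and the isometry group\<close>

definition bform :: "nat => real vec => real vec => real" where
 "bform d v w = (\<Sum>k<d + 4. v $ k * w $ flip d k)"

text \<open>The adjoint with respect to \<open>bform\<close>, that is J A^T J with the Gram matrix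
  J. On isometries it is the inverse, which makes inversion an explicit operation on
  entries.\<close>

definition finv :: "nat => real mat => real mat" where
 "finv d A = mat (d + 4) (d + 4) (%(i, j). A $$ (flip d j, flip d i))"

definition O2 :: "nat => real mat set" where
 "O2 d = {A \<in> Mat d. finv d A * A = 1\<^sub>m (d + 4)}"

lemma index_mult_sum:
 assumes "A : carrier_mat m m" "B : carrier_mat m m" "i < m" "j < m"
 shows "(A * B) $$ (i, j) = (\<Sum>k<m. A $$ (i, k) * B $$ (k, j))"
 using assms by (auto simp: scalar_prod_def lessThan_atLeast0)

lemma index_mult_vec_sum:
 assumes "A : carrier_mat m m" "v : carrier_vec m" "i < m"
 shows "(A *\<^sub>v v) $ i = (\<Sum>k<m. A $$ (i, k) * v $ k)"
 using assms by (auto simp: scalar_prod_def lessThan_atLeast0)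

lemma finv_carrier [simp]: "finv d A : Mat d"
 by (simp add: finv_def)

lemma finv_dim [simp]: "dim_row (finv d A) = d + 4" "dim_col (finv d A) = d + 4"
 by (simp_all add: finv_def)

lemma finv_index [simp]: "i < d + 4 ==> j < d + 4 ==> finv d A $$ (i, j) = A $$ (flip d j, flip d i)"
 by (simp add: finv_def)

lemma finv_finv [simp]: "A : Mat d ==> finv d (finv d A) = A"
 by (rule eq_matI) auto

lemma finv_one [simp]: "finv d (1\<^sub>m (d + 4)) = 1\<^sub>m (d + 4)"
 by (rule eq_matI) auto

lemma finv_mult:
 assumes "A : Mat d" "B : Mat d"
 shows "finv d (A * B) = finv d B * finv d A"
proof (rule eq_matI)
 fix i j assume "i < dim_row (finv d B * finv d A)" "j < dim_col (finv d B * finv d A)"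
 then have ij: "i < d + 4" "j < d + 4" by (simp_all add: finv_def)
 have "finv d (A * B) $$ (i, j) = (\<Sum>k<d + 4. A $$ (flip d j, k) * B $$ (k, flip d i))"
  using ij index_mult_sum[OF assms] by simp
 also have "\<dots> = (\<Sum>k<d + 4. A $$ (flip d j, flip d k) * B $$ (flip d k, flip d i))"
  by (rule sum_flip[symmetric])
 also have "\<dots> = (\<Sum>k<d + 4. finv d B $$ (i, k) * finv d A $$ (k, j))"
  by (rule sum.cong) (use ij in \<open>auto simp: mult.commute\<close>)
 also have "\<dots> = (finv d B * finv d A) $$ (i, j)"
  by (rule index_mult_sum[OF finv_carrier finv_carrier ij, symmetric])
 finally show "finv d (A * B) $$ (i, j) = (finv d B * finv d A) $$ (i, j)" .
qed (auto simp: finv_def)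

lemma bform_sym: "bform d v w = bform d w v"
proof -
 have "bform d v w = (\<Sum>k<d + 4. v $ flip d k * w $ flip d (flip d k))"
  unfolding bform_def by (rule sum_flip[symmetric])
 also have "\<dots> = bform d w v" unfolding bform_def by (simp add: mult.commute)
 finally show ?thesis .
qed

lemma qform_bform: "qform (d + 2) v = bform d v v"
proof -
 have "(\<Sum>i\<in>{2..<d + 2}. (v $ i)\<^sup>2) = (\<Sum>k<d. (v $ (k + 2))\<^sup>2)"
  by (rule sum.reindex_bij_witness[where i = "%k. k + 2" and j = "%i. i - 2"]) auto
 then show ?thesis
  unfolding qform_def bform_def sum_split
  by (simp add: power2_eq_square add.commute[of 3 d])
qed

lemma bform_add:
 assumes "v : carrier_vec (d + 4)" "w : carrier_vec (d + 4)"
 shows "bform d (v + w) (v + w) = bform d v v + 2 * bform d v w + bform d w w"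
proof -
 have "bform d (v + w) (v + w) =
   (\<Sum>k<d + 4. (v $ k + w $ k) * (v $ flip d k + w $ flip d k))"
  unfolding bform_def using assms by (intro sum.cong) auto
 also have "\<dots> = bform d v v + bform d v w + bform d w v + bform d w w"
  unfolding bform_def by (simp add: algebra_simps sum.distrib)
 finally show ?thesis using bform_sym[of d v w] by simp
qed

lemma bform_adjoint:
 assumes A: "A : Mat d" and v: "v : carrier_vec (d + 4)" and w: "w : carrier_vec (d + 4)"
 shows "bform d (A *\<^sub>v v) w = bform d v (finv d A *\<^sub>v w)"
proof -
 have "bform d (A *\<^sub>v v) w = (\<Sum>k<d + 4. (\<Sum>i<d + 4. A $$ (k, i) * v $ i) * w $ flip d k)"
  unfolding bform_def by (intro sum.cong refl) (simp add: index_mult_vec_sum[OF A v])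
 also have "\<dots> = (\<Sum>k<d + 4. (\<Sum>i<d + 4. A $$ (flip d k, i) * v $ i) * w $ k)"
  by (subst sum_flip[symmetric]) simp
 also have "\<dots> = (\<Sum>k<d + 4. \<Sum>i<d + 4. v $ i * (A $$ (flip d k, i) * w $ k))"
  by (simp add: sum_distrib_left sum_distrib_right algebra_simps)
 also have "\<dots> = (\<Sum>i<d + 4. v $ i * (\<Sum>k<d + 4. A $$ (flip d k, i) * w $ k))"
  by (subst sum.swap) (simp add: sum_distrib_left)
 also have "\<dots> = bform d v (finv d A *\<^sub>v w)"
  unfolding bform_def
  by (intro sum.cong refl, subst index_mult_vec_sum[OF finv_carrier w]) auto
 finally show ?thesis .
qed

lemma bform_unit:
 assumes "i < d + 4" "j < d + 4"
 shows "bform d (unit_vec (d + 4) i) w = w $ flip d i"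
proof -
 have "bform d (unit_vec (d + 4) i) w = (\<Sum>k<d + 4. if k = i then w $ flip d k else 0)"
  unfolding bform_def using assms by (intro sum.cong) auto
 then show ?thesis using assms by simp
qed

text \<open>Polarisation recovers the bilinear form, and its values on unit vectors are the entries
  of the matrix equation that defines \<open>O2\<close>.\<close>

lemma preserves_qform_iff:
 assumes A: "A : Mat d"
 shows "(\<forall>v\<in>carrier_vec (d + 4). qform (d + 2) (A *\<^sub>v v) = qform (d + 2) v) \<longleftrightarrow> A : O2 d"
proof
 assume "A : O2 d"
 then have 1: "finv d A * A = 1\<^sub>m (d + 4)" by (simp add: O2_def)
 show "\<forall>v\<in>carrier_vec (d + 4). qform (d + 2) (A *\<^sub>v v) = qform (d + 2) v"
 proof
  fix v :: "real vec" assume v: "v : carrier_vec (d + 4)"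
  have "finv d A *\<^sub>v (A *\<^sub>v v) = (finv d A * A) *\<^sub>v v"
   by (rule assoc_mult_mat_vec[symmetric]) (use A v in auto)
  also have "\<dots> = v" using 1 v by simp
  finally show "qform (d + 2) (A *\<^sub>v v) = qform (d + 2) v"
   unfolding qform_bform using bform_adjoint[OF A v, of "A *\<^sub>v v"] A v by simp
 qed
next
 assume q: "\<forall>v\<in>carrier_vec (d + 4). qform (d + 2) (A *\<^sub>v v) = qform (d + 2) v"
 have b: "bform d (A *\<^sub>v v) (A *\<^sub>v w) = bform d v w" if "v : carrier_vec (d + 4)" "w : carrier_vec (d + 4)" for v w
 proof -
  have "A *\<^sub>v (v + w) = A *\<^sub>v v + A *\<^sub>v w" by (rule mult_add_distrib_mat_vec[OF A that])
  then have "bform d (A *\<^sub>v v + A *\<^sub>v w) (A *\<^sub>v v + A *\<^sub>v w) = bform d (v + w) (v + w)"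
   using q[rule_format, of "v + w"] that by (simp add: qform_bform)
  moreover have "A *\<^sub>v v : carrier_vec (d + 4)" "A *\<^sub>v w : carrier_vec (d + 4)" using A that by auto
  ultimately show ?thesis
   using q[rule_format, of v] q[rule_format, of w] that by (simp add: bform_add qform_bform)
 qed
 have "finv d A * A = 1\<^sub>m (d + 4)"
 proof (rule eq_matI)
  fix i j assume "i < dim_row (1\<^sub>m (d + 4))" "j < dim_col (1\<^sub>m (d + 4))"
  then have ij: "i < d + 4" "j < d + 4" by simp_all
  have fi: "flip d i < d + 4" using ij by simp
  have col: "A *\<^sub>v unit_vec (d + 4) k = col A k" if "k < d + 4" for k
  proof (rule eq_vecI)
   fix i assume "i < dim_vec (col A k)"
   then have i: "i < d + 4" using A by simp
   have "(A *\<^sub>v unit_vec (d + 4) k) $ i = (\<Sum>l<d + 4. if l = k then A $$ (i, l) else 0)"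
    by (subst index_mult_vec_sum[OF A _ i], simp, rule sum.cong) (use that in auto)
   then show "(A *\<^sub>v unit_vec (d + 4) k) $ i = col A k $ i" using that i A by simp
  qed (use A in simp)
  have "(finv d A * A) $$ (i, j) = (\<Sum>k<d + 4. A $$ (flip d k, flip d i) * A $$ (k, j))"
   using ij index_mult_sum[OF finv_carrier A] by simp
  also have "\<dots> = (\<Sum>k<d + 4. A $$ (k, j) * A $$ (flip d k, flip d i))" by (simp add: mult.commute)
  also have "\<dots> = bform d (col A j) (col A (flip d i))"
   unfolding bform_def using A ij fi by (intro sum.cong) auto
  also have "\<dots> = bform d (unit_vec (d + 4) j) (unit_vec (d + 4) (flip d i))"
   unfolding col[OF ij(2), symmetric] col[OF fi, symmetric] by (rule b) auto
  also have "\<dots> = 1\<^sub>m (d + 4) $$ (i, j)" using ij by (auto simp: bform_unit)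
  finally show "(finv d A * A) $$ (i, j) = 1\<^sub>m (d + 4) $$ (i, j)" .
 qed (use A in \<open>auto simp: finv_def\<close>)
 then show "A : O2 d" using A by (simp add: O2_def)
qed

lemma O2_carrier: "A : O2 d ==> A : Mat d"
 by (simp add: O2_def)

lemma O2_left: "A : O2 d ==> finv d A * A = 1\<^sub>m (d + 4)"
 by (simp add: O2_def)

lemma O2_right: "A : O2 d ==> A * finv d A = 1\<^sub>m (d + 4)"
 using mat_mult_left_right_inverse[OF finv_carrier O2_carrier O2_left] by simp

lemma O2_finv: "A : O2 d ==> finv d A : O2 d"
 using O2_right[of A d] O2_carrier[of A d] by (simp add: O2_def)

lemma O2_one: "1\<^sub>m (d + 4) : O2 d"
 by (simp add: O2_def)

lemma O2_mult:
 assumes A: "A : O2 d" and B: "B : O2 d" shows "A * B : O2 d"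
proof -
 note c = O2_carrier[OF A] O2_carrier[OF B]
 have "finv d (A * B) * (A * B) = finv d B * finv d A * (A * B)" using c by (simp add: finv_mult)
 also have "\<dots> = finv d B * (finv d A * (A * B))" by (rule assoc_mult_mat) (use c in auto)
 also have "finv d A * (A * B) = (finv d A * A) * B" by (rule assoc_mult_mat[symmetric]) (use c in auto)
 also have "\<dots> = B" using O2_left[OF A] c by simp
 finally show ?thesis using c O2_left[OF B] by (simp add: O2_def)
qed

lemma O2_cancel:
 assumes A: "A : O2 d" and B: "B : Mat d"
 shows "finv d A * (A * B) = B" "A * (finv d A * B) = B" "(B * A) * finv d A = B" "(B * finv d A) * A = B"
proof -
 note c = O2_carrier[OF A] finv_carrier[of d A]
 show "finv d A * (A * B) = B" using assoc_mult_mat[OF c(2) c(1) B] O2_left[OF A] B by simp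
 show "A * (finv d A * B) = B" using assoc_mult_mat[OF c(1) c(2) B] O2_right[OF A] B by simp
 show "(B * A) * finv d A = B" using assoc_mult_mat[OF B c(1) c(2)] O2_right[OF A] B by simp
 show "(B * finv d A) * A = B" using assoc_mult_mat[OF B c(2) c(1)] O2_left[OF A] B by simp
qed

text \<open>The adjoint is J A^T J with an involution J, so it has the determinant of A; the product
  of the two is the identity.\<close>

lemma det_O2:
 assumes A: "A : O2 d" shows "det A = 1 | det A = - 1"
proof -
 define J :: "real mat" where "J = mat (d + 4) (d + 4) (%(i, j). if j = flip d i then 1 else 0)"
 have J: "J : Mat d" by (simp add: J_def)
 note Ac = O2_carrier[OF A]
 have JB: "(J * B) $$ (i, j) = B $$ (flip d i, j)" if "B : Mat d" "i < d + 4" "j < d + 4" for B i j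
 proof -
  have "(J * B) $$ (i, j) = (\<Sum>k<d + 4. if k = flip d i then B $$ (k, j) else 0)"
   unfolding index_mult_sum[OF J that] using that by (intro sum.cong) (auto simp: J_def)
  then show ?thesis using that by simp
 qed
 have BJ: "(B * J) $$ (i, j) = B $$ (i, flip d j)" if "B : Mat d" "i < d + 4" "j < d + 4" for B i j
 proof -
  have "(B * J) $$ (i, j) = (\<Sum>k<d + 4. if k = flip d j then B $$ (i, k) else 0)"
   unfolding index_mult_sum[OF that(1) J that(2,3)] using that by (intro sum.cong) (auto simp: J_def)
  then show ?thesis using that by simp
 qed
 have JJ: "J * J = 1\<^sub>m (d + 4)"
  by (rule eq_matI, subst JB[OF J]) (use J in \<open>auto simp: J_def\<close>)
 have "finv d A = J * (transpose_mat A * J)"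
 proof (rule eq_matI)
  fix i j assume "i < dim_row (J * (transpose_mat A * J))" "j < dim_col (J * (transpose_mat A * J))"
  then have ij: "i < d + 4" "j < d + 4" using J by auto
  have 1: "transpose_mat A : Mat d" "transpose_mat A * J : Mat d" using Ac J by auto
  show "finv d A $$ (i, j) = (J * (transpose_mat A * J)) $$ (i, j)"
   unfolding JB[OF 1(2) ij] using ij BJ[OF 1(1), of "flip d i" j] Ac by simp
 qed (use J Ac in auto)
 then have "det (finv d A) = det J * (det A * det J)"
  using J Ac by (simp add: det_mult[of _ "d + 4"] det_transpose)
 moreover have "det J * det J = 1" using arg_cong[OF JJ, of det] det_mult[OF J J] by simp
 moreover have "det (finv d A) * det A = 1"
  using arg_cong[OF O2_left[OF A], of det] det_mult[OF finv_carrier Ac] by simp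
 ultimately have "det A * det A = 1" by (metis mult.assoc mult.commute mult_1)
 then show ?thesis by (simp add: square_eq_1_iff)
qed

lemma carrier_SO2: "carrier (SO d) = {A \<in> O2 d. det A = 1}"
proof -
 have e: "d + 2 + 2 = d + 4" by simp
 have "A : carrier (SO d) \<longleftrightarrow> A : O2 d & det A = 1" for A
  unfolding SO2_def e using preserves_qform_iff[of A d] O2_carrier[of A d] by auto
 then show ?thesis by auto
qed

lemma SO2_mult [simp]: "A \<otimes>\<^bsub>SO2 n\<^esub> B = A * B"
 by (simp add: SO2_def)

lemma SO2_one: "\<one>\<^bsub>SO d\<^esub> = 1\<^sub>m (d + 4)"
proof -
 have e: "d + 2 + 2 = d + 4" by simp
 show ?thesis unfolding SO2_def e by simp
qed

lemma det_finv: assumes "A : O2 d" shows "det (finv d A) = det A"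
proof -
 have "det (finv d A) * det A = 1"
  using arg_cong[OF O2_left[OF assms], of det] det_mult[OF finv_carrier O2_carrier[OF assms]] by simp
 then show ?thesis using det_O2[OF assms] by auto
qed

lemma group_SO2: "group (SO d)"
proof (rule groupI)
 show "\<one>\<^bsub>SO d\<^esub> : carrier (SO d)" by (simp add: SO2_one carrier_SO2 O2_one)
 fix A assume A: "A : carrier (SO d)"
 then have A': "A : O2 d" "det A = 1" by (simp_all add: carrier_SO2)
 show "\<one>\<^bsub>SO d\<^esub> \<otimes>\<^bsub>SO d\<^esub> A = A" using O2_carrier[OF A'(1)] by (simp add: SO2_one)
 show "\<exists>B\<in>carrier (SO d). B \<otimes>\<^bsub>SO d\<^esub> A = \<one>\<^bsub>SO d\<^esub>"
  using A' by (intro bexI[of _ "finv d A"]) (auto simp: carrier_SO2 O2_finv O2_left det_finv SO2_one)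
 fix B assume B: "B : carrier (SO d)"
 then have B': "B : O2 d" "det B = 1" by (simp_all add: carrier_SO2)
 show "A \<otimes>\<^bsub>SO d\<^esub> B : carrier (SO d)"
  using A' B' by (auto simp: carrier_SO2 O2_mult det_mult[OF O2_carrier O2_carrier])
 fix C assume "C : carrier (SO d)"
 then show "A \<otimes>\<^bsub>SO d\<^esub> B \<otimes>\<^bsub>SO d\<^esub> C = A \<otimes>\<^bsub>SO d\<^esub> (B \<otimes>\<^bsub>SO d\<^esub> C)"
  using A' B' by (auto simp: carrier_SO2 intro!: assoc_mult_mat dest!: O2_carrier)
qed

lemma inv_SO2:
 assumes "A : carrier (SO d)" shows "inv\<^bsub>SO d\<^esub> A = finv d A"
proof -
 interpret group "SO d" by (rule group_SO2)
 show ?thesis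
  by (rule inv_equality) (use assms in \<open>auto simp: carrier_SO2 O2_left O2_finv det_finv SO2_one\<close>)
qed

text \<open>The exponential of the matrix (p, x, y, e), summed entry by entry up to its fourth
  power; \<open>mat_exp_nilX\<close> identifies it with \<open>mat_exp\<close>. The closed form
  turns the group law into a polynomial identity.\<close>

definition nexp :: "nat => nil => real mat" where
 "nexp d u = (case u of (p, x, y, e) => mat (d + 4) (d + 4) (%(i, j).
   if i = j then 1
   else if i = 0 then
    (if j = 1 then p else if j < d + 2 then fcoord (x + (p / 2) *\<^sub>R y) (j - 2)
    else if j = d + 2 then e - inner x y / 2 - p * inner y y / 6
    else - p * e - inner x x / 2 + p\<^sup>2 * inner y y / 24)
   else if i = 1 then
    (if j = 0 then 0 else if j < d + 2 then fcoord y (j - 2)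
    else if j = d + 2 then - inner y y / 2
    else - e - inner x y / 2 + p * inner y y / 6)
   else if i < d + 2 then
    (if j = d + 2 then - fcoord y (i - 2)
    else if j = d + 3 then fcoord ((p / 2) *\<^sub>R y - x) (i - 2) else 0)
   else if i = d + 2 & j = d + 3 then - p else 0))"

lemma nexp_carrier [simp]: "nexp d u : Mat d"
 by (cases u) (simp add: nexp_def)

lemma nexp_dim [simp]: "dim_row (nexp d u) = d + 4" "dim_col (nexp d u) = d + 4"
 by (cases u; simp add: nexp_def)+

lemma nexp_index:
 fixes p e :: real and x y :: fsv and d :: nat
 defines "h \<equiv> nexp d (p, x, y, e)"
 shows "h $$ (0, 0) = 1" "h $$ (0, 1) = p" "h $$ (0, d + 2) = e - inner x y / 2 - p * inner y y / 6"
  "h $$ (0, d + 3) = - p * e - inner x x / 2 + p\<^sup>2 * inner y y / 24"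
  "h $$ (1, 0) = 0" "h $$ (1, 1) = 1" "h $$ (1, d + 2) = - inner y y / 2"
  "h $$ (1, d + 3) = - e - inner x y / 2 + p * inner y y / 6"
  "h $$ (d + 2, 0) = 0" "h $$ (d + 2, 1) = 0" "h $$ (d + 2, d + 2) = 1" "h $$ (d + 2, d + 3) = - p"
  "h $$ (d + 3, 0) = 0" "h $$ (d + 3, 1) = 0" "h $$ (d + 3, d + 2) = 0" "h $$ (d + 3, d + 3) = 1"
  "k < d ==> h $$ (0, k + 2) = fcoord (x + (p / 2) *\<^sub>R y) k" "k < d ==> h $$ (1, k + 2) = fcoord y k"
  "k < d ==> h $$ (d + 2, k + 2) = 0" "k < d ==> h $$ (d + 3, k + 2) = 0"
  "k < d ==> h $$ (k + 2, 0) = 0" "k < d ==> h $$ (k + 2, 1) = 0"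
  "k < d ==> h $$ (k + 2, d + 2) = - fcoord y k"
  "k < d ==> h $$ (k + 2, d + 3) = fcoord ((p / 2) *\<^sub>R y - x) k"
  "k < d ==> l < d ==> h $$ (k + 2, l + 2) = (if k = l then 1 else 0)"
 unfolding h_def nexp_def by auto

lemma nexp_finv: "finv d (nexp d u) = nexp d (- u)"
proof (rule eq_matI)
 obtain p x y e where u: "u = (p, x, y, e)" by (cases u)
 fix i j assume "i < dim_row (nexp d (- u))" "j < dim_col (nexp d (- u))"
 then have i: "i < d + 4" and j: "j < d + 4" by simp_all
 show "finv d (nexp d u) $$ (i, j) = nexp d (- u) $$ (i, j)"
  unfolding u uminus_Pair finv_index[OF i j]
  by (cases rule: index_cases[OF i]; cases rule: index_cases[OF j])
    (simp_all only: flip_simps nexp_index, simp_all)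
qed (auto simp: finv_def)

lemma nexp_mult:
 assumes "u : Nd d" "v : Nd d"
 shows "nexp d u * nexp d v = nexp d (nmul u v)"
proof (rule eq_matI)
 obtain p x y e where u: "u = (p, x, y, e)" by (cases u)
 obtain p' x' y' e' where v: "v = (p', x', y', e')" by (cases v)
 have R: "x : Rd d" "y : Rd d" "x' : Rd d" "y' : Rd d" using assms by (auto simp: u v)
 fix i j assume "i < dim_row (nexp d (nmul u v))" "j < dim_col (nexp d (nmul u v))"
 then have i: "i < d + 4" and j: "j < d + 4" by simp_all
 have s: "(\<Sum>k<d. fcoord a k * fcoord b k) = inner a b" if "a : Rd d" for a b
  using inner_Rd[OF that] by simp
 have s': "(\<Sum>k<d. fcoord a k * - fcoord b k) = - inner a b" if "a : Rd d" for a b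
  using inner_Rd[OF that] by (simp add: sum_negf)
 have dl: "(\<Sum>k<d. g k * (if k = l then 1 else 0)) = g l" if "l < d" for g :: "nat => real" and l
  using sum.delta[of "{..<d}" l g] that by (simp add: if_distrib[of "(*) _"] cong: if_cong)
 have dl': "(\<Sum>k<d. (if l = k then 1 else 0) * g k) = g l" if "l < d" for g :: "nat => real" and l
  using sum.delta'[of "{..<d}" l g] that by (simp add: if_distrib[of "%x. x * _"] cong: if_cong)
 have c: "inner y' y = inner y y'" "inner x' y = inner y x'" "inner x' x = inner x x'" "inner y' x = inner x y'" "inner y x = inner x y" "inner y' x' = inner x' y'"
  by (rule inner_commute)+
 have ms: "(nexp d u * nexp d v) $$ (i, j) = (\<Sum>k<d + 4. nexp d u $$ (i, k) * nexp d v $$ (k, j))"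
  by (rule index_mult_sum[OF nexp_carrier nexp_carrier i j])
 show "(nexp d u * nexp d v) $$ (i, j) = nexp d (nmul u v) $$ (i, j)"
  unfolding ms sum_split
  unfolding u v nmul_simps
  by (cases rule: index_cases[OF i]; cases rule: index_cases[OF j];
    simp del: fcoord_simps add: nexp_index R s dl dl' sum_negf cong: sum.cong_simp)
    (simp_all add: inner_lin_simps inner_add_left inner_add_right c power2_eq_square field_simps)
qed simp_all

section \<open>The unipotent subgroup\<close>

text \<open>The first two rows of an exponential determine its exponent; the subtracted and added
  terms undo the quadratic and cubic contributions. It is defined on all matrices, hence available
  as a continuous map on the whole group.\<close>

definition nlog :: "nat => real mat => nil" where
 "nlog d A = (let p = A $$ (0, 1); y = fvec d (%k. A $$ (1, k + 2));
   x = fvec d (%k. A $$ (0, k + 2)) - (p / 2) *\<^sub>R y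
  in (p, x, y, A $$ (0, d + 2) + inner x y / 2 + p * inner y y / 6))"

lemma nlog_Nd [simp]: "nlog d A : Nd d"
 by (simp add: nlog_def Let_def)

lemma nlog_nexp:
 assumes "u : Nd d" shows "nlog d (nexp d u) = u"
proof -
 obtain p x y e where u: "u = (p, x, y, e)" by (cases u)
 have R: "x : Rd d" "y : Rd d" using assms by (auto simp: u)
 have y: "fvec d (%k. nexp d u $$ (1, k + 2)) = y"
  by (rule fsv_eqI) (use R in \<open>auto simp: u nexp_index Rd_D not_less\<close>)
 have x: "fvec d (%k. nexp d u $$ (0, k + 2)) - (p / 2) *\<^sub>R y = x"
  by (rule fsv_eqI) (use R in \<open>auto simp: u nexp_index Rd_D not_less\<close>)
 have p: "nexp d u $$ (0, 1) = p" by (simp add: u nexp_index)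
 show ?thesis unfolding nlog_def Let_def y p x by (simp add: u nexp_index)
qed

lemma nexp_inject: "u : Nd d ==> v : Nd d ==> nexp d u = nexp d v ==> u = v"
 by (metis nlog_nexp)

lemma nexp_0 [simp]: "nexp d 0 = 1\<^sub>m (d + 4)"
proof (rule eq_matI)
 fix i j assume "i < dim_row (1\<^sub>m (d + 4) :: real mat)" "j < dim_col (1\<^sub>m (d + 4) :: real mat)"
 then have i: "i < d + 4" and j: "j < d + 4" by simp_all
 show "nexp d 0 $$ (i, j) = 1\<^sub>m (d + 4) $$ (i, j)"
  unfolding zero_prod_def
  by (cases rule: index_cases[OF i]; cases rule: index_cases[OF j]; simp add: nexp_index)
qed simp_all

lemma zero_Nd [simp]: "0 : Nd d"
 using subspace_0[OF subspace_Nd] .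

lemma uminus_Nd [simp]: "- u : Nd d \<longleftrightarrow> u : Nd d"
 using subspace_neg[OF subspace_Nd, of u d] subspace_neg[OF subspace_Nd, of "- u" d] by auto

lemma nexp_O2: "u : Nd d ==> nexp d u : O2 d"
 by (simp add: O2_def nexp_finv nexp_mult)

lemma nexp_upper_triangular: "upper_triangular (nexp d u)"
 unfolding upper_triangular_def
proof (intro allI impI)
 obtain p x y e where u: "u = (p, x, y, e)" by (cases u)
 fix i j assume i: "i < dim_row (nexp d u)" and j: "j < i"
 then have "i < d + 4" "j < d + 4" by simp_all
 from index_cases[OF this(1)] index_cases[OF this(2)] show "nexp d u $$ (i, j) = 0"
  using j unfolding u by (cases rule: index_cases[OF \<open>i < d + 4\<close>]; cases rule: index_cases[OF \<open>j < d + 4\<close>]; simp add: nexp_index)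
qed

lemma nexp_diag: "i < d + 4 ==> nexp d u $$ (i, i) = 1"
 by (cases u) (simp add: nexp_def)

lemma det_nexp [simp]: "det (nexp d u) = 1"
proof -
 have "diag_mat (nexp d u) = replicate (d + 4) 1"
  unfolding diag_mat_def by (rule nth_equalityI) (auto simp: nexp_diag)
 then show ?thesis
  using det_upper_triangular[OF nexp_upper_triangular nexp_carrier, of d u] by simp
qed

text \<open>For the middle block of a unipotent isometry: its columns have length 1 and its diagonal
  consists of ones, which forces the identity matrix.\<close>

lemma sum_squares_one:
 fixes f :: "nat => real"
 assumes "(\<Sum>l<d. f l * f l) = 1" "k < d" "f k = 1" "l < d" "l ~= k"
 shows "f l = 0"
proof -
 have "(\<Sum>l\<in>{..<d} - {k}. f l * f l) = 0"
  using assms by (simp add: sum_diff1)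
 then have "\<forall>l\<in>{..<d} - {k}. f l * f l = 0" by (subst (asm) sum_nonneg_eq_0_iff) auto
 then show ?thesis using assms by auto
qed

text \<open>Once the middle block is the identity, the pairings of columns express all entries below
  the first two rows, and also those at (1, d + 2), (1, d + 3) and (0, d + 3), through the
  coordinates that \<open>nlog\<close> reads off.\<close>

lemma unipotent_eq_nexp:
 assumes A: "A : O2 d" and ut: "upper_triangular A" and dg: "!!i. i < d + 4 ==> A $$ (i, i) = 1"
 shows "A = nexp d (nlog d A)"
proof -
 note Ac = O2_carrier[OF A]
 have z: "A $$ (i, j) = 0" if "j < i" "i < d + 4" for i j
  using ut that Ac unfolding upper_triangular_def by auto
 have M: "(\<Sum>k<d + 4. A $$ (flip d k, i) * A $$ (k, j)) = (if flip d i = j then 1 else 0)"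
  if "i < d + 4" "j < d + 4" for i j
 proof -
  have "(finv d A * A) $$ (flip d i, j) = (\<Sum>k<d + 4. A $$ (flip d k, i) * A $$ (k, j))"
   using that index_mult_sum[OF finv_carrier Ac, of "flip d i" j] by simp
  then show ?thesis using O2_left[OF A] that by simp
 qed
 note M' = M[unfolded sum_split]
 define a where "a i j = A $$ (i, j)" for i j
 note M'' = M'[folded a_def]
 have za: "j < i ==> i < d + 4 ==> a i j = 0" for i j using z by (simp add: a_def)
 have da: "i < d + 4 ==> a i i = 1" for i using dg by (simp add: a_def)
 have sq: "(\<Sum>l<d. a (l + 2) (k + 2) * a (l + 2) (k + 2)) = 1" if "k < d" for k
  using M''[of "k + 2" "k + 2"] that by (simp add: za)
 have mid: "a (l + 2) (k + 2) = (if k = l then 1 else 0)" if "k < d" "l < d" for k l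
  using sum_squares_one[of "%l. a (l + 2) (k + 2)" d k l, OF sq] that da by auto
 have dl: "(\<Sum>l<d. (if k = l then 1 else 0) * g l) = g k" if "k < d" for g :: "nat => real" and k
  using sum.delta'[of "{..<d}" k g] that by (simp add: if_distrib[of "%x. x * _"] cong: if_cong)
 have midsum: "(\<Sum>l<d. a (l + 2) (k + 2) * g l) = g k" if "k < d" for g k
  using dl[OF that, of g] by (simp add: mid that cong: sum.cong_simp)
 have y: "a (k + 2) (d + 2) = - a 1 (k + 2)" if "k < d" for k
  using M''[of "k + 2" "d + 2"] that by (simp add: za da midsum)
 have pn: "a (d + 2) (d + 3) = - a 0 1"
  using M''[of 1 "d + 3"] by (simp add: za da)
 have x: "a (k + 2) (d + 3) = - a 0 (k + 2) + a 0 1 * a 1 (k + 2)" if "k < d" for k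
 proof -
  have "a (k + 2) (d + 3) + (a 0 (k + 2) - a 1 (k + 2) * a 0 1) = 0"
   using M''[of "k + 2" "d + 3"] that by (simp add: za da midsum pn)
  then show ?thesis by (simp add: algebra_simps)
 qed
 define p where "p = a 0 1"
 define Y where "Y = fvec d (%k. a 1 (k + 2))"
 define X where "X = fvec d (%k. a 0 (k + 2)) - (p / 2) *\<^sub>R Y"
 define e where "e = a 0 (d + 2) + inner X Y / 2 + p * inner Y Y / 6"
 have R: "Y : Rd d" "X : Rd d" by (simp_all add: X_def Y_def)
 have nl: "nlog d A = (p, X, Y, e)"
  unfolding nlog_def Let_def p_def X_def Y_def e_def a_def by simp
 have Yk: "fcoord Y k = a 1 (k + 2)" "fcoord (X + (p / 2) *\<^sub>R Y) k = a 0 (k + 2)"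
  "fcoord ((p / 2) *\<^sub>R Y - X) k = a (k + 2) (d + 3)" if "k < d" for k
  using that x[OF that] by (simp_all add: Y_def X_def p_def)
 have sYY: "(\<Sum>l<d. a (l + 2) (d + 2) * a (l + 2) (d + 2)) = inner Y Y"
  unfolding inner_Rd[OF R(1)] by (simp add: y Yk cong: sum.cong_simp)
 have sYX: "(\<Sum>l<d. a (l + 2) (d + 2) * a (l + 2) (d + 3)) = - inner Y ((p / 2) *\<^sub>R Y - X)"
  unfolding inner_Rd[OF R(1)] by (simp del: fcoord_simps add: y Yk sum_negf cong: sum.cong_simp)
 have sXX: "(\<Sum>l<d. a (l + 2) (d + 3) * a (l + 2) (d + 3)) = inner ((p / 2) *\<^sub>R Y - X) ((p / 2) *\<^sub>R Y - X)"
  by (subst inner_Rd[of _ d]) (use R in \<open>simp_all del: fcoord_simps add: Yk cong: sum.cong_simp\<close>)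
 have nn: "a 1 (d + 2) = - inner Y Y / 2"
  using M''[of "d + 2" "d + 2"] by (simp add: za da sYY)
 have c: "inner Y X = inner X Y" by (rule inner_commute)
 have n1: "a 1 (d + 3) = - e - inner X Y / 2 + p * inner Y Y / 6"
  using M''[of "d + 2" "d + 3"]
  by (simp add: za da sYX nn pn p_def[symmetric] e_def inner_lin_simps c field_simps)
 have n0: "a 0 (d + 3) = - p * e - inner X X / 2 + p\<^sup>2 * inner Y Y / 24"
  using M''[of "d + 3" "d + 3"]
  by (simp add: za da sXX n1 pn p_def[symmetric] inner_lin_simps c field_simps power2_eq_square)
 have e': "a 0 (d + 2) = e - inner X Y / 2 - p * inner Y Y / 6" by (simp add: e_def)
 show ?thesis
 proof (rule eq_matI)
  fix i j assume "i < dim_row (nexp d (nlog d A))" "j < dim_col (nexp d (nlog d A))"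
  then have i: "i < d + 4" and j: "j < d + 4" by simp_all
  show "A $$ (i, j) = nexp d (nlog d A) $$ (i, j)"
   unfolding nl a_def[symmetric]
   by (cases rule: index_cases[OF i]; cases rule: index_cases[OF j];
    simp del: fcoord_simps add: nexp_index za da mid y pn Yk nn n1 n0 e' p_def[symmetric])
 qed (use Ac in auto)
qed

lemma unipotent_N_eq: "unipotent_N (d + 2) = nexp d ` Nd d"
proof -
 have e: "d + 2 + 2 = d + 4" by simp
 show ?thesis
 proof safe
  fix A assume "A : unipotent_N (d + 2)"
  then have "A = nexp d (nlog d A)"
   unfolding unipotent_N_def carrier_SO2 e by (intro unipotent_eq_nexp) auto
  then show "A : nexp d ` Nd d" by (rule image_eqI) simp
 next
  fix u assume "u : Nd d"
  then show "nexp d u : unipotent_N (d + 2)"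
   unfolding unipotent_N_def carrier_SO2 e by (simp add: nexp_O2 nexp_upper_triangular nexp_diag)
 qed
qed

section \<open>Matrix topology, boxes, continuity of \<open>nexp\<close> and
  \<open>nlog\<close>\<close>

lemma topspace_mat_topology [simp]: "topspace (mat_topology m) = carrier_mat m m"
 unfolding mat_topology_def topspace_pullback_topology by (auto simp: PiE_def)

lemma continuous_map_mat_entry:
 assumes "i < m" "j < m"
 shows "continuous_map (mat_topology m) euclideanreal (%A. A $$ (i, j))"
proof -
 have "continuous_map (product_topology (%_. euclideanreal) ({..<m} \<times> {..<m})) euclideanreal (%f. f (i, j))"
  by (rule continuous_map_product_projection) (use assms in auto)
 from continuous_map_pullback[OF this, of "carrier_mat m m" "%A. restrict (%p. A $$ p) ({..<m} \<times> {..<m})"]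
 show ?thesis using assms by (simp add: mat_topology_def o_def)
qed

lemma continuous_map_into_mat_topology:
 assumes "!!x. x : topspace X ==> f x : carrier_mat m m"
  and "!!i j. i < m ==> j < m ==> continuous_map X euclideanreal (%x. f x $$ (i, j))"
 shows "continuous_map X (mat_topology m) f"
 unfolding mat_topology_def
proof (rule continuous_map_pullback')
 show "continuous_map X (product_topology (%_. euclideanreal) ({..<m} \<times> {..<m}))
   ((%A. restrict (%p. A $$ p) ({..<m} \<times> {..<m})) \<circ> f)"
  unfolding continuous_map_componentwise
 proof (intro conjI ballI)
  fix p assume "p : {..<m} \<times> {..<m}"
  then obtain i j where p: "p = (i, j)" "i < m" "j < m" by blast
  then show "continuous_map X euclideanreal (%x. ((%A. restrict (%p. A $$ p) ({..<m} \<times> {..<m})) \<circ> f) x p)"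
   using assms(2)[OF p(2,3)] by simp
 qed force
 show "topspace X \<subseteq> f -` carrier_mat m m" using assms(1) by blast
qed

text \<open>The box is a continuous image of a product of intervals, compact by Tychonoff.\<close>

lemma compactin_mat_box:
 "compactin (mat_topology m) {A \<in> carrier_mat m m. \<forall>i<m. \<forall>j<m. \<bar>A $$ (i, j)\<bar> <= B}"
proof -
 let ?I = "{..<m} \<times> {..<m}"
 let ?P = "product_topology (%_::nat \<times> nat. euclideanreal) ?I"
 have "compactin ?P (PiE ?I (%_. {-B..B}))"
  unfolding compactin_PiE by (intro disjI2 ballI) simp
 moreover have "continuous_map ?P (mat_topology m) (%f. mat m m f)"
 proof (rule continuous_map_into_mat_topology)
  fix i j assume ij: "i < m" "j < m"
  have "continuous_map ?P euclideanreal (%f. f (i, j))"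
   by (rule continuous_map_product_projection) (use ij in auto)
  then show "continuous_map ?P euclideanreal (%f. mat m m f $$ (i, j))" using ij by simp
 qed simp
 ultimately have "compactin (mat_topology m) ((%f. mat m m f) ` PiE ?I (%_. {-B..B}))"
  by (rule image_compactin)
 moreover have "(%f. mat m m f) ` PiE ?I (%_. {-B..B}) =
   {A \<in> carrier_mat m m. \<forall>i<m. \<forall>j<m. \<bar>A $$ (i, j)\<bar> <= B}" (is "?L = ?R")
 proof
  show "?L \<subseteq> ?R"
  proof
   fix A assume "A : ?L"
   then obtain f where f: "A = mat m m f" "f : PiE ?I (%_. {-B..B})" by blast
   have "f (i, j) : {-B..B}" if "i < m" "j < m" for i j
    using PiE_mem[OF f(2), of "(i, j)"] that by simp
   then show "A : ?R" unfolding f(1) by (simp add: abs_le_iff minus_le_iff)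
  qed
  show "?R \<subseteq> ?L"
  proof
   fix A assume A: "A : ?R"
   then have "A = mat m m (restrict (%p. A $$ p) ?I)" by (intro eq_matI) auto
   moreover have "A $$ p : {-B..B}" if "p : ?I" for p
    using A that by (cases p) (simp add: abs_le_iff minus_le_iff)
   then have "restrict (%p. A $$ p) ?I : PiE ?I (%_. {-B..B})"
    by (simp only: restrict_PiE_iff) blast
   ultimately show "A : ?L" by blast
  qed
 qed
 ultimately show ?thesis by simp
qed

lemma closedin_level:
 assumes "continuous_map X euclideanreal f"
 shows "closedin X {x \<in> topspace X. f x = c}"
 using closedin_continuous_map_preimage[OF assms, of "{c}"] by simp

text \<open>The defining equations are polynomial in the entries; for the determinant the Leibniz
  formula shows this.\<close>

lemma closedin_carrier_SO2: "closedin (mat_topology (d + 4)) (carrier (SO d))"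
proof -
 let ?T = "mat_topology (d + 4)"
 let ?M = "Mat d"
 have d: "continuous_map ?T euclideanreal det"
 proof -
  have "continuous_map ?T euclideanreal
    (%A. \<Sum>p | p permutes {0..<d + 4}. signof p * (\<Prod>i = 0..<d + 4. A $$ (i, p i)))"
   by (intro continuous_map_sum continuous_map_real_mult continuous_map_prod continuous_map_mat_entry
     finite_permutations) (auto simp: permutes_in_image)
  then show ?thesis
   by (rule continuous_map_eq) (simp add: det_def'[of _ "d + 4"])
 qed
 have "closedin ?T ((\<Inter>p\<in>{..<d + 4} \<times> {..<d + 4}. {A \<in> ?M. (finv d A * A) $$ p = 1\<^sub>m (d + 4) $$ p}) \<inter> {A \<in> ?M. det A = 1})"
 proof (intro closedin_Int closedin_INT)
  show "closedin ?T {A \<in> ?M. det A = 1}" using closedin_level[OF d] by simp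
  fix p assume "p : {..<d + 4} \<times> {..<d + 4}"
  then obtain i j where p: "p = (i, j)" "i < d + 4" "j < d + 4" by auto
  have "continuous_map ?T euclideanreal (%A. \<Sum>k<d + 4. A $$ (flip d k, flip d i) * A $$ (k, j))"
   by (intro continuous_map_sum continuous_map_real_mult continuous_map_mat_entry) (use p in auto)
  then have "continuous_map ?T euclideanreal (%A. (finv d A * A) $$ p)"
   by (rule continuous_map_eq) (use p index_mult_sum[OF finv_carrier] in auto)
  then show "closedin ?T {A \<in> ?M. (finv d A * A) $$ p = 1\<^sub>m (d + 4) $$ p}"
   using closedin_level by fastforce
 qed (auto simp: lessThan_empty_iff)
 moreover have "(\<Inter>p\<in>{..<d + 4} \<times> {..<d + 4}. {A \<in> ?M. (finv d A * A) $$ p = 1\<^sub>m (d + 4) $$ p}) \<inter> {A \<in> ?M. det A = 1}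
   = carrier (SO d)"
 proof -
  have "finv d A * A = 1\<^sub>m (d + 4)"
   if "\<forall>p\<in>{..<d + 4} \<times> {..<d + 4}. (finv d A * A) $$ p = 1\<^sub>m (d + 4) $$ p" "A : ?M" for A
   by (rule eq_matI) (use that in auto)
  then show ?thesis unfolding carrier_SO2 O2_def by auto
 qed
 ultimately show ?thesis by (simp only:)
qed

lemma SO2_topology_eq:
 "SO_top d = subtopology (mat_topology (d + 4)) (carrier (SO d))"
proof -
 have e: "d + 2 + 2 = d + 4" by simp
 show ?thesis unfolding SO2_topology_def e ..
qed

lemma topspace_SO2_topology [simp]: "topspace (SO_top d) = carrier (SO d)"
 unfolding SO2_topology_eq using closedin_subset[OF closedin_carrier_SO2] by auto

text \<open>These boxes are compact and, by \<open>compactin_SO2_bounded\<close>, absorb every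
  compact set, so compactness can be handled as a bound on the entries.\<close>

definition SObox :: "nat => real => real mat set" where
 "SObox d B = {A \<in> carrier (SO d). \<forall>i<d + 4. \<forall>j<d + 4. \<bar>A $$ (i, j)\<bar> <= B}"

lemma compactin_SObox: "compactin (SO_top d) (SObox d B)"
proof -
 have "SObox d B = carrier (SO d) \<inter> {A \<in> Mat d. \<forall>i<d + 4. \<forall>j<d + 4. \<bar>A $$ (i, j)\<bar> <= B}"
  unfolding SObox_def carrier_SO2 by (auto dest: O2_carrier)
 then have "compactin (mat_topology (d + 4)) (SObox d B)"
  by (simp only:) (rule closed_Int_compactin[OF closedin_carrier_SO2 compactin_mat_box])
 then show ?thesis unfolding SO2_topology_eq compactin_subtopology by (auto simp: SObox_def)
qed

lemma continuous_map_SO2_entry: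
 "i < d + 4 ==> j < d + 4 ==> continuous_map (SO_top d) euclideanreal (%A. A $$ (i, j))"
 unfolding SO2_topology_eq by (intro continuous_map_from_subtopology continuous_map_mat_entry)

lemma compactin_SO2_bounded:
 assumes "compactin (SO_top d) C"
 shows "\<exists>B. C \<subseteq> SObox d B"
proof -
 have "\<exists>B. \<forall>A\<in>C. \<bar>A $$ (i, j)\<bar> <= B" if "i < d + 4" "j < d + 4" for i j
 proof -
  have "compact ((%A. A $$ (i, j)) ` C)"
   using image_compactin[OF assms continuous_map_SO2_entry[OF that]] by simp
  then have "bounded ((%A. A $$ (i, j)) ` C)" by (rule compact_imp_bounded)
  then show ?thesis unfolding bounded_iff by auto
 qed
 then have "\<forall>i j. \<exists>B. i < d + 4 --> j < d + 4 --> (\<forall>A\<in>C. \<bar>A $$ (i, j)\<bar> <= B)" by blast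
 then obtain B where B: "!!i j A. i < d + 4 ==> j < d + 4 ==> A : C ==> \<bar>A $$ (i, j)\<bar> <= B i j"
  unfolding choice_iff by blast
 define D where "D = (\<Sum>i<d + 4. \<Sum>j<d + 4. \<bar>B i j\<bar>)"
 have "B i j <= D" if "i < d + 4" "j < d + 4" for i j
 proof -
  have "\<bar>B i j\<bar> <= (\<Sum>j<d + 4. \<bar>B i j\<bar>)" by (rule member_le_sum) (use that in auto)
  also have "\<dots> <= D" unfolding D_def by (rule member_le_sum) (use that in \<open>auto intro: sum_nonneg\<close>)
  finally show ?thesis by simp
 qed
 note D = this
 have C: "C \<subseteq> carrier (SO d)" using compactin_subset_topspace[OF assms] by simp
 have "C \<subseteq> SObox d D"
 proof
  fix A assume A: "A : C"
  have "\<bar>A $$ (i, j)\<bar> <= D" if "i < d + 4" "j < d + 4" for i j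
   using B[OF that A] D[OF that] by linarith
  then show "A : SObox d D" using A C unfolding SObox_def by blast
 qed
 then show ?thesis by blast
qed

lemma continuous_map_nexp: "continuous_map (top_of_set (Nd d)) (SO_top d) (nexp d)"
 unfolding SO2_topology_eq
proof (rule continuous_map_into_subtopology)
 show "continuous_map (top_of_set (Nd d)) (mat_topology (d + 4)) (nexp d)"
 proof (rule continuous_map_into_mat_topology)
  fix i j assume i: "i < d + 4" and j: "j < d + 4"
  have c: "continuous_on (Nd d) fst" "continuous_on (Nd d) (%u. fst (snd u))"
   "continuous_on (Nd d) (%u. fst (snd (snd u)))" "continuous_on (Nd d) (%u. snd (snd (snd u)))"
   by (intro continuous_on_fst continuous_on_snd continuous_on_id)+
  have dv: "continuous_on A (%u. f u / r)" if "continuous_on A f" for A :: "nil set" and f and r :: real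
   using continuous_on_mult_right[OF that, of "inverse r"] by (simp only: divide_inverse)
  have ci: "continuous_on A (%u. inner (f u) (g u))"
   if "continuous_on A f" "continuous_on A g" for A :: "nil set" and f g :: "nil => fsv"
   using that tendsto_inner unfolding continuous_on_def by blast
  have "continuous_on (Nd d) (%u. nexp d (fst u, fst (snd u), fst (snd (snd u)), snd (snd (snd u))) $$ (i, j))"
   by (cases rule: index_cases[OF i]; cases rule: index_cases[OF j];
    simp only: nexp_index;
    intro continuous_on_add continuous_on_diff continuous_on_mult continuous_on_minus dv ci
     continuous_on_power continuous_on_scaleR continuous_on_fcoord continuous_on_const c)
  then show "continuous_map (top_of_set (Nd d)) euclideanreal (%u. nexp d u $$ (i, j))" by simp
 qed simp
qed (auto simp: carrier_SO2 nexp_O2)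

text \<open>Constant vectors with polynomial coefficients: continuity of \<open>nlog\<close> thereby
  reduces to continuity of real functions of the entries.\<close>

lemma nlog_expansion:
 "nlog d A = A $$ (0, 1) *\<^sub>R (1, 0, 0, 0) +
   (\<Sum>k<d. (A $$ (0, k + 2) - A $$ (0, 1) / 2 * A $$ (1, k + 2)) *\<^sub>R (0, ax k, 0, 0)) +
   (\<Sum>k<d. A $$ (1, k + 2) *\<^sub>R (0, 0, ax k, 0)) +
   (A $$ (0, d + 2) + (\<Sum>k<d. (A $$ (0, k + 2) - A $$ (0, 1) / 2 * A $$ (1, k + 2)) * A $$ (1, k + 2)) / 2
    + A $$ (0, 1) * (\<Sum>k<d. A $$ (1, k + 2) * A $$ (1, k + 2)) / 6) *\<^sub>R (0, 0, 0, 1)"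
proof -
 have s: "(\<Sum>k<m. f k *\<^sub>R (0::real, ax k, 0::fsv, 0::real)) = (0, \<Sum>k<m. f k *\<^sub>R ax k, 0, 0)"
  "(\<Sum>k<m. f k *\<^sub>R (0::real, 0::fsv, ax k, 0::real)) = (0, 0, \<Sum>k<m. f k *\<^sub>R ax k, 0)" for f m
  by (induction m) (auto simp: zero_prod_def)
 let ?y = "fvec d (%k. A $$ (1, k + 2))"
 let ?x = "fvec d (%k. A $$ (0, k + 2)) - (A $$ (0, 1) / 2) *\<^sub>R ?y"
 have y: "?y = (\<Sum>k<d. A $$ (1, k + 2) *\<^sub>R ax k)"
  by (rule trans[OF Rd_expansion[of _ d]], simp, rule sum.cong) auto
 have x: "?x = (\<Sum>k<d. (A $$ (0, k + 2) - A $$ (0, 1) / 2 * A $$ (1, k + 2)) *\<^sub>R ax k)"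
  by (rule trans[OF Rd_expansion[of _ d]], simp, rule sum.cong) auto
 have i: "inner ?x ?y = (\<Sum>k<d. (A $$ (0, k + 2) - A $$ (0, 1) / 2 * A $$ (1, k + 2)) * A $$ (1, k + 2))"
   "inner ?y ?y = (\<Sum>k<d. A $$ (1, k + 2) * A $$ (1, k + 2))"
  by (subst inner_Rd[of _ d], simp, rule sum.cong, simp, simp)+
 have n: "nlog d A = (A $$ (0, 1), ?x, ?y, A $$ (0, d + 2) + inner ?x ?y / 2 + A $$ (0, 1) * inner ?y ?y / 6)"
  by (simp only: nlog_def Let_def)
 show ?thesis
  unfolding n i unfolding x unfolding y unfolding s by (simp only: scaleR_Pair add_Pair scaleR_zero_right real_scaleR_def) simp
qed

lemma continuous_map_nlog: "continuous_map (SO_top d) euclidean (nlog d)"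
proof -
 have sc: "continuous_map X euclidean (%A. f A *\<^sub>R c)" if "continuous_map X euclideanreal f"
  for X :: "real mat topology" and f and c :: nil
 proof -
  have "continuous_map euclideanreal euclidean (%t. t *\<^sub>R c)" by (simp add: continuous_intros)
  from continuous_map_compose[OF that this] show ?thesis by (simp add: o_def)
 qed
 let ?T = "SO_top d"
 have E: "continuous_map ?T euclideanreal (%A. A $$ (i, j))" if "i < d + 4" "j < d + 4" for i j
  using that by (rule continuous_map_SO2_entry)
 have dv: "continuous_map ?T euclideanreal (%A. f A / c)" if "continuous_map ?T euclideanreal f" for f and c :: real
  using continuous_map_real_mult_right[OF that, of "inverse c"] by (simp only: divide_inverse)
 have E0: "continuous_map ?T euclideanreal (%A. A $$ (0, 1))"
  "continuous_map ?T euclideanreal (%A. A $$ (0, d + 2))" by (rule E; simp)+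
 have E1: "continuous_map ?T euclideanreal (%A. A $$ (0, k + 2))"
  "continuous_map ?T euclideanreal (%A. A $$ (1, k + 2))" if "k < d" for k
  by (rule E; use that in simp)+
 have X: "continuous_map ?T euclideanreal (%A. A $$ (0, k + 2) - A $$ (0, 1) / 2 * A $$ (1, k + 2))" if "k < d" for k
  by (rule continuous_map_diff[OF E1(1)[OF that] continuous_map_real_mult[OF dv[OF E0(1)] E1(2)[OF that]]])
 have S1: "continuous_map ?T euclidean (%A. \<Sum>k<d. (A $$ (0, k + 2) - A $$ (0, 1) / 2 * A $$ (1, k + 2)) *\<^sub>R ((0, ax k, 0, 0) :: nil))"
  by (rule continuous_map_sum[OF finite_lessThan sc[OF X]]) simp
 have S2: "continuous_map ?T euclidean (%A. \<Sum>k<d. A $$ (1, k + 2) *\<^sub>R ((0, 0, ax k, 0) :: nil))"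
  by (rule continuous_map_sum[OF finite_lessThan sc[OF E1(2)]]) simp
 have S3: "continuous_map ?T euclideanreal (%A. \<Sum>k<d. (A $$ (0, k + 2) - A $$ (0, 1) / 2 * A $$ (1, k + 2)) * A $$ (1, k + 2))"
  by (rule continuous_map_sum[OF finite_lessThan]) (rule continuous_map_real_mult[OF X E1(2)], simp_all)
 have S4: "continuous_map ?T euclideanreal (%A. \<Sum>k<d. A $$ (1, k + 2) * A $$ (1, k + 2))"
  by (rule continuous_map_sum[OF finite_lessThan]) (rule continuous_map_real_mult[OF E1(2) E1(2)], simp_all)
 note last = sc[OF continuous_map_add[OF continuous_map_add[OF E0(2) dv[OF S3]] dv[OF continuous_map_real_mult[OF E0(1) S4]]]]
 show ?thesis
  unfolding nlog_expansion[abs_def]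
  by (rule continuous_map_add[OF continuous_map_add[OF continuous_map_add[OF sc[OF E0(1)] S1] S2] last])
qed

text \<open>Inside the group the image is described by closed conditions: the entries on and below
  the diagonal are those of the identity, and the continuous map \<open>nlog\<close> takes values in
  \<open>V\<close>.\<close>

lemma closedin_nexp_image:
 assumes V: "closed V" "V \<subseteq> Nd d"
 shows "closedin (SO_top d) (nexp d ` V)"
proof -
 let ?T = "SO_top d"
 let ?G = "carrier (SO d)"
 have "closedin ?T ((\<Inter>p\<in>{p \<in> {..<d + 4} \<times> {..<d + 4}. snd p <= fst p}. {A \<in> ?G. A $$ p = 1\<^sub>m (d + 4) $$ p}) \<inter> {A \<in> ?G. nlog d A : V})"
 proof (intro closedin_Int closedin_INT)
  show "closedin ?T {A \<in> ?G. nlog d A : V}"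
   using closedin_continuous_map_preimage[OF continuous_map_nlog, of V d] V by simp
  fix p assume "p : {p \<in> {..<d + 4} \<times> {..<d + 4}. snd p <= fst p}"
  then obtain i j where p: "p = (i, j)" "i < d + 4" "j < d + 4" by auto
  show "closedin ?T {A \<in> ?G. A $$ p = 1\<^sub>m (d + 4) $$ p}"
   using closedin_level[OF continuous_map_SO2_entry, of i d j] p by simp
 next
  have "(0, 0) : {p \<in> {..<d + 4} \<times> {..<d + 4}. snd p <= fst p}" by simp
  then show "{p \<in> {..<d + 4} \<times> {..<d + 4}. snd p <= fst p} ~= {}" by blast
 qed
 moreover have "(\<Inter>p\<in>{p \<in> {..<d + 4} \<times> {..<d + 4}. snd p <= fst p}. {A \<in> ?G. A $$ p = 1\<^sub>m (d + 4) $$ p}) \<inter> {A \<in> ?G. nlog d A : V} = nexp d ` V" (is "?L = _")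
 proof (intro Set.set_eqI iffI)
  fix A assume "A : ?L"
  then have e: "A $$ (i, j) = 1\<^sub>m (d + 4) $$ (i, j)" if "j <= i" "i < d + 4" for i j
   using that by auto
  from \<open>A : ?L\<close> have G: "A : ?G" and v: "nlog d A : V" by auto
  have "A = nexp d (nlog d A)"
  proof (rule unipotent_eq_nexp)
   show O: "A : O2 d" using G by (simp add: carrier_SO2)
   show "upper_triangular A" unfolding upper_triangular_def
    using e O2_carrier[OF O] by auto
   show "!!i. i < d + 4 ==> A $$ (i, i) = 1" using e by simp
  qed
  then show "A : nexp d ` V" using v by blast
 next
  fix A assume "A : nexp d ` V"
  then obtain u where u: "u : V" "A = nexp d u" by blast
  then have n: "u : Nd d" using V by auto
  have G: "A : ?G" using n u by (simp add: carrier_SO2 nexp_O2)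
  have l: "nlog d A : V" using u n by (simp add: nlog_nexp)
  have "A $$ (i, j) = 1\<^sub>m (d + 4) $$ (i, j)" if "i < d + 4" "j < d + 4" "j <= i" for i j
   using nexp_upper_triangular[of d u] nexp_diag[of i d u] that u(2)
   by (cases "i = j") (auto simp: upper_triangular_def)
  then have "A $$ p = 1\<^sub>m (d + 4) $$ p" if "p : {p \<in> {..<d + 4} \<times> {..<d + 4}. snd p <= fst p}" for p
   using that by (cases p) simp
  with G l show "A : ?L" by blast
 qed
 ultimately show ?thesis by (simp only:)
qed

lemma connectedin_nexp_image:
 "connected V ==> V \<subseteq> Nd d ==> connectedin (SO_top d) (nexp d ` V)"
 by (rule connectedin_continuous_map_image[OF continuous_map_nexp])
   (simp add: connectedin_subtopology)

text \<open>The logarithmic picture of the subgroup is closed because \<open>nexp\<close> is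
  continuous, connected because \<open>nlog\<close> is, and closed under \<open>nmul\<close> by
  \<open>nexp_mult\<close>.\<close>

lemma unipotent_subgroup_linear:
 assumes H: "subgroup H (SO d)" "closedin (SO_top d) H" "connectedin (SO_top d) H"
  and N: "H \<subseteq> unipotent_N (d + 2)"
 obtains V where "V \<subseteq> Nd d" "subspace V" "!!u v. u : V ==> v : V ==> nbr u v : V" "H = nexp d ` V"
proof -
 define V where "V = nlog d ` H"
 have HN: "A = nexp d (nlog d A)" if "A : H" for A
  using N that unfolding unipotent_N_eq by (auto simp: nlog_nexp)
 have VN: "V \<subseteq> Nd d" by (auto simp: V_def)
 have VH: "u : V \<longleftrightarrow> nexp d u : H" if "u : Nd d" for u
  unfolding V_def using HN that by (auto simp: nlog_nexp image_iff) (metis nlog_nexp)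
 have HV: "H = nexp d ` V" unfolding V_def using HN by (auto simp: image_image)
 have "V = Nd d \<inter> nexp d -` H" using VH VN by auto
 moreover have "closedin (top_of_set (Nd d)) (Nd d \<inter> nexp d -` H)"
  using closedin_continuous_map_preimage[OF continuous_map_nexp H(2)]
  by (simp add: Collect_conj_eq vimage_def)
 ultimately have cl: "closed V" using closed_Nd closedin_closed_trans by metis
 have co: "connected V" unfolding V_def
  using connectedin_continuous_map_image[OF continuous_map_nlog H(3)] by simp
 have 0: "0 : V"
  using subgroup.one_closed[OF H(1)] VH[of 0] by (simp add: SO2_one)
 have mul: "nmul u v : V" if "u : V" "v : V" for u v
 proof -
  have uv: "u : Nd d" "v : Nd d" using that VN by blast+
  have "nexp d u : H" "nexp d v : H" using that HV by blast+
  then have "nexp d u * nexp d v : H" using subgroup.m_closed[OF H(1)] by fastforce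
  then show ?thesis using VH[OF nmul_Nd[OF uv]] by (simp add: nexp_mult uv)
 qed
 have inv: "- u : V" if "u : V" for u
 proof -
  have "nexp d u : H" "u : Nd d" using that VN HV by auto
  then show ?thesis
   using subgroup.m_inv_closed[OF H(1), of "nexp d u"] VH[of "- u"]
   by (simp add: inv_SO2 carrier_SO2 nexp_O2 nexp_finv)
 qed
 note * = closed_connected_nil_subgroup[OF cl 0 mul inv VN subspace_Nd compact_Nd_sphere co]
 show ?thesis by (rule that[OF VN *(1) *(2) HV])
qed

lemma nexp_subgroup:
 assumes V: "V \<subseteq> Nd d" "0 : V" "!!u v. u : V ==> v : V ==> nmul u v : V" "!!u. u : V ==> - u : V"
 shows "subgroup (nexp d ` V) (SO d)"
proof (rule group.subgroupI[OF group_SO2])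
 have N: "u : V ==> u : Nd d" for u using V(1) by auto
 show "nexp d ` V \<subseteq> carrier (SO d)" using N by (auto simp: carrier_SO2 nexp_O2)
 show "nexp d ` V ~= {}" using V(2) by auto
 fix a assume "a : nexp d ` V"
 then obtain u where u: "u : V" "a = nexp d u" by auto
 then show "inv\<^bsub>SO d\<^esub> a : nexp d ` V"
  using N V(4) by (simp add: inv_SO2 carrier_SO2 nexp_O2 nexp_finv)
 fix b assume "b : nexp d ` V"
 then obtain v where v: "v : V" "b = nexp d v" by blast
 have "a \<otimes>\<^bsub>SO d\<^esub> b = nexp d (nmul u v)"
  using nexp_mult[OF N[OF u(1)] N[OF v(1)]] u(2) v(2) by simp
 then show "a \<otimes>\<^bsub>SO d\<^esub> b : nexp d ` V" using V(3)[OF u(1) v(1)] by blast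
qed

section \<open>A coarse Cartan decomposition\<close>

definition diagm :: "nat => (nat => real) => real mat" where
 "diagm d f = mat (d + 4) (d + 4) (%(i, j). if i = j then f i else 0)"

lemma diagm_carrier [simp]: "diagm d f : Mat d"
 by (simp add: diagm_def)

lemma diagm_index [simp]: "i < d + 4 ==> j < d + 4 ==> diagm d f $$ (i, j) = (if i = j then f i else 0)"
 by (simp add: diagm_def)

lemma sum_single:
 fixes f :: "nat => real"
 assumes "i < m" "!!k. k < m ==> k ~= i ==> f k = 0"
 shows "(\<Sum>k<m. f k) = f i"
proof -
 have "(\<Sum>k<m. f k) = (\<Sum>k\<in>{i}. f k)"
  by (rule sum.mono_neutral_right) (use assms in auto)
 then show ?thesis by simp
qed

lemma diagm_mult_left:
 assumes "A : Mat d" "i < d + 4" "j < d + 4"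
 shows "(diagm d f * A) $$ (i, j) = f i * A $$ (i, j)"
 unfolding index_mult_sum[OF diagm_carrier assms]
 by (subst sum_single[of i]) (use assms in auto)

lemma diagm_mult: "diagm d f * diagm d g = diagm d (%i. f i * g i)"
proof (rule eq_matI)
 fix i j assume "i < dim_row (diagm d (%i. f i * g i))" "j < dim_col (diagm d (%i. f i * g i))"
 then have ij: "i < d + 4" "j < d + 4" by (simp_all add: diagm_def)
 then show "(diagm d f * diagm d g) $$ (i, j) = diagm d (%i. f i * g i) $$ (i, j)"
  using diagm_mult_left[OF diagm_carrier ij, of f g] by simp
qed (simp_all add: diagm_def)

lemma diagm_O2:
 assumes "!!i. i < d + 4 ==> f i * f (flip d i) = 1"
 shows "diagm d f : O2 d"
proof -
 have "finv d (diagm d f) = diagm d (%i. f (flip d i))"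
  by (rule eq_matI) (auto simp: diagm_def)
 then have "finv d (diagm d f) * diagm d f = diagm d (%i. f (flip d i) * f i)"
  by (simp add: diagm_mult)
 also have "\<dots> = 1\<^sub>m (d + 4)"
  by (rule eq_matI) (use assms in \<open>auto simp: diagm_def mult.commute\<close>)
 finally show ?thesis by (simp add: O2_def)
qed

lemma det_diagm: "det (diagm d f) = (\<Prod>i<d + 4. f i)"
proof -
 have "upper_triangular (diagm d f)" by (auto simp: upper_triangular_def diagm_def)
 then have "det (diagm d f) = prod_list (diag_mat (diagm d f))"
  by (rule det_upper_triangular[OF _ diagm_carrier])
 also have "\<dots> = (\<Prod>i<d + 4. f i)"
  by (simp add: prod_list_diag_prod lessThan_atLeast0 diagm_def)
 finally show ?thesis .
qed

text \<open>A maximal split torus, signs included; the pairs with 1 <= b <= a form the closed Weyl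
  chamber.\<close>

definition dg :: "nat => real => real => real mat" where
 "dg d a b = diagm d (%i. if i = 0 then a else if i = 1 then b else if i = d + 2 then 1 / b
   else if i = d + 3 then 1 / a else 1)"

lemma dg_carrier [simp]: "dg d a b : Mat d"
 by (simp add: dg_def)

lemma dg_O2: "a ~= 0 ==> b ~= 0 ==> dg d a b : O2 d"
 unfolding dg_def by (rule diagm_O2) (auto simp: flip_def)

lemma prod_split:
 fixes f :: "nat => real"
 shows "(\<Prod>k<d + 4. f k) = f 0 * (f 1 * ((\<Prod>k<d. f (k + 2)) * (f (d + 2) * f (d + 3))))"
proof -
 have "(\<Prod>k<d + 4. f k) = (\<Prod>k<Suc (Suc (Suc (Suc d))). f k)" by (simp add: numeral_eq_Suc)
 also have "\<dots> = (\<Prod>k<Suc (Suc d). f k) * (f (d + 2) * f (d + 3))"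
  by (simp add: mult.assoc numeral_eq_Suc)
 also have "(\<Prod>k<Suc (Suc d). f k) = f 0 * (f 1 * (\<Prod>k<d. f (k + 2)))"
  by (simp only: prod.lessThan_Suc_shift) (simp add: add_2_eq_Suc' One_nat_def)
 finally show ?thesis by (simp add: mult.assoc)
qed

lemma det_dg: "a ~= 0 ==> b ~= 0 ==> det (dg d a b) = 1"
 unfolding dg_def det_diagm prod_split by simp

lemma dg_mult: "dg d a b * dg d a' b' = dg d (a * a') (b * b')"
 unfolding dg_def diagm_mult by (intro arg_cong[of _ _ "diagm d"] ext) auto

text \<open>An isometry of determinant -1 that commutes with every \<open>dg\<close>; it corrects
  determinants in \<open>coarsely_dense_imp_cartan\<close>.\<close>

definition rf :: "nat => real mat" where
 "rf d = diagm d (%i. if i = 2 then - 1 else 1)"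

lemma rf_O2: "1 <= d ==> rf d : O2 d"
 unfolding rf_def by (rule diagm_O2) (auto simp: flip_def)

lemma det_rf: assumes "1 <= d" shows "det (rf d) = - 1"
proof -
 have "(\<Prod>k<d. if k = 0 then - 1 else (1::real)) = - 1"
  using assms prod.delta[of "{..<d}" 0 "%_. - 1::real"] by simp
 then show ?thesis using assms unfolding rf_def det_diagm prod_split by simp
qed

lemma rf_dg: "rf d * (dg d a b * rf d) = dg d a b" if "1 <= d"
 unfolding rf_def dg_def diagm_mult
 by (intro arg_cong[of _ _ "diagm d"] ext) (use that in auto)

definition pm :: "nat => (nat => nat) => real mat" where
 "pm d \<sigma> = mat (d + 4) (d + 4) (%(i, j). if j = \<sigma> i then 1 else 0)"

lemma pm_carrier [simp]: "pm d \<sigma> : Mat d"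
 by (simp add: pm_def)

text \<open>Involutions of the indices that respect the pairing \<open>flip\<close>, so that the
  permutation matrix is a symmetric isometry.\<close>

definition good_perm :: "nat => (nat => nat) => bool" where
 "good_perm d \<sigma> \<longleftrightarrow> (\<forall>i<d + 4. \<sigma> i < d + 4 & \<sigma> (\<sigma> i) = i & \<sigma> (flip d i) = flip d (\<sigma> i))"

lemma pm_mult_left:
 assumes "good_perm d \<sigma>" "A : Mat d" "i < d + 4" "j < d + 4"
 shows "(pm d \<sigma> * A) $$ (i, j) = A $$ (\<sigma> i, j)"
 unfolding index_mult_sum[OF pm_carrier assms(2-4)]
 by (subst sum_single[of "\<sigma> i"]) (use assms in \<open>auto simp: pm_def good_perm_def\<close>)

lemma pm_O2:
 assumes g: "good_perm d \<sigma>" shows "pm d \<sigma> : O2 d"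
proof -
 have "finv d (pm d \<sigma>) = pm d \<sigma>"
 proof (rule eq_matI)
  fix i j assume "i < dim_row (pm d \<sigma>)" "j < dim_col (pm d \<sigma>)"
  then have ij: "i < d + 4" "j < d + 4" by (simp_all add: pm_def)
  have "flip d i = \<sigma> (flip d j) \<longleftrightarrow> j = \<sigma> i"
   using g ij unfolding good_perm_def by (metis flip_flip)
  then show "finv d (pm d \<sigma>) $$ (i, j) = pm d \<sigma> $$ (i, j)"
   using ij by (simp add: pm_def)
 qed (simp_all add: pm_def)
 moreover have "pm d \<sigma> * pm d \<sigma> = 1\<^sub>m (d + 4)"
 proof (rule eq_matI)
  fix i j assume "i < dim_row (1\<^sub>m (d + 4) :: real mat)" "j < dim_col (1\<^sub>m (d + 4) :: real mat)"
  then have ij: "i < d + 4" "j < d + 4" by simp_all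
  then have s: "\<sigma> i < d + 4" "\<sigma> (\<sigma> i) = i" using g unfolding good_perm_def by auto
  show "(pm d \<sigma> * pm d \<sigma>) $$ (i, j) = 1\<^sub>m (d + 4) $$ (i, j)"
   unfolding pm_mult_left[OF g pm_carrier ij] using s ij by (auto simp: pm_def)
 qed (simp_all add: pm_def)
 ultimately show ?thesis by (simp add: O2_def)
qed

lemma pm_conj_dg:
 assumes g: "good_perm d \<sigma>"
  and f: "!!i. i < d + 4 ==> (if \<sigma> i = 0 then a else if \<sigma> i = 1 then b else if \<sigma> i = d + 2 then 1 / b
   else if \<sigma> i = d + 3 then 1 / a else 1) = (if i = 0 then a' else if i = 1 then b' else if i = d + 2 then 1 / b'
   else if i = d + 3 then 1 / a' else (1::real))"
 shows "pm d \<sigma> * dg d a b = dg d a' b' * pm d \<sigma>"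
proof (rule eq_matI)
 fix i j assume "i < dim_row (dg d a' b' * pm d \<sigma>)" "j < dim_col (dg d a' b' * pm d \<sigma>)"
 then have ij: "i < d + 4" "j < d + 4" by (simp_all add: pm_def dg_def diagm_def)
 have s: "\<sigma> i < d + 4" using g ij unfolding good_perm_def by auto
 show "(pm d \<sigma> * dg d a b) $$ (i, j) = (dg d a' b' * pm d \<sigma>) $$ (i, j)"
  unfolding pm_mult_left[OF g dg_carrier ij]
  unfolding dg_def diagm_mult_left[OF pm_carrier ij] diagm_index[OF s ij(2)] f[OF ij(1)]
  using ij by (auto simp: pm_def)
qed (simp_all add: pm_def dg_def diagm_def)

text \<open>Weyl group representatives: \<open>sw03\<close> inverts a, \<open>sw12\<close> inverts
  b, \<open>sw01\<close> exchanges a and b, and \<open>sw02\<close> serves to bring row d + 2 to row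
  0.\<close>

definition sw03 :: "nat => nat => nat" where
 "sw03 d i = (if i = 0 then d + 3 else if i = d + 3 then 0 else i)"
definition sw01 :: "nat => nat => nat" where
 "sw01 d i = (if i = 0 then 1 else if i = 1 then 0 else if i = d + 2 then d + 3 else if i = d + 3 then d + 2 else i)"
definition sw02 :: "nat => nat => nat" where
 "sw02 d i = (if i = 0 then d + 2 else if i = d + 2 then 0 else if i = 1 then d + 3 else if i = d + 3 then 1 else i)"
definition sw12 :: "nat => nat => nat" where
 "sw12 d i = (if i = 1 then d + 2 else if i = d + 2 then 1 else i)"

lemma good_perms [simp]: "good_perm d (sw03 d)" "good_perm d (sw01 d)" "good_perm d (sw02 d)" "good_perm d (sw12 d)"
 by (simp_all add: good_perm_def sw03_def sw01_def sw02_def sw12_def flip_def)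

lemma transpose_O2:
 assumes A: "A : O2 d" shows "transpose_mat A : O2 d"
proof -
 note Ac = O2_carrier[OF A]
 have "finv d (transpose_mat A) = transpose_mat (finv d A)"
  by (rule eq_matI) (use Ac in auto)
 then have "finv d (transpose_mat A) * transpose_mat A = transpose_mat (A * finv d A)"
  using transpose_mult[OF Ac finv_carrier] by simp
 also have "\<dots> = 1\<^sub>m (d + 4)" using O2_right[OF A] by simp
 finally show ?thesis using Ac by (simp add: O2_def)
qed

definition BO :: "nat => real => real mat set" where
 "BO d B = {A \<in> O2 d. \<forall>i<d + 4. \<forall>j<d + 4. \<bar>A $$ (i, j)\<bar> <= B}"

lemma BO_I: "A : O2 d ==> (!!i j. i < d + 4 ==> j < d + 4 ==> \<bar>A $$ (i, j)\<bar> <= B) ==> A : BO d B"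
 by (simp add: BO_def)

lemma BO_O2: "A : BO d B ==> A : O2 d"
 by (simp add: BO_def)

lemma BO_le: "A : BO d B ==> i < d + 4 ==> j < d + 4 ==> \<bar>A $$ (i, j)\<bar> <= B"
 by (simp add: BO_def)

lemma BO_nonneg: "A : BO d B ==> 0 <= B"
 using BO_le[of A d B 0 0] by linarith

lemma BO_mono:
 assumes "A : BO d B" "B <= B'" shows "A : BO d B'"
proof (rule BO_I[OF BO_O2[OF assms(1)]])
 fix i j assume "i < d + 4" "j < d + 4"
 from order_trans[OF BO_le[OF assms(1) this] assms(2)] show "\<bar>A $$ (i, j)\<bar> <= B'" .
qed

lemma BO_finv: "A : BO d B ==> finv d A : BO d B"
 by (simp add: BO_def O2_finv)

lemma BO_transpose: assumes "A : BO d B" shows "transpose_mat A : BO d B"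
proof (rule BO_I)
 show "transpose_mat A : O2 d" by (rule transpose_O2[OF BO_O2[OF assms]])
 fix i j assume "i < d + 4" "j < d + 4"
 then show "\<bar>transpose_mat A $$ (i, j)\<bar> <= B"
  using BO_le[OF assms] O2_carrier[OF BO_O2[OF assms]] by simp
qed

lemma BO_one: "1\<^sub>m (d + 4) : BO d 1"
 by (rule BO_I) (auto simp: O2_one)

lemma abs_mult_sum_le:
 fixes f g :: "nat => real"
 assumes "!!k. k < m ==> \<bar>f k\<bar> <= B" "!!k. k < m ==> \<bar>g k\<bar> <= C" "0 <= B"
 shows "\<bar>\<Sum>k<m. f k * g k\<bar> <= real m * (B * C)"
proof -
 have "\<bar>\<Sum>k<m. f k * g k\<bar> <= (\<Sum>k<m. \<bar>f k * g k\<bar>)" by (rule sum_abs)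
 also have "\<dots> <= (\<Sum>k<m. B * C)"
  by (rule sum_mono) (use assms in \<open>auto simp: abs_mult intro!: mult_mono\<close>)
 finally show ?thesis by simp
qed

lemma BO_mult:
 assumes A: "A : BO d B" and C: "C : BO d B'"
 shows "A * C : BO d (real (d + 4) * (B * B'))"
proof (rule BO_I)
 show "A * C : O2 d" by (rule O2_mult[OF BO_O2[OF A] BO_O2[OF C]])
 fix i j assume ij: "i < d + 4" "j < d + 4"
 show "\<bar>(A * C) $$ (i, j)\<bar> <= real (d + 4) * (B * B')"
  unfolding index_mult_sum[OF O2_carrier[OF BO_O2[OF A]] O2_carrier[OF BO_O2[OF C]] ij]
  by (rule abs_mult_sum_le) (use BO_le[OF A] BO_le[OF C] BO_nonneg[OF A] ij in auto)
qed

lemma pm_BO: "good_perm d \<sigma> ==> pm d \<sigma> : BO d 1"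
 by (rule BO_I, erule pm_O2) (simp add: pm_def)

text \<open>A normalisation step whose bound is uniform in \<open>g\<close>. Steps compose by
  \<open>reach_trans\<close>, and \<open>reach_transpose\<close> turns row operations into column
  operations.\<close>

definition reach :: "nat => (real mat => bool) => (real mat => bool) => bool" where
 "reach d P Q \<longleftrightarrow> (\<exists>B. \<forall>g\<in>O2 d. P g --> (\<exists>k\<in>BO d B. \<exists>k'\<in>BO d B. Q (k * g * k')))"

lemma mat_mult_4:
 assumes "A : carrier_mat m m" "B : carrier_mat m m" "C : carrier_mat m m" "D : carrier_mat m m" "E : carrier_mat m m"
 shows "A * (B * C * D) * E = (A * B) * C * (D * (E :: real mat))"
proof -
 have "A * (B * C * D) * E = A * ((B * C * D) * E)" using assms by (intro assoc_mult_mat) auto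
 also have "(B * C * D) * E = (B * C) * (D * E)" using assms by (intro assoc_mult_mat) auto
 also have "A * ((B * C) * (D * E)) = (A * (B * C)) * (D * E)" using assms by (intro assoc_mult_mat[symmetric]) auto
 also have "A * (B * C) = (A * B) * C" using assms by (intro assoc_mult_mat[symmetric]) auto
 finally show ?thesis .
qed

lemma reach_trans:
 assumes "reach d P Q" "reach d Q R" shows "reach d P R"
proof -
 obtain B where B: "!!g. g : O2 d ==> P g ==> \<exists>k\<in>BO d B. \<exists>k'\<in>BO d B. Q (k * g * k')"
  using assms(1) unfolding reach_def by blast
 obtain C where C: "!!g. g : O2 d ==> Q g ==> \<exists>k\<in>BO d C. \<exists>k'\<in>BO d C. R (k * g * k')"
  using assms(2) unfolding reach_def by blast
 show ?thesis unfolding reach_def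
 proof (intro exI ballI impI)
  fix g assume g: "g : O2 d" "P g"
  then obtain k k' where k: "k : BO d B" "k' : BO d B" "Q (k * g * k')" using B by blast
  have "k * g * k' : O2 d" by (intro O2_mult BO_O2[OF k(1)] BO_O2[OF k(2)] g(1))
  then obtain l l' where l: "l : BO d C" "l' : BO d C" "R (l * (k * g * k') * l')" using C k(3) by blast
  have e: "l * (k * g * k') * l' = (l * k) * g * (k' * l')"
   by (rule mat_mult_4[of _ "d + 4"]) (use k l g in \<open>auto intro: O2_carrier BO_O2\<close>)
  have "k' * l' : BO d (real (d + 4) * (C * B))"
   using BO_mult[OF k(2) l(2)] by (simp add: mult.commute)
  then show "\<exists>k\<in>BO d (real (d + 4) * (C * B)). \<exists>k'\<in>BO d (real (d + 4) * (C * B)). R (k * g * k')"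
   using l(3) BO_mult[OF l(1) k(1)] unfolding e by blast
 qed
qed

lemma reach_transpose:
 assumes "reach d P Q" shows "reach d (%g. P (transpose_mat g)) (%g. Q (transpose_mat g))"
proof -
 obtain B where B: "!!g. g : O2 d ==> P g ==> \<exists>k\<in>BO d B. \<exists>k'\<in>BO d B. Q (k * g * k')"
  using assms(1) unfolding reach_def by blast
 show ?thesis unfolding reach_def
 proof (intro exI[of _ B] ballI impI)
  fix g assume g: "g : O2 d" "P (transpose_mat g)"
  then obtain k k' where k: "k : BO d B" "k' : BO d B" "Q (k * transpose_mat g * k')"
   using B transpose_O2 by blast
  have c: "k : Mat d" "k' : Mat d" "g : Mat d"
   using k g by (auto intro: O2_carrier BO_O2)
  have "transpose_mat (transpose_mat k' * g * transpose_mat k) = k * (transpose_mat g * k')"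
  proof -
   have "transpose_mat (transpose_mat k' * g * transpose_mat k)
     = transpose_mat (transpose_mat k) * transpose_mat (transpose_mat k' * g)"
    using c by (intro transpose_mult) auto
   also have "transpose_mat (transpose_mat k' * g) = transpose_mat g * transpose_mat (transpose_mat k')"
    using c by (intro transpose_mult) auto
   finally show ?thesis by simp
  qed
  also have "\<dots> = k * transpose_mat g * k'" using c by (intro assoc_mult_mat[symmetric]) auto
  finally have "Q (transpose_mat (transpose_mat k' * g * transpose_mat k))" using k(3) by simp
  then show "\<exists>k\<in>BO d B. \<exists>k'\<in>BO d B. Q (transpose_mat (k * g * k'))"
   using BO_transpose[OF k(1)] BO_transpose[OF k(2)] by blast
 qed
qed

lemma reach_mono:
 assumes "reach d P Q" "!!g. g : O2 d ==> P' g ==> P g" "!!g. g : O2 d ==> Q g ==> Q' g"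
 shows "reach d P' Q'"
proof -
 obtain B where B: "!!g. g : O2 d ==> P g ==> \<exists>k\<in>BO d B. \<exists>k'\<in>BO d B. Q (k * g * k')"
  using assms(1) unfolding reach_def by blast
 show ?thesis unfolding reach_def
 proof (intro exI[of _ B] ballI impI)
  fix g assume g: "g : O2 d" "P' g"
  then obtain k k' where k: "k : BO d B" "k' : BO d B" "Q (k * g * k')" using B assms(2) by blast
  have "k * g * k' : O2 d" by (intro O2_mult BO_O2[OF k(1)] BO_O2[OF k(2)] g(1))
  from assms(3)[OF this k(3)] k(1,2) show "\<exists>k\<in>BO d B. \<exists>k'\<in>BO d B. Q' (k * g * k')" by blast
 qed
qed

section \<open>Elimination with pivoting among isometries\<close>

definition inr :: "nat => nat => nat => bool" where
 "inr d q i \<longleftrightarrow> q <= i & i + q < d + 4"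

text \<open>The stage of the elimination: outside the central indices q, ..., d + 3 - q only
  diagonal entries are left. Stage 0 is no restriction; at stage 2 only the definite block is
  unknown.\<close>

definition Pq :: "nat => nat => real mat => bool" where
 "Pq d q g \<longleftrightarrow> (\<forall>i<d + 4. \<forall>j<d + 4. i ~= j --> \<not> (inr d q i & inr d q j) --> g $$ (i, j) = 0)"

lemma Pq_D: "Pq d q g ==> i < d + 4 ==> j < d + 4 ==> i ~= j ==> \<not> (inr d q i & inr d q j) ==> g $$ (i, j) = 0"
 unfolding Pq_def by blast

lemma Pq_0: "Pq d 0 g"
 by (simp add: Pq_def inr_def)

lemma Pq_one: "Pq d q (1\<^sub>m (d + 4))"
 by (simp add: Pq_def)

lemma inr_flip: "q <= 1 ==> i < d + 4 ==> inr d q (flip d i) = inr d q i"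
 unfolding inr_def flip_def by auto

lemma Pq_mult:
 assumes "A : Mat d" "C : Mat d" "Pq d q A" "Pq d q C"
 shows "Pq d q (A * C)"
 unfolding Pq_def
proof (intro allI impI)
 fix i j assume ij: "i < d + 4" "j < d + 4" "i ~= j" "\<not> (inr d q i & inr d q j)"
 have "A $$ (i, k) * C $$ (k, j) = 0" if "k < d + 4" for k
 proof (cases "inr d q i")
  case True
  then have "\<not> inr d q j" using ij by simp
  then show ?thesis using Pq_D[OF assms(4) that ij(2)] Pq_D[OF assms(3) ij(1) that] ij(3) by (cases "k = j") auto
 next
  case False
  then show ?thesis using Pq_D[OF assms(3) ij(1) that] Pq_D[OF assms(4) that ij(2)] ij(3) by (cases "k = i") auto
 qed
 then show "(A * C) $$ (i, j) = 0"
  unfolding index_mult_sum[OF assms(1,2) ij(1,2)] by (simp add: sum.neutral)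
qed

lemma Pq_transpose: "A : Mat d ==> Pq d q (transpose_mat A) \<longleftrightarrow> Pq d q A"
proof -
 assume A: "A : Mat d"
 have "Pq d q (transpose_mat B)" if "Pq d q B" "B : Mat d" for B
  unfolding Pq_def
 proof (intro allI impI)
  fix i j assume "i < d + 4" "j < d + 4" "i ~= j" "\<not> (inr d q i & inr d q j)"
  then show "transpose_mat B $$ (i, j) = 0" using Pq_D[OF that(1), of j i] that(2) by auto
 qed
 from this[of A] this[of "transpose_mat A"] A show ?thesis by auto
qed

lemma Pq_finv: "q <= 1 ==> Pq d q A ==> Pq d q (finv d A)"
 unfolding Pq_def[of d q "finv d A"]
proof (intro allI impI)
 fix i j assume "q <= 1" "Pq d q A" "i < d + 4" "j < d + 4" "i ~= j" "\<not> (inr d q i & inr d q j)"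
 then show "finv d A $$ (i, j) = 0"
  using Pq_D[of d q A "flip d j" "flip d i"] by (simp add: inr_flip conj_commute)
qed

lemma O2_rel:
 assumes g: "g : O2 d" and ij: "i < d + 4" "j < d + 4"
 shows "(\<Sum>k<d + 4. g $$ (flip d k, i) * g $$ (k, j)) = (if flip d i = j then 1 else 0)"
proof -
 have "(finv d g * g) $$ (flip d i, j) = (\<Sum>k<d + 4. g $$ (flip d k, i) * g $$ (k, j))"
  using ij index_mult_sum[OF finv_carrier O2_carrier[OF g], of "flip d i" j] by simp
 then show ?thesis using O2_left[OF g] ij by simp
qed

text \<open>The entries are polynomials of degree at most 4 in the coordinates.\<close>

lemma nexp_entry_bound:
 assumes r: "1 <= r" "\<bar>p\<bar> <= r" "norm x <= r" "norm y <= r" "\<bar>e\<bar> <= r" and i: "i < d + 4" and j: "j < d + 4"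
 shows "\<bar>nexp d (p, x, y, e) $$ (i, j)\<bar> <= 3 * r ^ 4"
proof -
 have r1: "r <= r ^ 4" using power_increasing[of 1 4 r] r by simp
 have r2: "r ^ 2 <= r ^ 4" using r by (intro power_increasing) auto
 have r3: "r ^ 3 <= r ^ 4" using r by (intro power_increasing) auto
 have one: "1 <= r ^ 4" using r by (intro one_le_power) auto
 have ii: "\<bar>inner a b\<bar> <= r ^ 2" if "norm a <= r" "norm b <= r" for a b :: fsv
  using Cauchy_Schwarz_ineq2[of a b] mult_mono[OF that] r(1) by (simp add: power2_eq_square)
 have xy: "\<bar>inner x y\<bar> <= r ^ 2" "\<bar>inner x x\<bar> <= r ^ 2" "\<bar>inner y y\<bar> <= r ^ 2"
  by (rule ii[OF r(3) r(4)], rule ii[OF r(3) r(3)], rule ii[OF r(4) r(4)])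
 have pyy: "\<bar>p * inner y y\<bar> <= r ^ 3"
  using mult_mono[OF r(2) xy(3)] r by (simp add: abs_mult power2_eq_square power3_eq_cube)
 have ppyy: "\<bar>p\<^sup>2 * inner y y\<bar> <= r ^ 4"
 proof -
  have "p\<^sup>2 <= r\<^sup>2" using r by (simp add: abs_le_square_iff[symmetric])
  then have "p\<^sup>2 * \<bar>inner y y\<bar> <= r\<^sup>2 * r\<^sup>2" using xy(3) by (intro mult_mono) auto
  then show ?thesis by (simp add: abs_mult power2_eq_square power4_eq_xxxx mult.assoc)
 qed
 have pe: "\<bar>p * e\<bar> <= r ^ 2" using mult_mono[OF r(2) r(5)] r by (simp add: abs_mult power2_eq_square)
 have fc: "\<bar>fcoord x k\<bar> <= r" "\<bar>fcoord y k\<bar> <= r" for k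
  using abs_fcoord_le[of x k] abs_fcoord_le[of y k] r by linarith+
 have pf: "\<bar>p * fcoord y k\<bar> <= r ^ 2" for k
  using mult_mono[OF r(2) fc(2)[of k]] r by (simp add: abs_mult power2_eq_square)
 have a: "\<bar>fcoord x k + p / 2 * fcoord y k\<bar> <= 3 * r ^ 4" "\<bar>p / 2 * fcoord y k - fcoord x k\<bar> <= 3 * r ^ 4" for k
  using fc(1)[of k] pf[of k] r1 r2 by (simp_all add: abs_le_iff)
 have b: "\<bar>e - inner x y / 2 - p * inner y y / 6\<bar> <= 3 * r ^ 4"
   "\<bar>- e - inner x y / 2 + p * inner y y / 6\<bar> <= 3 * r ^ 4"
  using xy(1) pyy r(5) r1 r2 r3 by (simp_all only: abs_le_iff) linarith+
 have c: "\<bar>- p * e - inner x x / 2 + p\<^sup>2 * inner y y / 24\<bar> <= 3 * r ^ 4"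
  using xy(2) pe ppyy r2 one by (simp only: abs_le_iff mult_minus_left) linarith
 have z: "0 <= 3 * r ^ 4" "\<bar>1\<bar> <= 3 * r ^ 4" "\<bar>p\<bar> <= 3 * r ^ 4" "\<bar>- p\<bar> <= 3 * r ^ 4" "\<bar>- inner y y / 2\<bar> <= 3 * r ^ 4"
  "\<bar>fcoord y k\<bar> <= 3 * r ^ 4" "\<bar>- fcoord y k\<bar> <= 3 * r ^ 4" for k
  using one r r1 r2 xy(3) fc(2)[of k] by auto
 have z1: "1 <= 3 * r ^ 4" using one by linarith
 show ?thesis
  by (cases rule: index_cases[OF i]; cases rule: index_cases[OF j]; simp only: nexp_index fcoord_simps;
   (rule a b c z | simp add: z z1))
qed

text \<open>Partial pivoting by bounded isometries. Isotropic rows can be interchanged by an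
  admissible permutation; a row of the definite block has no isotropic partner and is instead added
  to row q by a unipotent element.\<close>

lemma mover:
 assumes q: "q <= 1" and i: "i < d + 4" "inr d q i" and g: "g : Mat d" and j: "j < d + 4"
 shows "\<exists>k\<in>BO d 1. Pq d q k & \<bar>g $$ (i, j)\<bar> <= \<bar>(k * g) $$ (q, j)\<bar>"
proof -
 have q4: "q < d + 4" using q by simp
 have perm: ?thesis if s: "good_perm d \<sigma>" "\<sigma> q = i" "Pq d q (pm d \<sigma>)" for \<sigma>
  using pm_BO[OF s(1)] s pm_mult_left[OF s(1) g q4 j] by (intro bexI[of _ "pm d \<sigma>"]) auto
 have P0: "Pq d 0 h" for h by (rule Pq_0)
 have P1: "Pq d 1 (pm d (sw12 d))"
  unfolding Pq_def
 proof (intro allI impI)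
  fix a b assume ab: "a < d + 4" "b < d + 4" "a ~= b" "\<not> (inr d 1 a & inr d 1 b)"
  then have "b ~= sw12 d a" unfolding inr_def sw12_def by (cases "a = 1"; cases "a = d + 2"; simp; arith)
  then show "pm d (sw12 d) $$ (a, b) = 0" using ab by (simp add: pm_def)
 qed
 have unip: ?thesis if k: "k < d" "i = k + 2" "q = 0 | q = 1" for k
 proof -
  define u :: "real => nil" where "u s = (if q = 0 then (0, s *\<^sub>R ax k, 0, 0) else (0, 0, s *\<^sub>R ax k, 0))" for s
  define f where "f = flip d q"
  have f: "f < d + 4" "f ~= q" "f ~= k + 2" "q ~= k + 2" using q k by (auto simp: f_def flip_def)
  have N: "u s : Nd d" for s using k by (simp add: u_def)
  have B: "nexp d (u s) : BO d 1" if "s = 1 | s = -1" for s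
  proof (rule BO_I)
   show "nexp d (u s) : O2 d" by (rule nexp_O2[OF N])
   fix a b assume a: "a < d + 4" and b: "b < d + 4"
   show "\<bar>nexp d (u s) $$ (a, b)\<bar> <= 1"
    using that unfolding u_def
    by (cases "q = 0"; cases rule: index_cases[OF a]; cases rule: index_cases[OF b]; simp add: nexp_index)
      (auto simp: inner_lin_simps)
  qed
  have P: "Pq d q (nexp d (u s))" for s
  proof (cases "q = 0")
   case True
   then show ?thesis by (simp add: Pq_0)
  next
   case False
   then have q1: "q = 1" using q by simp
   show ?thesis unfolding Pq_def
   proof (intro allI impI)
    fix a b assume a: "a < d + 4" and b: "b < d + 4" and "a ~= b" "\<not> (inr d q a & inr d q b)"
    then show "nexp d (u s) $$ (a, b) = 0"
     unfolding u_def q1 inr_def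
     by (cases rule: index_cases[OF a]; cases rule: index_cases[OF b]; simp add: nexp_index)
   qed
  qed
  have row: "(nexp d (u s) * g) $$ (q, j) = g $$ (q, j) + s * g $$ (i, j) - s\<^sup>2 / 2 * g $$ (f, j)" for s
  proof -
   have s0: "(\<Sum>l<d. fcoord (s *\<^sub>R ax k) l * g $$ (l + 2, j)) = s * g $$ (i, j)"
   proof -
    have "(\<Sum>l<d. fcoord (s *\<^sub>R ax k) l * g $$ (l + 2, j)) = fcoord (s *\<^sub>R ax k) k * g $$ (k + 2, j)"
     by (rule sum_single) (use k in auto)
    then show ?thesis using k by simp
   qed
   have s1: "(\<Sum>l<d. nexp d (u s) $$ (q, l + 2) * g $$ (l + 2, j)) = s * g $$ (i, j)"
    unfolding s0[symmetric] using k(3) by (intro sum.cong refl) (auto simp: u_def nexp_index)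
   show ?thesis
    unfolding index_mult_sum[OF nexp_carrier g q4 j] sum_split s1
    using k(3) by (auto simp: u_def nexp_index f_def inner_lin_simps power2_eq_square)
  qed
  \<comment> \<open>The values for s = 1 and s = -1 differ by twice the entry at (i, j), so one of
    them is at least as large as this entry.\<close>
  have "\<bar>g $$ (i, j)\<bar> <= \<bar>(nexp d (u 1) * g) $$ (q, j)\<bar> | \<bar>g $$ (i, j)\<bar> <= \<bar>(nexp d (u (-1)) * g) $$ (q, j)\<bar>"
   unfolding row by (simp add: abs_if) linarith
  then show ?thesis using B P by blast
 qed
 show ?thesis
 proof (cases "q = 0")
  case q0: True
  show ?thesis
  proof (cases rule: index_cases[OF i(1)])
   case 1
   then show ?thesis using q0 BO_one g by (intro bexI[of _ "1\<^sub>m (d + 4)"]) (auto simp: Pq_0)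
  next
   case 2
   then show ?thesis using q0 by (intro perm[of "sw01 d"]) (auto simp: sw01_def Pq_0)
  next
   case (3 k)
   then show ?thesis using q0 by (intro unip) auto
  next
   case 4
   then show ?thesis using q0 by (intro perm[of "sw02 d"]) (auto simp: sw02_def Pq_0)
  next
   case 5
   then show ?thesis using q0 by (intro perm[of "sw03 d"]) (auto simp: sw03_def Pq_0)
  qed
 next
  case False
  then have q1: "q = 1" using q by simp
  show ?thesis
  proof (cases rule: index_cases[OF i(1)])
   case 1
   then show ?thesis using i(2) q1 by (simp add: inr_def)
  next
   case 2
   then show ?thesis using q1 BO_one g by (intro bexI[of _ "1\<^sub>m (d + 4)"]) (auto simp: Pq_one)
  next
   case (3 k)
   then show ?thesis using q1 by (intro unip) auto
  next
   case 4
   then show ?thesis using q1 P1 by (intro perm[of "sw12 d"]) (auto simp: sw12_def)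
  next
   case 5
   then show ?thesis using i(2) q1 by (simp add: inr_def)
  qed
 qed
qed

definition blk_le :: "nat => nat => real => real mat => bool" where
 "blk_le d q C g \<longleftrightarrow> (\<forall>i<d + 4. \<forall>j<d + 4. inr d q i --> inr d q j --> \<bar>g $$ (i, j)\<bar> <= C)"

lemma blk_le_mult:
 assumes k: "k : BO d 1" "Pq d q k" and g: "g : Mat d" "blk_le d q C g" and C: "0 <= C"
 shows "blk_le d q (real (d + 4) * C) (k * g)"
 unfolding blk_le_def
proof (intro allI impI)
 fix i j assume ij: "i < d + 4" "j < d + 4" "inr d q i" "inr d q j"
 have "(k * g) $$ (i, j) = (\<Sum>l<d + 4. k $$ (i, l) * (if inr d q l then g $$ (l, j) else 0))"
  unfolding index_mult_sum[OF O2_carrier[OF BO_O2[OF k(1)]] g(1) ij(1,2)]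
 proof (rule sum.cong[OF refl])
  fix l assume "l : {..<d + 4}"
  then show "k $$ (i, l) * g $$ (l, j) = k $$ (i, l) * (if inr d q l then g $$ (l, j) else 0)"
   using Pq_D[OF k(2) ij(1), of l] ij(3) by auto
 qed
 also have "\<bar>\<dots>\<bar> <= real (d + 4) * (1 * C)"
  by (rule abs_mult_sum_le) (use BO_le[OF k(1) ij(1)] g(2) C ij in \<open>auto simp: blk_le_def\<close>)
 finally show "\<bar>(k * g) $$ (i, j)\<bar> <= real (d + 4) * C" by simp
qed

lemma blk_max:
 assumes q: "q <= 1" and g: "g : O2 d" "Pq d q g"
 shows "\<exists>M>0. blk_le d q M g & (\<exists>i<d + 4. \<exists>j<d + 4. inr d q i & inr d q j & M <= \<bar>g $$ (i, j)\<bar>)"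
proof -
 let ?S = "(%(i, j). \<bar>g $$ (i, j)\<bar>) ` {p \<in> {..<d + 4} \<times> {..<d + 4}. inr d q (fst p) & inr d q (snd p)}"
 have "finite ({..<d + 4} \<times> {..<d + 4})" by simp
 then have "finite {p \<in> {..<d + 4} \<times> {..<d + 4}. inr d q (fst p) & inr d q (snd p)}"
  by (rule rev_finite_subset) blast
 then have fin: "finite ?S" by (rule finite_imageI)
 have q4: "q < d + 4" "inr d q q" using q by (auto simp: inr_def)
 have mem: "\<bar>g $$ (i, j)\<bar> : ?S" if "i < d + 4" "j < d + 4" "inr d q i" "inr d q j" for i j
  using that by (intro image_eqI[of _ _ "(i, j)"]) auto
 have ne: "?S ~= {}" using mem[OF q4(1) q4(1) q4(2) q4(2)] by blast
 have le: "blk_le d q (Max ?S) g"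
  unfolding blk_le_def using Max_ge[OF fin mem] by blast
 have "Max ?S : ?S" by (rule Max_in[OF fin ne])
 then obtain i j where ij: "i < d + 4" "j < d + 4" "inr d q i" "inr d q j" "Max ?S = \<bar>g $$ (i, j)\<bar>" by auto
 \<comment> \<open>Otherwise column q vanishes, although it must pair to 1 with its dual
   column.\<close>
 have "Max ?S > 0"
 proof (rule ccontr)
  assume "\<not> ?thesis"
  then have z: "g $$ (k, q) = 0" if "k < d + 4" for k
  proof (cases "inr d q k")
   case True
   then have "\<bar>g $$ (k, q)\<bar> <= Max ?S" using le that q4 by (simp add: blk_le_def)
   then show ?thesis using \<open>\<not> Max ?S > 0\<close> by linarith
  next
   case False
   then show ?thesis using Pq_D[OF g(2) that q4(1)] q4(2) by auto
  qed
  have "(\<Sum>k<d + 4. g $$ (flip d k, flip d q) * g $$ (k, q)) = 0"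
   by (rule sum.neutral) (use z in auto)
  then show False using O2_rel[OF g(1), of "flip d q" q] q4 by simp
 qed
 then show ?thesis using le ij by (intro exI[of _ "Max ?S"] conjI) auto
qed

text \<open>The factor d + 4 is the price of one multiplication by a matrix with entries at most
  1.\<close>

lemma reach_pivot_row:
 assumes q: "q <= 1"
 shows "reach d (Pq d q) (%g. Pq d q g & (\<exists>M>0. blk_le d q (real (d + 4) * M) g &
   (\<exists>j<d + 4. inr d q j & M <= \<bar>g $$ (q, j)\<bar>)))"
 unfolding reach_def
proof (intro exI[of _ 1] ballI impI)
 fix g assume g: "g : O2 d" "Pq d q g"
 note gc = O2_carrier[OF g(1)]
 obtain M i j where M: "M > 0" "blk_le d q M g" "i < d + 4" "j < d + 4" "inr d q i" "inr d q j" "M <= \<bar>g $$ (i, j)\<bar>"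
  using blk_max[OF q g] by blast
 obtain k where k: "k : BO d 1" "Pq d q k" "\<bar>g $$ (i, j)\<bar> <= \<bar>(k * g) $$ (q, j)\<bar>"
  using mover[OF q M(3) M(5) gc M(4)] by blast
 note kc = O2_carrier[OF BO_O2[OF k(1)]]
 have e: "k * g * 1\<^sub>m (d + 4) = k * g" using kc gc by simp
 have "M <= \<bar>(k * g) $$ (q, j)\<bar>" using M(7) k(3) by linarith
 then have R: "Pq d q (k * g) & (\<exists>M>0. blk_le d q (real (d + 4) * M) (k * g) &
   (\<exists>j<d + 4. inr d q j & M <= \<bar>(k * g) $$ (q, j)\<bar>))"
  using M(1,4,6) blk_le_mult[OF k(1,2) gc M(2)] Pq_mult[OF kc gc k(2) g(2)] by auto
 show "\<exists>k\<in>BO d 1. \<exists>k'\<in>BO d 1. Pq d q (k * g * k') & (\<exists>M>0. blk_le d q (real (d + 4) * M) (k * g * k') &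
   (\<exists>j<d + 4. inr d q j & M <= \<bar>(k * g * k') $$ (q, j)\<bar>))"
  by (rule bexI[where x = k], rule bexI[where x = "1\<^sub>m (d + 4)"], unfold e, rule R, rule BO_one, rule k(1))
qed

lemma reach_pivot_col:
 assumes q: "q <= 1"
 shows "reach d (%g. Pq d q g & (\<exists>M>0. blk_le d q (C * M) g & (\<exists>i<d + 4. inr d q i & M <= \<bar>g $$ (i, q)\<bar>)))
  (%g. Pq d q g & (\<exists>M>0. blk_le d q (real (d + 4) * (C * M)) g & M <= \<bar>g $$ (q, q)\<bar>))"
 unfolding reach_def
proof (intro exI[of _ 1] ballI impI, elim conjE exE)
 fix g M i assume g: "g : O2 d" "Pq d q g" and M: "M > 0" "blk_le d q (C * M) g"
  "i < d + 4" "inr d q i" "M <= \<bar>g $$ (i, q)\<bar>"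
 note gc = O2_carrier[OF g(1)]
 have q4: "q < d + 4" "inr d q q" using q by (auto simp: inr_def)
 obtain k where k: "k : BO d 1" "Pq d q k" "\<bar>g $$ (i, q)\<bar> <= \<bar>(k * g) $$ (q, q)\<bar>"
  using mover[OF q M(3) M(4) gc q4(1)] by blast
 note kc = O2_carrier[OF BO_O2[OF k(1)]]
 have e: "k * g * 1\<^sub>m (d + 4) = k * g" using kc gc by simp
 have "\<bar>g $$ (i, q)\<bar> <= C * M" using M q4 by (simp add: blk_le_def)
 then have "0 <= C * M" by linarith
 then have "blk_le d q (real (d + 4) * (C * M)) (k * g)" by (rule blk_le_mult[OF k(1,2) gc M(2)])
 moreover have "M <= \<bar>(k * g) $$ (q, q)\<bar>" using M(5) k(3) by linarith
 ultimately have R: "Pq d q (k * g) & (\<exists>M>0. blk_le d q (real (d + 4) * (C * M)) (k * g) &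
   M <= \<bar>(k * g) $$ (q, q)\<bar>)"
  using M(1) Pq_mult[OF kc gc k(2) g(2)] by auto
 show "\<exists>k\<in>BO d 1. \<exists>k'\<in>BO d 1. Pq d q (k * g * k') & (\<exists>M>0. blk_le d q (real (d + 4) * (C * M)) (k * g * k') &
   M <= \<bar>(k * g * k') $$ (q, q)\<bar>)"
  by (rule bexI[where x = k], rule bexI[where x = "1\<^sub>m (d + 4)"], unfold e, rule R, rule BO_one, rule k(1))
qed

text \<open>Column q is isotropic; divided by the pivot it is row q of some \<open>nexp d w\<close>
  with bounded w. The inverse of the transposed exponential therefore maps the column to the pivot
  times a unit vector. The row q of this inverse is a unit row, so row q of g is unchanged.\<close>

lemma clearing:
 assumes q: "q <= 1" and g: "g : O2 d" "Pq d q g" and nz: "g $$ (q, q) ~= 0"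
  and c: "!!i. i < d + 4 ==> \<bar>g $$ (i, q)\<bar> <= c * \<bar>g $$ (q, q)\<bar>"
 shows "\<exists>k\<in>BO d (3 * (1 + c + real d * c) ^ 4). Pq d q k &
  (\<forall>i<d + 4. (k * g) $$ (i, q) = (if i = q then g $$ (q, q) else 0)) &
  (\<forall>j<d + 4. (k * g) $$ (q, j) = g $$ (q, j))"
proof -
 define p where "p = g $$ (q, q)"
 have q4: "q < d + 4" using q by simp
 note gc = O2_carrier[OF g(1)]
 have c0: "0 <= c" using c[OF q4] nz by (simp add: mult_le_cancel_right1)
 have ratio: "\<bar>g $$ (i, q) / p\<bar> <= c" if "i < d + 4" for i
  using c[OF that] nz by (simp add: p_def field_simps)
 define v where "v = fvec d (%l. g $$ (l + 2, q) / p)"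
 define w :: nil where "w = (if q = 0 then (g $$ (1, 0) / p, v, 0, g $$ (d + 2, 0) / p) else (0, 0, v, 0))"
 have vR: "v : Rd d" by (simp add: v_def)
 have wN: "w : Nd d" using vR by (simp add: w_def)
 have vnorm: "norm v <= real d * c"
 proof -
  have "norm v <= (\<Sum>l<d. \<bar>fcoord v l\<bar>)" by (rule norm_Rd_le[OF vR])
  also have "\<dots> <= (\<Sum>l<d. c)" by (rule sum_mono) (use ratio in \<open>auto simp: v_def\<close>)
  finally show ?thesis by simp
 qed
 \<comment> \<open>Isotropy of column q. It yields the entry in row \<open>flip d q\<close>, the
   only one not prescribed by the coordinates of \<open>w\<close>.\<close>
 have rel: "g $$ (d + 3, q) * g $$ (0, q) + (g $$ (d + 2, q) * g $$ (1, q)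
  + ((\<Sum>l<d. g $$ (l + 2, q) * g $$ (l + 2, q)) + (g $$ (1, q) * g $$ (d + 2, q) + g $$ (0, q) * g $$ (d + 3, q)))) = 0"
 proof -
  have "flip d q ~= q" using q by (auto simp: flip_def)
  then show ?thesis using O2_rel[OF g(1) q4 q4] by (simp add: sum_split cong: sum.cong_simp)
 qed
 have vv: "inner v v * p\<^sup>2 = (\<Sum>l<d. g $$ (l + 2, q) * g $$ (l + 2, q))"
  unfolding inner_Rd[OF vR] sum_distrib_right
  by (rule sum.cong) (use nz in \<open>auto simp: v_def p_def power2_eq_square\<close>)
 have colq: "nexp d w $$ (q, i) = g $$ (i, q) / p" if i: "i < d + 4" for i
 proof (cases "q = 0")
  case True
  have "2 * p * g $$ (d + 3, 0) = - 2 * g $$ (1, 0) * g $$ (d + 2, 0) - inner v v * p\<^sup>2"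
   using rel vv unfolding p_def True by (simp add: algebra_simps)
  then have X: "g $$ (d + 3, 0) = (- 2 * g $$ (1, 0) * g $$ (d + 2, 0) - inner v v * p\<^sup>2) / (2 * p)"
   using nz unfolding p_def[symmetric] by (simp add: eq_divide_eq mult_ac)
  have l: "- (g $$ (1, 0) / p) * (g $$ (d + 2, 0) / p) - inner v v / 2 = g $$ (d + 3, 0) / p"
   using nz unfolding X p_def[symmetric] by (simp add: field_simps power2_eq_square)
  show ?thesis
   using True nz l unfolding w_def
   by (cases rule: index_cases[OF i]) (simp_all add: nexp_index v_def p_def)
 next
  case False
  then have q1: "q = 1" using q by simp
  have z: "g $$ (0, 1) = 0" "g $$ (d + 3, 1) = 0"
   using Pq_D[OF g(2), of 0 1] Pq_D[OF g(2), of "d + 3" 1] by (simp_all add: q1 inr_def)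
  have "2 * p * g $$ (d + 2, 1) = - inner v v * p\<^sup>2"
   using rel vv unfolding p_def q1 by (simp add: z algebra_simps)
  then have X: "g $$ (d + 2, 1) = (- inner v v * p\<^sup>2) / (2 * p)"
   using nz nonzero_mult_div_cancel_left[of "2 * p" "g $$ (d + 2, 1)"] unfolding p_def[symmetric] by simp
  have l: "- inner v v / 2 = g $$ (d + 2, 1) / p"
   using nz unfolding X p_def[symmetric] by (simp add: field_simps power2_eq_square)
  show ?thesis
   using q1 nz l z unfolding w_def
   by (cases rule: index_cases[OF i]) (simp_all add: nexp_index v_def p_def)
 qed
 define T where "T = transpose_mat (nexp d w)"
 have TO: "T : O2 d" unfolding T_def by (rule transpose_O2[OF nexp_O2[OF wN]])
 have Tc: "T : Mat d" by (rule O2_carrier[OF TO])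
 have Tij: "T $$ (i, j) = nexp d w $$ (j, i)" if "i < d + 4" "j < d + 4" for i j
  using that by (simp add: T_def)
 let ?k = "finv d T"
 have bound: "nexp d w : BO d (3 * (1 + c + real d * c) ^ 4)"
 proof (rule BO_I[OF nexp_O2[OF wN]])
  fix i j assume ij: "i < d + 4" "j < d + 4"
  have r: "1 <= 1 + c + real d * c" "c <= 1 + c + real d * c" "real d * c <= 1 + c + real d * c" "0 <= 1 + c + real d * c"
   using c0 by auto
  have 1: "\<bar>g $$ (1, 0) / p\<bar> <= 1 + c + real d * c" "\<bar>g $$ (d + 2, 0) / p\<bar> <= 1 + c + real d * c" if "q = 0"
   using ratio[of 1] ratio[of "d + 2"] that r by simp_all
  have 2: "norm v <= 1 + c + real d * c" using vnorm r by linarith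
  show "\<bar>nexp d w $$ (i, j)\<bar> <= 3 * (1 + c + real d * c) ^ 4"
   unfolding w_def using r 1 2 ij by (auto intro!: nexp_entry_bound)
 qed
 have kB: "?k : BO d (3 * (1 + c + real d * c) ^ 4)"
  unfolding T_def by (intro BO_finv BO_transpose bound)
 have kP: "Pq d q ?k"
 proof (cases "q = 0")
  case True
  then show ?thesis by (simp add: Pq_0)
 next
  case False
  then have q1: "q = 1" using q by simp
  have "Pq d 1 (nexp d (0, 0, v, 0))" unfolding Pq_def
  proof (intro allI impI)
   fix a b assume a: "a < d + 4" and b: "b < d + 4" and "a ~= b" "\<not> (inr d 1 a & inr d 1 b)"
   then show "nexp d (0, 0, v, 0) $$ (a, b) = 0"
    unfolding inr_def
    by (cases rule: index_cases[OF a]; cases rule: index_cases[OF b]; simp add: nexp_index)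
  qed
  then have "Pq d 1 T" unfolding T_def by (simp add: Pq_transpose w_def q1)
  then show ?thesis using Pq_finv[OF q, of d T] q1 by simp
 qed
 have "(?k * g) $$ (i, q) = (if i = q then p else 0)" if i: "i < d + 4" for i
 proof -
  have "(?k * g) $$ (i, q) = (\<Sum>l<d + 4. ?k $$ (i, l) * (p * T $$ (l, q)))"
   unfolding index_mult_sum[OF finv_carrier gc i q4]
   by (rule sum.cong) (use nz colq q4 Tij in \<open>auto simp: p_def\<close>)
  also have "\<dots> = p * (?k * T) $$ (i, q)"
   unfolding index_mult_sum[OF finv_carrier Tc i q4] sum_distrib_left
   by (rule sum.cong) auto
  also have "(?k * T) $$ (i, q) = (if i = q then 1 else 0)" using O2_left[OF TO] i q4 by simp
  finally show ?thesis by simp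
 qed
 moreover have "(?k * g) $$ (q, j) = g $$ (q, j)" if j: "j < d + 4" for j
 proof -
  have kq: "?k $$ (q, l) = (if l = q then 1 else 0)" if l: "l < d + 4" for l
  proof -
   have fl: "flip d l < d + 4" using l by simp
   have "?k $$ (q, l) = nexp d w $$ (flip d q, flip d l)" using l q4 Tij by simp
   also have "\<dots> = (if flip d l = flip d q then 1 else 0)"
   proof (cases "q = 0")
    case True
    show ?thesis unfolding True w_def
     by (cases rule: index_cases[OF fl]) (simp_all add: nexp_index)
   next
    case False
    then have q1: "q = 1" using q by simp
    show ?thesis unfolding q1 w_def
     by (cases rule: index_cases[OF fl]) (simp_all add: nexp_index)
   qed
   finally show ?thesis by simp
  qed
  have "(?k * g) $$ (q, j) = ?k $$ (q, q) * g $$ (q, j)"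
   unfolding index_mult_sum[OF finv_carrier gc q4 j]
   by (rule sum_single[OF q4]) (use kq in auto)
  then show ?thesis using kq[OF q4] by simp
 qed
 ultimately show ?thesis using kB kP unfolding p_def by blast
qed

definition colz :: "nat => nat => real mat => bool" where
 "colz d q g \<longleftrightarrow> (\<forall>i<d + 4. i ~= q --> g $$ (i, q) = 0)"

definition rowr :: "nat => nat => real => real mat => bool" where
 "rowr d q c g \<longleftrightarrow> (\<forall>j<d + 4. \<bar>g $$ (q, j)\<bar> <= c * \<bar>g $$ (q, q)\<bar>)"

text \<open>The parameter \<open>R\<close> stands for any property that depends on row q alone. It
  lets the second, transposed clearing keep what the first one has achieved.\<close>

lemma reach_clear:
 assumes q: "q <= 1"
  and R: "!!g h. g : O2 d ==> R g ==> (!!j. j < d + 4 ==> h $$ (q, j) = g $$ (q, j)) ==> R h"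
 shows "reach d (%g. Pq d q g & g $$ (q, q) ~= 0 & rowr d q c (transpose_mat g) & R g)
   (%g. Pq d q g & g $$ (q, q) ~= 0 & colz d q g & R g)"
 unfolding reach_def
proof (intro exI[of _ "max 1 (3 * (1 + c + real d * c) ^ 4)"] ballI impI, elim conjE)
 let ?B = "max 1 (3 * (1 + c + real d * c) ^ 4)"
 fix g assume g: "g : O2 d" "Pq d q g" "g $$ (q, q) ~= 0" "rowr d q c (transpose_mat g)" "R g"
 note gc = O2_carrier[OF g(1)]
 have q4: "q < d + 4" using q by simp
 have "\<bar>g $$ (i, q)\<bar> <= c * \<bar>g $$ (q, q)\<bar>" if "i < d + 4" for i
  using g(4) that q4 gc unfolding rowr_def by auto
 from clearing[OF q g(1-3) this] obtain k where k: "k : BO d (3 * (1 + c + real d * c) ^ 4)" "Pq d q k"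
  "!!i. i < d + 4 ==> (k * g) $$ (i, q) = (if i = q then g $$ (q, q) else 0)"
  "!!j. j < d + 4 ==> (k * g) $$ (q, j) = g $$ (q, j)" by blast
 note kc = O2_carrier[OF BO_O2[OF k(1)]]
 have e: "k * g * 1\<^sub>m (d + 4) = k * g" using kc gc by simp
 have "(k * g) $$ (q, q) ~= 0" using k(3)[OF q4] g(3) by simp
 moreover have "colz d q (k * g)" unfolding colz_def using k(3) by simp
 ultimately have F: "Pq d q (k * g) & (k * g) $$ (q, q) ~= 0 & colz d q (k * g) & R (k * g)"
  using Pq_mult[OF kc gc k(2) g(2)] R[OF g(1) g(5) k(4)] by blast
 have kB: "k : BO d ?B" by (rule BO_mono[OF k(1)]) simp
 have oB: "1\<^sub>m (d + 4) : BO d ?B" by (rule BO_mono[OF BO_one]) simp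
 show "\<exists>k\<in>BO d ?B. \<exists>k'\<in>BO d ?B. Pq d q (k * g * k') & (k * g * k') $$ (q, q) ~= 0 & colz d q (k * g * k') & R (k * g * k')"
  by (rule bexI[where x = k], rule bexI[where x = "1\<^sub>m (d + 4)"], unfold e, rule F, rule oB, rule kB)
qed

text \<open>With column q reduced to the pivot, its pairing with column j is the pivot times the
  entry at (flip d q, j); so row \<open>flip d q\<close> is cleared too, and its column by
  transposition.\<close>

lemma Pq_Suc:
 assumes q: "q <= 1" and g: "g : O2 d" "Pq d q g" "g $$ (q, q) ~= 0" "colz d q g" "colz d q (transpose_mat g)"
 shows "Pq d (Suc q) g"
proof -
 have q4: "q < d + 4" using q by simp
 note gc = O2_carrier[OF g(1)]
 have row: "h $$ (flip d q, j) = 0"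
  if h: "h : O2 d" "h $$ (q, q) ~= 0" "colz d q h" and j: "j < d + 4" "j ~= flip d q" for h j
 proof -
  have "(\<Sum>k<d + 4. h $$ (flip d k, q) * h $$ (k, j)) = h $$ (flip d (flip d q), q) * h $$ (flip d q, j)"
  proof (rule sum_single)
   show "flip d q < d + 4" using q4 by simp
   fix k assume "k < d + 4" "k ~= flip d q"
   then have "flip d k ~= q" "flip d k < d + 4" by (metis flip_flip, simp)
   then show "h $$ (flip d k, q) * h $$ (k, j) = 0" using h(3) by (simp add: colz_def)
  qed
  then show ?thesis using O2_rel[OF h(1) q4 j(1)] h(2) j(2) by simp
 qed
 have col: "g $$ (j, flip d q) = 0" if "j < d + 4" "j ~= flip d q" for j
  using row[OF transpose_O2[OF g(1)] _ g(5) that] g(3) gc q4 that by simp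
 have rq: "g $$ (q, j) = 0" if "j < d + 4" "j ~= q" for j
  using g(5) that gc q4 by (simp add: colz_def)
 have cq: "g $$ (i, q) = 0" if "i < d + 4" "i ~= q" for i
  using g(4) that by (simp add: colz_def)
 have inrS: "inr d (Suc q) i \<longleftrightarrow> inr d q i & i ~= q & i ~= flip d q" if "i < d + 4" for i
  using q that unfolding inr_def flip_def by auto
 show ?thesis unfolding Pq_def
 proof (intro allI impI)
  fix i j assume ij: "i < d + 4" "j < d + 4" "i ~= j" "\<not> (inr d (Suc q) i & inr d (Suc q) j)"
  then consider "\<not> (inr d q i & inr d q j)" | "i = q" | "j = q" | "i = flip d q" | "j = flip d q"
   using inrS by blast
  then show "g $$ (i, j) = 0"
  proof cases
   case 1 then show ?thesis using Pq_D[OF g(2)] ij by blast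
  next
   case 2 then show ?thesis using rq ij by blast
  next
   case 3 then show ?thesis using cq ij by blast
  next
   case 4 then show ?thesis using row[OF g(1,3,4), of j] ij by blast
  next
   case 5 then show ?thesis using col ij by blast
  qed
 qed
qed

lemma reach_Suc:
 assumes q: "q <= 1"
 shows "reach d (Pq d q) (Pq d (Suc q))"
proof -
 let ?m = "real (d + 4)"
 have q4: "q < d + 4" "inr d q q" using q by (auto simp: inr_def)
 have t: "transpose_mat g : O2 d" "transpose_mat g : Mat d"
   "transpose_mat g $$ (i, j) = g $$ (j, i)" if "g : O2 d" "i < d + 4" "j < d + 4" for g i j
  using transpose_O2[OF that(1)] O2_carrier[OF that(1)] that by auto
 have b: "blk_le d q C (transpose_mat g) \<longleftrightarrow> blk_le d q C g" if "g : O2 d" for g C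
  unfolding blk_le_def using O2_carrier[OF that] by auto
 have P: "Pq d q (transpose_mat g) \<longleftrightarrow> Pq d q g" if "g : O2 d" for g
  by (rule Pq_transpose[OF O2_carrier[OF that]])
 define A1 where "A1 g \<longleftrightarrow> Pq d q g & (\<exists>M>0. blk_le d q (?m * M) g & (\<exists>j<d + 4. inr d q j & M <= \<bar>g $$ (q, j)\<bar>))" for g
 \<comment> \<open>Each of the two pivot moves costs a factor d + 4. Hence row and column are
   bounded by (d + 4)^2 times the pivot, and this ratio bounds the clearing matrices
   uniformly.\<close>
 define A2 where "A2 g \<longleftrightarrow> Pq d q g & g $$ (q, q) ~= 0 & rowr d q (?m * ?m) (transpose_mat g) & rowr d q (?m * ?m) g" for g
 define A3 where "A3 g \<longleftrightarrow> Pq d q g & g $$ (q, q) ~= 0 & colz d q g & rowr d q (?m * ?m) g" for g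
 define A4 where "A4 g \<longleftrightarrow> Pq d q g & g $$ (q, q) ~= 0 & colz d q g & colz d q (transpose_mat g)" for g
 have 1: "reach d (Pq d q) A1" using reach_pivot_row[OF q] unfolding A1_def .
 have 2: "reach d A1 A2"
 proof (rule reach_mono[OF reach_transpose[OF reach_pivot_col[OF q, of d ?m]]])
  fix g assume g: "g : O2 d"
  show "Pq d q (transpose_mat g) & (\<exists>M>0. blk_le d q (?m * M) (transpose_mat g) &
    (\<exists>i<d + 4. inr d q i & M <= \<bar>transpose_mat g $$ (i, q)\<bar>))" if "A1 g"
  proof -
   from that obtain M j where M: "Pq d q g" "M > 0" "blk_le d q (?m * M) g" "j < d + 4" "inr d q j" "M <= \<bar>g $$ (q, j)\<bar>"
    unfolding A1_def by blast
   have "M <= \<bar>transpose_mat g $$ (j, q)\<bar>" using M(6) t(3)[OF g M(4) q4(1)] by simp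
   then show ?thesis using M P[OF g] b[OF g] by blast
  qed
  show "A2 g" if h: "Pq d q (transpose_mat g) & (\<exists>M>0. blk_le d q (?m * (?m * M)) (transpose_mat g) &
    M <= \<bar>transpose_mat g $$ (q, q)\<bar>)"
  proof -
   obtain M where M: "M > 0" "blk_le d q (?m * (?m * M)) g" "M <= \<bar>g $$ (q, q)\<bar>"
    using h b[OF g] t(3)[OF g q4(1) q4(1)] by auto
   have Pg: "Pq d q g" using h P[OF g] by blast
   have le: "?m * (?m * M) <= ?m * ?m * \<bar>g $$ (q, q)\<bar>"
    using mult_left_mono[OF M(3), of "?m * ?m"] by (simp add: mult.assoc)
   have nn: "0 <= ?m * ?m * \<bar>g $$ (q, q)\<bar>" by simp
   have r: "\<bar>g $$ (q, j)\<bar> <= ?m * ?m * \<bar>g $$ (q, q)\<bar>" "\<bar>g $$ (j, q)\<bar> <= ?m * ?m * \<bar>g $$ (q, q)\<bar>" if j: "j < d + 4" for j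
   proof -
    show "\<bar>g $$ (q, j)\<bar> <= ?m * ?m * \<bar>g $$ (q, q)\<bar>"
    proof (cases "inr d q j")
     case True
     then have "\<bar>g $$ (q, j)\<bar> <= ?m * (?m * M)" using M(2) q4 j by (simp add: blk_le_def)
     then show ?thesis using le by linarith
    next
     case False
     then have "g $$ (q, j) = 0" using Pq_D[OF Pg q4(1) j] q4 by auto
     then show ?thesis using nn by simp
    qed
    show "\<bar>g $$ (j, q)\<bar> <= ?m * ?m * \<bar>g $$ (q, q)\<bar>"
    proof (cases "inr d q j")
     case True
     then have "\<bar>g $$ (j, q)\<bar> <= ?m * (?m * M)" using M(2) q4 j by (simp add: blk_le_def)
     then show ?thesis using le by linarith
    next
     case False
     then have "g $$ (j, q) = 0" using Pq_D[OF Pg j q4(1)] q4 by auto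
     then show ?thesis using nn by simp
    qed
   qed
   have "g $$ (q, q) ~= 0" using M(1,3) by auto
   moreover have "rowr d q (?m * ?m) g" unfolding rowr_def using r(1) by blast
   moreover have "rowr d q (?m * ?m) (transpose_mat g)" unfolding rowr_def
    using r(2) t(3)[OF g q4(1)] t(3)[OF g q4(1) q4(1)] by simp
   ultimately show ?thesis unfolding A2_def using Pg by blast
  qed
 qed
 have 3: "reach d A2 A3" unfolding A2_def A3_def
  by (rule reach_clear[OF q]) (use q4 in \<open>simp add: rowr_def\<close>)
 \<comment> \<open>Transposed clearing: the line already cleared is exactly the one that
   \<open>clearing\<close> leaves alone.\<close>
 have 4: "reach d A3 A4"
 proof (rule reach_mono[OF reach_transpose[OF reach_clear[OF q, of d "%g. \<forall>j<d + 4. j ~= q --> g $$ (q, j) = 0" "?m * ?m"]]])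
  fix g assume g: "g : O2 d"
  have tt: "transpose_mat (transpose_mat g) = g" by simp
  show "A4 g" if "Pq d q (transpose_mat g) & transpose_mat g $$ (q, q) ~= 0 & colz d q (transpose_mat g) &
    (\<forall>j<d + 4. j ~= q --> transpose_mat g $$ (q, j) = 0)"
   using that P[OF g] t(3)[OF g q4(1)] q4(1) unfolding A4_def colz_def by simp
  show "Pq d q (transpose_mat g) & transpose_mat g $$ (q, q) ~= 0 & rowr d q (?m * ?m) (transpose_mat (transpose_mat g)) &
    (\<forall>j<d + 4. j ~= q --> transpose_mat g $$ (q, j) = 0)" if "A3 g"
   using that P[OF g] t(3)[OF g q4(1)] q4(1) unfolding A3_def colz_def tt by simp
 qed auto
 have 5: "reach d A4 (Pq d (Suc q))"
  unfolding reach_def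
 proof (intro exI[of _ 1] ballI impI)
  fix g assume g: "g : O2 d" "A4 g"
  have e: "1\<^sub>m (d + 4) * g * 1\<^sub>m (d + 4) = g" using O2_carrier[OF g(1)] by simp
  have F: "Pq d (Suc q) g" using Pq_Suc[OF q g(1)] g(2) unfolding A4_def by blast
  show "\<exists>k\<in>BO d 1. \<exists>k'\<in>BO d 1. Pq d (Suc q) (k * g * k')"
   by (rule bexI[where x = "1\<^sub>m (d + 4)"], rule bexI[where x = "1\<^sub>m (d + 4)"], unfold e, rule F, rule BO_one, rule BO_one)
 qed
 show ?thesis by (rule reach_trans[OF 1 reach_trans[OF 2 reach_trans[OF 3 reach_trans[OF 4 5]]]])
qed

section \<open>From the last stage into the Weyl chamber\<close>

definition isdg :: "nat => (real => real => bool) => real mat => bool" where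
 "isdg d P g \<longleftrightarrow> (\<exists>a b. a ~= 0 & b ~= 0 & P a b & g = dg d a b)"

text \<open>Besides a, b, 1 / b, 1 / a there remains an orthogonal d x d block. Its entries are at
  most 1, so its inverse is an admissible right factor.\<close>

lemma reach_dg: "reach d (Pq d 2) (isdg d (%_ _. True))"
 unfolding reach_def
proof (intro exI[of _ 1] ballI impI)
 fix D assume D: "D : O2 d" "Pq d 2 D"
 note Dc = O2_carrier[OF D(1)]
 have z: "D $$ (i, j) = 0" if "i < d + 4" "j < d + 4" "i ~= j" "\<not> (inr d 2 i & inr d 2 j)" for i j
  using Pq_D[OF D(2) that] .
 define a where "a = D $$ (0, 0)"
 define b where "b = D $$ (1, 1)"
 have "a * D $$ (d + 3, d + 3) = 1"
  using O2_rel[OF D(1), of 0 "d + 3"] by (simp add: sum_split z inr_def a_def)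
 then have a: "a ~= 0" "D $$ (d + 3, d + 3) = 1 / a" by (auto simp: eq_divide_eq mult.commute)
 have "b * D $$ (d + 2, d + 2) = 1"
  using O2_rel[OF D(1), of 1 "d + 2"] by (simp add: sum_split z inr_def b_def)
 then have b: "b ~= 0" "D $$ (d + 2, d + 2) = 1 / b" by (auto simp: eq_divide_eq mult.commute)
 define W where "W = dg d (1 / a) (1 / b) * D"
 have WO: "W : O2 d" unfolding W_def by (rule O2_mult[OF dg_O2 D(1)]) (use a b in auto)
 have sq: "(\<Sum>l<d. D $$ (l + 2, k + 2) * D $$ (l + 2, k + 2)) = 1" if "k < d" for k
  using O2_rel[OF D(1), of "k + 2" "k + 2"] that by (simp add: sum_split z inr_def cong: sum.cong_simp)
 have le1: "\<bar>D $$ (l + 2, k + 2)\<bar> <= 1" if "l < d" "k < d" for l k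
 proof -
  have "D $$ (l + 2, k + 2) * D $$ (l + 2, k + 2) <= (\<Sum>l<d. D $$ (l + 2, k + 2) * D $$ (l + 2, k + 2))"
   by (rule member_le_sum) (use that in auto)
  then have "(D $$ (l + 2, k + 2))\<^sup>2 <= 1" using sq[OF that(2)] by (simp add: power2_eq_square)
  then show ?thesis by (simp add: abs_square_le_1)
 qed
 have WB: "W : BO d 1"
 proof (rule BO_I[OF WO])
  fix i j assume i: "i < d + 4" and j: "j < d + 4"
  show "\<bar>W $$ (i, j)\<bar> <= 1"
   unfolding W_def dg_def diagm_mult_left[OF Dc i j]
   by (cases rule: index_cases[OF i]; cases rule: index_cases[OF j])
     (use a b le1 in \<open>simp_all add: z inr_def a_def[symmetric] b_def[symmetric]\<close>)
 qed
 have "dg d a b * W = D"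
 proof -
  have "dg d a b * W = (dg d a b * dg d (1 / a) (1 / b)) * D"
   unfolding W_def by (rule assoc_mult_mat[OF dg_carrier dg_carrier Dc, symmetric])
  also have "dg d a b * dg d (1 / a) (1 / b) = 1\<^sub>m (d + 4)"
   unfolding dg_mult unfolding dg_def by (rule eq_matI) (use a b in \<open>auto simp: diagm_def\<close>)
  finally show ?thesis using Dc by simp
 qed
 then have "1\<^sub>m (d + 4) * D * finv d W = dg d a b"
  using O2_cancel(3)[OF WO dg_carrier, of a b] Dc by simp
 then have F: "isdg d (%_ _. True) (1\<^sub>m (d + 4) * D * finv d W)"
  unfolding isdg_def using a b by blast
 show "\<exists>k\<in>BO d 1. \<exists>k'\<in>BO d 1. isdg d (%_ _. True) (k * D * k')"
  by (rule bexI[where x = "1\<^sub>m (d + 4)"], rule bexI[where x = "finv d W"], rule F, rule BO_finv[OF WB], rule BO_one)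
qed

lemma reach_isdg:
 assumes "!!a b. a ~= 0 ==> b ~= 0 ==> P a b ==> \<exists>k\<in>BO d 1. \<exists>k'\<in>BO d 1. isdg d Q (k * dg d a b * k')"
 shows "reach d (isdg d P) (isdg d Q)"
 unfolding reach_def isdg_def[of d P] using assms by blast

lemma isdg_perm:
 assumes "good_perm d \<sigma>" "pm d \<sigma> * dg d a b = dg d a' b' * pm d \<sigma>" "a' ~= 0" "b' ~= 0" "Q a' b'"
 shows "\<exists>k\<in>BO d 1. \<exists>k'\<in>BO d 1. isdg d Q (k * dg d a b * k')"
proof -
 have "pm d \<sigma> * dg d a b * finv d (pm d \<sigma>) = dg d a' b'"
  unfolding assms(2) by (rule O2_cancel(3)[OF pm_O2[OF assms(1)] dg_carrier])
 then have "isdg d Q (pm d \<sigma> * dg d a b * finv d (pm d \<sigma>))" unfolding isdg_def using assms by blast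
 then show ?thesis using pm_BO[OF assms(1)] BO_finv by blast
qed

lemma isdg_id:
 assumes "a ~= 0" "b ~= 0" "Q a b"
 shows "\<exists>k\<in>BO d 1. \<exists>k'\<in>BO d 1. isdg d Q (k * dg d a b * k')"
proof -
 have "1\<^sub>m (d + 4) * dg d a b * 1\<^sub>m (d + 4) = dg d a b"
  by (simp add: left_mult_one_mat[OF dg_carrier] right_mult_one_mat[OF dg_carrier])
 then have "isdg d Q (1\<^sub>m (d + 4) * dg d a b * 1\<^sub>m (d + 4))" unfolding isdg_def using assms by metis
 then show ?thesis using BO_one by blast
qed

text \<open>Signs are removed by \<open>dg d (sgn a) (sgn b)\<close>; then Weyl group elements
  invert and exchange a and b as required.\<close>

lemma reach_normalise: "reach d (isdg d (%_ _. True)) (isdg d (%a b. 1 <= b & b <= a))"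
proof -
 have 1: "reach d (isdg d (%_ _. True)) (isdg d (%a b. 0 < a & 0 < b))"
 proof (rule reach_isdg)
  fix a b :: real assume ab: "a ~= 0" "b ~= 0"
  have s: "dg d (sgn a) (sgn b) : BO d 1"
   by (rule BO_I[OF dg_O2]) (use ab in \<open>auto simp: dg_def sgn_if\<close>)
  have "dg d (sgn a) (sgn b) * dg d a b * 1\<^sub>m (d + 4) = dg d \<bar>a\<bar> \<bar>b\<bar>"
   by (simp add: dg_mult abs_sgn mult.commute right_mult_one_mat[OF dg_carrier])
  then have "isdg d (%a b. 0 < a & 0 < b) (dg d (sgn a) (sgn b) * dg d a b * 1\<^sub>m (d + 4))"
   unfolding isdg_def using ab by (intro exI[of _ "\<bar>a\<bar>"] exI[of _ "\<bar>b\<bar>"]) simp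
  then show "\<exists>k\<in>BO d 1. \<exists>k'\<in>BO d 1. isdg d (%a b. 0 < a & 0 < b) (k * dg d a b * k')"
   using s BO_one by blast
 qed
 have 2: "reach d (isdg d (%a b. 0 < a & 0 < b)) (isdg d (%a b. 1 <= a & 0 < b))"
 proof (rule reach_isdg)
  fix a b :: real assume ab: "a ~= 0" "b ~= 0" "0 < a & 0 < b"
  show "\<exists>k\<in>BO d 1. \<exists>k'\<in>BO d 1. isdg d (%a b. 1 <= a & 0 < b) (k * dg d a b * k')"
  proof (cases "1 <= a")
   case True
   then show ?thesis using ab by (intro isdg_id) auto
  next
   case False
   show ?thesis
    by (rule isdg_perm[of d "sw03 d" a b "1 / a" b], simp, rule pm_conj_dg)
      (use ab False in \<open>auto simp: sw03_def field_simps\<close>)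
  qed
 qed
 have 3: "reach d (isdg d (%a b. 1 <= a & 0 < b)) (isdg d (%a b. 1 <= a & 1 <= b))"
 proof (rule reach_isdg)
  fix a b :: real assume ab: "a ~= 0" "b ~= 0" "1 <= a & 0 < b"
  show "\<exists>k\<in>BO d 1. \<exists>k'\<in>BO d 1. isdg d (%a b. 1 <= a & 1 <= b) (k * dg d a b * k')"
  proof (cases "1 <= b")
   case True
   then show ?thesis using ab by (intro isdg_id) auto
  next
   case False
   show ?thesis
    by (rule isdg_perm[of d "sw12 d" a b a "1 / b"], simp, rule pm_conj_dg)
      (use ab False in \<open>auto simp: sw12_def field_simps\<close>)
  qed
 qed
 have 4: "reach d (isdg d (%a b. 1 <= a & 1 <= b)) (isdg d (%a b. 1 <= b & b <= a))"
 proof (rule reach_isdg)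
  fix a b :: real assume ab: "a ~= 0" "b ~= 0" "1 <= a & 1 <= b"
  show "\<exists>k\<in>BO d 1. \<exists>k'\<in>BO d 1. isdg d (%a b. 1 <= b & b <= a) (k * dg d a b * k')"
  proof (cases "b <= a")
   case True
   then show ?thesis using ab by (intro isdg_id) auto
  next
   case False
   show ?thesis
    by (rule isdg_perm[of d "sw01 d" a b b a], simp, rule pm_conj_dg)
      (use ab False in \<open>auto simp: sw01_def\<close>)
  qed
 qed
 show ?thesis by (rule reach_trans[OF 1 reach_trans[OF 2 reach_trans[OF 3 4]]])
qed

theorem coarse_cartan_decomposition:
 "\<exists>B. \<forall>g\<in>O2 d. \<exists>k\<in>BO d B. \<exists>k'\<in>BO d B. \<exists>a b. 1 <= b & b <= a & k * g * k' = dg d a b"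
proof -
 have r0: "reach d (Pq d 0) (Pq d 1)" using reach_Suc[of 0 d] by (simp add: One_nat_def)
 have r1: "reach d (Pq d 1) (Pq d 2)" using reach_Suc[of 1 d] by (simp add: One_nat_def numeral_2_eq_2)
 have "reach d (Pq d 0) (isdg d (%a b. 1 <= b & b <= a))"
  by (rule reach_trans[OF r0 reach_trans[OF r1 reach_trans[OF reach_dg reach_normalise]]])
 then show ?thesis unfolding reach_def isdg_def using Pq_0 by blast
qed

section \<open>Growth of matrix norms\<close>

definition N1 :: "nat => real mat => real" where
 "N1 d A = (\<Sum>i<d + 4. \<Sum>j<d + 4. \<bar>A $$ (i, j)\<bar>)"

definition mnr :: "real mat => nat \<times> nat => nat \<times> nat => real" where
 "mnr A p q = A $$ (fst p, fst q) * A $$ (snd p, snd q) - A $$ (fst p, snd q) * A $$ (snd p, fst q)"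

text \<open>The l1-norm of the second compound matrix, that is of the action on the second exterior
  power, with rows and columns indexed by all ordered pairs.\<close>

definition N2 :: "nat => real mat => real" where
 "N2 d A = (\<Sum>p\<in>{..<d + 4} \<times> {..<d + 4}. \<Sum>q\<in>{..<d + 4} \<times> {..<d + 4}. \<bar>mnr A p q\<bar>)"

lemma sum_mult_bound:
 fixes a :: "'p => 'r => real" and b :: "'r => 'q => real"
 assumes fin: "finite P" "finite R" "finite Q"
  and c: "!!p q. p : P ==> q : Q ==> c p q <= (\<Sum>r\<in>R. a p r * b r q)"
  and nn: "!!p r. 0 <= a p r" "!!r q. 0 <= b r q"
 shows "(\<Sum>p\<in>P. \<Sum>q\<in>Q. c p q) <= (\<Sum>p\<in>P. \<Sum>r\<in>R. a p r) * (\<Sum>r\<in>R. \<Sum>q\<in>Q. b r q)"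
proof -
 let ?T = "\<Sum>r\<in>R. \<Sum>q\<in>Q. b r q"
 have "(\<Sum>p\<in>P. \<Sum>q\<in>Q. c p q) <= (\<Sum>p\<in>P. \<Sum>q\<in>Q. \<Sum>r\<in>R. a p r * b r q)"
  by (intro sum_mono c)
 also have "\<dots> = (\<Sum>p\<in>P. \<Sum>r\<in>R. a p r * (\<Sum>q\<in>Q. b r q))"
  by (intro sum.cong refl, subst sum.swap) (simp add: sum_distrib_left)
 also have "\<dots> <= (\<Sum>p\<in>P. \<Sum>r\<in>R. a p r * ?T)"
 proof (intro sum_mono mult_left_mono nn)
  fix r assume "r : R"
  then show "(\<Sum>q\<in>Q. b r q) <= ?T"
   using fin by (intro member_le_sum[of r R "%r. \<Sum>q\<in>Q. b r q"] sum_nonneg nn) auto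
 qed
 also have "\<dots> = (\<Sum>p\<in>P. \<Sum>r\<in>R. a p r) * ?T" by (simp add: sum_distrib_right)
 finally show ?thesis .
qed

lemma N1_mult:
 assumes "A : Mat d" "B : Mat d"
 shows "N1 d (A * B) <= N1 d A * N1 d B"
 unfolding N1_def
proof (rule sum_mult_bound)
 fix i j assume "i : {..<d + 4}" "j : {..<d + 4}"
 then have ij: "i < d + 4" "j < d + 4" by auto
 show "\<bar>(A * B) $$ (i, j)\<bar> <= (\<Sum>k<d + 4. \<bar>A $$ (i, k)\<bar> * \<bar>B $$ (k, j)\<bar>)"
  unfolding index_mult_sum[OF assms ij] abs_mult[symmetric] by (rule sum_abs)
qed auto

text \<open>Cauchy-Binet; a sum over ordered pairs counts every two-element set twice, hence the
  factor 2.\<close>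

lemma mnr_mult:
 assumes "A : Mat d" "B : Mat d"
  and p: "p : {..<d + 4} \<times> {..<d + 4}" and q: "q : {..<d + 4} \<times> {..<d + 4}"
 shows "2 * mnr (A * B) p q = (\<Sum>r\<in>{..<d + 4} \<times> {..<d + 4}. mnr A p r * mnr B r q)"
proof -
 obtain i j k l where pq: "p = (i, j)" "q = (k, l)" "i < d + 4" "j < d + 4" "k < d + 4" "l < d + 4"
  using p q by auto
 let ?I = "{..<d + 4}"
 let ?b = "%s t. B $$ (s, k) * B $$ (t, l) - B $$ (s, l) * B $$ (t, k)"
 have 1: "mnr (A * B) p q = (\<Sum>s\<in>?I. \<Sum>t\<in>?I. A $$ (i, s) * A $$ (j, t) * ?b s t)"
  unfolding mnr_def pq fst_conv snd_conv index_mult_sum[OF assms(1,2) pq(3) pq(5)] index_mult_sum[OF assms(1,2) pq(4) pq(6)]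
   index_mult_sum[OF assms(1,2) pq(3) pq(6)] index_mult_sum[OF assms(1,2) pq(4) pq(5)]
   sum_product sum_subtractf[symmetric]
  by (intro sum.cong refl) (simp add: algebra_simps)
 have 2: "mnr (A * B) p q = (\<Sum>s\<in>?I. \<Sum>t\<in>?I. - (A $$ (i, t) * A $$ (j, s) * ?b s t))"
  unfolding 1 by (subst sum.swap) (intro sum.cong refl, simp add: algebra_simps)
 have "2 * mnr (A * B) p q = (\<Sum>s\<in>?I. \<Sum>t\<in>?I. (A $$ (i, s) * A $$ (j, t) - A $$ (i, t) * A $$ (j, s)) * ?b s t)"
 proof -
  have "2 * mnr (A * B) p q = (\<Sum>s\<in>?I. \<Sum>t\<in>?I. A $$ (i, s) * A $$ (j, t) * ?b s t)
    + (\<Sum>s\<in>?I. \<Sum>t\<in>?I. - (A $$ (i, t) * A $$ (j, s) * ?b s t))"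
   using 1 2 by linarith
  also have "\<dots> = (\<Sum>s\<in>?I. \<Sum>t\<in>?I. A $$ (i, s) * A $$ (j, t) * ?b s t + - (A $$ (i, t) * A $$ (j, s) * ?b s t))"
   by (simp only: sum.distrib)
  finally show ?thesis by (simp add: algebra_simps)
 qed
 also have "\<dots> = (\<Sum>r\<in>?I \<times> ?I. mnr A p r * mnr B r q)"
  unfolding sum.cartesian_product by (intro sum.cong refl) (auto simp: mnr_def pq)
 finally show ?thesis .
qed

lemma N2_mult:
 assumes "A : Mat d" "B : Mat d"
 shows "N2 d (A * B) <= N2 d A * N2 d B"
 unfolding N2_def
proof (rule sum_mult_bound)
 fix p q assume pq: "p : {..<d + 4} \<times> {..<d + 4}" "q : {..<d + 4} \<times> {..<d + 4}"
 have "\<bar>mnr (A * B) p q\<bar> <= \<bar>2 * mnr (A * B) p q\<bar>" by simp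
 also have "\<dots> <= (\<Sum>r\<in>{..<d + 4} \<times> {..<d + 4}. \<bar>mnr A p r * mnr B r q\<bar>)"
  unfolding mnr_mult[OF assms pq] by (rule sum_abs)
 finally show "\<bar>mnr (A * B) p q\<bar> <= (\<Sum>r\<in>{..<d + 4} \<times> {..<d + 4}. \<bar>mnr A p r\<bar> * \<bar>mnr B r q\<bar>)"
  by (simp add: abs_mult)
qed auto

lemma N1_nonneg [simp]: "0 <= N1 d A"
 unfolding N1_def by (intro sum_nonneg) auto

lemma N2_nonneg [simp]: "0 <= N2 d A"
 unfolding N2_def by (intro sum_nonneg) auto

lemma entry_le_N1: assumes "i < d + 4" "j < d + 4" shows "\<bar>A $$ (i, j)\<bar> <= N1 d A"
proof -
 have "\<bar>A $$ (i, j)\<bar> <= (\<Sum>j<d + 4. \<bar>A $$ (i, j)\<bar>)"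
  by (rule member_le_sum) (use assms in auto)
 also have "\<dots> <= N1 d A" unfolding N1_def
  by (rule member_le_sum[of i _ "%i. \<Sum>j<d + 4. \<bar>A $$ (i, j)\<bar>"]) (use assms in \<open>auto intro: sum_nonneg\<close>)
 finally show ?thesis .
qed

lemma mnr_le_N2:
 assumes "i < d + 4" "j < d + 4" "k < d + 4" "l < d + 4"
 shows "\<bar>A $$ (i, k) * A $$ (j, l) - A $$ (i, l) * A $$ (j, k)\<bar> <= N2 d A"
proof -
 let ?I = "{..<d + 4} \<times> {..<d + 4}"
 have "\<bar>mnr A (i, j) (k, l)\<bar> <= (\<Sum>q\<in>?I. \<bar>mnr A (i, j) q\<bar>)"
  by (rule member_le_sum) (use assms in auto)
 also have "\<dots> <= N2 d A" unfolding N2_def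
  by (rule member_le_sum[of "(i, j)" ?I "%p. \<Sum>q\<in>?I. \<bar>mnr A p q\<bar>"]) (use assms in \<open>auto intro: sum_nonneg\<close>)
 finally show ?thesis by (simp add: mnr_def)
qed

lemma N1_le:
 assumes "!!i j. i < d + 4 ==> j < d + 4 ==> \<bar>A $$ (i, j)\<bar> <= B"
 shows "N1 d A <= real (d + 4) ^ 2 * B"
proof -
 have "N1 d A <= (\<Sum>i<d + 4. \<Sum>j<d + 4. B)" unfolding N1_def by (intro sum_mono assms) auto
 then show ?thesis by (simp add: power2_eq_square mult.assoc)
qed

lemma N2_le:
 assumes "!!i j k l. i < d + 4 ==> j < d + 4 ==> k < d + 4 ==> l < d + 4 ==>
  \<bar>A $$ (i, k) * A $$ (j, l) - A $$ (i, l) * A $$ (j, k)\<bar> <= B"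
 shows "N2 d A <= real (d + 4) ^ 4 * B"
proof -
 have "N2 d A <= (\<Sum>p\<in>{..<d + 4} \<times> {..<d + 4}. \<Sum>q\<in>{..<d + 4} \<times> {..<d + 4}. B)"
  unfolding N2_def mnr_def by (intro sum_mono assms) auto
 then show ?thesis by (simp add: power4_eq_xxxx mult.assoc card_cartesian_product)
qed

text \<open>A common bound for both norms on \<open>BO d B\<close>; the summand 1 makes it at least
  1.\<close>

definition NK :: "nat => real => real" where
 "NK d B = real (d + 4) ^ 4 * (B + 2 * B\<^sup>2) + 1"

lemma BO_N:
 assumes "A : BO d B"
 shows "N1 d A <= NK d B" "N2 d A <= NK d B" "1 <= NK d B"
proof -
 have B: "0 <= B" using BO_nonneg[OF assms] .
 have m: "1 <= real (d + 4)" by simp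
 have "N1 d A <= real (d + 4) ^ 2 * B" by (rule N1_le) (use BO_le[OF assms] in auto)
 also have "\<dots> <= real (d + 4) ^ 4 * (B + 2 * B\<^sup>2)"
  using B m by (intro mult_mono power_increasing) auto
 finally show "N1 d A <= NK d B" by (simp add: NK_def)
 have "N2 d A <= real (d + 4) ^ 4 * (2 * B\<^sup>2)"
 proof (rule N2_le)
  fix i j k l assume "i < d + 4" "j < d + 4" "k < d + 4" "l < d + 4"
  then have "\<bar>A $$ (i, k)\<bar> * \<bar>A $$ (j, l)\<bar> <= B * B" "\<bar>A $$ (i, l)\<bar> * \<bar>A $$ (j, k)\<bar> <= B * B"
   using BO_le[OF assms] B by (auto intro!: mult_mono)
  then show "\<bar>A $$ (i, k) * A $$ (j, l) - A $$ (i, l) * A $$ (j, k)\<bar> <= 2 * B\<^sup>2"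
   using abs_triangle_ineq4[of "A $$ (i, k) * A $$ (j, l)" "A $$ (i, l) * A $$ (j, k)"]
   by (simp add: abs_mult power2_eq_square)
 qed
 also have "\<dots> <= real (d + 4) ^ 4 * (B + 2 * B\<^sup>2)"
  using B m by (intro mult_left_mono) auto
 finally show "N2 d A <= NK d B" by (simp add: NK_def)
 show "1 <= NK d B" unfolding NK_def using B by simp
qed

lemma N_sandwich:
 assumes k: "k : BO d B" "k' : BO d B" and A: "A : Mat d"
 shows "N1 d (k * A * k') <= (NK d B)\<^sup>2 * N1 d A" "N2 d (k * A * k') <= (NK d B)\<^sup>2 * N2 d A"
proof -
 note c = O2_carrier[OF BO_O2[OF k(1)]] O2_carrier[OF BO_O2[OF k(2)]]
 have kA: "k * A : Mat d" using c A by auto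
 have "N1 d (k * A * k') <= N1 d k * N1 d A * N1 d k'"
  using N1_mult[OF kA c(2)] mult_right_mono[OF N1_mult[OF c(1) A], of "N1 d k'"] by simp
 also have "\<dots> <= NK d B * N1 d A * NK d B"
  using BO_N[OF k(1)] BO_N[OF k(2)] by (intro mult_mono) auto
 finally show "N1 d (k * A * k') <= (NK d B)\<^sup>2 * N1 d A" by (simp add: power2_eq_square mult_ac)
 have "N2 d (k * A * k') <= N2 d k * N2 d A * N2 d k'"
  using N2_mult[OF kA c(2)] mult_right_mono[OF N2_mult[OF c(1) A], of "N2 d k'"] by simp
 also have "\<dots> <= NK d B * N2 d A * NK d B"
  using BO_N[OF k(1)] BO_N[OF k(2)] by (intro mult_mono) auto
 finally show "N2 d (k * A * k') <= (NK d B)\<^sup>2 * N2 d A" by (simp add: power2_eq_square mult_ac)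
qed

lemma O2_unsandwich:
 assumes k: "k : O2 d" "k' : O2 d" and A: "A : Mat d"
 shows "finv d k * (k * A * k') * finv d k' = A"
proof -
 note c = O2_carrier[OF k(1)] O2_carrier[OF k(2)]
 have kA: "k * A : Mat d" using c A by auto
 have "finv d k * (k * A * k') = finv d k * (k * A) * k'"
  by (rule assoc_mult_mat[OF finv_carrier kA c(2), symmetric])
 also have "\<dots> = A * k'" using O2_cancel(1)[OF k(1) A] by simp
 finally show ?thesis using O2_cancel(3)[OF k(2) A] by simp
qed

lemma N_sandwich':
 assumes k: "k : BO d B" "k' : BO d B" and A: "A : Mat d"
 shows "N1 d A <= (NK d B)\<^sup>2 * N1 d (k * A * k')" "N2 d A <= (NK d B)\<^sup>2 * N2 d (k * A * k')"
proof -
 note c = O2_carrier[OF BO_O2[OF k(1)]] O2_carrier[OF BO_O2[OF k(2)]]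
 have kA: "k * A * k' : Mat d" using c A by auto
 show "N1 d A <= (NK d B)\<^sup>2 * N1 d (k * A * k')" "N2 d A <= (NK d B)\<^sup>2 * N2 d (k * A * k')"
  using N_sandwich[OF BO_finv[OF k(1)] BO_finv[OF k(2)] kA]
  unfolding O2_unsandwich[OF BO_O2[OF k(1)] BO_O2[OF k(2)] A] .
qed

text \<open>The largest entry is a and the largest minor a * b, because all other diagonal entries
  are at most b. The two norms thus determine a and b up to bounded factors.\<close>

lemma dg_norms:
 assumes "1 <= b" "b <= a"
 shows "a <= N1 d (dg d a b)" "N1 d (dg d a b) <= real (d + 4) ^ 4 * a"
  "a * b <= N2 d (dg d a b)" "N2 d (dg d a b) <= real (d + 4) ^ 4 * (a * b)"
proof -
 define f where "f i = (if i = 0 then a else if i = 1 then b else if i = d + 2 then 1 / b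
   else if i = d + 3 then 1 / a else 1)" for i
 have e: "dg d a b $$ (i, j) = (if i = j then f i else 0)" if "i < d + 4" "j < d + 4" for i j
  using that by (simp add: dg_def f_def)
 have a1: "1 <= a" using assms by simp
 have ab: "a <= a * b" "1 <= a * b" using assms a1 mult_mono[of 1 a 1 b] by auto
 have aa: "1 <= a * a" "1 <= b * b" "1 <= b * a"
  using assms a1 by (auto intro: mult_ge1_I)
 have fb: "0 < f i" "f i <= a" for i using assms a1 aa ab by (auto simp: f_def divide_le_eq)
 have fb': "f i <= b" if "i ~= 0" for i using assms a1 aa that by (auto simp: f_def divide_le_eq)
 show "a <= N1 d (dg d a b)" using entry_le_N1[of 0 d 0 "dg d a b"] a1 by (simp add: e f_def)
 have "N1 d (dg d a b) <= real (d + 4) ^ 2 * a"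
  by (rule N1_le) (use fb a1 in \<open>auto simp: e less_imp_le\<close>)
 also have "\<dots> <= real (d + 4) ^ 4 * a" using a1 by (intro mult_right_mono power_increasing) auto
 finally show "N1 d (dg d a b) <= real (d + 4) ^ 4 * a" .
 show "a * b <= N2 d (dg d a b)"
  using mnr_le_N2[of 0 d 1 0 1 "dg d a b"] ab by (simp add: e f_def)
 have ff: "f i * f j <= a * b" if "i ~= j" for i j
 proof (cases "i = 0")
  case True
  then show ?thesis using that fb[of i] fb'[of j] fb[of j] assms by (intro mult_mono) auto
 next
  case False
  then show ?thesis using mult_mono[OF fb(2)[of j] fb'[OF False]] fb[of i] fb[of j] a1 by (simp add: mult.commute less_imp_le)
 qed
 show "N2 d (dg d a b) <= real (d + 4) ^ 4 * (a * b)"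
 proof (rule N2_le)
  fix i j k l assume ijkl: "i < d + 4" "j < d + 4" "k < d + 4" "l < d + 4"
  have p: "0 <= f i * f j" for i j using fb[of i] fb[of j] by simp
  show "\<bar>dg d a b $$ (i, k) * dg d a b $$ (j, l) - dg d a b $$ (i, l) * dg d a b $$ (j, k)\<bar> <= a * b"
   unfolding e[OF ijkl(1,3)] e[OF ijkl(2,4)] e[OF ijkl(1,4)] e[OF ijkl(2,3)]
   using ff[of i j] p[of i j] ab by (cases "i = j"; cases "i = k"; cases "i = l"; cases "j = k"; cases "j = l"; simp)
 qed
qed

section \<open>Norms of elements versus Cartan-decomposition subgroups\<close>

lemma SObox_BO: "A : SObox d B \<longleftrightarrow> A : BO d B & det A = 1"
 unfolding SObox_def BO_def carrier_SO2 by auto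

lemma carrier_SO2_I: "A : O2 d ==> det A = 1 ==> A : carrier (SO d)"
 by (simp add: carrier_SO2)

lemma cds_growth:
 assumes "cds d H"
 shows "\<exists>K\<ge>1. \<forall>g\<in>carrier (SO d). \<exists>h\<in>H. N1 d h <= K * N1 d g & N1 d g <= K * N1 d h &
   N2 d h <= K * N2 d g & N2 d g <= K * N2 d h"
proof -
 obtain C where C: "compactin (SO_top d) C" "C <#>\<^bsub>SO d\<^esub> H <#>\<^bsub>SO d\<^esub> C = carrier (SO d)"
  and H: "subgroup H (SO d)"
  using assms unfolding cartan_decomposition_subgroup_def by blast
 obtain B where B: "C \<subseteq> SObox d B" using compactin_SO2_bounded[OF C(1)] by blast
 have HO: "h : O2 d" if "h : H" for h using subgroup.subset[OF H] that by (auto simp: carrier_SO2)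
 have "\<exists>h\<in>H. N1 d h <= (NK d B)\<^sup>2 * N1 d g & N1 d g <= (NK d B)\<^sup>2 * N1 d h &
   N2 d h <= (NK d B)\<^sup>2 * N2 d g & N2 d g <= (NK d B)\<^sup>2 * N2 d h" if "g : carrier (SO d)" for g
 proof -
  have "g : C <#>\<^bsub>SO d\<^esub> H <#>\<^bsub>SO d\<^esub> C" using that C(2) by simp
  then obtain c h c' where c: "c : C" "h : H" "c' : C" "g = c * h * c'"
   unfolding set_mult_def by auto
  have b: "c : BO d B" "c' : BO d B" using B c by (auto simp: SObox_BO)
  show ?thesis
   using N_sandwich[OF b O2_carrier[OF HO[OF c(2)]]] N_sandwich'[OF b O2_carrier[OF HO[OF c(2)]]] c by blast
 qed
 moreover have "1 <= (NK d B)\<^sup>2" unfolding NK_def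
 proof -
  obtain c where "c : C" using C(2) monoid.one_closed[OF group.is_monoid[OF group_SO2], of d] unfolding set_mult_def by auto
  then have "c : BO d B" using B by (auto simp: SObox_BO)
  from BO_N(3)[OF this] show "1 <= (real (d + 4) ^ 4 * (B + 2 * B\<^sup>2) + 1)\<^sup>2"
   unfolding NK_def by (rule one_le_power)
 qed
 ultimately show ?thesis by blast
qed

text \<open>Elements arbitrarily far out within a bounded factor of the wall b = 1;
  \<open>wall2\<close> is the same for the wall b = a. They result from comparing with
  \<open>dg d t 1\<close> and \<open>dg d t t\<close>.\<close>

definition wall1 :: "nat => real mat set => bool" where
 "wall1 d H \<longleftrightarrow> (\<exists>K\<ge>1. \<forall>t\<ge>1. \<exists>h\<in>H. t <= K * N1 d h & N2 d h <= K * N1 d h)"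

definition wall2 :: "nat => real mat set => bool" where
 "wall2 d H \<longleftrightarrow> (\<exists>K\<ge>1. \<forall>t\<ge>1. \<exists>h\<in>H. t <= K * N1 d h & (N1 d h)\<^sup>2 <= K * N2 d h)"

lemma cds_walls:
 assumes "cds d H"
 shows "wall1 d H" "wall2 d H"
proof -
 obtain K where K: "K \<ge> 1" "!!g. g : carrier (SO d) ==> \<exists>h\<in>H. N1 d h <= K * N1 d g & N1 d g <= K * N1 d h &
   N2 d h <= K * N2 d g & N2 d g <= K * N2 d h" using cds_growth[OF assms] by blast
 let ?m = "real (d + 4) ^ 4"
 have m: "1 <= ?m" by (rule one_le_power) simp
 show "wall1 d H" unfolding wall1_def
 proof (intro exI[of _ "K * ?m * K"] conjI allI impI)
  show "1 <= K * ?m * K" using K m by (intro mult_ge1_I) auto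
  have KK: "K <= K * ?m * K" using mult_mono[of 1 "?m * K" K K] mult_ge1_I[OF m K(1)] K(1) by (simp add: mult_ac)
  fix t :: real assume t: "1 <= t"
  have "dg d t 1 : carrier (SO d)" using t by (intro carrier_SO2_I dg_O2 det_dg) auto
  then obtain h where h: "h : H" "N1 d (dg d t 1) <= K * N1 d h" "N2 d h <= K * N2 d (dg d t 1)" using K(2) by blast
  note n0 = dg_norms[OF order_refl t, of d]
  have n: "t <= N1 d (dg d t 1)" "N2 d (dg d t 1) <= ?m * t"
   using n0(1,4) by (simp_all only: mult_1_right)
  have th: "t <= K * N1 d h" using n(1) h(2) by linarith
  also have "\<dots> <= K * ?m * K * N1 d h" using KK by (intro mult_right_mono) auto
  finally have 1: "t <= K * ?m * K * N1 d h" .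
  have "N2 d h <= K * (?m * t)" using h(3) mult_left_mono[OF n(2), of K] K(1) by linarith
  also have "\<dots> <= K * (?m * (K * N1 d h))" using th K(1) by (intro mult_left_mono) auto
  finally have "N2 d h <= K * ?m * K * N1 d h" by (simp add: mult_ac)
  then show "\<exists>h\<in>H. t <= K * ?m * K * N1 d h & N2 d h <= K * ?m * K * N1 d h" using 1 h(1) by blast
 qed
 show "wall2 d H" unfolding wall2_def
 proof (intro exI[of _ "(K * ?m)\<^sup>2 * K"] conjI allI impI)
  have Km: "1 <= K * ?m" by (rule mult_ge1_I[OF K(1) m])
  then have Km2: "1 <= (K * ?m)\<^sup>2" by (rule one_le_power)
  show "1 <= (K * ?m)\<^sup>2 * K" by (rule mult_ge1_I[OF Km2 K(1)])
  have KK: "K <= (K * ?m)\<^sup>2 * K" using mult_right_mono[OF Km2, of K] K(1) by simp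
  fix t :: real assume t: "1 <= t"
  have "dg d t t : carrier (SO d)" using t by (intro carrier_SO2_I dg_O2 det_dg) auto
  then obtain h where h: "h : H" "N1 d (dg d t t) <= K * N1 d h" "N1 d h <= K * N1 d (dg d t t)" "N2 d (dg d t t) <= K * N2 d h"
   using K(2) by blast
  note n = dg_norms[OF t order_refl, of d]
  have "t <= K * N1 d h" using n(1) h(2) by linarith
  also have "\<dots> <= (K * ?m)\<^sup>2 * K * N1 d h" using KK by (intro mult_right_mono) auto
  finally have 1: "t <= (K * ?m)\<^sup>2 * K * N1 d h" .
  have "N1 d h <= K * (?m * t)" using h(3) mult_left_mono[OF n(2), of K] K(1) by linarith
  then have "(N1 d h)\<^sup>2 <= (K * (?m * t))\<^sup>2" by (rule power_mono) simp
  also have "\<dots> = (K * ?m)\<^sup>2 * (t * t)" by (simp add: power_mult_distrib power2_eq_square mult_ac)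
  also have "\<dots> <= (K * ?m)\<^sup>2 * (K * N2 d h)" using n(3) h(4) by (intro mult_left_mono) auto
  finally have "(N1 d h)\<^sup>2 <= (K * ?m)\<^sup>2 * K * N2 d h" by (simp add: mult_ac)
  then show "\<exists>h\<in>H. t <= (K * ?m)\<^sup>2 * K * N1 d h & (N1 d h)\<^sup>2 <= (K * ?m)\<^sup>2 * K * N2 d h" using 1 h(1) by blast
 qed
qed

text \<open>Both g and a suitable h in \<open>H\<close> are brought into the chamber by bounded
  factors. If their norms are comparable, the two chamber elements differ by a bounded torus
  element, so g lies in C h C for a fixed box C.\<close>

lemma coarsely_dense_imp_cartan:
 assumes d: "1 <= d" and H: "H \<subseteq> carrier (SO d)" and K: "1 <= K"
  and dense: "!!a b. 1 <= b ==> b <= a ==> \<exists>h\<in>H. a <= K * N1 d h & N1 d h <= K * a & a * b <= K * N2 d h & N2 d h <= K * (a * b)"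
 shows "\<exists>C. compactin (SO_top d) C & C <#>\<^bsub>SO d\<^esub> H <#>\<^bsub>SO d\<^esub> C = carrier (SO d)"
proof -
 obtain B where B: "!!g. g : O2 d ==> \<exists>k\<in>BO d B. \<exists>k'\<in>BO d B. \<exists>a b. 1 <= b & b <= a & k * g * k' = dg d a b"
  using coarse_cartan_decomposition[of d] by blast
 define m where "m = real (d + 4)"
 \<comment> \<open>\<open>K\<close> comes from the density hypothesis, the square of
   \<open>NK d B\<close> from the bounded outer factors, and \<open>m ^ 4\<close> from
   \<open>dg_norms\<close>.\<close>
 define S where "S = K * (NK d B)\<^sup>2 * m ^ 4"
 define B' where "B' = m * (m * (m * (B * S\<^sup>2)) * B) + m * (m * B * B)"
 let ?C = "SObox d B'"
 have rB: "rf d : BO d 1" by (rule BO_I[OF rf_O2[OF d]]) (auto simp: rf_def)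
 have B0: "0 <= B" using B[OF O2_one] BO_nonneg by blast
 have m1: "1 <= m" by (simp add: m_def)
 have L: "1 <= NK d B" using B[OF O2_one] BO_N(3) by blast
 have S1: "1 <= S" unfolding S_def using K L m1 by (intro mult_ge1_I one_le_power)
 have main: "\<exists>c\<in>?C. \<exists>h\<in>H. \<exists>c'\<in>?C. g = c * h * c'" if g: "g : carrier (SO d)" for g
 proof -
  have gO: "g : O2 d" "det g = 1" using g by (simp_all add: carrier_SO2)
  note gc = O2_carrier[OF gO(1)]
  obtain k k' a b where k: "k : BO d B" "k' : BO d B" "1 <= b" "b <= a" "k * g * k' = dg d a b"
   using B[OF gO(1)] by blast
  obtain h where h: "h : H" "a <= K * N1 d h" "N1 d h <= K * a" "a * b <= K * N2 d h" "N2 d h <= K * (a * b)"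
   using dense[OF k(3,4)] by blast
  have hO: "h : O2 d" "det h = 1" using h(1) H by (auto simp: carrier_SO2)
  note hc = O2_carrier[OF hO(1)]
  obtain l l' a' b' where l: "l : BO d B" "l' : BO d B" "1 <= b'" "b' <= a'" "l * h * l' = dg d a' b'"
   using B[OF hO(1)] by blast
  have pos: "1 <= a" "1 <= a'" "0 < a" "0 < a'" "0 < b" "0 < b'" using k l by auto
  note s = N_sandwich[OF l(1,2) hc, unfolded l(5)] N_sandwich'[OF l(1,2) hc, unfolded l(5)]
  note n = dg_norms[OF l(3,4), of d, folded m_def]
  let ?L = "(NK d B)\<^sup>2"
  have L0: "0 <= ?L" by simp
  have m4: "1 <= m ^ 4" using m1 by (rule one_le_power)
  have "a' <= ?L * (K * a)" using n(1) s(1) mult_left_mono[OF h(3) L0] by linarith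
  also have "\<dots> <= ?L * (K * a) * m ^ 4"
   using mult_left_mono[OF m4, of "?L * (K * a)"] K pos by simp
  finally have r1: "a' <= S * a" unfolding S_def by (simp add: mult_ac)
  have "a <= K * (?L * (m ^ 4 * a'))"
  proof -
   have "N1 d h <= ?L * (m ^ 4 * a')" using s(3) mult_left_mono[OF n(2) L0] by linarith
   then show ?thesis using h(2) mult_left_mono[of "N1 d h" "?L * (m ^ 4 * a')" K] K by linarith
  qed
  then have r2: "a <= S * a'" unfolding S_def by (simp add: mult_ac)
  have "a' * b' <= ?L * (K * (a * b))" using n(3) s(2) mult_left_mono[OF h(5) L0] by linarith
  also have "\<dots> <= ?L * (K * (a * b)) * m ^ 4"
   using mult_left_mono[OF m4, of "?L * (K * (a * b))"] K pos by simp
  finally have r3: "a' * b' <= S * (a * b)" unfolding S_def by (simp add: mult_ac)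
  have "a * b <= K * (?L * (m ^ 4 * (a' * b')))"
  proof -
   have "N2 d h <= ?L * (m ^ 4 * (a' * b'))" using s(4) mult_left_mono[OF n(4) L0] by linarith
   then show ?thesis using h(4) mult_left_mono[of "N2 d h" "?L * (m ^ 4 * (a' * b'))" K] K by linarith
  qed
  then have r4: "a * b <= S * (a' * b')" unfolding S_def by (simp add: mult_ac)
  have S2: "S <= S\<^sup>2" using S1 by (simp add: power2_eq_square)
  have q1: "a / a' <= S\<^sup>2" "a' / a <= S\<^sup>2" using r1 r2 pos S2 by (auto simp: divide_le_eq intro: order_trans mult_right_mono)
  \<comment> \<open>Only a and the product a * b are compared directly; the comparison of b needs
    both estimates, hence the square of \<open>S\<close>.\<close>
  have q2: "b / b' <= S\<^sup>2"
  proof -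
   have "a * b * a' <= S * (a' * b') * (S * a)"
    by (rule mult_mono[OF r4 r1]) (use pos S1 in auto)
   then have "(a * a') * b <= (a * a') * (S\<^sup>2 * b')" by (simp add: power2_eq_square mult_ac)
   then show ?thesis using pos by (simp add: divide_le_eq)
  qed
  have q3: "b' / b <= S\<^sup>2"
  proof -
   have "a' * b' * a <= S * (a * b) * (S * a')"
    by (rule mult_mono[OF r3 r2]) (use pos S1 in auto)
   then have "(a * a') * b' <= (a * a') * (S\<^sup>2 * b)" by (simp add: power2_eq_square mult_ac)
   then show ?thesis using pos by (simp add: divide_le_eq)
  qed
  define E where "E = dg d (a / a') (b / b')"
  have S21: "1 <= S\<^sup>2" using S1 by (rule one_le_power)
  have EB: "E : BO d (S\<^sup>2)"
   unfolding E_def by (rule BO_I[OF dg_O2]) (use q1 q2 q3 pos S21 in \<open>auto simp: dg_def\<close>)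
  have Edg: "E * dg d a' b' = dg d a b" unfolding E_def dg_mult using pos by simp
  \<comment> \<open>\<open>X\<close> will be the identity or \<open>rf d\<close>. It commutes with
    the torus, so it can be inserted on both sides of the chamber element, and the choice gives both
    outer factors determinant 1.\<close>
  have key: "\<exists>c\<in>?C. \<exists>h\<in>H. \<exists>c'\<in>?C. g = c * h * c'"
   if X: "X : BO d 1" "X * (dg d a' b' * X) = dg d a' b'" "det (finv d k * (E * (X * l))) = 1" for X
  proof -
   define c where "c = finv d k * (E * (X * l))"
   define c' where "c' = (l' * X) * finv d k'"
   note kc = O2_carrier[OF BO_O2[OF k(1)]] O2_carrier[OF BO_O2[OF k(2)]] O2_carrier[OF BO_O2[OF l(1)]]
    O2_carrier[OF BO_O2[OF l(2)]] O2_carrier[OF BO_O2[OF X(1)]] O2_carrier[OF BO_O2[OF EB]]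
   have cB: "c : BO d (m * (B * (m * (S\<^sup>2 * (m * (1 * B))))))"
    unfolding c_def m_def by (intro BO_mult BO_finv k l X EB)
   have cB': "c' : BO d (m * (m * (B * 1) * B))"
    unfolding c'_def m_def by (intro BO_mult BO_finv k l X)
   have nn: "0 <= m * (m * (m * (B * S\<^sup>2)) * B)" "0 <= m * (m * B * B)" using B0 m1 by auto
   have cB2: "c : BO d B'" by (rule BO_mono[OF cB]) (use nn in \<open>simp add: B'_def mult_ac\<close>)
   have cB2': "c' : BO d B'" by (rule BO_mono[OF cB']) (use nn in \<open>simp add: B'_def mult_ac\<close>)
   have cc: "c : Mat d" "c' : Mat d"
    using cB2 cB2' by (auto intro: O2_carrier BO_O2)
   have ge: "g = c * h * c'"
   proof -
    have "X * (l * h * l') * X = X * (dg d a' b' * X)"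
     unfolding l(5) by (rule assoc_mult_mat[OF kc(5) dg_carrier kc(5)])
    then have 1: "(X * l) * h * (l' * X) = dg d a' b'"
     using mat_mult_4[OF kc(5) kc(3) hc kc(4) kc(5)] X(2) by simp
    have Xl: "X * l : Mat d" "l' * X : Mat d"
     "E * (X * l) : Mat d" using kc by auto
    have "E * ((X * l) * h * (l' * X)) * 1\<^sub>m (d + 4) = (E * (X * l)) * h * ((l' * X) * 1\<^sub>m (d + 4))"
     by (rule mat_mult_4[OF kc(6) Xl(1) hc Xl(2)]) simp
    then have 2: "(E * (X * l)) * h * (l' * X) = dg d a b"
     using 1 Edg Xl kc by (simp add: right_mult_one_mat[OF dg_carrier])
    have "finv d k * ((E * (X * l)) * h * (l' * X)) * finv d k' = c * h * c'"
     unfolding c_def c'_def by (rule mat_mult_4[OF finv_carrier Xl(3) hc Xl(2) finv_carrier])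
    then show ?thesis
     using O2_unsandwich[OF BO_O2[OF k(1)] BO_O2[OF k(2)] gc] unfolding 2 k(5) by simp
   qed
   have dc: "det c = 1" using X(3) by (simp add: c_def)
   have "det g = det c * det h * det c'"
    unfolding ge using cc hc by (simp add: det_mult[of _ "d + 4"])
   then have "det c' = 1" using dc gO hO by simp
   then show ?thesis using ge cB2 cB2' dc h(1) SObox_BO by blast
  qed
  note kc = O2_carrier[OF BO_O2[OF k(1)]] O2_carrier[OF BO_O2[OF l(1)]] O2_carrier[OF BO_O2[OF EB]]
  have dets: "det (finv d k * (E * (X * l))) = det (finv d k * (E * l)) * det X"
   if "X : Mat d" for X
  proof -
   have "det (finv d k * (E * (X * l))) = det (finv d k) * (det E * (det X * det l))"
    using that kc by (simp add: det_mult[of _ "d + 4"])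
   moreover have "det (finv d k * (E * l)) = det (finv d k) * (det E * det l)"
    using kc by (simp add: det_mult[of _ "d + 4"])
   ultimately show ?thesis by simp
  qed
  have "finv d k * (E * l) : O2 d"
   by (intro O2_mult O2_finv BO_O2[OF k(1)] BO_O2[OF l(1)] BO_O2[OF EB])
  then consider "det (finv d k * (E * l)) = 1" | "det (finv d k * (E * l)) = -1" using det_O2 by blast
  then show ?thesis
  proof cases
   case 1
   show ?thesis
    by (rule key[OF BO_one]) (use 1 dets[of "1\<^sub>m (d + 4)"] kc in \<open>simp_all add: left_mult_one_mat[OF dg_carrier] right_mult_one_mat[OF dg_carrier]\<close>)
  next
   case 2
   show ?thesis
    by (rule key[OF rB rf_dg[OF d]]) (use 2 dets[of "rf d"] det_rf[OF d] O2_carrier[OF rf_O2[OF d]] in simp)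
  qed
 qed
 have "?C <#>\<^bsub>SO d\<^esub> H <#>\<^bsub>SO d\<^esub> ?C = carrier (SO d)"
 proof (intro Set.set_eqI iffI)
  fix g assume "g : ?C <#>\<^bsub>SO d\<^esub> H <#>\<^bsub>SO d\<^esub> ?C"
  then obtain c h c' where c: "c : ?C" "h : H" "c' : ?C" "g = c * h * c'" unfolding set_mult_def by auto
  then have "c : carrier (SO d)" "h : carrier (SO d)" "c' : carrier (SO d)"
   using H by (auto simp: SObox_def)
  then have "c \<otimes>\<^bsub>SO d\<^esub> h \<otimes>\<^bsub>SO d\<^esub> c' : carrier (SO d)"
   using group_SO2[of d] by (intro monoid.m_closed group.is_monoid)
  then show "g : carrier (SO d)" using c(4) by simp
 next
  fix g assume "g : carrier (SO d)"
  from main[OF this] show "g : ?C <#>\<^bsub>SO d\<^esub> H <#>\<^bsub>SO d\<^esub> ?C"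
   unfolding set_mult_def by auto
 qed
 then show ?thesis using compactin_SObox by blast
qed

section \<open>Abelian planes\<close>

definition sp :: "nil => nil => nil set" where
 "sp u v = {\<alpha> *\<^sub>R u + \<beta> *\<^sub>R v | \<alpha> \<beta>. True}"

lemma sp_I: "\<alpha> *\<^sub>R u + \<beta> *\<^sub>R v : sp u v"
 unfolding sp_def by blast

lemma subspace_sp: "subspace (sp u v)"
 unfolding subspace_def
proof (intro conjI ballI allI)
 show "0 : sp u v" using sp_I[of 0 u 0 v] by simp
 fix a b assume "a : sp u v" "b : sp u v"
 then obtain \<alpha> \<beta> \<alpha>' \<beta>' where "a = \<alpha> *\<^sub>R u + \<beta> *\<^sub>R v" "b = \<alpha>' *\<^sub>R u + \<beta>' *\<^sub>R v" unfolding sp_def by blast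
 then have "a + b = (\<alpha> + \<alpha>') *\<^sub>R u + (\<beta> + \<beta>') *\<^sub>R v" by (simp add: scaleR_add_left)
 then show "a + b : sp u v" using sp_I by simp
next
 fix c :: real and a assume "a : sp u v"
 then obtain \<alpha> \<beta> where "a = \<alpha> *\<^sub>R u + \<beta> *\<^sub>R v" unfolding sp_def by blast
 then have "c *\<^sub>R a = (c * \<alpha>) *\<^sub>R u + (c * \<beta>) *\<^sub>R v" by (simp add: scaleR_add_right)
 then show "c *\<^sub>R a : sp u v" using sp_I by simp
qed

lemma sp_least: "subspace V ==> u : V ==> v : V ==> sp u v \<subseteq> V"
 unfolding sp_def using subspace_add subspace_scale by blast

lemma sp_Nd: "u : Nd d ==> v : Nd d ==> sp u v \<subseteq> Nd d"
 by (rule sp_least[OF subspace_Nd])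

lemma nbr_self [simp]: "nbr u u = 0"
 by (cases u) (simp add: zero_prod_def)

lemma nbr_add_left: "nbr (u + v) w = nbr u w + nbr v w"
 by (cases u; cases v; cases w) (simp add: inner_lin_simps algebra_simps)

lemma nbr_scaleR_left: "nbr (t *\<^sub>R u) w = t *\<^sub>R nbr u w"
 by (cases u; cases w) (simp add: inner_lin_simps algebra_simps)

lemma nbr_swap: "nbr v u = - nbr u v"
 by (cases u; cases v) (simp add: inner_commute)

lemma nbr_sp:
 assumes "nbr u v = 0" "a : sp u v" "b : sp u v" shows "nbr a b = 0"
proof -
 obtain \<alpha> \<beta> \<alpha>' \<beta>' where "a = \<alpha> *\<^sub>R u + \<beta> *\<^sub>R v" "b = \<alpha>' *\<^sub>R u + \<beta>' *\<^sub>R v"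
  using assms unfolding sp_def by blast
 then show ?thesis using assms(1) nbr_swap[of v u]
  by (simp add: nbr_add_left nbr_add_right nbr_scaleR_left nbr_scaleR_right)
qed

lemma nmul_commuting: "nbr u v = 0 ==> nmul u v = u + v"
 unfolding nmul_eq_nbr by (cases u; cases v) (simp add: zero_prod_def)

lemma connected_subspace:
 fixes V :: "nil set" assumes V: "subspace V" shows "connected V"
proof -
 have e: "V = (\<Union>u\<in>V. (%t. t *\<^sub>R u) ` {0..1::real})"
 proof (intro Set.set_eqI iffI)
  fix u assume "u : V"
  then show "u : (\<Union>u\<in>V. (%t. t *\<^sub>R u) ` {0..1::real})"
   by (intro UN_I[of u] image_eqI[of _ _ 1]) auto
 next
  fix v assume "v : (\<Union>u\<in>V. (%t. t *\<^sub>R u) ` {0..1::real})"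
  then show "v : V" using subspace_scale[OF V] by blast
 qed
 have "connected (\<Union>u\<in>V. (%t. t *\<^sub>R u) ` {0..1::real})"
 proof (rule connected_Union)
  fix S assume "S : (%u. (%t. t *\<^sub>R u) ` {0..1::real}) ` V"
  then obtain u where S: "S = (%t. t *\<^sub>R u) ` {0..1::real}" by blast
  have "continuous_on {0..1::real} (%t. t *\<^sub>R u)"
   by (intro continuous_on_scaleR continuous_on_id continuous_on_const)
  then show "connected S" unfolding S by (rule connected_continuous_image) (rule connected_Icc)
 next
  have "0 : (%t. t *\<^sub>R u) ` {0..1::real}" for u :: nil
   by (rule image_eqI[of _ _ 0]) auto
  then show "\<Inter> ((%u. (%t. t *\<^sub>R u) ` {0..1::real}) ` V) ~= {}" by blast
 qed
 then show ?thesis using e by simp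
qed

lemma continuous_on_nexp_entry:
 assumes "i < d + 4" "j < d + 4" shows "continuous_on (Nd d) (%u. nexp d u $$ (i, j))"
 using continuous_map_compose[OF continuous_map_nexp continuous_map_SO2_entry[OF assms]] by (simp add: o_def)

lemma continuous_on_N2_nexp: "continuous_on (Nd d) (%u. N2 d (nexp d u))"
 unfolding N2_def mnr_def
 by (intro continuous_on_sum continuous_on_rabs continuous_on_diff continuous_on_mult continuous_on_nexp_entry) auto

text \<open>Along the path N1 stays comparable to t while N2 passes from order t to order t^2. For a
  chamber element with t = a the intermediate value theorem finds a point where N2 is comparable to
  a * b.\<close>

lemma plane_cds:
 assumes d: "1 <= d" and U: "subspace U" "U \<subseteq> Nd d" "closed U" "!!u v. u : U ==> v : U ==> nbr u v = 0"
  and K: "1 <= K"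
  and path: "!!t. 1 <= t ==> \<exists>p lo hi e1 e2. continuous_on {lo..hi} p & p ` {lo..hi} \<subseteq> U & e1 : {lo..hi} & e2 : {lo..hi} &
   (\<forall>\<sigma>\<in>{lo..hi::real}. t <= K * N1 d (nexp d (p \<sigma>)) & N1 d (nexp d (p \<sigma>)) <= K * t) &
   N2 d (nexp d (p e1)) <= K * t & t\<^sup>2 <= K * N2 d (nexp d (p e2))"
 shows "cds d (nexp d ` U)"
proof -
 have sg: "subgroup (nexp d ` U) (SO d)"
 proof (rule nexp_subgroup[OF U(2) subspace_0[OF U(1)]])
  fix u v assume uv: "u : U" "v : U"
  show "nmul u v : U" unfolding nmul_commuting[OF U(4)[OF uv]] by (rule subspace_add[OF U(1) uv])
 qed (rule subspace_neg[OF U(1)])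
 have dense: "\<exists>h\<in>nexp d ` U. a <= K * N1 d h & N1 d h <= K * a & a * b <= K * N2 d h & N2 d h <= K * (a * b)"
  if ab: "1 <= b" "b <= a" for a b
 proof -
  have a: "1 <= a" using ab by simp
  obtain p lo hi e1 e2 where p: "continuous_on {lo..hi} p" "p ` {lo..hi} \<subseteq> U" "e1 : {lo..hi}" "e2 : {lo..hi::real}"
   "!!\<sigma>. \<sigma> : {lo..hi} ==> a <= K * N1 d (nexp d (p \<sigma>)) & N1 d (nexp d (p \<sigma>)) <= K * a"
   "N2 d (nexp d (p e1)) <= K * a" "a\<^sup>2 <= K * N2 d (nexp d (p e2))"
   using path[OF a] by blast
  define f where "f \<sigma> = N2 d (nexp d (p \<sigma>))" for \<sigma>
  have "continuous_on {lo..hi} f" unfolding f_def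
   by (rule continuous_on_compose2[OF continuous_on_N2_nexp p(1)]) (use p(2) U(2) in blast)
  then have con: "connected (f ` {lo..hi})" by (rule connected_continuous_image) (rule connected_Icc)
  have ab0: "a <= a * b" "a * b <= a\<^sup>2" using ab a by (simp_all add: power2_eq_square)
  have "\<exists>\<sigma>\<in>{lo..hi}. a * b <= K * f \<sigma> & f \<sigma> <= K * (a * b)"
  proof -
   have f0: "0 <= f \<sigma>" for \<sigma> by (simp add: f_def)
   have fK: "f \<sigma> <= K * f \<sigma>" for \<sigma> using mult_right_mono[OF K f0] by simp
   have abK: "a * b <= K * (a * b)" using mult_right_mono[OF K, of "a * b"] ab0 a by simp
   have aK: "K * a <= K * (a * b)" using ab0 K by simp
   \<comment> \<open>If a * b lies outside the values at the two marked points, then one of these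
     points is itself comparable to a * b.\<close>
   consider "a * b < f e1" | "f e2 < a * b" | "f e1 <= a * b" "a * b <= f e2" by linarith
   then show ?thesis
   proof cases
    case 1
    then have "a * b <= K * f e1 & f e1 <= K * (a * b)" using p(6) fK[of e1] aK unfolding f_def by linarith
    then show ?thesis using p(3) by blast
   next
    case 2
    then have "a * b <= K * f e2 & f e2 <= K * (a * b)" using p(7) ab0 abK unfolding f_def by linarith
    then show ?thesis using p(4) by blast
   next
    case 3
    then have "a * b : f ` {lo..hi}"
     using connectedD_interval[OF con _ _ 3] p(3,4) by blast
    then obtain \<sigma> where "\<sigma> : {lo..hi}" "f \<sigma> = a * b" by auto
    then show ?thesis using fK[of \<sigma>] abK by (intro bexI[of _ \<sigma>]) auto
   qed
  qed
  then obtain \<sigma> where s: "\<sigma> : {lo..hi}" "a * b <= K * f \<sigma>" "f \<sigma> <= K * (a * b)" by blast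
  have "nexp d (p \<sigma>) : nexp d ` U" using p(2) s(1) by blast
  then show ?thesis using p(5)[OF s(1)] s(2,3) unfolding f_def by blast
 qed
 show ?thesis
  unfolding cartan_decomposition_subgroup_def
  using sg closedin_nexp_image[OF U(3,2)] connectedin_nexp_image[OF connected_subspace[OF U(1)] U(2)]
   coarsely_dense_imp_cartan[OF d subgroup.subset[OF sg] K dense] by blast
qed

text \<open>For y = 0 only the corner at (0, d + 3) is quadratic in the coordinates, the other
  entries being at most linear. In a minor the corner is multiplied by an entry outside row 0 and
  column d + 3, and those are at most 1.\<close>

lemma nexp_y0_N2:
 assumes x: "x : Rd d" and V: "\<bar>p\<bar> <= V" "norm x <= V" "\<bar>e\<bar> <= V"
 shows "N2 d (nexp d (p, x, 0, e)) <= real (d + 4) ^ 4 * (8 * (1 + V)\<^sup>2)"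
proof (rule N2_le)
 let ?h = "nexp d (p, x, 0, e)"
 have V0: "0 <= V" using V(1) by linarith
 have fc: "\<bar>fcoord x k\<bar> <= 1 + V" for k using abs_fcoord_le[of x k] V(2) by linarith
 have ent: "\<bar>?h $$ (i, j)\<bar> <= 1 + V" if i: "i < d + 4" and j: "j < d + 4" and "\<not> (i = 0 & j = d + 3)" for i j
  using that(3) by (cases rule: index_cases[OF i]; cases rule: index_cases[OF j])
   (use V V0 fc in \<open>simp_all add: nexp_index\<close>)
 have cor: "\<bar>?h $$ (0, d + 3)\<bar> <= 2 * V\<^sup>2"
 proof -
  have "\<bar>p * e\<bar> <= V * V" unfolding abs_mult by (rule mult_mono) (use V V0 in auto)
  moreover have "0 <= inner x x" "inner x x <= V * V"
   using V(2) V0 mult_mono[OF V(2) V(2)] by (simp_all add: dot_square_norm power2_eq_square)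
  ultimately have "\<bar>- p * e - inner x x / 2\<bar> <= 2 * (V * V)" unfolding mult_minus_left by argo
  then show ?thesis by (simp add: nexp_index power2_eq_square)
 qed
 have one: "\<bar>?h $$ (i, j)\<bar> <= 1" if i: "i < d + 4" and j: "j < d + 4" and "i ~= 0" "j ~= d + 3" for i j
  using that(3,4) by (cases rule: index_cases[OF i]; cases rule: index_cases[OF j]) (simp_all add: nexp_index)
 have prod: "\<bar>?h $$ (i, k) * ?h $$ (j, l)\<bar> <= 4 * (1 + V)\<^sup>2"
  if "i < d + 4" "j < d + 4" "k < d + 4" "l < d + 4" "i ~= j" "k ~= l" for i j k l
 proof -
  have VV: "2 * V\<^sup>2 <= 4 * (1 + V)\<^sup>2" "(1 + V) * (1 + V) <= 4 * (1 + V)\<^sup>2"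
   using V0 by (simp_all add: power2_eq_square algebra_simps)
  consider "i = 0" "k = d + 3" | "j = 0" "l = d + 3" | "\<not> (i = 0 & k = d + 3)" "\<not> (j = 0 & l = d + 3)" by blast
  then show ?thesis
  proof cases
   case 1
   then have "\<bar>?h $$ (i, k)\<bar> * \<bar>?h $$ (j, l)\<bar> <= (2 * V\<^sup>2) * 1"
    using cor one[of j l] that by (intro mult_mono) auto
   then show ?thesis using VV by (simp add: abs_mult)
  next
   case 2
   then have "\<bar>?h $$ (i, k)\<bar> * \<bar>?h $$ (j, l)\<bar> <= 1 * (2 * V\<^sup>2)"
    using cor one[of i k] that by (intro mult_mono) auto
   then show ?thesis using VV by (simp add: abs_mult)
  next
   case 3
   then have "\<bar>?h $$ (i, k)\<bar> * \<bar>?h $$ (j, l)\<bar> <= (1 + V) * (1 + V)"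
    using ent[of i k] ent[of j l] that V0 by (intro mult_mono) auto
   then show ?thesis using VV by (simp add: abs_mult)
  qed
 qed
 fix i j k l assume ijkl: "i < d + 4" "j < d + 4" "k < d + 4" "l < d + 4"
 show "\<bar>?h $$ (i, k) * ?h $$ (j, l) - ?h $$ (i, l) * ?h $$ (j, k)\<bar> <= 8 * (1 + V)\<^sup>2"
 proof (cases "i = j | k = l")
  case True
  then have "?h $$ (i, k) * ?h $$ (j, l) - ?h $$ (i, l) * ?h $$ (j, k) = 0" by auto
  then show ?thesis by (simp only: abs_zero) simp
 next
  case False
  then show ?thesis
   using prod[OF ijkl] prod[of i j l k] ijkl
    abs_triangle_ineq4[of "?h $$ (i, k) * ?h $$ (j, l)" "?h $$ (i, l) * ?h $$ (j, k)"] by linarith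
 qed
qed

text \<open>The products of two rank one terms cancel in every minor. Six terms remain, each at most
  64 * Q.\<close>

lemma rank_one_approx_N2:
 assumes E: "!!i j. i < d + 4 ==> j < d + 4 ==> \<exists>e. A $$ (i, j) = p i * q j + e & \<bar>e\<bar> <= 8"
  and p: "!!i. i < d + 4 ==> \<bar>p i\<bar> <= 8" and q: "!!j. j < d + 4 ==> \<bar>q j\<bar> <= Q" and Q: "1 <= Q"
 shows "N2 d A <= real (d + 4) ^ 4 * (384 * Q)"
proof (rule N2_le)
 fix i j k l assume ijkl: "i < d + 4" "j < d + 4" "k < d + 4" "l < d + 4"
 define e where "e i j = A $$ (i, j) - p i * q j" for i j
 have A: "A $$ (i, j) = p i * q j + e i j" for i j by (simp add: e_def)
 have e8: "\<bar>e i j\<bar> <= 8" if "i < d + 4" "j < d + 4" for i j using E[OF that] by (auto simp: e_def)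
 have pq: "\<bar>p i * q j * e k l\<bar> <= 64 * Q" if "i < d + 4" "j < d + 4" "k < d + 4" "l < d + 4" for i j k l
 proof -
  have "\<bar>p i\<bar> * \<bar>q j\<bar> * \<bar>e k l\<bar> <= 8 * Q * 8"
   using p q e8 that Q by (intro mult_mono) auto
  then show ?thesis by (simp add: abs_mult)
 qed
 have ee: "\<bar>e i j * e k l\<bar> <= 64 * Q" if "i < d + 4" "j < d + 4" "k < d + 4" "l < d + 4" for i j k l
 proof -
  have "\<bar>e i j\<bar> * \<bar>e k l\<bar> <= 8 * 8" using e8 that by (intro mult_mono) auto
  then show ?thesis using Q by (simp add: abs_mult)
 qed
 have eq: "A $$ (i, k) * A $$ (j, l) - A $$ (i, l) * A $$ (j, k) =
   p i * q k * e j l + p j * q l * e i k + e i k * e j l - p i * q l * e j k - p j * q k * e i l - e i l * e j k"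
  unfolding A by (simp add: algebra_simps)
 show "\<bar>A $$ (i, k) * A $$ (j, l) - A $$ (i, l) * A $$ (j, k)\<bar> <= 384 * Q"
  unfolding eq
 proof (rule abs_leI, goal_cases)
  case 1
  show ?case using abs_le_D1[OF pq[of i k j l]] abs_le_D1[OF pq[of j l i k]] abs_le_D2[OF pq[of i l j k]]
    abs_le_D2[OF pq[of j k i l]] abs_le_D1[OF ee[of i k j l]] abs_le_D2[OF ee[of i l j k]] ijkl by linarith
 next
  case 2
  show ?case using abs_le_D2[OF pq[of i k j l]] abs_le_D2[OF pq[of j l i k]] abs_le_D1[OF pq[of i l j k]]
    abs_le_D1[OF pq[of j k i l]] abs_le_D2[OF ee[of i k j l]] abs_le_D1[OF ee[of i l j k]] ijkl by linarith
 qed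
qed

lemma nexp_N1_le:
 assumes d: "1 <= t"
  and b: "\<bar>p\<bar> <= C * t" "!!k. \<bar>fcoord x k\<bar> <= C * t" "!!k. \<bar>p * fcoord y k\<bar> <= C * t" "!!k. \<bar>fcoord y k\<bar> <= C * t"
   "\<bar>e - inner x y / 2 - p * inner y y / 6\<bar> <= C * t" "\<bar>- e - inner x y / 2 + p * inner y y / 6\<bar> <= C * t"
   "\<bar>- p * e - inner x x / 2 + p\<^sup>2 * inner y y / 24\<bar> <= C * t" "inner y y <= C * t" "1 <= C"
 shows "N1 d (nexp d (p, x, y, e)) <= real (d + 4) ^ 2 * (2 * C * t)"
proof (rule N1_le)
 fix i j assume i: "i < d + 4" and j: "j < d + 4"
 have Ct: "1 <= C * t" using b(9) d by (rule mult_ge1_I)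
 have a: "\<bar>fcoord x k + p / 2 * fcoord y k\<bar> <= 2 * C * t" "\<bar>p / 2 * fcoord y k - fcoord x k\<bar> <= 2 * C * t" for k
  using b(2)[of k] b(3)[of k] by (simp_all add: abs_le_iff)
 have yy: "\<bar>- inner y y / 2\<bar> <= 2 * C * t" using b(8) Ct inner_ge_zero[of y] by simp
 have CC: "C * t <= 2 * C * t" using Ct by simp
 have c: "\<bar>e - inner x y / 2 - p * inner y y / 6\<bar> <= 2 * C * t" "\<bar>- e - inner x y / 2 + p * inner y y / 6\<bar> <= 2 * C * t"
   "\<bar>- p * e - inner x x / 2 + p\<^sup>2 * inner y y / 24\<bar> <= 2 * C * t" "\<bar>p\<bar> <= 2 * C * t" "\<bar>- p\<bar> <= 2 * C * t"
   "\<bar>fcoord y k\<bar> <= 2 * C * t" "\<bar>- fcoord y k\<bar> <= 2 * C * t" for k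
  by (rule order_trans[OF _ CC], (simp only: abs_minus_cancel)?, rule b)+
 have z: "\<bar>0\<bar> <= 2 * C * t" "\<bar>1\<bar> <= 2 * C * t" "\<bar>if Q then 1 else 0\<bar> <= 2 * C * t" for Q using Ct by auto
 show "\<bar>nexp d (p, x, y, e) $$ (i, j)\<bar> <= 2 * C * t"
  by (cases rule: index_cases[OF i]; cases rule: index_cases[OF j]; simp only: nexp_index fcoord_simps; rule a yy c z)
qed

lemma corner_le_N1: "\<bar>- p * e - inner x x / 2 + p\<^sup>2 * inner y y / 24\<bar> <= N1 d (nexp d (p, x, y, e))"
 using entry_le_N1[of 0 d "d + 3" "nexp d (p, x, y, e)"] by (simp add: nexp_index)

text \<open>The minor of rows 0, 1 and columns d + 2, d + 3, which governs the growth of N2 when y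
  is involved; \<open>phi_minor_le_N2\<close> uses rows 0, d + 2 and columns 1, d + 3.\<close>

lemma corner_minor_le_N2:
 "\<bar>(e - inner x y / 2 - p * inner y y / 6) * (- e - inner x y / 2 + p * inner y y / 6)
  - (- p * e - inner x x / 2 + p\<^sup>2 * inner y y / 24) * (- inner y y / 2)\<bar> <= N2 d (nexp d (p, x, y, e))"
 using mnr_le_N2[of 0 d 1 "d + 2" "d + 3" "nexp d (p, x, y, e)"] by (simp add: nexp_index)

lemma phi_minor_le_N2: "p\<^sup>2 <= N2 d (nexp d (p, x, y, e))"
 using mnr_le_N2[of 0 d "d + 2" 1 "d + 3" "nexp d (p, x, y, e)"] by (simp add: nexp_index power2_eq_square)

lemma one_le_N2: "1 <= N2 d (nexp d (p, x, y, e))"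
 using mnr_le_N2[of 0 d 1 0 1 "nexp d (p, x, y, e)"] by (simp add: nexp_index)

section \<open>The standard planes\<close>

definition ty1 :: "real => nil set" where
 "ty1 \<epsilon> = sp (1, 0, \<epsilon> *\<^sub>R ax 0, 0) (0, 0, 0, 1)"

definition ty2 :: "real => nil set" where
 "ty2 \<epsilon> = sp (1, 0, \<epsilon> *\<^sub>R ax 1, 0) (0, ax 0, 0, 0)"

definition ty3 :: "real => nil set" where
 "ty3 \<epsilon> = sp (0, \<epsilon> *\<^sub>R ax 2, ax 1, 0) (0, ax 0, 0, 0)"

lemma ty1_iff: "(p, x, y, e) : ty1 \<epsilon> \<longleftrightarrow> x = 0 & y = (\<epsilon> * p) *\<^sub>R ax 0"
 unfolding ty1_def sp_def by (auto simp: mult.commute)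

lemma ty2_iff: "(p, x, y, e) : ty2 \<epsilon> \<longleftrightarrow> x = fcoord x 0 *\<^sub>R ax 0 & y = (\<epsilon> * p) *\<^sub>R ax 1 & e = 0"
proof
 assume "(p, x, y, e) : ty2 \<epsilon>"
 then obtain \<alpha> \<beta> where "p = \<alpha>" "x = \<beta> *\<^sub>R ax 0" "y = (\<alpha> * \<epsilon>) *\<^sub>R ax 1" "e = 0"
  unfolding ty2_def sp_def by auto
 then show "x = fcoord x 0 *\<^sub>R ax 0 & y = (\<epsilon> * p) *\<^sub>R ax 1 & e = 0" by (simp add: mult.commute)
next
 assume h: "x = fcoord x 0 *\<^sub>R ax 0 & y = (\<epsilon> * p) *\<^sub>R ax 1 & e = 0"
 have "(p, x, y, e) = p *\<^sub>R (1, 0, \<epsilon> *\<^sub>R ax 1, 0) + fcoord x 0 *\<^sub>R (0, ax 0, 0, 0)"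
  using h by (simp add: mult.commute)
 then show "(p, x, y, e) : ty2 \<epsilon>" unfolding ty2_def by (simp only: sp_I)
qed

lemma ty3_iff: "(p, x, y, e) : ty3 \<epsilon> \<longleftrightarrow>
  p = 0 & x = fcoord x 0 *\<^sub>R ax 0 + (\<epsilon> * fcoord y 1) *\<^sub>R ax 2 & y = fcoord y 1 *\<^sub>R ax 1 & e = 0"
proof
 assume "(p, x, y, e) : ty3 \<epsilon>"
 then obtain \<alpha> \<beta> where "p = 0" "x = (\<alpha> * \<epsilon>) *\<^sub>R ax 2 + \<beta> *\<^sub>R ax 0" "y = \<alpha> *\<^sub>R ax 1" "e = 0"
  unfolding ty3_def sp_def by auto
 then show "p = 0 & x = fcoord x 0 *\<^sub>R ax 0 + (\<epsilon> * fcoord y 1) *\<^sub>R ax 2 & y = fcoord y 1 *\<^sub>R ax 1 & e = 0"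
  by (simp add: mult.commute)
next
 assume h: "p = 0 & x = fcoord x 0 *\<^sub>R ax 0 + (\<epsilon> * fcoord y 1) *\<^sub>R ax 2 & y = fcoord y 1 *\<^sub>R ax 1 & e = 0"
 have "fcoord y 1 *\<^sub>R (0, \<epsilon> *\<^sub>R ax 2, ax 1, 0) + fcoord x 0 *\<^sub>R (0, ax 0, 0, 0)
   = (0, fcoord x 0 *\<^sub>R ax 0 + (\<epsilon> * fcoord y 1) *\<^sub>R ax 2, fcoord y 1 *\<^sub>R ax 1, 0)"
  by (simp add: mult.commute)
 also have "\<dots> = (p, x, y, e)"
 proof -
  have a: "p = 0" "e = 0" using h by blast+
  have b: "fcoord x 0 *\<^sub>R ax 0 + (\<epsilon> * fcoord y 1) *\<^sub>R ax 2 = x" "fcoord y 1 *\<^sub>R ax 1 = y"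
   using h by (blast intro: sym)+
  show ?thesis unfolding a b ..
 qed
 finally have "(p, x, y, e) = fcoord y 1 *\<^sub>R (0, \<epsilon> *\<^sub>R ax 2, ax 1, 0) + fcoord x 0 *\<^sub>R (0, ax 0, 0, 0)" by (rule sym)
 then show "(p, x, y, e) : ty3 \<epsilon>" unfolding ty3_def by (simp only: sp_I)
qed

lemma ty_Nd:
 "1 <= d ==> ty1 \<epsilon> \<subseteq> Nd d"
 "1 <= d ==> \<epsilon> = 0 | 2 <= d ==> ty2 \<epsilon> \<subseteq> Nd d"
 "2 <= d ==> \<epsilon> = 0 | 3 <= d ==> ty3 \<epsilon> \<subseteq> Nd d"
 unfolding ty1_def ty2_def ty3_def by (rule sp_Nd; auto)+

lemma ty_subspace: "subspace (ty1 \<epsilon>)" "subspace (ty2 \<epsilon>)" "subspace (ty3 \<epsilon>)"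
 unfolding ty1_def ty2_def ty3_def by (rule subspace_sp)+

lemma ty_nbr:
 "u : ty1 \<epsilon> ==> v : ty1 \<epsilon> ==> nbr u v = 0"
 "u : ty2 \<epsilon> ==> v : ty2 \<epsilon> ==> nbr u v = 0"
 "u : ty3 \<epsilon> ==> v : ty3 \<epsilon> ==> nbr u v = 0"
 unfolding ty1_def ty2_def ty3_def by (rule nbr_sp[rotated], assumption, assumption, simp add: zero_prod_def)+

lemma ty_closed: "closed (ty1 \<epsilon>)" "closed (ty2 \<epsilon>)" "closed (ty3 \<epsilon>)"
proof -
 have P: "continuous_on UNIV (%u :: nil. fst u)" and X: "continuous_on UNIV (%u :: nil. fst (snd u))"
  and Y: "continuous_on UNIV (%u :: nil. fst (snd (snd u)))" and E: "continuous_on UNIV (%u :: nil. snd (snd (snd u)))"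
  by (intro continuous_on_fst continuous_on_snd continuous_on_id)+
 note c = closed_Collect_eq continuous_on_scaleR continuous_on_mult continuous_on_add continuous_on_const
  continuous_on_fcoord P X Y E
 have "ty1 \<epsilon> = {u. fst (snd u) = 0} \<inter> {u. fst (snd (snd u)) = (\<epsilon> * fst u) *\<^sub>R ax 0}"
  by (rule Set.set_eqI, rename_tac u, case_tac u) (simp add: ty1_iff)
 then show "closed (ty1 \<epsilon>)" by (simp only:) (intro closed_Int c)
 have "ty2 \<epsilon> = {u. fst (snd u) = fcoord (fst (snd u)) 0 *\<^sub>R ax 0} \<inter> {u. fst (snd (snd u)) = (\<epsilon> * fst u) *\<^sub>R ax 1}
   \<inter> {u. snd (snd (snd u)) = 0}"
  by (rule Set.set_eqI, rename_tac u, case_tac u) (simp add: ty2_iff)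
 then show "closed (ty2 \<epsilon>)" by (simp only:) (intro closed_Int c)
 have "ty3 \<epsilon> = {u. fst u = 0} \<inter> {u. fst (snd u) = fcoord (fst (snd u)) 0 *\<^sub>R ax 0 + (\<epsilon> * fcoord (fst (snd (snd u))) 1) *\<^sub>R ax 2}
   \<inter> {u. fst (snd (snd u)) = fcoord (fst (snd (snd u))) 1 *\<^sub>R ax 1} \<inter> {u. snd (snd (snd u)) = 0}"
  by (rule Set.set_eqI, rename_tac u, case_tac u) (simp add: ty3_iff conj_assoc)
 then show "closed (ty3 \<epsilon>)" by (simp only:) (intro closed_Int c)
qed

lemma sqrt_bounds:
 assumes "1 <= t" shows "1 <= sqrt t" "sqrt t <= t" "8 * (1 + sqrt t)\<^sup>2 <= 32 * t" "sqrt t * sqrt t = t"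
proof -
 show a: "1 <= sqrt t" using assms by simp
 show b: "sqrt t * sqrt t = t" using assms by simp
 show c: "sqrt t <= t" using mult_left_mono[OF a, of "sqrt t"] a b by simp
 have "(1 + sqrt t)\<^sup>2 = 1 + 2 * sqrt t + t" using b by (simp add: power2_eq_square algebra_simps)
 then show "8 * (1 + sqrt t)\<^sup>2 <= 32 * t" using c assms by simp
qed

text \<open>One constant for all six planes: it exceeds every numerical factor below times the power
  of d + 4 in \<open>N1_le\<close> and \<open>N2_le\<close>.\<close>

definition KK :: "nat => real" where "KK d = 1000 * real (d + 4) ^ 4"

lemma KK_ge:
 "1000 * real (d + 4) ^ 4 <= KK d" "1000 * real (d + 4) ^ 2 <= KK d" "1000 <= KK d"
proof -
 have m: "1 <= real (d + 4)" by linarith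
 have "1 <= real (d + 4) ^ 2" "real (d + 4) ^ 2 <= real (d + 4) ^ 4"
  by (rule one_le_power[OF m], rule power_increasing[OF _ m]) simp
 then show "1000 * real (d + 4) ^ 4 <= KK d" "1000 * real (d + 4) ^ 2 <= KK d" "1000 <= KK d"
  unfolding KK_def by linarith+
qed

lemma KK_one: "1 <= KK d"
 using KK_ge(3)[of d] by linarith

lemma KK_lower: "t <= c * z ==> 0 <= z ==> c <= 1000 ==> t <= KK d * z"
 using mult_right_mono[of c "KK d" z] KK_ge(3)[of d] by linarith

lemma KK_upper:
 assumes "0 <= t" "c <= 1000"
 shows "z <= real (d + 4) ^ 2 * (c * t) ==> z <= KK d * t" "z <= real (d + 4) ^ 4 * (c * t) ==> z <= KK d * t"
proof -
 have a: "real (d + 4) ^ n * (c * t) <= KK d * t" if "1000 * real (d + 4) ^ n <= KK d" for n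
 proof -
  have "real (d + 4) ^ n * c <= real (d + 4) ^ n * 1000" by (rule mult_left_mono) (use assms in auto)
  then have "real (d + 4) ^ n * c * t <= KK d * t" using that assms(1) by (intro mult_right_mono) linarith+
  then show ?thesis by (simp only: mult.assoc)
 qed
 show "z <= real (d + 4) ^ 2 * (c * t) ==> z <= KK d * t" using a[OF KK_ge(2)] by linarith
 show "z <= real (d + 4) ^ 4 * (c * t) ==> z <= KK d * t" using a[OF KK_ge(1)] by linarith
qed

lemma plane_path_I:
 assumes "continuous_on {lo..hi} p" "p ` {lo..hi} \<subseteq> U" "e1 : {lo..hi}" "e2 : {lo..hi}"
  "!!\<sigma>. \<sigma> : {lo..hi::real} ==> t <= K * N1 d (nexp d (p \<sigma>)) & N1 d (nexp d (p \<sigma>)) <= K * t"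
  "N2 d (nexp d (p e1)) <= K * t" "t\<^sup>2 <= K * N2 d (nexp d (p e2))"
 shows "\<exists>p lo hi e1 e2. continuous_on {lo..hi} p & p ` {lo..hi} \<subseteq> U & e1 : {lo..hi} & e2 : {lo..hi} &
   (\<forall>\<sigma>\<in>{lo..hi::real}. t <= K * N1 d (nexp d (p \<sigma>)) & N1 d (nexp d (p \<sigma>)) <= K * t) &
   N2 d (nexp d (p e1)) <= K * t & t\<^sup>2 <= K * N2 d (nexp d (p e2))"
 using assms by blast

lemma cds_ty1_0:
 assumes d: "1 <= d" shows "cds d (nexp d ` ty1 0)"
proof (rule plane_cds[OF d ty_subspace(1) ty_Nd(1)[OF d] ty_closed(1) ty_nbr(1) KK_one])
 fix t :: real assume t: "1 <= t"
 note s = sqrt_bounds[OF t]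
 \<comment> \<open>The product of the outer coordinates is held at t, so the corner is -t. N2 has
   order t where they are equal and is at least t^2 where the first one is t.\<close>
 define p :: "real => nil" where "p \<sigma> = (\<sigma>, 0, 0, t / \<sigma>)" for \<sigma>
 have pos: "0 < \<sigma>" "1 <= \<sigma>" "\<sigma> <= t" if "\<sigma> : {sqrt t..t}" for \<sigma>
  using that s(1) unfolding atLeastAtMost_iff by linarith+
 have cont: "continuous_on {sqrt t..t} p" unfolding p_def
  by (intro continuous_on_Pair continuous_on_divide continuous_on_id continuous_on_const) (rule ballI, drule pos(1), simp)
 have mem: "p ` {sqrt t..t} \<subseteq> ty1 0" by (auto simp: p_def ty1_iff)
 have n1: "t <= KK d * N1 d (nexp d (p \<sigma>)) & N1 d (nexp d (p \<sigma>)) <= KK d * t" if "\<sigma> : {sqrt t..t}" for \<sigma>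
 proof
  note \<sigma> = pos[OF that]
  have ts: "t / \<sigma> <= t" "0 <= t / \<sigma>" using \<sigma> t by (simp_all add: divide_le_eq)
  have "t <= N1 d (nexp d (p \<sigma>))" using corner_le_N1[of \<sigma> "t / \<sigma>" 0 0 d] \<sigma> t by (simp add: p_def)
  then show "t <= KK d * N1 d (nexp d (p \<sigma>))" by (intro KK_lower[of _ 1]) simp_all
  have "N1 d (nexp d (p \<sigma>)) <= real (d + 4) ^ 2 * (2 * 1 * t)" unfolding p_def
   by (rule nexp_N1_le[OF t]) (use \<sigma> t ts in simp_all)
  then show "N1 d (nexp d (p \<sigma>)) <= KK d * t" by (rule KK_upper(1)[rotated 2]) (use t in auto)
 qed
 have "N2 d (nexp d (p (sqrt t))) <= real (d + 4) ^ 4 * (8 * (1 + sqrt t)\<^sup>2)" unfolding p_def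
  by (rule nexp_y0_N2) (use t in \<open>simp_all add: real_div_sqrt\<close>)
 also have "\<dots> <= real (d + 4) ^ 4 * (32 * t)" by (intro mult_left_mono s) simp
  finally have e1: "N2 d (nexp d (p (sqrt t))) <= KK d * t" by (rule KK_upper(2)[rotated 2]) (use t in auto)
 have e2: "t\<^sup>2 <= KK d * N2 d (nexp d (p t))"
  using phi_minor_le_N2[of t d 0 0 "t / t"] unfolding p_def by (intro KK_lower[of _ 1]) simp_all
 show "\<exists>p lo hi e1 e2. continuous_on {lo..hi} p & p ` {lo..hi} \<subseteq> ty1 0 & e1 : {lo..hi} & e2 : {lo..hi} &
   (\<forall>\<sigma>\<in>{lo..hi::real}. t <= KK d * N1 d (nexp d (p \<sigma>)) & N1 d (nexp d (p \<sigma>)) <= KK d * t) &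
   N2 d (nexp d (p e1)) <= KK d * t & t\<^sup>2 <= KK d * N2 d (nexp d (p e2))"
  by (rule plane_path_I[OF cont mem _ _ n1 e1 e2]) (use s in simp_all)
qed

lemma cds_ty2_0:
 assumes d: "1 <= d" shows "cds d (nexp d ` ty2 0)"
proof (rule plane_cds[OF d ty_subspace(2) ty_Nd(2)[OF d] ty_closed(2) ty_nbr(2) KK_one])
 fix t :: real assume t: "1 <= t"
 note s = sqrt_bounds[OF t]
 \<comment> \<open>An x of length sqrt t makes the corner -t / 2, whatever the first coordinate is;
   the latter alone drives N2 up to t^2.\<close>
 define p :: "real => nil" where "p \<sigma> = (\<sigma>, sqrt t *\<^sub>R ax 0, 0, 0)" for \<sigma>
 have cont: "continuous_on {0..t} p" unfolding p_def
  by (intro continuous_on_Pair continuous_on_id continuous_on_const)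
 have mem: "p ` {0..t} \<subseteq> ty2 0" by (auto simp: p_def ty2_iff)
 have n1: "t <= KK d * N1 d (nexp d (p \<sigma>)) & N1 d (nexp d (p \<sigma>)) <= KK d * t" if "\<sigma> : {0..t}" for \<sigma>
 proof
  have "t / 2 <= N1 d (nexp d (p \<sigma>))" using corner_le_N1[of \<sigma> 0 "sqrt t *\<^sub>R ax 0" 0 d] t by (simp add: p_def)
  then show "t <= KK d * N1 d (nexp d (p \<sigma>))" by (intro KK_lower[of _ 2]) simp_all
  have "N1 d (nexp d (p \<sigma>)) <= real (d + 4) ^ 2 * (2 * 1 * t)" unfolding p_def
   by (rule nexp_N1_le[OF t]) (use that t s in auto)
  then show "N1 d (nexp d (p \<sigma>)) <= KK d * t" by (rule KK_upper(1)[rotated 2]) (use t in auto)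
 qed
 have "N2 d (nexp d (p 0)) <= real (d + 4) ^ 4 * (8 * (1 + sqrt t)\<^sup>2)" unfolding p_def
  by (rule nexp_y0_N2) (use d t s in auto)
 also have "\<dots> <= real (d + 4) ^ 4 * (32 * t)" by (intro mult_left_mono s) simp
  finally have e1: "N2 d (nexp d (p 0)) <= KK d * t" by (rule KK_upper(2)[rotated 2]) (use t in auto)
 have e2: "t\<^sup>2 <= KK d * N2 d (nexp d (p t))"
  using phi_minor_le_N2[of t d "sqrt t *\<^sub>R ax 0" 0 0] unfolding p_def by (intro KK_lower[of _ 1]) simp_all
 show "\<exists>p lo hi e1 e2. continuous_on {lo..hi} p & p ` {lo..hi} \<subseteq> ty2 0 & e1 : {lo..hi} & e2 : {lo..hi} &
   (\<forall>\<sigma>\<in>{lo..hi::real}. t <= KK d * N1 d (nexp d (p \<sigma>)) & N1 d (nexp d (p \<sigma>)) <= KK d * t) &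
   N2 d (nexp d (p e1)) <= KK d * t & t\<^sup>2 <= KK d * N2 d (nexp d (p e2))"
  by (rule plane_path_I[OF cont mem _ _ n1 e1 e2]) (use t in simp_all)
qed simp

lemma cds_ty3:
 assumes d: "2 <= d" and \<epsilon>: "\<epsilon> = 0 | \<epsilon> = 1 & 3 <= d"
 shows "cds d (nexp d ` ty3 \<epsilon>)"
proof -
 have d1: "1 <= d" using d by simp
 have N: "ty3 \<epsilon> \<subseteq> Nd d" using \<epsilon> d by (intro ty_Nd) auto
 have ee: "\<epsilon> * \<epsilon> = \<epsilon>" "0 <= \<epsilon>" "\<epsilon> <= 1" using \<epsilon> by auto
 show ?thesis
 proof (rule plane_cds[OF d1 ty_subspace(3) N ty_closed(3) ty_nbr(3) KK_one])
  fix t :: real assume t: "1 <= t"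
  note s = sqrt_bounds[OF t]
  \<comment> \<open>An x of length at least sqrt t gives the corner size t. Since x and y are
    orthogonal, the corner minor is a quarter of the product of their squared lengths, of order t^2
    at the end of the path.\<close>
  define p :: "real => nil" where "p \<sigma> = (0, sqrt t *\<^sub>R ax 0 + (\<epsilon> * \<sigma>) *\<^sub>R ax 2, \<sigma> *\<^sub>R ax 1, 0)" for \<sigma>
  have cont: "continuous_on {0..sqrt t} p" unfolding p_def
   by (intro continuous_on_Pair continuous_on_add continuous_on_mult continuous_on_scaleR continuous_on_id continuous_on_const)
  have mem: "p ` {0..sqrt t} \<subseteq> ty3 \<epsilon>" by (auto simp: p_def ty3_iff)
  have ii: "inner (sqrt t *\<^sub>R ax 0 + (\<epsilon> * \<sigma>) *\<^sub>R ax 2) (sqrt t *\<^sub>R ax 0 + (\<epsilon> * \<sigma>) *\<^sub>R ax 2) = t + \<epsilon> * (\<sigma> * \<sigma>)"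
    "inner (sqrt t *\<^sub>R ax 0 + (\<epsilon> * \<sigma>) *\<^sub>R ax 2) (\<sigma> *\<^sub>R ax 1) = 0" "inner (\<sigma> *\<^sub>R ax 1) (\<sigma> *\<^sub>R ax 1) = \<sigma> * \<sigma>" for \<sigma>
  proof -
   have "inner (sqrt t *\<^sub>R ax 0 + (\<epsilon> * \<sigma>) *\<^sub>R ax 2) (sqrt t *\<^sub>R ax 0 + (\<epsilon> * \<sigma>) *\<^sub>R ax 2)
     = sqrt t * sqrt t + (\<epsilon> * \<epsilon>) * (\<sigma> * \<sigma>)" by (simp add: inner_lin_simps)
   then show "inner (sqrt t *\<^sub>R ax 0 + (\<epsilon> * \<sigma>) *\<^sub>R ax 2) (sqrt t *\<^sub>R ax 0 + (\<epsilon> * \<sigma>) *\<^sub>R ax 2) = t + \<epsilon> * (\<sigma> * \<sigma>)"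
    unfolding s(4) ee(1) .
  qed (simp_all add: inner_lin_simps)
  have n1: "t <= KK d * N1 d (nexp d (p \<sigma>)) & N1 d (nexp d (p \<sigma>)) <= KK d * t" if \<sigma>: "\<sigma> : {0..sqrt t}" for \<sigma>
  proof
   have ss: "0 <= \<sigma> * \<sigma>" "\<sigma> * \<sigma> <= t" "\<sigma> <= t" using \<sigma> s mult_mono[of \<sigma> "sqrt t" \<sigma> "sqrt t"] by auto
   have es: "0 <= \<epsilon> * (\<sigma> * \<sigma>)" "\<epsilon> * (\<sigma> * \<sigma>) <= t"
    using ee ss mult_mono[of \<epsilon> 1 "\<sigma> * \<sigma>" t] by auto
   have e1: "0 <= \<epsilon> * \<sigma>" "\<epsilon> * \<sigma> <= t" using ee \<sigma> ss mult_mono[of \<epsilon> 1 \<sigma> t] by auto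
   have "t / 2 <= N1 d (nexp d (p \<sigma>))"
    using corner_le_N1[of 0 0 "sqrt t *\<^sub>R ax 0 + (\<epsilon> * \<sigma>) *\<^sub>R ax 2" "\<sigma> *\<^sub>R ax 1" d] t es unfolding p_def ii by simp
   then show "t <= KK d * N1 d (nexp d (p \<sigma>))" by (intro KK_lower[of _ 2]) simp_all
   have "N1 d (nexp d (p \<sigma>)) <= real (d + 4) ^ 2 * (2 * 1 * t)" unfolding p_def
    by (rule nexp_N1_le[OF t], unfold ii) (use \<sigma> t s ss es e1 in auto)
   then show "N1 d (nexp d (p \<sigma>)) <= KK d * t" by (rule KK_upper(1)[rotated 2]) (use t in auto)
  qed
  have "N2 d (nexp d (p 0)) <= real (d + 4) ^ 4 * (8 * (1 + sqrt t)\<^sup>2)"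
   using nexp_y0_N2[of "sqrt t *\<^sub>R ax 0" d 0 "sqrt t" 0] d t s by (simp add: p_def)
  also have "\<dots> <= real (d + 4) ^ 4 * (32 * t)" by (intro mult_left_mono s) simp
  finally have e1: "N2 d (nexp d (p 0)) <= KK d * t" by (rule KK_upper(2)[rotated 2]) (use t in auto)
  have "(t + \<epsilon> * t) / 2 * (t / 2) <= N2 d (nexp d (p (sqrt t)))"
   using corner_minor_le_N2[of 0 "sqrt t *\<^sub>R ax 0 + (\<epsilon> * sqrt t) *\<^sub>R ax 2" "sqrt t *\<^sub>R ax 1" 0 d] t ee
   unfolding p_def ii s(4) by simp
  moreover have "t\<^sup>2 / 4 <= (t + \<epsilon> * t) / 2 * (t / 2)"
   using ee t by (simp add: power2_eq_square algebra_simps)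
  ultimately have e2: "t\<^sup>2 <= KK d * N2 d (nexp d (p (sqrt t)))"
   by (intro KK_lower[of _ 4]) simp_all
  show "\<exists>p lo hi e1 e2. continuous_on {lo..hi} p & p ` {lo..hi} \<subseteq> ty3 \<epsilon> & e1 : {lo..hi} & e2 : {lo..hi} &
    (\<forall>\<sigma>\<in>{lo..hi::real}. t <= KK d * N1 d (nexp d (p \<sigma>)) & N1 d (nexp d (p \<sigma>)) <= KK d * t) &
    N2 d (nexp d (p e1)) <= KK d * t & t\<^sup>2 <= KK d * N2 d (nexp d (p e2))"
   by (rule plane_path_I[OF cont mem _ _ n1 e1 e2]) (use s in simp_all)
 qed
qed

lemma cds_ty2_1:
 assumes d: "2 <= d" shows "cds d (nexp d ` ty2 1)"
proof -
 have d1: "1 <= d" using d by simp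
 have N: "ty2 1 \<subseteq> Nd d" using d by (intro ty_Nd) auto
 show ?thesis
 proof (rule plane_cds[OF d1 ty_subspace(2) N ty_closed(2) ty_nbr(2) KK_one])
  fix t :: real assume t: "1 <= t"
  note s = sqrt_bounds[OF t]
  define c where "c = root 3 t"
  have c: "1 <= c" "c ^ 3 = t" using t by (simp_all add: c_def)
  \<comment> \<open>The corner is -|x|^2 / 2 + \<sigma>^4 / 24, and this length of x keeps it at -t
    / 2. The range ends at the cube root of t because entries of size \<sigma>^3 must not outgrow t;
    there the corner minor has order t^2.\<close>
  define q where "q \<sigma> = sqrt (t + \<sigma> ^ 4 / 12)" for \<sigma>
  define p :: "real => nil" where "p \<sigma> = (\<sigma>, q \<sigma> *\<^sub>R ax 0, \<sigma> *\<^sub>R ax 1, 0)" for \<sigma>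
  have qq: "q \<sigma> * q \<sigma> = t + \<sigma> ^ 4 / 12" "0 <= q \<sigma>" for \<sigma> using t by (simp_all add: q_def)
  have cont: "continuous_on {0..c} p" unfolding p_def q_def
   by (intro continuous_on_Pair continuous_on_add continuous_on_divide continuous_on_power continuous_on_real_sqrt
     continuous_on_scaleR continuous_on_id continuous_on_const) auto
  have mem: "p ` {0..c} \<subseteq> ty2 1" by (auto simp: p_def ty2_iff)
  have ii: "inner (q \<sigma> *\<^sub>R ax 0) (q \<sigma> *\<^sub>R ax 0) = t + \<sigma> ^ 4 / 12"
    "inner (q \<sigma> *\<^sub>R ax 0) (\<sigma> *\<^sub>R ax 1) = 0" "inner (\<sigma> *\<^sub>R ax 1) (\<sigma> *\<^sub>R ax 1) = \<sigma> * \<sigma>" for \<sigma>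
   using qq by (simp_all add: inner_lin_simps)
  have n1: "t <= KK d * N1 d (nexp d (p \<sigma>)) & N1 d (nexp d (p \<sigma>)) <= KK d * t" if \<sigma>: "\<sigma> : {0..c}" for \<sigma>
  proof
   have s3: "\<sigma> ^ 3 <= t" using \<sigma> c(2) power_mono[of \<sigma> c 3] by simp
   have s2: "\<sigma> * \<sigma> <= t"
   proof (cases "\<sigma> <= 1")
    case True
    then have "\<sigma> * \<sigma> <= 1 * 1" using \<sigma> by (intro mult_mono) auto
    then show ?thesis using t by simp
   next
    case False
    then have "1 * (\<sigma> * \<sigma>) <= \<sigma> * (\<sigma> * \<sigma>)" by (intro mult_right_mono) auto
    then show ?thesis using s3 by (simp add: power3_eq_cube)
   qed
   have s1: "\<sigma> <= t"
   proof (cases "\<sigma> <= 1")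
    case False
    then have "\<sigma> * 1 <= \<sigma> * \<sigma>" by (intro mult_left_mono) auto
    then show ?thesis using s2 by simp
   qed (use t in simp)
   have s4: "\<sigma> ^ 4 <= t * t"
    using mult_mono[OF s2 s2] t by (simp add: power4_eq_xxxx mult.assoc)
   have "q \<sigma> * q \<sigma> <= (2 * t) * (2 * t)"
    using qq(1)[of \<sigma>] s4 t mult_left_mono[OF t, of t] by linarith
   then have q2: "q \<sigma> <= 2 * t" using t by (intro power2_le_imp_le[of "q \<sigma>"]) (simp_all add: power2_eq_square)
   have cr: "- \<sigma> * 0 - (t + \<sigma> ^ 4 / 12) / 2 + \<sigma>\<^sup>2 * (\<sigma> * \<sigma>) / 24 = - t / 2"
    by (simp add: power2_eq_square power4_eq_xxxx algebra_simps)
   have "t / 2 <= N1 d (nexp d (p \<sigma>))"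
    using corner_le_N1[of \<sigma> 0 "q \<sigma> *\<^sub>R ax 0" "\<sigma> *\<^sub>R ax 1" d] t unfolding p_def ii cr by simp
   then show "t <= KK d * N1 d (nexp d (p \<sigma>))" by (intro KK_lower[of _ 2]) simp_all
   have s30: "0 <= \<sigma> * (\<sigma> * \<sigma>)" "\<sigma> * (\<sigma> * \<sigma>) <= t" using \<sigma> s3 by (simp_all add: power3_eq_cube)
   have "N1 d (nexp d (p \<sigma>)) <= real (d + 4) ^ 2 * (2 * 2 * t)" unfolding p_def
    by (rule nexp_N1_le[OF t], unfold ii cr) (use \<sigma> t s1 s2 s30 q2 qq(2)[of \<sigma>] in auto)
   then show "N1 d (nexp d (p \<sigma>)) <= KK d * t" by (rule KK_upper(1)[rotated 2]) (use t in auto)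
  qed
  have "N2 d (nexp d (p 0)) <= real (d + 4) ^ 4 * (8 * (1 + sqrt t)\<^sup>2)"
   using nexp_y0_N2[of "sqrt t *\<^sub>R ax 0" d 0 "sqrt t" 0] d t s by (simp add: p_def q_def)
  also have "\<dots> <= real (d + 4) ^ 4 * (32 * t)" by (intro mult_left_mono s) simp
  finally have e1: "N2 d (nexp d (p 0)) <= KK d * t" by (rule KK_upper(2)[rotated 2]) (use t in auto)
  have "t\<^sup>2 / 36 <= N2 d (nexp d (p c))"
  proof -
   have ccc: "c * (c * c) = t" using c(2) by (simp add: power3_eq_cube)
   have cr: "- c * 0 - (t + c ^ 4 / 12) / 2 + c\<^sup>2 * (c * c) / 24 = - t / 2"
    by (simp add: power2_eq_square power4_eq_xxxx algebra_simps)
   have "\<bar>(0 - 0 / 2 - t / 6) * (- 0 - 0 / 2 + t / 6) - (- t / 2) * (- (c * c) / 2)\<bar> <= N2 d (nexp d (p c))"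
    using corner_minor_le_N2[of 0 "q c *\<^sub>R ax 0" "c *\<^sub>R ax 1" c d] unfolding p_def ii cr ccc by simp
   moreover have "0 <= t * (c * c)" using t by simp
   ultimately show ?thesis by (simp add: power2_eq_square)
  qed
  then have e2: "t\<^sup>2 <= KK d * N2 d (nexp d (p c))"
   by (intro KK_lower[of _ 36]) simp_all
  show "\<exists>p lo hi e1 e2. continuous_on {lo..hi} p & p ` {lo..hi} \<subseteq> ty2 1 & e1 : {lo..hi} & e2 : {lo..hi} &
    (\<forall>\<sigma>\<in>{lo..hi::real}. t <= KK d * N1 d (nexp d (p \<sigma>)) & N1 d (nexp d (p \<sigma>)) <= KK d * t) &
    N2 d (nexp d (p e1)) <= KK d * t & t\<^sup>2 <= KK d * N2 d (nexp d (p e2))"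
   by (rule plane_path_I[OF cont mem _ _ n1 e1 e2]) (use c in simp_all)
 qed
qed

text \<open>Here the wall N2 ~ N1 is reached at the far end. For x = 0 and y = \<sigma> times a unit
  vector the corner minor is exactly -(\<eta> + \<sigma>^3 / 12)^2, so \<eta> has to approach the
  double root -\<sigma>^3 / 12.\<close>

lemma cds_ty1_1:
 assumes d: "1 <= d" shows "cds d (nexp d ` ty1 1)"
proof (rule plane_cds[OF d ty_subspace(1) ty_Nd(1)[OF d] ty_closed(1) ty_nbr(1) KK_one])
 fix t :: real assume t: "1 <= t"
 define c where "c = root 4 t"
 have c: "1 <= c" "c ^ 4 = t" using t by (simp_all add: c_def)
 \<comment> \<open>\<open>\<delta>\<close> is the deviation from the double root, so the corner
   minor is -\<delta>^2. It falls from t - 1 at \<sigma> = 1 to 0 at the fourth root of t, while the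
   corner t - 7/8 \<sigma>^4 stays between t / 8 and t.\<close>
 define \<delta> where "\<delta> \<sigma> = (t - \<sigma> ^ 4) / \<sigma>" for \<sigma>
 define \<eta> where "\<eta> \<sigma> = - (\<sigma> ^ 3) / 12 - \<delta> \<sigma>" for \<sigma>
 define p :: "real => nil" where "p \<sigma> = (\<sigma>, 0, \<sigma> *\<^sub>R ax 0, \<eta> \<sigma>)" for \<sigma>
 have cont: "continuous_on {1..c} p" unfolding p_def \<eta>_def \<delta>_def
  by (intro continuous_on_Pair continuous_on_diff continuous_on_minus continuous_on_divide continuous_on_power
    continuous_on_scaleR continuous_on_id continuous_on_const) auto
 have mem: "p ` {1..c} \<subseteq> ty1 1" by (auto simp: p_def ty1_iff)
 have ii: "inner (\<sigma> *\<^sub>R ax 0) (\<sigma> *\<^sub>R ax 0) = \<sigma> * \<sigma>" "inner 0 (\<sigma> *\<^sub>R ax 0) = 0" "inner (0::fsv) 0 = 0" for \<sigma>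
  by simp_all
 have n1: "t <= KK d * N1 d (nexp d (p \<sigma>)) & N1 d (nexp d (p \<sigma>)) <= KK d * t" if \<sigma>: "\<sigma> : {1..c}" for \<sigma>
 proof
  have s4: "\<sigma> ^ 4 <= t" using \<sigma> c(2) power_mono[of \<sigma> c 4] by simp
  have s1: "\<sigma> <= t" "\<sigma> * \<sigma> <= t" "\<sigma> ^ 3 <= t" "0 <= \<sigma> ^ 3" "0 <= \<sigma> ^ 4"
   using s4 \<sigma> power_increasing[of 1 4 \<sigma>] power_increasing[of 2 4 \<sigma>] power_increasing[of 3 4 \<sigma>]
   by (auto simp: power2_eq_square)
  have \<delta>: "0 <= \<delta> \<sigma>" "\<delta> \<sigma> <= t" "\<sigma> * \<delta> \<sigma> = t - \<sigma> ^ 4"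
  proof -
   show "0 <= \<delta> \<sigma>" using s4 \<sigma> by (simp add: \<delta>_def)
   show "\<sigma> * \<delta> \<sigma> = t - \<sigma> ^ 4" using \<sigma> by (simp add: \<delta>_def)
   have "t - \<sigma> ^ 4 <= t * \<sigma>" using mult_left_mono[of 1 \<sigma> t] \<sigma> t s1(5) unfolding atLeastAtMost_iff by linarith
   then show "\<delta> \<sigma> <= t" using \<sigma> by (simp add: \<delta>_def divide_le_eq)
  qed
  have cr: "- \<sigma> * \<eta> \<sigma> - 0 / 2 + \<sigma>\<^sup>2 * (\<sigma> * \<sigma>) / 24 = t - 7 / 8 * \<sigma> ^ 4"
  proof -
   have "- \<sigma> * \<eta> \<sigma> = \<sigma> * \<sigma> ^ 3 / 12 + \<sigma> * \<delta> \<sigma>" by (simp add: \<eta>_def algebra_simps)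
   then show ?thesis unfolding \<delta>(3) by (simp add: power2_eq_square power3_eq_cube power4_eq_xxxx)
  qed
  have "t / 8 <= N1 d (nexp d (p \<sigma>))"
   using corner_le_N1[of \<sigma> "\<eta> \<sigma>" 0 "\<sigma> *\<^sub>R ax 0" d] s4 unfolding p_def ii cr by simp
  then show "t <= KK d * N1 d (nexp d (p \<sigma>))" by (intro KK_lower[of _ 8]) simp_all
  have k: "\<sigma> * (\<sigma> * \<sigma>) = \<sigma> ^ 3" by (simp add: power3_eq_cube)
  have z: "- (\<sigma> ^ 3 / 4) - \<delta> \<sigma> <= 2 * t" "- (\<sigma> ^ 3 / 4) <= 2 * t + \<delta> \<sigma>" "- (7 * \<sigma> ^ 4 / 8) <= t" "7 * \<sigma> ^ 4 / 8 - t <= 2 * t"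
   using t s1(4,5) s4 \<delta>(1) by linarith+
  have "N1 d (nexp d (p \<sigma>)) <= real (d + 4) ^ 2 * (2 * 2 * t)" unfolding p_def
   by (rule nexp_N1_le[OF t], unfold ii cr k) (use \<sigma> t s1 s4 \<delta>(1,2) z in \<open>auto simp: \<eta>_def abs_le_iff\<close>)
  then show "N1 d (nexp d (p \<sigma>)) <= KK d * t" by (rule KK_upper(1)[rotated 2]) (use t in auto)
 qed
 have "(t - 1)\<^sup>2 <= N2 d (nexp d (p 1))"
 proof -
  have e: "\<eta> 1 = - 1 / 12 - (t - 1)" by (simp add: \<eta>_def \<delta>_def)
  have "\<bar>(\<eta> 1 - 0 / 2 - 1 * (1 * 1) / 6) * (- \<eta> 1 - 0 / 2 + 1 * (1 * 1) / 6)
    - (- 1 * \<eta> 1 - 0 / 2 + 1\<^sup>2 * (1 * 1) / 24) * (- (1 * 1) / 2)\<bar> <= N2 d (nexp d (p 1))"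
   using corner_minor_le_N2[of "\<eta> 1" 0 "1 *\<^sub>R ax 0" 1 d] unfolding p_def ii by simp
  moreover have "(\<eta> 1 - 0 / 2 - 1 * (1 * 1) / 6) * (- \<eta> 1 - 0 / 2 + 1 * (1 * 1) / 6)
    - (- 1 * \<eta> 1 - 0 / 2 + 1\<^sup>2 * (1 * 1) / 24) * (- (1 * 1) / 2) = - ((t - 1)\<^sup>2)"
   unfolding e by (simp add: field_simps power2_eq_square)
  ultimately show ?thesis by simp
 qed
 moreover have "1 <= N2 d (nexp d (p 1))" unfolding p_def by (rule one_le_N2)
 moreover have "t\<^sup>2 <= 2 * (t - 1)\<^sup>2 + 2"
  using zero_le_power2[of "t - 2"] by (simp add: power2_eq_square algebra_simps)
 ultimately have "t\<^sup>2 <= 4 * N2 d (nexp d (p 1))" by linarith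
 then have e2: "t\<^sup>2 <= KK d * N2 d (nexp d (p 1))"
  by (intro KK_lower[of _ 4]) simp_all
 have e1: "N2 d (nexp d (p c)) <= KK d * t"
 proof -
  define s where "s = 1 / c"
  have cs: "c * s = 1" using c by (simp add: s_def)
  have s01: "0 <= s" "s <= 1" using c by (auto simp: s_def divide_le_eq)
  have sp: "0 <= s ^ n" "s ^ n <= 1" for n using s01 by (simp_all add: power_le_one)
  have \<eta>c: "\<eta> c = - (c ^ 3) / 12" using c by (simp add: \<eta>_def \<delta>_def)
  have pc: "p c = (c, 0, c *\<^sub>R ax 0, - (c ^ 3) / 12)" by (simp add: p_def \<eta>c)
  \<comment> \<open>At the double root the matrix is nearly of rank one: \<open>Q\<close> is its row
    0, and \<open>P\<close> its last column divided by the corner c^4 / 8. The exponents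
    \<open>pe\<close> record the powers of c and of s = 1 / c.\<close>
  define pa where "pa i = (if i = 0 then 1 else if i = 1 then 2 else if i = 2 then 4
    else if i = d + 2 then - 8 else if i = d + 3 then 8 else (0::real))" for i
  define pe where "pe i = (if i = d + 2 then 3 else if i = d + 3 then 4 else i)" for i
  define qa where "qa j = (if j = 0 then 1 else if j = 1 then 1 else if j = 2 then 1 / 2
    else if j = d + 2 then - 1 / 4 else if j = d + 3 then 1 / 8 else (0::real))" for j
  define P where "P i = pa i * s ^ pe i" for i
  define Q where "Q j = qa j * c ^ pe j" for j
  have d0: "d ~= 0" using d by simp
  have sc: "s ^ m * c ^ n = (if m <= n then c ^ (n - m) else s ^ (m - n))" for m n
  proof (cases "m <= n")
   case True
   then have "c ^ n = c ^ m * c ^ (n - m)" by (simp flip: power_add)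
   then show ?thesis using True cs by (simp add: mult.assoc[symmetric] power_mult_distrib[symmetric] mult.commute)
  next
   case False
   then have "s ^ m = s ^ (m - n) * s ^ n" by (simp flip: power_add)
   then show ?thesis using False cs by (simp add: mult.assoc power_mult_distrib[symmetric] mult.commute)
  qed
  have PQ: "P i * Q j = pa i * qa j * (if pe i <= pe j then c ^ (pe j - pe i) else s ^ (pe i - pe j))" for i j
   unfolding P_def Q_def sc[symmetric] by simp
  have fc: "fcoord (c *\<^sub>R ax 0) k = (if k = 0 then c else 0)" for k by simp
  have ic: "inner (c *\<^sub>R ax 0) (c *\<^sub>R ax 0) = c * c" by simp
  have sx: "0 <= s * s" "s * s <= 1" "0 <= s * (s * s)" "s * (s * s) <= 1" "0 <= s * (s * (s * s))" "s * (s * (s * s)) <= 1"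
   using sp[of 2] sp[of 3] sp[of 4] by (simp_all add: power2_eq_square power3_eq_cube power4_eq_xxxx mult.assoc)
  have "N2 d (nexp d (p c)) <= real (d + 4) ^ 4 * (384 * t)"
  proof (rule rank_one_approx_N2[where p = P and q = Q])
   show "1 <= t" by (rule t)
   have "\<bar>pa i\<bar> * s ^ pe i <= 8 * 1" for i by (rule mult_mono) (use sp in \<open>auto simp: pa_def\<close>)
   then show "\<bar>P i\<bar> <= 8" for i using sp[of "pe i"] by (simp add: P_def abs_mult)
   have "\<bar>qa j\<bar> * c ^ pe j <= 1 * t" if "j < d + 4" for j
   proof (cases "qa j = 0")
    case False
    then have "pe j <= 4" by (auto simp: qa_def pe_def split: if_splits)
    then have "c ^ pe j <= t" unfolding c(2)[symmetric] by (rule power_increasing) (rule c)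
    then show ?thesis by (intro mult_mono) (use c in \<open>auto simp: qa_def\<close>)
   qed (use t in simp)
   then show "\<bar>Q j\<bar> <= t" if "j < d + 4" for j using that c by (simp add: Q_def abs_mult)
   fix i j assume i: "i < d + 4" and j: "j < d + 4"
   have "\<bar>nexp d (p c) $$ (i, j) - P i * Q j\<bar> <= 8"
    unfolding pc PQ
    by (cases rule: index_cases[OF i]; cases rule: index_cases[OF j];
     simp only: nexp_index fcoord_simps fc ic;
     simp add: pa_def qa_def pe_def d0 power2_eq_square power3_eq_cube power4_eq_xxxx abs_le_iff algebra_simps;
     (use sx s01 in argo)?)
   then have "\<exists>e. e = nexp d (p c) $$ (i, j) - P i * Q j & \<bar>e\<bar> <= 8" by blast
   then show "\<exists>e. nexp d (p c) $$ (i, j) = P i * Q j + e & \<bar>e\<bar> <= 8" by (metis add_diff_cancel_left' diff_add_cancel add.commute)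
  qed
  then show ?thesis by (rule KK_upper(2)[rotated 2]) (use t in auto)
 qed
 show "\<exists>p lo hi e1 e2. continuous_on {lo..hi} p & p ` {lo..hi} \<subseteq> ty1 1 & e1 : {lo..hi} & e2 : {lo..hi} &
   (\<forall>\<sigma>\<in>{lo..hi::real}. t <= KK d * N1 d (nexp d (p \<sigma>)) & N1 d (nexp d (p \<sigma>)) <= KK d * t) &
   N2 d (nexp d (p e1)) <= KK d * t & t\<^sup>2 <= KK d * N2 d (nexp d (p e2))"
  by (rule plane_path_I[OF cont mem _ _ n1 e1 e2]) (use c in simp_all)
qed

section \<open>Conjugation\<close>

text \<open>Conjugation by any isometry, also of determinant -1; by \<open>cj_carrier\<close> and
  \<open>cds_cj\<close> it preserves the group and its Cartan-decomposition subgroups.\<close>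

definition cj :: "nat => real mat => real mat set => real mat set" where
 "cj d g S = (%A. g * A * finv d g) ` S"

lemma cj_mono: "S \<subseteq> T ==> cj d g S \<subseteq> cj d g T"
 unfolding cj_def by (rule image_mono)

lemma cj_elem_mult:
 assumes "g : O2 d" "h : O2 d" "A : Mat d"
 shows "g * (h * A * finv d h) * finv d g = (g * h) * A * finv d (g * h)"
 using mat_mult_4[OF O2_carrier[OF assms(1)] O2_carrier[OF assms(2)] assms(3) finv_carrier[of d h] finv_carrier[of d g]]
 by (simp only: finv_mult[OF O2_carrier[OF assms(1)] O2_carrier[OF assms(2)]])

lemma cj_cj:
 assumes "g : O2 d" "h : O2 d" "S \<subseteq> Mat d"
 shows "cj d g (cj d h S) = cj d (g * h) S"
 unfolding cj_def image_image
proof (rule image_cong[OF refl])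
 fix A assume "A : S"
 then show "g * (h * A * finv d h) * finv d g = g * h * A * finv d (g * h)"
  using assms(3) by (intro cj_elem_mult assms) blast
qed

lemma cj_one:
 assumes "S \<subseteq> Mat d" shows "cj d (1\<^sub>m (d + 4)) S = S"
proof -
 have "1\<^sub>m (d + 4) * A * finv d (1\<^sub>m (d + 4)) = A" if "A : S" for A
 proof -
  have A: "A : Mat d" using assms that by blast
  show ?thesis unfolding finv_one left_mult_one_mat[OF A] by (rule right_mult_one_mat[OF A])
 qed
 then show ?thesis unfolding cj_def by simp
qed

lemma cj_carrier_mat:
 assumes "g : O2 d" "S \<subseteq> Mat d"
 shows "cj d g S \<subseteq> Mat d"
 unfolding cj_def
proof (rule image_subsetI)
 fix A assume "A : S"
 then have A: "A : Mat d" using assms by blast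
 show "g * A * finv d g : Mat d"
  by (rule mult_carrier_mat[OF mult_carrier_mat[OF O2_carrier[OF assms(1)] A] finv_carrier])
qed

lemma cj_finv:
 assumes g: "g : O2 d" and S: "S \<subseteq> Mat d"
 shows "cj d (finv d g) (cj d g S) = S" "cj d g (cj d (finv d g) S) = S"
 by (simp_all add: cj_cj[OF _ _ S] g O2_finv O2_left O2_right cj_one[OF S])

lemma carrier_SO2_mat: "carrier (SO d) \<subseteq> Mat d"
 by (auto simp: carrier_SO2 O2_carrier)

lemma nexp_image_mat: "nexp d ` V \<subseteq> Mat d"
 by auto

lemma cj_elem_carrier:
 assumes g: "g : O2 d" and A: "A : carrier (SO d)"
 shows "g * A * finv d g : carrier (SO d)"
proof -
 have A': "A : O2 d" "det A = 1" using A by (auto simp: carrier_SO2)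
 have "det (g * A * finv d g) = det g * det A * det (finv d g)"
  using g A'(1) by (simp add: det_mult[where n = "d + 4"] O2_carrier mult_carrier_mat[where n = "d + 4"])
 then have "det (g * A * finv d g) = 1" using det_O2[OF g] A'(2) by (auto simp: det_finv[OF g])
 then show ?thesis using g A'(1) by (intro carrier_SO2_I O2_mult O2_finv)
qed

lemma cj_carrier: "g : O2 d ==> cj d g (carrier (SO d)) = carrier (SO d)"
proof (rule subset_antisym)
 assume g: "g : O2 d"
 have sub: "cj d h (carrier (SO d)) \<subseteq> carrier (SO d)" if "h : O2 d" for h
  unfolding cj_def using cj_elem_carrier[OF that] by blast
 show "cj d g (carrier (SO d)) \<subseteq> carrier (SO d)" by (rule sub[OF g])
 have "cj d g (cj d (finv d g) (carrier (SO d))) \<subseteq> cj d g (carrier (SO d))"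
  by (rule cj_mono[OF sub[OF O2_finv[OF g]]])
 then show "carrier (SO d) \<subseteq> cj d g (carrier (SO d))"
  unfolding cj_finv(2)[OF g carrier_SO2_mat] .
qed

lemma cj_elem_hom:
 assumes g: "g : O2 d" and A: "A : Mat d" and B: "B : Mat d"
 shows "(g * A * finv d g) * (g * B * finv d g) = g * (A * B) * finv d g"
proof -
 note gc = O2_carrier[OF g]
 have Bf: "B * finv d g : Mat d" by (rule mult_carrier_mat[OF B finv_carrier])
 have "(g * A * finv d g) * (g * B * finv d g) = g * A * (finv d g * (g * (B * finv d g)))"
  unfolding assoc_mult_mat[OF gc B finv_carrier]
  by (rule assoc_mult_mat[OF mult_carrier_mat[OF gc A] finv_carrier mult_carrier_mat[OF gc Bf]])
 also have "\<dots> = g * A * (B * finv d g)" using O2_cancel(1)[OF g, of "B * finv d g"] B by simp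
 also have "\<dots> = g * (A * B) * finv d g"
  unfolding assoc_mult_mat[OF gc A Bf] assoc_mult_mat[OF A B finv_carrier, symmetric]
  by (rule assoc_mult_mat[OF gc mult_carrier_mat[OF A B] finv_carrier, symmetric])
 finally show ?thesis .
qed

lemma continuous_map_cj:
 assumes g: "g : O2 d"
 shows "continuous_map (SO_top d) (SO_top d) (%A. g * A * finv d g)"
proof -
 have "continuous_map (SO_top d) (mat_topology (d + 4)) (%A. g * A * finv d g)"
 proof (rule continuous_map_into_mat_topology)
  show "g * A * finv d g : Mat d" if "A : topspace (SO_top d)" for A
   using cj_elem_carrier[OF g, of A] that carrier_SO2_mat by auto
  fix i j assume ij: "i < d + 4" "j < d + 4"
  have e: "(\<Sum>l<d + 4. (\<Sum>k<d + 4. g $$ (i, k) * A $$ (k, l)) * finv d g $$ (l, j)) = (g * A * finv d g) $$ (i, j)"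
   if "A : topspace (SO_top d)" for A
  proof -
   have Ac: "A : Mat d" using that carrier_SO2_mat by auto
   show ?thesis
    using index_mult_sum[OF mult_carrier_mat[OF O2_carrier[OF g] Ac] finv_carrier ij, of g]
    by (simp add: index_mult_sum[OF O2_carrier[OF g] Ac ij(1)])
  qed
  have "continuous_map (SO_top d) euclideanreal
    (%A. \<Sum>l<d + 4. (\<Sum>k<d + 4. g $$ (i, k) * A $$ (k, l)) * finv d g $$ (l, j))"
   by (intro continuous_map_sum continuous_map_real_mult continuous_map_SO2_entry continuous_map_const[THEN iffD2])
    (use ij in auto)
  then show "continuous_map (SO_top d) euclideanreal (%A. (g * A * finv d g) $$ (i, j))"
   by (rule continuous_map_eq) (rule e)
 qed
 then show ?thesis
  unfolding SO2_topology_eq[of d, symmetric] using cj_elem_carrier[OF g]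
  by (auto simp: SO2_topology_eq continuous_map_in_subtopology)
qed

lemma homeomorphic_map_cj:
 assumes g: "g : O2 d"
 shows "homeomorphic_map (SO_top d) (SO_top d) (%A. g * A * finv d g)"
proof -
 have inv: "h' * (h * A * finv d h) * finv d h' = A"
  if "h' * h = 1\<^sub>m (d + 4)" "h : O2 d" "h' : O2 d" "A : carrier (SO d)" for h h' A
  using cj_elem_mult[OF that(3,2), of A] that(1,4) carrier_SO2_mat[of d] by auto
 have "homeomorphic_maps (SO_top d) (SO_top d)
   (%A. g * A * finv d g) (%A. finv d g * A * finv d (finv d g))"
  unfolding homeomorphic_maps_def
  using continuous_map_cj[OF g] continuous_map_cj[OF O2_finv[OF g]]
   inv[OF O2_left[OF g] g O2_finv[OF g]] inv[OF O2_right[OF g] O2_finv[OF g] g] by simp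
 then show ?thesis using homeomorphic_map_maps by blast
qed

lemma cds_cj:
 assumes H: "cds d H" and g: "g : O2 d"
 shows "cds d (cj d g H)"
proof -
 let ?f = "%A. g * A * finv d g"
 note D = H[unfolded cartan_decomposition_subgroup_def]
 have sg: "subgroup H (SO d)" using D by blast
 note Hc = subgroup.subset[OF sg]
 obtain C where C: "compactin (SO_top d) C" "C <#>\<^bsub>SO d\<^esub> H <#>\<^bsub>SO d\<^esub> C = carrier (SO d)"
  using D by blast
 have Cc: "C \<subseteq> carrier (SO d)" using compactin_subset_topspace[OF C(1)] by simp
 have hom: "?f : hom (SO d) (SO d)"
 proof (rule homI)
  fix A B assume A: "A : carrier (SO d)" and B: "B : carrier (SO d)"
  show "?f A : carrier (SO d)" by (rule cj_elem_carrier[OF g A])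
  show "?f (A \<otimes>\<^bsub>SO d\<^esub> B) = ?f A \<otimes>\<^bsub>SO d\<^esub> ?f B"
   using cj_elem_hom[OF g, of A B] A B carrier_SO2_mat by (simp add: subset_iff)
 qed
 interpret group_hom "SO d" "SO d" ?f
  by (intro group_hom.intro group_hom_axioms.intro group_SO2 hom)
 have setm: "?f ` (X <#>\<^bsub>SO d\<^esub> Y) = ?f ` X <#>\<^bsub>SO d\<^esub> ?f ` Y"
  if "X \<subseteq> carrier (SO d)" "Y \<subseteq> carrier (SO d)" for X Y
 proof -
  have "?f (x * y) = ?f x * ?f y" if "x : X" "y : Y" for x y
   using cj_elem_hom[OF g, of x y] that \<open>X \<subseteq> _\<close> \<open>Y \<subseteq> _\<close> carrier_SO2_mat by (metis subsetD)
  then show ?thesis unfolding set_mult_def by (simp add: image_UN)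
 qed
 have CH: "C <#>\<^bsub>SO d\<^esub> H \<subseteq> carrier (SO d)"
  using monoid.set_mult_closed[OF group.is_monoid[OF group_SO2] Cc Hc] .
 have "?f ` C <#>\<^bsub>SO d\<^esub> ?f ` H <#>\<^bsub>SO d\<^esub> ?f ` C = carrier (SO d)"
  using cj_carrier[OF g] unfolding cj_def C(2)[symmetric] setm[OF CH Cc] setm[OF Cc Hc] .
 moreover have "subgroup (?f ` H) (SO d)" by (rule subgroup_img_is_subgroup[OF sg])
 moreover have "closedin (SO_top d) (?f ` H)"
  using D homeomorphic_map_closedness_eq[OF homeomorphic_map_cj[OF g]] by blast
 moreover have "connectedin (SO_top d) (?f ` H)"
  using D connectedin_continuous_map_image[OF continuous_map_cj[OF g]] by blast
 moreover have "compactin (SO_top d) (?f ` C)"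
  by (rule image_compactin[OF C(1) continuous_map_cj[OF g]])
 ultimately show ?thesis unfolding cartan_decomposition_subgroup_def cj_def by blast
qed

section \<open>Containing a conjugate of a standard plane\<close>

definition Std :: "nat => nil set set" where
 "Std d = {ty1 0, ty1 1, ty2 0} \<union> (if 2 <= d then {ty2 1, ty3 0} else {}) \<union> (if 3 <= d then {ty3 1} else {})"

definition good :: "nat => real mat set => bool" where
 "good d S \<longleftrightarrow> (\<exists>g\<in>O2 d. \<exists>T\<in>Std d. cj d g (nexp d ` T) \<subseteq> S)"

lemma good_mono: "good d S ==> S \<subseteq> S' ==> good d S'"
 unfolding good_def by blast

lemma good_Std: "T : Std d ==> nexp d ` T \<subseteq> S ==> good d S"
 unfolding good_def by (rule bexI[OF _ O2_one], rule bexI[of _ T]) (simp_all add: cj_one[OF nexp_image_mat])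

lemma good_cj:
 assumes "good d S" "g : O2 d" shows "good d (cj d g S)"
proof -
 obtain h T where h: "h : O2 d" "T : Std d" "cj d h (nexp d ` T) \<subseteq> S" using assms(1) unfolding good_def by blast
 have "cj d (g * h) (nexp d ` T) \<subseteq> cj d g S"
  using cj_mono[OF h(3), of d g] unfolding cj_cj[OF assms(2) h(1) nexp_image_mat] .
 then show ?thesis unfolding good_def using O2_mult[OF assms(2) h(1)] h(2) by blast
qed

lemma cj_nexp_image:
 assumes g: "g : O2 d" and e: "!!u. u : V ==> g * nexp d u = nexp d (f u) * g"
 shows "cj d g (nexp d ` V) = nexp d ` f ` V"
proof -
 have "g * nexp d u * finv d g = nexp d (f u)" if "u : V" for u
  unfolding e[OF that] by (rule O2_cancel(3)[OF g nexp_carrier])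
 then show ?thesis unfolding cj_def image_image by (intro image_cong) auto
qed

lemma good_step:
 assumes g: "g : O2 d" and e: "!!u. u : V ==> g * nexp d u = nexp d (f u) * g"
  and G: "good d (nexp d ` f ` V)"
 shows "good d (nexp d ` V)"
proof -
 have c: "cj d g (nexp d ` V) = nexp d ` f ` V" by (rule cj_nexp_image[OF g e])
 show ?thesis using good_cj[OF G O2_finv[OF g]] unfolding c[symmetric] cj_finv(1)[OF g nexp_image_mat] .
qed

lemma cds_step:
 assumes g: "g : O2 d" and e: "!!u. u : V ==> g * nexp d u = nexp d (f u) * g"
  and G: "cds d (nexp d ` V)"
 shows "cds d (nexp d ` f ` V)"
proof -
 have c: "cj d g (nexp d ` V) = nexp d ` f ` V" by (rule cj_nexp_image[OF g e])
 show ?thesis using cds_cj[OF G g] unfolding c .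
qed

text \<open>Simultaneous conjugacy of two vectors together with all their combinations. Keeping
  track of the vectors, and not only of the plane, lets coordinate changes be chained.\<close>

definition eqp :: "nat => nil => nil => nil => nil => bool" where
 "eqp d u v u' v' \<longleftrightarrow> (\<exists>g\<in>O2 d. \<forall>\<alpha> \<beta>. g * nexp d (\<alpha> *\<^sub>R u + \<beta> *\<^sub>R v) = nexp d (\<alpha> *\<^sub>R u' + \<beta> *\<^sub>R v') * g)"

lemma eqp_cj:
 assumes "eqp d u v u' v'" obtains g where "g : O2 d" "cj d g (nexp d ` sp u v) = nexp d ` sp u' v'"
proof -
 obtain g where g: "g : O2 d" "!!\<alpha> \<beta>. g * nexp d (\<alpha> *\<^sub>R u + \<beta> *\<^sub>R v) = nexp d (\<alpha> *\<^sub>R u' + \<beta> *\<^sub>R v') * g"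
  using assms unfolding eqp_def by blast
 have a: "g * nexp d (\<alpha> *\<^sub>R u + \<beta> *\<^sub>R v) * finv d g = nexp d (\<alpha> *\<^sub>R u' + \<beta> *\<^sub>R v')" for \<alpha> \<beta>
  unfolding g(2) by (rule O2_cancel(3)[OF g(1) nexp_carrier])
 have i: "nexp d ` sp a b = (%(\<alpha>, \<beta>). nexp d (\<alpha> *\<^sub>R a + \<beta> *\<^sub>R b)) ` UNIV" for a b
 proof -
  have "sp a b = (%(\<alpha>, \<beta>). \<alpha> *\<^sub>R a + \<beta> *\<^sub>R b) ` UNIV"
   by (rule Set.set_eqI) (simp add: sp_def image_def)
  then show ?thesis by (simp add: image_image split_beta)
 qed
 have "cj d g (nexp d ` sp u v) = nexp d ` sp u' v'"
  unfolding cj_def i image_image by (rule image_cong[OF refl]) (simp add: a split_beta)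
 then show ?thesis using that g(1) by blast
qed

lemma good_eqp:
 assumes "eqp d u v u' v'" "good d (nexp d ` sp u' v')" shows "good d (nexp d ` sp u v)"
proof -
 obtain g where g: "g : O2 d" "cj d g (nexp d ` sp u v) = nexp d ` sp u' v'" using eqp_cj[OF assms(1)] by blast
 show ?thesis using good_cj[OF assms(2) O2_finv[OF g(1)]] unfolding g(2)[symmetric] cj_finv(1)[OF g(1) nexp_image_mat] .
qed

lemma eqp_trans:
 assumes "eqp d u v u' v'" "eqp d u' v' u'' v''" shows "eqp d u v u'' v''"
proof -
 obtain g where g: "g : O2 d" "!!\<alpha> \<beta>. g * nexp d (\<alpha> *\<^sub>R u + \<beta> *\<^sub>R v) = nexp d (\<alpha> *\<^sub>R u' + \<beta> *\<^sub>R v') * g"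
  using assms(1) unfolding eqp_def by blast
 obtain h where h: "h : O2 d" "!!\<alpha> \<beta>. h * nexp d (\<alpha> *\<^sub>R u' + \<beta> *\<^sub>R v') = nexp d (\<alpha> *\<^sub>R u'' + \<beta> *\<^sub>R v'') * h"
  using assms(2) unfolding eqp_def by blast
 note as = assoc_mult_mat[where n\<^sub>1 = "d + 4" and n\<^sub>2 = "d + 4" and n\<^sub>3 = "d + 4" and n\<^sub>4 = "d + 4"]
 note c = O2_carrier[OF g(1)] O2_carrier[OF h(1)]
 have "(h * g) * nexp d (\<alpha> *\<^sub>R u + \<beta> *\<^sub>R v) = nexp d (\<alpha> *\<^sub>R u'' + \<beta> *\<^sub>R v'') * (h * g)" for \<alpha> \<beta>
 proof -
  have "(h * g) * nexp d (\<alpha> *\<^sub>R u + \<beta> *\<^sub>R v) = h * (nexp d (\<alpha> *\<^sub>R u' + \<beta> *\<^sub>R v') * g)"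
   unfolding g(2)[symmetric] by (rule as[OF c(2) c(1) nexp_carrier])
  also have "\<dots> = (h * nexp d (\<alpha> *\<^sub>R u' + \<beta> *\<^sub>R v')) * g" by (rule as[OF c(2) nexp_carrier c(1), symmetric])
  also have "\<dots> = nexp d (\<alpha> *\<^sub>R u'' + \<beta> *\<^sub>R v'') * (h * g)" unfolding h(2) by (rule as[OF nexp_carrier c(2) c(1)])
  finally show ?thesis .
 qed
 then show ?thesis unfolding eqp_def using O2_mult[OF h(1) g(1)] by blast
qed

section \<open>Conjugation by unipotent, Levi and Weyl elements and by reflections\<close>

definition Ad :: "nil => nil => nil" where
 "Ad w u = u + nbr w u + (1/2) *\<^sub>R nbr w (nbr w u)"

lemma Ad_Nd: "w : Nd d ==> u : Nd d ==> Ad w u : Nd d"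
 unfolding Ad_def nmul_conj[symmetric] by (intro nmul_Nd) simp_all

lemma nexp_Ad:
 assumes w: "w : Nd d" and u: "u : Nd d"
 shows "nexp d w * nexp d u = nexp d (Ad w u) * nexp d w"
proof -
 have "nexp d w * nexp d u = nexp d (nmul w u)" by (rule nexp_mult[OF w u])
 also have "nmul w u = nmul (nmul (nmul w u) (- w)) w" unfolding nmul_assoc by simp
 also have "nexp d \<dots> = nexp d (Ad w u) * nexp d w"
  unfolding Ad_def nmul_conj[symmetric] using w u by (intro nexp_mult[symmetric] nmul_Nd) simp_all
 finally show ?thesis .
qed

lemma Ad_linear: "Ad w (\<alpha> *\<^sub>R u + \<beta> *\<^sub>R v) = \<alpha> *\<^sub>R Ad w u + \<beta> *\<^sub>R Ad w v"
 unfolding Ad_def nbr_add_right nbr_scaleR_right by (simp add: algebra_simps)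

lemma eqp_Ad:
 assumes w: "w : Nd d" and u: "u : Nd d" and v: "v : Nd d"
 shows "eqp d u v (Ad w u) (Ad w v)"
 unfolding eqp_def
proof (intro bexI[of _ "nexp d w"] allI nexp_O2 w)
 fix \<alpha> \<beta> :: real
 have "\<alpha> *\<^sub>R u + \<beta> *\<^sub>R v : Nd d" using u v by (intro subspace_add subspace_scale subspace_Nd)
 then show "nexp d w * nexp d (\<alpha> *\<^sub>R u + \<beta> *\<^sub>R v) = nexp d (\<alpha> *\<^sub>R Ad w u + \<beta> *\<^sub>R Ad w v) * nexp d w"
  using nexp_Ad[OF w] Ad_linear by metis
qed

lemma Ad_simps:
 "Ad (0, \<xi>, \<upsilon>, 0) (p, x, y, e) = (p, x - p *\<^sub>R \<upsilon>, y, e + inner x \<upsilon> - inner \<xi> y - p * inner \<upsilon> \<upsilon> / 2)"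
 by (simp add: Ad_def algebra_simps inner_lin_simps)

text \<open>The GL(2) part of the Levi factor: the block on indices 0, 1 is arbitrary, the block on
  d + 2, d + 3 is then forced by the form.\<close>

definition glm :: "nat => real => real => real => real => real mat" where
 "glm d a b c k = (let D = a * k - b * c in mat (d + 4) (d + 4) (%(i, j).
   if i = 0 then (if j = 0 then a else if j = 1 then b else 0)
   else if i = 1 then (if j = 0 then c else if j = 1 then k else 0)
   else if i = d + 2 then (if j = d + 2 then a / D else if j = d + 3 then - b / D else 0)
   else if i = d + 3 then (if j = d + 2 then - c / D else if j = d + 3 then k / D else 0)
   else if i = j then 1 else 0))"

lemma glm_carrier [simp]: "glm d a b c k : Mat d"
 by (simp add: glm_def Let_def)

lemma sum_delta_lessThan:
 fixes f :: "nat => real"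
 assumes "l < d"
 shows "(\<Sum>k<d. (if l = k then 1 else 0) * f k) = f l" "(\<Sum>k<d. (if k = l then 1 else 0) * f k) = f l"
  "(\<Sum>k<d. f k * (if l = k then 1 else 0)) = f l" "(\<Sum>k<d. f k * (if k = l then 1 else 0)) = f l"
 by (subst sum_single[OF assms]; auto)+

lemma glm_mult_left:
 assumes B: "B : Mat d" and j: "j < d + 4"
 shows "(glm d a b c k * B) $$ (0, j) = a * B $$ (0, j) + b * B $$ (1, j)"
  "(glm d a b c k * B) $$ (1, j) = c * B $$ (0, j) + k * B $$ (1, j)"
  "l < d ==> (glm d a b c k * B) $$ (l + 2, j) = B $$ (l + 2, j)"
  "(glm d a b c k * B) $$ (d + 2, j) = (a * B $$ (d + 2, j) - b * B $$ (d + 3, j)) / (a * k - b * c)"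
  "(glm d a b c k * B) $$ (d + 3, j) = (k * B $$ (d + 3, j) - c * B $$ (d + 2, j)) / (a * k - b * c)"
proof -
 show "(glm d a b c k * B) $$ (l + 2, j) = B $$ (l + 2, j)" if "l < d" for l
 proof -
  have l: "l + 2 < d + 4" using that by simp
  have "(\<Sum>q<d. glm d a b c k $$ (l + 2, q + 2) * B $$ (q + 2, j)) = (\<Sum>q<d. (if l = q then 1 else 0) * B $$ (q + 2, j))"
   by (rule sum.cong[OF refl]) (use that in \<open>simp add: glm_def Let_def\<close>)
  then show ?thesis unfolding index_mult_sum[OF glm_carrier B l j] sum_split
   using that by (simp add: glm_def Let_def sum_delta_lessThan(1)[of l d "%q. B $$ (q + 2, j)"])
 qed
qed (subst index_mult_sum[OF glm_carrier B _ j], simp, simp add: sum_split glm_def Let_def add_divide_distrib diff_divide_distrib)+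

lemma glm_mult_right:
 assumes B: "B : Mat d" and j: "j < d + 4"
 shows "(B * glm d a b c k) $$ (j, 0) = a * B $$ (j, 0) + c * B $$ (j, 1)"
  "(B * glm d a b c k) $$ (j, 1) = b * B $$ (j, 0) + k * B $$ (j, 1)"
  "l < d ==> (B * glm d a b c k) $$ (j, l + 2) = B $$ (j, l + 2)"
  "(B * glm d a b c k) $$ (j, d + 2) = (a * B $$ (j, d + 2) - c * B $$ (j, d + 3)) / (a * k - b * c)"
  "(B * glm d a b c k) $$ (j, d + 3) = (k * B $$ (j, d + 3) - b * B $$ (j, d + 2)) / (a * k - b * c)"
proof -
 show "(B * glm d a b c k) $$ (j, l + 2) = B $$ (j, l + 2)" if "l < d" for l
 proof -
  have l: "l + 2 < d + 4" using that by simp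
  have "(\<Sum>q<d. B $$ (j, q + 2) * glm d a b c k $$ (q + 2, l + 2)) = (\<Sum>q<d. B $$ (j, q + 2) * (if q = l then 1 else 0))"
   by (rule sum.cong[OF refl]) (use that in \<open>simp add: glm_def Let_def\<close>)
  then show ?thesis unfolding index_mult_sum[OF B glm_carrier j l] sum_split
   using that by (simp add: glm_def Let_def sum_delta_lessThan(4)[of l d "%q. B $$ (j, q + 2)"])
 qed
qed (subst index_mult_sum[OF B glm_carrier j], simp, simp add: sum_split glm_def Let_def add_divide_distrib diff_divide_distrib algebra_simps)+

lemma glm_O2:
 assumes D: "a * k - b * c ~= 0" shows "glm d a b c k : O2 d"
proof -
 obtain D where DD: "a * k - b * c = D" by blast
 have "finv d (glm d a b c k) * glm d a b c k = 1\<^sub>m (d + 4)"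
 proof (rule eq_matI)
  fix i j assume "i < dim_row (1\<^sub>m (d + 4) :: real mat)" "j < dim_col (1\<^sub>m (d + 4) :: real mat)"
  then have i: "i < d + 4" and j: "j < d + 4" by simp_all
  show "(finv d (glm d a b c k) * glm d a b c k) $$ (i, j) = 1\<^sub>m (d + 4) $$ (i, j)"
   by (cases rule: index_cases[OF i]; cases rule: index_cases[OF j])
    (simp_all add: glm_mult_right[OF finv_carrier] del: index_mult_mat(1), use D in \<open>simp_all add: glm_def Let_def DD\<close>, use D DD in \<open>simp_all add: field_simps\<close>)
 qed (auto simp: glm_def Let_def)
 then show ?thesis unfolding O2_def by simp
qed

lemma nexp_glm:
 assumes D: "a * k - b * c ~= 0" and p: "p = 0 | b = 0 & c = 0"
 shows "glm d a b c k * nexp d (p, x, y, e)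
  = nexp d (a * p / k, a *\<^sub>R x + b *\<^sub>R y, c *\<^sub>R x + k *\<^sub>R y, (a * k - b * c) * e) * glm d a b c k"
  (is "?L = nexp d ?u * _")
proof (rule eq_matI)
 let ?D = "a * k - b * c"
 fix i j assume "i < dim_row (nexp d ?u * glm d a b c k)" "j < dim_col (nexp d ?u * glm d a b c k)"
 then have i: "i < d + 4" and j: "j < d + 4" by (simp_all add: glm_def Let_def)
 have ic: "inner y x = inner x y" by (rule inner_commute)
 show "?L $$ (i, j) = (nexp d ?u * glm d a b c k) $$ (i, j)"
 proof (cases "p = 0")
  case True
  show ?thesis unfolding True
   by (cases rule: index_cases[OF i]; cases rule: index_cases[OF j];
    simp add: glm_mult_left[OF nexp_carrier] glm_mult_right[OF nexp_carrier] nexp_index inner_lin_simps ic; use D in \<open>simp add: field_simps\<close>)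
 next
  case False
  then have bc: "b = 0" "c = 0" using p by auto
  have ak: "a ~= 0" "k ~= 0" using D bc by auto
  show ?thesis unfolding bc
   by (cases rule: index_cases[OF i]; cases rule: index_cases[OF j];
    simp add: glm_mult_left[OF nexp_carrier] glm_mult_right[OF nexp_carrier] nexp_index inner_lin_simps ic power2_eq_square; use ak in \<open>simp add: field_simps\<close>)
 qed
qed (auto simp: glm_def Let_def)

lemma eqp_glm:
 assumes D: "a * k - b * c ~= 0" and p: "p = 0 & p' = 0 | b = 0 & c = 0"
 shows "eqp d (p, x, y, e) (p', x', y', e')
  (a * p / k, a *\<^sub>R x + b *\<^sub>R y, c *\<^sub>R x + k *\<^sub>R y, (a * k - b * c) * e)
  (a * p' / k, a *\<^sub>R x' + b *\<^sub>R y', c *\<^sub>R x' + k *\<^sub>R y', (a * k - b * c) * e')"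
 unfolding eqp_def
proof (intro bexI[of _ "glm d a b c k"] allI glm_O2 D)
 fix \<alpha> \<beta> :: real
 have q: "\<alpha> * p + \<beta> * p' = 0 | b = 0 & c = 0" using p by auto
 show "glm d a b c k * nexp d (\<alpha> *\<^sub>R (p, x, y, e) + \<beta> *\<^sub>R (p', x', y', e')) =
   nexp d (\<alpha> *\<^sub>R (a * p / k, a *\<^sub>R x + b *\<^sub>R y, c *\<^sub>R x + k *\<^sub>R y, (a * k - b * c) * e)
    + \<beta> *\<^sub>R (a * p' / k, a *\<^sub>R x' + b *\<^sub>R y', c *\<^sub>R x' + k *\<^sub>R y', (a * k - b * c) * e')) * glm d a b c k"
  using nexp_glm[OF D q, of d "\<alpha> *\<^sub>R x + \<beta> *\<^sub>R x'" "\<alpha> *\<^sub>R y + \<beta> *\<^sub>R y'" "\<alpha> * e + \<beta> * e'"]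
  by (simp add: algebra_simps add_divide_distrib)
qed

text \<open>The swap does not preserve N, but it preserves the elements with y = 0, on which the
  corner is the quadratic form -(2 p e + |x|^2) / 2, symmetric in p and e.\<close>

lemma nexp_sw12: "pm d (sw12 d) * nexp d (p, x, 0, e) = nexp d (e, x, 0, p) * pm d (sw12 d)"
proof -
 have g: "good_perm d (sw12 d)" by simp
 have r: "(B * pm d (sw12 d)) $$ (i, j) = B $$ (i, sw12 d j)"
  if "B : Mat d" "i < d + 4" "j < d + 4" for B i j
  unfolding index_mult_sum[OF that(1) pm_carrier that(2,3)]
 proof (subst sum_single[of "sw12 d j"])
  have "sw12 d j < d + 4 & sw12 d (sw12 d j) = j" using g that(3) unfolding good_perm_def by blast
  then show "sw12 d j < d + 4" "B $$ (i, sw12 d j) * pm d (sw12 d) $$ (sw12 d j, j) = B $$ (i, sw12 d j)"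
   using that by (auto simp: pm_def)
  fix k assume k: "k < d + 4" "k ~= sw12 d j"
  have "sw12 d (sw12 d k) = k" using g k(1) unfolding good_perm_def by blast
  then show "B $$ (i, k) * pm d (sw12 d) $$ (k, j) = 0" using k that by (auto simp: pm_def)
 qed
 show ?thesis
 proof (rule eq_matI)
  fix i j assume "i < dim_row (nexp d (e, x, 0, p) * pm d (sw12 d))" "j < dim_col (nexp d (e, x, 0, p) * pm d (sw12 d))"
  then have i: "i < d + 4" and j: "j < d + 4" by (simp_all add: pm_def)
  show "(pm d (sw12 d) * nexp d (p, x, 0, e)) $$ (i, j) = (nexp d (e, x, 0, p) * pm d (sw12 d)) $$ (i, j)"
   unfolding pm_mult_left[OF g nexp_carrier i j] r[OF nexp_carrier i j]
   by (cases rule: index_cases[OF i]; cases rule: index_cases[OF j]; simp add: sw12_def nexp_index)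
 qed (auto simp: pm_def)
qed

lemma eqp_sw12: "eqp d (p, x, 0, e) (p', x', 0, e') (e, x, 0, p) (e', x', 0, p')"
 unfolding eqp_def by (intro bexI[of _ "pm d (sw12 d)"] allI pm_O2) (simp_all add: nexp_sw12)

text \<open>The reflection in the hyperplane orthogonal to w. For w = 0 the quotient is 0 and the
  map is the identity, which covers the degenerate case of \<open>rfl_swap\<close>.\<close>

definition rfl :: "fsv => fsv => fsv" where
 "rfl w x = x - (2 * inner w x / inner w w) *\<^sub>R w"

lemma rfl_Rd [simp]: "w : Rd d ==> x : Rd d ==> rfl w x : Rd d"
 unfolding rfl_def by simp

lemma rfl_linear: "rfl w (\<alpha> *\<^sub>R x + \<beta> *\<^sub>R y) = \<alpha> *\<^sub>R rfl w x + \<beta> *\<^sub>R rfl w y"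
 by (simp add: rfl_def inner_lin_simps algebra_simps add_divide_distrib)

lemma rfl_scaleR: "rfl w (\<alpha> *\<^sub>R x) = \<alpha> *\<^sub>R rfl w x"
 using rfl_linear[of w \<alpha> x 0 0] by (simp add: rfl_def)

lemma rfl_inner: "inner (rfl w x) (rfl w y) = inner x y"
proof (cases "w = 0")
 case False
 then have "inner w w ~= 0" by simp
 then show ?thesis unfolding rfl_def inner_lin_simps
  by (simp add: inner_commute[of x w] field_simps)
qed (simp add: rfl_def)

lemma rfl_orth: "inner w x = 0 ==> rfl w x = x"
 by (simp add: rfl_def)

lemma rfl_zero [simp]: "rfl w 0 = 0"
 by (simp add: rfl_def)

lemma rfl_swap:
 assumes "inner a a = inner b b" shows "rfl (a - b) a = b"
proof (cases "a = b")
 case False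
 have "inner (a - b) (a - b) = 2 * inner (a - b) a"
  using assms by (simp add: inner_lin_simps inner_commute)
 moreover have "inner (a - b) (a - b) ~= 0" using False by simp
 ultimately show ?thesis by (simp add: rfl_def)
qed (simp add: rfl_def)

definition rflm :: "nat => fsv => real mat" where
 "rflm d w = mat (d + 4) (d + 4) (%(i, j). (if i = j then 1 else 0)
   - (if i : {2..<d + 2} & j : {2..<d + 2} then 2 * fcoord w (i - 2) * fcoord w (j - 2) / inner w w else 0))"

lemma rflm_carrier [simp]: "rflm d w : Mat d"
 by (simp add: rflm_def)

lemma rflm_mult_left:
 assumes B: "B : Mat d" and j: "j < d + 4"
 shows "i : {0, 1, d + 2, d + 3} ==> (rflm d w * B) $$ (i, j) = B $$ (i, j)"
  "l < d ==> (rflm d w * B) $$ (l + 2, j) =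
    B $$ (l + 2, j) - 2 * fcoord w l / inner w w * (\<Sum>k<d. fcoord w k * B $$ (k + 2, j))"
proof -
 show "(rflm d w * B) $$ (i, j) = B $$ (i, j)" if "i : {0, 1, d + 2, d + 3}"
 proof -
  have "i < d + 4" using that by auto
  then show ?thesis unfolding index_mult_sum[OF rflm_carrier B \<open>i < d + 4\<close> j]
   by (subst sum_single[of i]) (use that in \<open>auto simp: rflm_def\<close>)
 qed
 show "(rflm d w * B) $$ (l + 2, j) =
    B $$ (l + 2, j) - 2 * fcoord w l / inner w w * (\<Sum>k<d. fcoord w k * B $$ (k + 2, j))" if "l < d"
 proof -
  have l: "l + 2 < d + 4" using that by simp
  have "(\<Sum>q<d. rflm d w $$ (l + 2, q + 2) * B $$ (q + 2, j))
   = (\<Sum>q<d. (if l = q then 1 else 0) * B $$ (q + 2, j) - 2 * fcoord w l / inner w w * (fcoord w q * B $$ (q + 2, j)))"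
   by (rule sum.cong[OF refl]) (use that in \<open>simp add: rflm_def algebra_simps\<close>)
  also have "\<dots> = B $$ (l + 2, j) - 2 * fcoord w l / inner w w * (\<Sum>k<d. fcoord w k * B $$ (k + 2, j))"
   unfolding sum_subtractf sum_distrib_left[symmetric] using sum_delta_lessThan(1)[OF that, of "%q. B $$ (q + 2, j)"] by simp
  finally show ?thesis unfolding index_mult_sum[OF rflm_carrier B l j] sum_split
   using that by (simp add: rflm_def)
 qed
qed

lemma rflm_transpose: "transpose_mat (rflm d w) = rflm d w"
 by (rule eq_matI) (auto simp: rflm_def)

lemma rflm_mult_right:
 assumes B: "B : Mat d" and j: "j < d + 4" and i: "i < d + 4"
 shows "(B * rflm d w) $$ (j, i) = (rflm d w * transpose_mat B) $$ (i, j)"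
proof -
 have "(rflm d w * transpose_mat B) $$ (i, j) = transpose_mat (rflm d w * transpose_mat B) $$ (j, i)"
  using B i j by (simp add: rflm_def)
 also have "transpose_mat (rflm d w * transpose_mat B) = B * rflm d w"
  using transpose_mult[OF rflm_carrier transpose_carrier_mat[THEN iffD2, OF B], of w] by (simp add: rflm_transpose)
 finally show ?thesis by simp
qed

lemma rflm_O2:
 assumes w: "w : Rd d" shows "rflm d w : O2 d"
proof -
 have f: "finv d (rflm d w) = rflm d w"
 proof (rule eq_matI)
  fix i j assume "i < dim_row (rflm d w)" "j < dim_col (rflm d w)"
  then have i: "i < d + 4" and j: "j < d + 4" by (simp_all add: rflm_def)
  show "finv d (rflm d w) $$ (i, j) = rflm d w $$ (i, j)"
   unfolding finv_index[OF i j]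
   by (cases rule: index_cases[OF i]; cases rule: index_cases[OF j]) (simp_all add: rflm_def)
 qed (simp_all add: rflm_def)
 have ww: "(\<Sum>k<d. fcoord w k * fcoord w k) = inner w w" using inner_Rd[OF w, of w] by simp
 have "rflm d w * rflm d w = 1\<^sub>m (d + 4)"
 proof (rule eq_matI)
  fix i j assume "i < dim_row (1\<^sub>m (d + 4) :: real mat)" "j < dim_col (1\<^sub>m (d + 4) :: real mat)"
  then have i: "i < d + 4" and j: "j < d + 4" by simp_all
  have s: "(\<Sum>k<d. fcoord w k * rflm d w $$ (k + 2, l + 2)) = - fcoord w l" if "l < d" "w ~= 0" for l
  proof -
   have "(\<Sum>k<d. fcoord w k * rflm d w $$ (k + 2, l + 2))
    = (\<Sum>k<d. fcoord w k * (if k = l then 1 else 0) - 2 * fcoord w l / inner w w * (fcoord w k * fcoord w k))"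
    by (rule sum.cong[OF refl]) (use that in \<open>simp add: rflm_def algebra_simps\<close>)
   also have "\<dots> = fcoord w l - 2 * fcoord w l / inner w w * inner w w"
    unfolding sum_subtractf sum_distrib_left[symmetric] ww using sum_delta_lessThan(4)[OF that(1), of "fcoord w"] by simp
   finally show ?thesis using that(2) by simp
  qed
  have s0: "(\<Sum>k<d. fcoord w k * rflm d w $$ (k + 2, m)) = 0" if "m : {0, 1, d + 2, d + 3}" for m
   by (rule sum.neutral) (use that in \<open>auto simp: rflm_def\<close>)
  show "(rflm d w * rflm d w) $$ (i, j) = 1\<^sub>m (d + 4) $$ (i, j)"
  proof (cases "w = 0")
   case True
   have "rflm d 0 = 1\<^sub>m (d + 4)" by (rule eq_matI) (auto simp: rflm_def)
   then show ?thesis unfolding True by simp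
  next
   case False
   show ?thesis
    by (cases rule: index_cases[OF i]; cases rule: index_cases[OF j])
     (simp_all add: rflm_mult_left[OF rflm_carrier] s[OF _ False] s0 del: index_mult_mat(1), simp_all add: rflm_def)
  qed
 qed (simp_all add: rflm_def)
 then show ?thesis by (simp add: O2_def f)
qed

lemma nexp_rfl:
 assumes w: "w : Rd d" and xy: "x : Rd d" "y : Rd d"
 shows "rflm d w * nexp d (p, x, y, e) = nexp d (p, rfl w x, rfl w y, e) * rflm d w"
proof (rule eq_matI)
 let ?R = "nexp d (p, rfl w x, rfl w y, e)"
 fix i j assume "i < dim_row (?R * rflm d w)" "j < dim_col (?R * rflm d w)"
 then have i: "i < d + 4" and j: "j < d + 4" by (simp_all add: rflm_def)
 have wz: "(\<Sum>k<d. fcoord w k * fcoord z k) = inner w z" for z using inner_Rd[OF w] by simp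
 have wr: "inner w (rfl w z) = - inner w z" for z
  by (cases "w = 0") (simp_all add: rfl_def inner_lin_simps)
 have sq: "(\<Sum>k<d. fcoord w k * B (k + 2)) = inner w z" if "!!k. k < d ==> B (k + 2) = fcoord z k" for B z
 proof -
  have "(\<Sum>k<d. fcoord w k * B (k + 2)) = (\<Sum>k<d. fcoord w k * fcoord z k)"
   by (rule sum.cong[OF refl]) (use that in simp)
  then show ?thesis by (simp only: wz)
 qed
 have sd: "(\<Sum>k<d. fcoord w k * B (k + 2)) = fcoord w l" if "l < d" "!!k. k < d ==> B (k + 2) = (if k = l then 1 else 0)" for B l
  using sq[of B "ax l"] that(2) by simp
 have sd': "(\<Sum>k<d. fcoord w k * B (k + 2)) = fcoord w l" if "l < d" "!!k. k < d ==> B (k + 2) = (if l = k then 1 else 0)" for B l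
  by (rule sd[OF that(1)]) (use that(2) in auto)
 have S1: "q : {0, 1} ==> (\<Sum>k<d. fcoord w k * nexp d (p, x, y, e) $$ (k + 2, q)) = 0"
  "l < d ==> (\<Sum>k<d. fcoord w k * nexp d (p, x, y, e) $$ (k + 2, l + 2)) = fcoord w l"
  "(\<Sum>k<d. fcoord w k * nexp d (p, x, y, e) $$ (k + 2, d + 2)) = - inner w y"
  "(\<Sum>k<d. fcoord w k * nexp d (p, x, y, e) $$ (k + 2, d + 3)) = p / 2 * inner w y - inner w x" for q l
  using sq[of "%k. nexp d (p, x, y, e) $$ (k, q)" 0] sd[of l "%k. nexp d (p, x, y, e) $$ (k, l + 2)"]
   sq[of "%k. nexp d (p, x, y, e) $$ (k, d + 2)" "- y"] sq[of "%k. nexp d (p, x, y, e) $$ (k, d + 3)" "(p / 2) *\<^sub>R y - x"]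
  by (auto simp: nexp_index inner_lin_simps)
 have S2: "q : {d + 2, d + 3} ==> (\<Sum>k<d. fcoord w k * ?R $$ (q, k + 2)) = 0"
  "l < d ==> (\<Sum>k<d. fcoord w k * ?R $$ (l + 2, k + 2)) = fcoord w l"
  "(\<Sum>k<d. fcoord w k * ?R $$ (0, k + 2)) = - inner w x - p / 2 * inner w y"
  "(\<Sum>k<d. fcoord w k * ?R $$ (1, k + 2)) = - inner w y" for q l
  using sq[of "%k. ?R $$ (q, k)" 0] sd'[of l "%k. ?R $$ (l + 2, k)"]
   sq[of "%k. ?R $$ (0, k)" "rfl w x + (p / 2) *\<^sub>R rfl w y"] sq[of "%k. ?R $$ (1, k)" "rfl w y"]
  by (auto simp: nexp_index inner_lin_simps wr)
 have rm: "m : {0, 1, d + 2, d + 3} ==> (?R * rflm d w) $$ (i, m) = ?R $$ (i, m)"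
  "l < d ==> (?R * rflm d w) $$ (i, l + 2) = ?R $$ (i, l + 2) - 2 * fcoord w l / inner w w * (\<Sum>k<d. fcoord w k * ?R $$ (i, k + 2))" for m l
 proof -
  have tr: "transpose_mat ?R : Mat d" by simp
  have tri: "transpose_mat ?R $$ (m, i) = ?R $$ (i, m)" if "m < d + 4" for m using that i by simp
  show "(?R * rflm d w) $$ (i, m) = ?R $$ (i, m)" if "m : {0, 1, d + 2, d + 3}"
  proof -
   have m: "m < d + 4" using that by auto
   show ?thesis unfolding rflm_mult_right[OF nexp_carrier i m] rflm_mult_left(1)[OF tr i that] by (rule tri[OF m])
  qed
  show "(?R * rflm d w) $$ (i, l + 2) = ?R $$ (i, l + 2) - 2 * fcoord w l / inner w w * (\<Sum>k<d. fcoord w k * ?R $$ (i, k + 2))" if l: "l < d"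
  proof -
   have m: "l + 2 < d + 4" using l by simp
   have "(\<Sum>k<d. fcoord w k * transpose_mat ?R $$ (k + 2, i)) = (\<Sum>k<d. fcoord w k * ?R $$ (i, k + 2))"
   proof (rule sum.cong[OF refl])
    fix q assume "q : {..<d}"
    then have "q + 2 < d + 4" by simp
    then show "fcoord w q * transpose_mat ?R $$ (q + 2, i) = fcoord w q * ?R $$ (i, q + 2)" by (simp only: tri)
   qed
   then show ?thesis unfolding rflm_mult_right[OF nexp_carrier i m] rflm_mult_left(2)[OF tr i l] tri[OF m] by simp
  qed
 qed
 have rc: "fcoord (rfl w z) k = fcoord z k - 2 * fcoord w k / inner w w * inner w z" for z k
  by (simp add: rfl_def)
 note L = rflm_mult_left[OF nexp_carrier j, of _ w "(p, x, y, e)"]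
 have fin: "(rflm d w * nexp d (p, x, y, e)) $$ (i, j) = (?R * rflm d w) $$ (i, j)" if i': "i : {0, 1, d + 2, d + 3}"
  and ne: "!!l. l < d ==> nexp d (p, x, y, e) $$ (i, l + 2) = ?R $$ (i, l + 2) - 2 * fcoord w l / inner w w * (\<Sum>k<d. fcoord w k * ?R $$ (i, k + 2))"
  and ns: "!!m. m : {0, 1, d + 2, d + 3} ==> nexp d (p, x, y, e) $$ (i, m) = ?R $$ (i, m)"
 proof (cases rule: index_cases[OF j])
  case j1: (3 l)
  show ?thesis using L(1)[OF i'] unfolding j1(2) rm(2)[OF j1(1)] ne[OF j1(1), symmetric] .
 qed (use L(1)[OF i'] rm(1)[of j] ns[of j] in auto)
 show "(rflm d w * nexp d (p, x, y, e)) $$ (i, j) = (?R * rflm d w) $$ (i, j)"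
 proof (cases rule: index_cases[OF i])
  case 1
  show ?thesis
   by (rule fin, unfold 1 S2) (auto simp: nexp_index rfl_inner rc inner_lin_simps algebra_simps add_divide_distrib)
 next
  case 2
  show ?thesis
   by (rule fin, unfold 2 S2) (auto simp: nexp_index rfl_inner rc inner_lin_simps algebra_simps add_divide_distrib)
 next
  case i1: (3 m)
  show ?thesis
  proof (cases rule: index_cases[OF j])
   case j1: (3 l)
   show ?thesis unfolding i1(2) L(2)[OF i1(1)] unfolding j1(2) rm(2)[OF j1(1), unfolded i1(2)] S1(2)[OF j1(1)] S2(2)[OF i1(1)]
    using i1 j1 by (simp add: nexp_index)
  next
   case j1: 1
   show ?thesis unfolding i1(2) L(2)[OF i1(1)] unfolding j1 S1(1)[of 0, simplified] using rm(1)[of 0, unfolded i1(2)] i1 by (simp add: nexp_index)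
  next
   case j1: 2
   show ?thesis unfolding i1(2) L(2)[OF i1(1)] unfolding j1 S1(1)[of 1, simplified] using rm(1)[of 1, unfolded i1(2)] i1 by (simp add: nexp_index)
  next
   case j1: 4
   show ?thesis unfolding i1(2) L(2)[OF i1(1)] unfolding j1 S1(3) using rm(1)[of "d + 2", unfolded i1(2)] i1
    by (simp add: nexp_index rc)
  next
   case j1: 5
   show ?thesis unfolding i1(2) L(2)[OF i1(1)] unfolding j1 S1(4) using rm(1)[of "d + 3", unfolded i1(2)] i1
    by (simp add: nexp_index rc algebra_simps add_divide_distrib)
  qed
 next
  case 4
  show ?thesis by (rule fin, unfold 4 S2) (auto simp: nexp_index S2)
 next
  case 5
  show ?thesis by (rule fin, unfold 5 S2) (auto simp: nexp_index S2)
 qed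
qed (simp_all add: rflm_def)

lemma eqp_rfl:
 assumes w: "w : Rd d" and xy: "x : Rd d" "y : Rd d" "x' : Rd d" "y' : Rd d"
 shows "eqp d (p, x, y, e) (p', x', y', e') (p, rfl w x, rfl w y, e) (p', rfl w x', rfl w y', e')"
 unfolding eqp_def
proof (intro bexI[of _ "rflm d w"] allI rflm_O2 w)
 fix \<alpha> \<beta> :: real
 have "\<alpha> *\<^sub>R x + \<beta> *\<^sub>R x' : Rd d" "\<alpha> *\<^sub>R y + \<beta> *\<^sub>R y' : Rd d" using xy by simp_all
 from nexp_rfl[OF w this, of "\<alpha> * p + \<beta> * p'" "\<alpha> * e + \<beta> * e'"]
 show "rflm d w * nexp d (\<alpha> *\<^sub>R (p, x, y, e) + \<beta> *\<^sub>R (p', x', y', e')) =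
   nexp d (\<alpha> *\<^sub>R (p, rfl w x, rfl w y, e) + \<beta> *\<^sub>R (p', rfl w x', rfl w y', e')) * rflm d w"
  by (simp add: rfl_linear)
qed

section \<open>Every Cartan-decomposition subgroup contains a conjugate of a standard plane\<close>

text \<open>Since \<open>nexp\<close> is injective on \<open>Nd d\<close>, \<open>V\<close>
  coincides with the subspace that \<open>unipotent_subgroup_linear\<close> provides.\<close>

lemma cds_linear:
 assumes H: "cds d (nexp d ` V)" and V: "V \<subseteq> Nd d"
 shows "subspace V" "!!u v. u : V ==> v : V ==> nbr u v : V" "closed V"
proof -
 note D = H[unfolded cartan_decomposition_subgroup_def]
 have N: "nexp d ` V \<subseteq> unipotent_N (d + 2)" unfolding unipotent_N_eq using V by blast
 have inj: "nexp d u = nexp d v ==> u = v" if "u : Nd d" "v : Nd d" for u v by (rule nexp_inject[OF that])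
 obtain W where W: "W \<subseteq> Nd d" "subspace W" "!!u v. u : W ==> v : W ==> nbr u v : W" "nexp d ` V = nexp d ` W"
  using unipotent_subgroup_linear[OF _ _ _ N] D by blast
 have "V = W"
  by (rule inj_on_image_eq_iff[THEN iffD1, OF inj_onI[OF nexp_inject] V W(1) W(4)])
 then show "subspace V" "!!u v. u : V ==> v : V ==> nbr u v : V" using W by blast+
 have e: "{u \<in> topspace (top_of_set (Nd d)). nexp d u : nexp d ` V} = V"
 proof (intro Set.set_eqI iffI)
  fix u assume "u : {u \<in> topspace (top_of_set (Nd d)). nexp d u : nexp d ` V}"
  then obtain v where "u : Nd d" "v : V" "nexp d u = nexp d v" by auto
  then show "u : V" using inj[of u v] V by blast
 next
  fix u assume "u : V"
  then show "u : {u \<in> topspace (top_of_set (Nd d)). nexp d u : nexp d ` V}" using V by auto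
 qed
 have "closedin (top_of_set (Nd d)) {u \<in> topspace (top_of_set (Nd d)). nexp d u : nexp d ` V}"
  using closedin_continuous_map_preimage[OF continuous_map_nexp] D by blast
 then show "closed V" unfolding e by (rule closedin_closed_trans[OF _ closed_Nd])
qed

lemma good_sp:
 assumes "sp a b : Std d" "a : sp u v" "b : sp u v" shows "good d (nexp d ` sp u v)"
 by (rule good_Std[OF assms(1)]) (intro image_mono sp_least subspace_sp assms)

lemma good_sub:
 assumes "subspace V" "u : V" "v : V" "good d (nexp d ` sp u v)" shows "good d (nexp d ` V)"
 by (rule good_mono[OF assms(4)]) (intro image_mono sp_least assms)

lemma sp_mem1: "\<alpha> *\<^sub>R u : sp u v" using sp_I[of \<alpha> u 0 v] by simp
lemma sp_mem2: "\<beta> *\<^sub>R v : sp u v" using sp_I[of 0 u \<beta> v] by simp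

lemma good_sp_scaled:
 assumes "sp a b : Std d" "a = \<alpha> *\<^sub>R u" "b = \<beta> *\<^sub>R v"
 shows "good d (nexp d ` sp u v)" "good d (nexp d ` sp v u)"
proof -
 have "a : sp u v" "b : sp u v" "a : sp v u" "b : sp v u"
  unfolding assms(2,3) by (rule sp_mem1 sp_mem2)+
 then show "good d (nexp d ` sp u v)" "good d (nexp d ` sp v u)" by (blast intro: good_sp[OF assms(1)])+
qed

lemma good_sp_shift:
 assumes "good d (nexp d ` sp u (v + c *\<^sub>R u))" shows "good d (nexp d ` sp u v)"
proof (rule good_sub[OF subspace_sp _ _ assms])
 show "u : sp u v" using sp_mem1[of 1 u v] by simp
 show "v + c *\<^sub>R u : sp u v" using sp_I[of c u 1 v] by (simp add: add.commute)
qed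

lemma good_sp_swap: "good d (nexp d ` sp v u) ==> good d (nexp d ` sp u v)"
proof -
 have "sp a b \<subseteq> sp b a" for a b
  by (rule sp_least[OF subspace_sp]) (use sp_mem1[of 1 b a] sp_mem2[of 1 a b] in simp_all)
 then have "sp v u = sp u v" by (intro subset_antisym)
 then show "good d (nexp d ` sp v u) ==> good d (nexp d ` sp u v)" by simp
qed

text \<open>Stands for products of reflections: isometries of \<open>Rd d\<close> induced by
  conjugation. Unlike a single reflection, this notion is closed under composition.\<close>

definition rot :: "nat => (fsv => fsv) => bool" where
 "rot d R \<longleftrightarrow> (\<forall>a\<in>Rd d. R a : Rd d) & (\<forall>a b. inner (R a) (R b) = inner a b) &
   (\<forall>p p' e e'. \<forall>x\<in>Rd d. \<forall>y\<in>Rd d. \<forall>x'\<in>Rd d. \<forall>y'\<in>Rd d.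
    eqp d (p, x, y, e) (p', x', y', e') (p, R x, R y, e) (p', R x', R y', e'))"

lemma rot_mem: "rot d R ==> a : Rd d ==> R a : Rd d"
 unfolding rot_def by (drule conjunct1) (rule bspec)

lemma rot_inner: "rot d R ==> inner (R a) (R b) = inner a b"
 unfolding rot_def by (drule conjunct2, drule conjunct1, drule spec, drule spec, assumption)

lemma rot_eqpD:
 "rot d R ==> x : Rd d ==> y : Rd d ==> x' : Rd d ==> y' : Rd d ==>
   eqp d (p, x, y, e) (p', x', y', e') (p, R x, R y, e) (p', R x', R y', e')"
 unfolding rot_def
 by (drule conjunct2, drule conjunct2, drule spec[of _ p], drule spec[of _ p'], drule spec[of _ e], drule spec[of _ e'],
  drule (1) bspec, drule (1) bspec, drule (1) bspec, drule (1) bspec, assumption)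

lemma rot_rfl: "w : Rd d ==> rot d (rfl w)"
 unfolding rot_def by (intro conjI allI ballI eqp_rfl rfl_inner rfl_Rd)

lemma rot_comp:
 assumes R: "rot d R" and S: "rot d S" shows "rot d (%x. S (R x))"
 unfolding rot_def
proof (intro conjI allI ballI)
 show "S (R a) : Rd d" if "a : Rd d" for a by (intro rot_mem[OF S] rot_mem[OF R] that)
 show "inner (S (R a)) (S (R b)) = inner a b" for a b by (simp only: rot_inner[OF S] rot_inner[OF R])
 fix p p' e e' x y x' y' assume xy: "x : Rd d" "y : Rd d" "x' : Rd d" "y' : Rd d"
 show "eqp d (p, x, y, e) (p', x', y', e') (p, S (R x), S (R y), e) (p', S (R x'), S (R y'), e')"
  by (rule eqp_trans[OF rot_eqpD[OF R] rot_eqpD[OF S]]) (intro xy rot_mem[OF R])+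
qed

lemma rot_zero: "rot d R ==> R 0 = 0"
 using rot_inner[of d R 0 0] by simp

lemma Rd_dim:
 assumes "x : Rd d" "x ~= 0" "!!i. i < k ==> fcoord x i = 0" shows "k < d"
proof (rule ccontr)
 assume "\<not> k < d"
 then have "fcoord x i = 0" for i using assms(3)[of i] Rd_D[OF assms(1), of i] by (cases "i < k") auto
 then have "x = 0" by (intro fsv_eqI) simp
 then show False using assms(2) by simp
qed

text \<open>The reflection that exchanges x with a multiple of the axis k. Its direction is
  orthogonal to the earlier axes, so these are fixed. For x = 0 the direction is 0 and k may exceed
  d.\<close>

lemma frame_step:
 assumes x: "x : Rd d" "!!i. i < k ==> fcoord x i = 0"
 shows "\<exists>R. rot d R & R x = norm x *\<^sub>R ax k & (\<forall>i<k. \<forall>c. R (c *\<^sub>R ax i) = c *\<^sub>R ax i)"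
proof -
 define w where "w = x - norm x *\<^sub>R ax k"
 have "w : Rd d"
 proof (cases "x = 0")
  case False
  then show ?thesis using Rd_dim[OF x(1) False x(2)] x(1) by (simp add: w_def)
 qed (simp add: w_def)
 moreover have "rfl w x = norm x *\<^sub>R ax k"
  unfolding w_def by (rule rfl_swap) (simp add: inner_lin_simps dot_square_norm power2_eq_square)
 moreover have "rfl w (c *\<^sub>R ax i) = c *\<^sub>R ax i" if "i < k" for i c
  by (rule rfl_orth) (use that x(2) in \<open>simp add: w_def\<close>)
 ultimately show ?thesis by (intro exI[of _ "rfl w"] conjI allI impI rot_rfl)
qed

lemma frame1: assumes "x : Rd d" obtains R where "rot d R" "R x = norm x *\<^sub>R ax 0"
proof -
 have "\<exists>R. rot d R & R x = norm x *\<^sub>R ax 0 & (\<forall>i<0. \<forall>c. R (c *\<^sub>R ax i) = c *\<^sub>R ax i)"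
  by (rule frame_step[OF assms]) simp
 then show ?thesis using that by blast
qed

text \<open>Gram-Schmidt by reflections. Nonzero orthogonal vectors need room for their axes; this
  is where the conditions 2 <= d and 3 <= d of \<open>Std\<close> come from.\<close>

lemma frame3:
 assumes x: "x : Rd d" "x ~= 0" and y: "y : Rd d" "y ~= 0" and z: "z : Rd d"
  and o: "inner x y = 0" "inner x z = 0" "inner y z = 0"
 obtains R where "rot d R" "R x = norm x *\<^sub>R ax 0" "R y = norm y *\<^sub>R ax 1" "R z = norm z *\<^sub>R ax 2" "2 <= d" "z ~= 0 --> 3 <= d"
proof -
 have nrm: "norm (R a) = norm a" if "rot d R" for R a unfolding norm_eq_sqrt_inner by (simp only: rot_inner[OF that])
 have inn: "inner (R a) (R b) = inner a b" if "rot d R" for R a b by (rule rot_inner[OF that])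
 have mem: "R a : Rd d" if "rot d R" "a : Rd d" for R a by (rule rot_mem[OF that])
 have nz: "R a ~= 0" if "rot d R" "a ~= 0" for R a using nrm[OF that(1), of a] that(2) by auto
 obtain R where R: "rot d R" "R x = norm x *\<^sub>R ax 0" by (rule frame1[OF x(1)])
 have y1: "fcoord (R y) i = 0" if "i < 1" for i using inn[OF R(1), of x y] o(1) x(2) that by (simp add: R(2))
 have z1: "fcoord (R z) 0 = 0" using inn[OF R(1), of x z] o(2) x(2) by (simp add: R(2))
 obtain S where S: "rot d S" "S (R y) = norm (R y) *\<^sub>R ax 1" "\<forall>i<1. \<forall>c. S (c *\<^sub>R ax i) = c *\<^sub>R ax i"
  using frame_step[OF mem[OF R(1) y(1)] y1] by blast
 have d2: "2 <= d" using Rd_dim[where k = 1, OF mem[OF R(1) y(1)] nz[OF R(1) y(2)] y1] by linarith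
 note SR = rot_comp[OF R(1) S(1)]
 have SRx: "S (R x) = norm x *\<^sub>R ax 0" unfolding R(2) using S(3) by simp
 have SRy: "S (R y) = norm y *\<^sub>R ax 1" unfolding S(2) nrm[OF R(1)] ..
 have z2: "fcoord (S (R z)) i = 0" if "i < 2" for i
 proof -
  have "i = 0 | i = 1" using that by linarith
  moreover have "fcoord (S (R z)) 0 = 0" using inn[OF SR, of x z] o(2) x(2) by (simp add: SRx)
  moreover have "fcoord (S (R z)) 1 = 0" using inn[OF SR, of y z] o(3) y(2) by (simp add: SRy)
  ultimately show ?thesis by metis
 qed
 obtain T where T: "rot d T" "T (S (R z)) = norm (S (R z)) *\<^sub>R ax 2" "\<forall>i<2. \<forall>c. T (c *\<^sub>R ax i) = c *\<^sub>R ax i"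
  using frame_step[OF mem[OF SR z] z2] by blast
 have d3: "z ~= 0 --> 3 <= d" using Rd_dim[where k = 2, OF mem[OF SR z] nz[OF SR] z2] by linarith
 show ?thesis
 proof (rule that[OF rot_comp[OF SR T(1)] _ _ _ d2 d3])
  show "T (S (R x)) = norm x *\<^sub>R ax 0" unfolding SRx using T(3) by simp
  show "T (S (R y)) = norm y *\<^sub>R ax 1" unfolding SRy using T(3) by simp
  show "T (S (R z)) = norm z *\<^sub>R ax 2" unfolding T(2) nrm[OF SR] ..
 qed
qed

section \<open>Normal forms of planes\<close>

lemma rot_eqp:
 assumes "rot d R" "x : Rd d" "y : Rd d" "x' : Rd d" "y' : Rd d"
  "good d (nexp d ` sp (p, R x, R y, e) (p', R x', R y', e'))"
 shows "good d (nexp d ` sp (p, x, y, e) (p', x', y', e'))"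
 by (rule good_eqp[OF rot_eqpD[OF assms(1-5)] assms(6)])

lemma good_Ad:
 assumes "w : Nd d" "u : Nd d" "v : Nd d" "good d (nexp d ` sp (Ad w u) (Ad w v))"
 shows "good d (nexp d ` sp u v)"
 by (rule good_eqp[OF eqp_Ad assms(4)]) (fact assms)+

lemma Std_mem:
 "sp (1, 0, 0, 0) (0, 0, 0, 1) : Std d" "sp (1, 0, ax 0, 0) (0, 0, 0, 1) : Std d" "sp (1, 0, 0, 0) (0, ax 0, 0, 0) : Std d"
 "2 <= d ==> sp (1, 0, ax 1, 0) (0, ax 0, 0, 0) : Std d" "2 <= d ==> sp (0, 0, ax 1, 0) (0, ax 0, 0, 0) : Std d"
 "3 <= d ==> sp (0, ax 2, ax 1, 0) (0, ax 0, 0, 0) : Std d"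
proof -
 have e: "ty1 0 = sp (1, 0, 0, 0) (0, 0, 0, 1)" "ty1 1 = sp (1, 0, ax 0, 0) (0, 0, 0, 1)" "ty2 0 = sp (1, 0, 0, 0) (0, ax 0, 0, 0)"
  "ty2 1 = sp (1, 0, ax 1, 0) (0, ax 0, 0, 0)" "ty3 0 = sp (0, 0, ax 1, 0) (0, ax 0, 0, 0)" "ty3 1 = sp (0, ax 2, ax 1, 0) (0, ax 0, 0, 0)"
  by (simp_all add: ty1_def ty2_def ty3_def)
 show "sp (1, 0, 0, 0) (0, 0, 0, 1) : Std d" "sp (1, 0, ax 0, 0) (0, 0, 0, 1) : Std d" "sp (1, 0, 0, 0) (0, ax 0, 0, 0) : Std d"
  "2 <= d ==> sp (1, 0, ax 1, 0) (0, ax 0, 0, 0) : Std d" "2 <= d ==> sp (0, 0, ax 1, 0) (0, ax 0, 0, 0) : Std d"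
  "3 <= d ==> sp (0, ax 2, ax 1, 0) (0, ax 0, 0, 0) : Std d"
  unfolding e[symmetric] Std_def by simp_all
qed

text \<open>The swap \<open>sw12\<close> exchanges the outer coordinates and leads to
  \<open>ty2 0\<close>.\<close>

lemma good_x_eta:
 assumes y: "y : Rd d" "y ~= 0" shows "good d (nexp d ` sp (0, y, 0, 0) (0, 0, 0, 1))"
proof -
 obtain R where R: "rot d R" "R y = norm y *\<^sub>R ax 0" by (rule frame1[OF y(1)])
 have "good d (nexp d ` sp (0, norm y *\<^sub>R ax 0, 0, 0) (0, 0, 0, 1))"
  by (rule good_eqp[OF eqp_sw12], rule good_sp_scaled(2)[OF Std_mem(3), of 1 _ "1 / norm y"]) (use y in simp_all)
 then show ?thesis by - (rule rot_eqp[OF R(1)], (use y in \<open>simp_all add: R rot_zero[OF R(1)]\<close>))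
qed

text \<open>For p = 0 subtracting the last coordinate leads to \<open>good_x_eta\<close>. For p
  nonzero conjugation along w removes w, and the plane becomes \<open>ty1 0\<close>.\<close>

lemma good_null_nonnull_normal:
 assumes w: "w : Rd d" "2 * p * e + inner w w ~= 0"
 shows "good d (nexp d ` sp (0, 0, 0, 1) (p, w, 0, e))"
proof (cases "p = 0")
 case True
 then have w0: "w ~= 0" using w by auto
 show ?thesis unfolding True
  by (rule good_sp_shift[of _ _ _ "- e"]) (use good_sp_swap[OF good_x_eta[OF w(1) w0]] in simp)
next
 case False
 have "good d (nexp d ` sp (0, 0, 0, 1) (p, 0, 0, e'))" for e'
  by (rule good_sp_shift[of _ _ _ "- e'"], rule good_sp_scaled(2)[OF Std_mem(1), of "1 / p" _ 1]) (use False in simp_all)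
 then show ?thesis
  by - (rule good_Ad[of "(0, 0, (1 / p) *\<^sub>R w, 0)"], (use False w in \<open>simp_all add: Ad_simps\<close>))
qed

text \<open>The form 2 p e + |x|^2 on the part y = 0 is respected by the conjugations used. They
  move the null vector to the last axis and keep the other vector nonnull.\<close>

lemma good_null_nonnull:
 assumes n: "x : Rd d" "2 * p * e + inner x x = 0" "(p, x, e) ~= (0, 0, 0)"
  and w: "w : Rd d" "2 * p' * e' + inner w w ~= 0"
 shows "good d (nexp d ` sp (p, x, 0, e) (p', w, 0, e'))"
proof (cases "p = 0")
 case True
 then have x0: "x = 0" using n(2) by simp
 then have e: "e ~= 0" using True n(3) by simp
 show ?thesis unfolding True x0
  by (rule good_sub[OF subspace_sp _ _ good_null_nonnull_normal[OF w]])
   (use e sp_mem1[of "1 / e" "(0, 0, 0, e)"] sp_mem2[of 1] in simp_all)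
next
 case False
 let ?y = "(1 / p) *\<^sub>R x"
 have a1: "e + inner x ?y - p * inner ?y ?y / 2 = 0"
 proof -
  have xx: "inner x x = - (2 * p * e)" using n(2) by linarith
  show ?thesis unfolding inner_lin_simps xx using False by (simp add: field_simps)
 qed
 define w' where "w' = w - p' *\<^sub>R ?y"
 define e'' where "e'' = e' + inner w ?y - p' * inner ?y ?y / 2"
 have "2 * p' * e'' + inner w' w' = 2 * p' * e' + inner w w"
  unfolding w'_def e''_def inner_lin_simps using inner_commute[of x w] by (simp add: algebra_simps)
 then have q: "2 * e'' * p' + inner w' w' ~= 0" using w(2) by (simp add: mult.commute mult.left_commute)
 have w'R: "w' : Rd d" using n w by (simp add: w'_def)
 have "good d (nexp d ` sp (p, 0, 0, 0) (p', w', 0, e''))"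
  by (rule good_eqp[OF eqp_sw12], rule good_sub[OF subspace_sp _ _ good_null_nonnull_normal[OF w'R q]])
   (use False sp_mem1[of "1 / p" "(0, 0, 0, p)"] sp_mem2[of 1] in simp_all)
 then show ?thesis
  by - (rule good_Ad[of "(0, 0, ?y, 0)"], (use False n w a1 in \<open>simp_all add: Ad_simps w'_def e''_def\<close>))
qed

text \<open>Leads to \<open>ty1 1\<close>: x is removed by conjugation, e by subtracting the first
  vector, and y is normalised by a rotation and the torus.\<close>

lemma good_phi_eta:
 assumes y: "x : Rd d" "y : Rd d" "y ~= 0"
 shows "good d (nexp d ` sp (0, 0, 0, 1) (1, x, y, e))"
proof -
 obtain R where R: "rot d R" "R y = norm y *\<^sub>R ax 0" by (rule frame1[OF y(2)])
 let ?a = "1 / norm y"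
 have "good d (nexp d ` sp (0, 0, 0, 1) (1, 0, norm y *\<^sub>R ax 0, 0))"
  by (rule good_eqp[OF eqp_glm[where a = ?a and b = 0 and c = 0 and k = ?a]], simp_all add: y(3),
    rule good_sp_scaled(2)[OF Std_mem(2), of 1 _ "norm y * norm y"]) (use y in simp_all)
 then have "good d (nexp d ` sp (0, 0, 0, 1) (1, 0, y, 0))"
  by - (rule rot_eqp[OF R(1)], (use y in \<open>simp_all add: R rot_zero[OF R(1)]\<close>))
 then have "good d (nexp d ` sp (0, 0, 0, 1) (1, 0, y, e'))" for e' by - (rule good_sp_shift[of _ _ _ "- e'"], simp)
 then show ?thesis by - (rule good_Ad[of "(0, 0, x, 0)"], (use y in \<open>simp_all add: Ad_simps\<close>))
qed

text \<open>Leads to \<open>ty2 1\<close>. The facts 1 to 4 admit one more coordinate each; in 3 the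
  orthogonality of z and v ensures that conjugation along v leaves the first vector alone.\<close>

lemma good_phi_x:
 assumes x: "x : Rd d" and y: "y : Rd d" "y ~= 0" and z: "z : Rd d" "z ~= 0" "inner z y = 0"
 shows "good d (nexp d ` sp (0, z, 0, e') (1, x, y, e))"
proof -
 obtain R where R: "rot d R" "R z = norm z *\<^sub>R ax 0" "R y = norm y *\<^sub>R ax 1" "2 <= d"
  by (rule frame3[OF z(1,2) y, of 0]) (simp_all add: z(3))
 have zz: "inner z z ~= 0" and yy: "inner y y ~= 0" using z y by simp_all
 let ?a = "1 / norm y"
 have "good d (nexp d ` sp (0, norm z *\<^sub>R ax 0, 0, 0) (1, 0, norm y *\<^sub>R ax 1, 0))"
  by (rule good_eqp[OF eqp_glm[where a = ?a and b = 0 and c = 0 and k = ?a]], simp_all add: y(2),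
    rule good_sp_scaled(2)[OF Std_mem(4)[OF R(4)], of 1 _ "norm y / norm z"]) (use y z in simp_all)
 then have 1: "good d (nexp d ` sp (0, z, 0, 0) (1, 0, y, 0))"
  by - (rule rot_eqp[OF R(1)], (use y z in \<open>simp_all add: R rot_zero[OF R(1)]\<close>))
 have 2: "good d (nexp d ` sp (0, z, 0, 0) (1, 0, y, f))" for f
  by (rule good_Ad[of "(0, (f / inner y y) *\<^sub>R y, 0, 0)"]) (use 1 y z yy in \<open>simp_all add: Ad_simps\<close>)
 have 3: "good d (nexp d ` sp (0, z, 0, 0) (1, v, y, f))" if "v : Rd d" "inner z v = 0" for f v
  by (rule good_Ad[of "(0, 0, v, 0)"]) (use 2 that y z in \<open>simp_all add: Ad_simps\<close>)
 have 4: "good d (nexp d ` sp (0, z, 0, 0) (1, v, y, f))" if "v : Rd d" for f v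
  by (rule good_sp_shift[of _ _ _ "- (inner z v / inner z z)"]) (use 3[of "v - (inner z v / inner z z) *\<^sub>R z"] that z zz in \<open>simp add: inner_lin_simps\<close>)
 show ?thesis
  by (rule good_Ad[of "(0, 0, - (e' / inner z z) *\<^sub>R z, 0)"]) (use 4 x y z zz in \<open>simp_all add: Ad_simps\<close>)
qed

text \<open>Leads to \<open>ty3 0\<close> or \<open>ty3 1\<close>, according to whether x has a part
  orthogonal to both y and z. Its part along y is removed by a shear of the Levi factor, available
  because both first coordinates vanish, and its part along z by subtracting the first
  vector.\<close>

lemma good_x_y:
 assumes x: "x : Rd d" and y: "y : Rd d" "y ~= 0" and z: "z : Rd d" "z ~= 0" "inner z y = 0"
 shows "good d (nexp d ` sp (0, z, 0, 0) (0, x, y, e))"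
proof -
 have zz: "inner z z ~= 0" and yy: "inner y y ~= 0" using z y by simp_all
 have 1: "good d (nexp d ` sp (0, z, 0, 0) (0, v, y, 0))" if v: "v : Rd d" "inner z v = 0" "inner y v = 0" for v
 proof -
  obtain R where R: "rot d R" "R z = norm z *\<^sub>R ax 0" "R y = norm y *\<^sub>R ax 1" "R v = norm v *\<^sub>R ax 2" "2 <= d" "v ~= 0 --> 3 <= d"
   using frame3[OF z(1,2) y v(1) z(3) v(2,3)] by blast
  have "good d (nexp d ` sp (0, norm z *\<^sub>R ax 0, 0, 0) (0, norm v *\<^sub>R ax 2, norm y *\<^sub>R ax 1, 0))"
  proof (cases "v = 0")
   case True
   show ?thesis unfolding True
    by (rule good_sp_scaled(2)[OF Std_mem(5)[OF R(5)], of "1 / norm y" _ "1 / norm z"]) (use y z in simp_all)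
  next
   case False
   show ?thesis
    by (rule good_eqp[OF eqp_glm[where a = "1 / norm v" and b = 0 and c = 0 and k = "1 / norm y"]], simp_all add: y(2) False,
     rule good_sp_scaled(2)[OF Std_mem(6)[OF R(6)[rule_format, OF False]], of 1 _ "norm v / norm z"]) (use y z False in simp_all)
  qed
  then show ?thesis
   by - (rule rot_eqp[OF R(1)], (use y z v in \<open>simp_all add: R rot_zero[OF R(1)]\<close>))
 qed
 have 2: "good d (nexp d ` sp (0, z, 0, 0) (0, v, y, f))" if v: "v : Rd d" "inner z v = 0" "inner y v = 0" for v f
  by (rule good_Ad[of "(0, (f / inner y y) *\<^sub>R y, 0, 0)"]) (use 1[OF v] v y z yy in \<open>simp_all add: Ad_simps\<close>)
 have 3: "good d (nexp d ` sp (0, z, 0, 0) (0, v, y, f))" if v: "v : Rd d" "inner z v = 0" for v f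
  by (rule good_eqp[OF eqp_glm[where a = 1 and b = "- (inner y v / inner y y)" and c = 0 and k = 1]])
   (use 2[of "v - (inner y v / inner y y) *\<^sub>R y" f] v y z yy in \<open>simp_all add: inner_lin_simps\<close>)
 show ?thesis
  by (rule good_sp_shift[of _ _ _ "- (inner z x / inner z z)"]) (use 3[of "x - (inner z x / inner z z) *\<^sub>R z"] x z zz in \<open>simp add: inner_lin_simps\<close>)
qed

section \<open>Case analysis with the wall conditions\<close>

lemma compact_Nd_bounded:
 assumes S: "closed S" "S \<subseteq> Nd d" and b: "!!u. u : S ==> norm u <= R"
 shows "compact S"
proof -
 let ?B = "(%(t, u). t *\<^sub>R u) ` ({0..R} \<times> (Nd d \<inter> sphere 0 1))"
 have "continuous_on ({0..R} \<times> (Nd d \<inter> sphere 0 1)) (%(t, u :: nil). t *\<^sub>R u)"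
  unfolding split_beta by (intro continuous_on_scaleR continuous_on_fst continuous_on_snd continuous_on_id)
 then have c: "compact ?B" by (rule compact_continuous_image) (intro compact_Times compact_Icc compact_Nd_sphere)
 have "S \<subseteq> ?B"
 proof
  fix u assume u: "u : S"
  have o: "(1, 0, 0, 0) : Nd d \<inter> sphere 0 1" by (simp add: norm_Pair)
  show "u : ?B"
  proof (cases "u = 0")
   case True
   have "0 <= R" using b[OF u] norm_ge_zero[of u] by linarith
   then have "(0, (1, 0, 0, 0)) : {0..R} \<times> (Nd d \<inter> sphere 0 1)" using o by simp
   moreover have "u = (%(t, u). t *\<^sub>R u) (0, (1, 0, 0, 0))" using True by (simp add: zero_prod_def)
   ultimately show ?thesis by (rule rev_image_eqI)
  next
   case False
   have "(norm u, (1 / norm u) *\<^sub>R u) : {0..R} \<times> (Nd d \<inter> sphere 0 1)"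
    using False b[OF u] subspace_scale[OF subspace_Nd subsetD[OF S(2) u], of "1 / norm u"] by simp
   moreover have "u = (%(t, u). t *\<^sub>R u) (norm u, (1 / norm u) *\<^sub>R u)" using False by simp
   ultimately show ?thesis by (rule rev_image_eqI)
  qed
 qed
 then show ?thesis using compact_Int_closed[OF c S(1)] by (simp add: Int_absorb1)
qed

lemma positive_min:
 assumes "compact S" "continuous_on S F" "!!u. u : S ==> 0 < (F u :: real)"
 shows "\<exists>c>0. \<forall>u\<in>S. c <= F u"
proof (cases "S = {}")
 case False
 then show ?thesis using continuous_attains_inf[OF assms(1) _ assms(2)] assms(3) by metis
qed (auto intro: exI[of _ 1])

text \<open>Write u and v for the two given elements. The bracket [u, v] has second coordinate p y',
  and [v, [u, v]] is a nonzero multiple of the last axis; subtracting leaves y' in the second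
  coordinate, so \<open>good_x_eta\<close> applies.\<close>

lemma caseA:
 assumes V: "subspace V" "V \<subseteq> Nd d" "!!u v. u : V ==> v : V ==> nbr u v : V"
  and u: "(p, x, y, e) : V" "p ~= 0" and v: "(0, x', y', e') : V" "y' ~= 0"
 shows "good d (nexp d ` V)"
proof -
 obtain c where z: "(0, p *\<^sub>R y', 0, c) : V" using V(3)[OF u(1) v(1)] by simp
 have "(0, 0, 0, p * inner y' y') : V" using V(3)[OF v(1) z] by simp
 from subspace_scale[OF V(1) this, of "1 / (p * inner y' y')"] have n: "(0, 0, 0, 1) : V"
  using u v by simp
 have "(1 / p) *\<^sub>R ((0, p *\<^sub>R y', 0, c) - c *\<^sub>R (0, 0, 0, 1)) : V"
  by (intro subspace_scale subspace_diff V(1) z n)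
 then have y: "(0, y', 0, 0) : V" using u(2) by (simp add: zero_prod_def)
 have "y' : Rd d" using v(1) V(2) by auto
 then show ?thesis by (rule good_sub[OF V(1) y n good_x_eta[OF _ v(2)]])
qed

text \<open>Both wall conditions supply elements with N1 arbitrarily large.\<close>

lemma wall_contra:
 assumes "!!t. 1 <= t ==> \<exists>h\<in>H. t <= K * N1 d h & Q h" "1 <= K" "!!h. h : H ==> Q h ==> N1 d h <= B"
 shows False
proof -
 have "1 <= K * \<bar>B\<bar> + 1" using assms(2) by simp
 then obtain h where h: "h : H" "K * \<bar>B\<bar> + 1 <= K * N1 d h" "Q h" using assms(1) by blast
 have "K * N1 d h <= K * \<bar>B\<bar>" using assms(2) assms(3)[OF h(1,3)] by (intro mult_left_mono) auto
 then show False using h(2) by simp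
qed

text \<open>Here N1 is at least half of the absolute value of the form \<open>q\<close>. If
  \<open>q\<close> is anisotropic on V, then N1 grows quadratically and N2 at most quadratically,
  against \<open>wall2\<close>. If \<open>q\<close> vanishes on V, then N1 grows at most linearly
  while N2 bounds the squares of all coordinates, against \<open>wall1\<close>. Otherwise a null and
  a nonnull vector are available.\<close>

lemma caseC:
 assumes V: "subspace V" "V \<subseteq> Nd d" "closed V" and y0: "!!p x y e. (p, x, y, e) : V ==> y = 0"
  and w: "wall1 d (nexp d ` V)" "wall2 d (nexp d ` V)"
 shows "good d (nexp d ` V)"
proof -
 define q :: "nil => real" where "q u = 2 * fst u * snd (snd (snd u)) + inner (fst (snd u)) (fst (snd u))" for u
 have corner: "\<bar>q u\<bar> / 2 <= N1 d (nexp d u)" if "u : V" for u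
 proof -
  obtain p x y e where u: "u = (p, x, y, e)" by (cases u)
  have "y = 0" using y0 that u by blast
  then show ?thesis using corner_le_N1[of p e x 0 d] unfolding u q_def
   by (simp add: abs_minus_commute[of "- (p * e)"] add.commute flip: abs_divide)
 qed
 define m where "m = real (d + 4)"
 have m1: "1 <= m" by (simp add: m_def)
 consider (a) "\<forall>u\<in>V. u ~= 0 --> q u ~= 0" | (b) "\<forall>u\<in>V. q u = 0" | (c) "\<exists>u\<in>V. u ~= 0 & q u = 0" "\<exists>u\<in>V. q u ~= 0" by blast
 then show ?thesis
 proof cases
  case a
  have "compact (V \<inter> sphere 0 1)"
  proof (rule compact_Nd_bounded[of _ d 1])
   have "V \<inter> sphere 0 1 = V \<inter> {u. norm u = 1}" by auto
   then show "closed (V \<inter> sphere 0 1)"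
    by (simp only:) (intro closed_Int V(3) closed_Collect_eq continuous_on_norm continuous_on_id continuous_on_const)
  qed (use V in auto)
  moreover have "continuous_on (V \<inter> sphere 0 1) (%u. \<bar>q u\<bar>)"
   unfolding q_def by (intro continuous_on_rabs continuous_on_add continuous_on_mult bounded_bilinear.continuous_on[OF bounded_bilinear_inner]
    continuous_on_fst continuous_on_snd continuous_on_id continuous_on_const)
  moreover have "0 < \<bar>q u\<bar>" if "u : V \<inter> sphere 0 1" for u using a that by auto
  ultimately obtain c where c: "c > 0" "!!u. u : V \<inter> sphere 0 1 ==> c <= \<bar>q u\<bar>"
   using positive_min[of "V \<inter> sphere 0 1" "%u. \<bar>q u\<bar>"] by blast
  have cq: "c * (norm u)\<^sup>2 <= \<bar>q u\<bar>" if u: "u : V" for u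
  proof (cases "u = 0")
   case False
   have "c <= \<bar>q ((1 / norm u) *\<^sub>R u)\<bar>" using c(2) False subspace_scale[OF V(1) u] by simp
   also have "q ((1 / norm u) *\<^sub>R u) = (1 / norm u)\<^sup>2 * q u"
   proof -
    have "q (t *\<^sub>R u) = t\<^sup>2 * q u" for t by (cases u) (simp add: q_def power2_eq_square algebra_simps)
    then show ?thesis .
   qed
   finally show ?thesis using False by (simp add: abs_mult field_simps)
  qed simp
  obtain K where K: "1 <= K" "!!t. 1 <= t ==> \<exists>h\<in>nexp d ` V. t <= K * N1 d h & (N1 d h)\<^sup>2 <= K * N2 d h"
   using w(2) unfolding wall2_def by blast
  define A where "A = K * (m ^ 4 * 16)"
  have A0: "0 <= A" using K m1 by (simp add: A_def)
  have bd: "N1 d h <= A + A * (2 / c) + 1" if h: "h : nexp d ` V" "(N1 d h)\<^sup>2 <= K * N2 d h" for h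
  proof -
   obtain u where u: "u : V" "h = nexp d u" using h(1) by blast
   obtain p x y e where uu: "u = (p, x, y, e)" by (cases u)
   have y: "y = 0" and x: "x : Rd d" using y0 u(1) V(2) uu by auto
   define r where "r = norm u"
   have "N2 d h <= m ^ 4 * (8 * (1 + r)\<^sup>2)"
    unfolding u(2) uu y m_def r_def
    by (rule nexp_y0_N2[OF x]) (use norm_nilp_components[where p = p and x = x and y = 0 and e = e] in auto)
   moreover have "(1 + r)\<^sup>2 <= 2 * (1 + r\<^sup>2)" using zero_le_power2[of "1 - r"] by (simp add: power2_eq_square algebra_simps)
   ultimately have "N2 d h <= m ^ 4 * (16 * (1 + r\<^sup>2))"
    using mult_left_mono[of "8 * (1 + r)\<^sup>2" "16 * (1 + r\<^sup>2)" "m ^ 4"] zero_le_power[of m 4] m1 by linarith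
   then have "K * N2 d h <= K * (m ^ 4 * (16 * (1 + r\<^sup>2)))" using K(1) by (intro mult_left_mono) auto
   then have "(N1 d h)\<^sup>2 <= A * (1 + r\<^sup>2)" using h(2) by (simp add: A_def mult.assoc)
   moreover have "r\<^sup>2 <= 2 / c * N1 d h"
    using cq[OF u(1)] corner[OF u(1)] c(1) unfolding u(2) r_def by (simp add: field_simps)
   ultimately have q: "(N1 d h)\<^sup>2 <= A + A * (2 / c) * N1 d h"
    using mult_left_mono[of "1 + r\<^sup>2" "1 + 2 / c * N1 d h" A] A0 by (simp add: algebra_simps)
   show ?thesis
   proof (rule ccontr)
    assume n: "\<not> ?thesis"
    have "0 <= A * (2 / c)" using A0 c by simp
    then have n1: "1 <= N1 d h" using n A0 by linarith
    have "(A + A * (2 / c) + 1) * N1 d h <= N1 d h * N1 d h" using n n1 by (intro mult_right_mono) auto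
    moreover have "A * 1 <= A * N1 d h" using n1 A0 by (intro mult_left_mono)
    ultimately show False using q n1 by (simp add: power2_eq_square algebra_simps)
   qed
  qed
  show ?thesis using wall_contra[OF K(2,1) bd] by simp
 next
  case b
  obtain K where K: "1 <= K" "!!t. 1 <= t ==> \<exists>h\<in>nexp d ` V. t <= K * N1 d h & N2 d h <= K * N1 d h"
   using w(1) unfolding wall1_def by blast
  have bd: "N1 d h <= m ^ 2 * (2 * 1 * (20 * (K * (m ^ 2 * 2))))" if h: "h : nexp d ` V" "N2 d h <= K * N1 d h" for h
  proof -
   obtain u where u: "u : V" "h = nexp d u" using h(1) by blast
   obtain p x y e where uu: "u = (p, x, y, e)" by (cases u)
   have y: "y = 0" using y0 u(1) uu by blast
   have q0: "2 * p * e + inner x x = 0" using b u(1) by (auto simp: uu q_def)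
   define T where "T = 1 + \<bar>p\<bar> + norm x + \<bar>e\<bar>"
   have T1: "1 <= T" by (simp add: T_def)
   have N: "N1 d h <= m\<^sup>2 * (2 * 1 * T)" unfolding u(2) uu y m_def
   proof (rule nexp_N1_le[OF T1])
    show "\<bar>fcoord x k\<bar> <= 1 * T" for k using abs_fcoord_le[of x k] by (simp add: T_def)
    have "- p * e - inner x x / 2 = 0" using q0 by argo
    then show "\<bar>- p * e - inner x x / 2 + p\<^sup>2 * inner 0 (0::fsv) / 24\<bar> <= 1 * T" using T1 by simp
   qed (simp_all add: T_def)
   have p2: "p\<^sup>2 <= N2 d h" unfolding u(2) uu y by (rule phi_minor_le_N2)
   have e2: "e\<^sup>2 <= N2 d h" using corner_minor_le_N2[of e x 0 p d] unfolding u(2) uu y by (simp add: power2_eq_square)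
   have n2: "1 <= N2 d h" unfolding u(2) uu by (rule one_le_N2)
   have "- (2 * p * e) <= p\<^sup>2 + e\<^sup>2" using zero_le_power2[of "p + e"] by (simp add: power2_eq_square algebra_simps)
   then have x2: "(norm x)\<^sup>2 <= 2 * N2 d h" using q0 p2 e2 unfolding dot_square_norm[symmetric] by argo
   have "T\<^sup>2 <= 4 * (1 + p\<^sup>2 + (norm x)\<^sup>2 + e\<^sup>2)"
   proof -
    have cs: "(a1 + a2 + a3 + a4)\<^sup>2 <= 4 * (a1\<^sup>2 + a2\<^sup>2 + a3\<^sup>2 + a4\<^sup>2)" for a1 a2 a3 a4 :: real
    proof -
     have "0 <= (a1 - a2)\<^sup>2 + (a1 - a3)\<^sup>2 + (a1 - a4)\<^sup>2 + (a2 - a3)\<^sup>2 + (a2 - a4)\<^sup>2 + (a3 - a4)\<^sup>2" by simp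
     then show ?thesis by (simp add: power2_eq_square algebra_simps)
    qed
    show ?thesis unfolding T_def using cs[of 1 "\<bar>p\<bar>" "norm x" "\<bar>e\<bar>"] by simp
   qed
   \<comment> \<open>20 = 4 * (1 + 1 + 2 + 1), as 1, the squares of p and e, and half the square of
     norm x are each at most N2.\<close>
   then have "T * T <= 20 * N2 d h" using p2 e2 x2 n2 by (simp add: power2_eq_square)
   also have "\<dots> <= 20 * (K * (m\<^sup>2 * (2 * 1 * T)))"
    using order_trans[OF h(2) mult_left_mono[OF N, of K]] K(1) by linarith
   finally have "T * T <= (20 * (K * (m\<^sup>2 * 2))) * T" by (simp add: algebra_simps)
   then have "T <= 20 * (K * (m\<^sup>2 * 2))" using T1 by (simp add: mult_le_cancel_right)
   then have "m\<^sup>2 * (2 * 1 * T) <= m\<^sup>2 * (2 * 1 * (20 * (K * (m ^ 2 * 2))))" by (intro mult_left_mono) auto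
   then show ?thesis using N by linarith
  qed
  show ?thesis using wall_contra[OF K(2,1) bd] by simp
 next
  case c
  then obtain u v where uv: "u : V" "u ~= 0" "q u = 0" "v : V" "q v ~= 0" by blast
  obtain p x y e where u: "u = (p, x, y, e)" by (cases u)
  obtain p' x' y' e' where v: "v = (p', x', y', e')" by (cases v)
  have y: "y = 0" "y' = 0" using y0 uv u v by blast+
  have "x : Rd d" "x' : Rd d" using V(2) uv u v by auto
  then have "good d (nexp d ` sp u v)" unfolding u v y
   by (intro good_null_nonnull) (use uv in \<open>auto simp: u v y q_def zero_prod_def\<close>)
  then show ?thesis by (rule good_sub[OF V(1) uv(1,4)])
 qed
qed

text \<open>For p = 0 the corner minor is -(e^2 + D / 4) with the Gram determinant D of x and y. If
  D were positive whenever (x, y) is nonzero, compactness would bound it below by a multiple of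
  \<mu>^2, where \<mu> = |x|^2 + |y|^2. Since N1 is of order 1 + \<mu> + |e| at most,
  \<open>wall1\<close> would then bound N1.\<close>

lemma rank_one_element:
 assumes V: "subspace V" "V \<subseteq> Nd d" "closed V" and p0: "!!p x y e. (p, x, y, e) : V ==> p = 0"
  and w: "wall1 d (nexp d ` V)"
 shows "\<exists>x y e. (0, x, y, e) : V & (x, y) ~= (0, 0) & inner x x * inner y y = (inner x y)\<^sup>2"
proof (rule ccontr)
 assume neg: "\<not> ?thesis"
 define X :: "nil => fsv" where "X u = fst (snd u)" for u
 define Y :: "nil => fsv" where "Y u = fst (snd (snd u))" for u
 define E :: "nil => real" where "E u = snd (snd (snd u))" for u
 note XYE = X_def Y_def E_def
 define D where "D u = inner (X u) (X u) * inner (Y u) (Y u) - (inner (X u) (Y u))\<^sup>2" for u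
 define M where "M u = inner (X u) (X u) + inner (Y u) (Y u)" for u
 obtain K where K: "1 <= K" "!!t. 1 <= t ==> \<exists>h\<in>nexp d ` V. t <= K * N1 d h & N2 d h <= K * N1 d h"
  using w unfolding wall1_def by blast
 define A where "A = K * (real (d + 4) ^ 2 * (2 * 1))"
 have "1 <= real (d + 4) ^ 2" by (rule one_le_power) linarith
 then have "1 <= real (d + 4) ^ 2 * (2 * 1)" by linarith
 then have A1: "1 <= A" unfolding A_def by (rule mult_ge1_I[OF K(1)])
 \<comment> \<open>The slice |x|^2 + |y|^2 = 1 is not bounded in the last coordinate. The estimate
   from \<open>wall1\<close> gives |e| <= 3 * A after scaling, and with this bound the slice is
   compact.\<close>
 define S where "S = V \<inter> {u. M u = 1} \<inter> {u. \<bar>E u\<bar> <= 3 * A}"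
 have cont: "continuous_on T X" "continuous_on T Y" "continuous_on T E" for T
  unfolding XYE by (intro continuous_on_fst continuous_on_snd continuous_on_id)+
 have "closed S" unfolding S_def M_def
  by (intro closed_Int V(3) closed_Collect_eq closed_Collect_le continuous_on_add bounded_bilinear.continuous_on[OF bounded_bilinear_inner] cont
    continuous_on_const continuous_on_rabs)
 moreover have "norm u <= 2 + 3 * A" if "u : S" for u
 proof -
  obtain p x y e where u: "u = (p, x, y, e)" by (cases u)
  have h: "(norm x)\<^sup>2 + (norm y)\<^sup>2 = 1" "\<bar>e\<bar> <= 3 * A" "p = 0"
   using that p0 unfolding S_def M_def XYE u dot_square_norm by auto
  have one: "a <= 1" if "a\<^sup>2 <= 1" for a :: real
   by (rule power2_le_imp_le) (simp_all only: that power_one zero_le_one)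
  have "norm x <= 1" "norm y <= 1"
   by (rule one, use h(1) zero_le_power2[of "norm x"] zero_le_power2[of "norm y"] in linarith)+
  then show ?thesis using norm_nilp_le[of p x y e] h unfolding u by simp
 qed
 ultimately have "compact S" using V(2) by (intro compact_Nd_bounded[of S d]) (auto simp: S_def)
 moreover have "continuous_on S D" unfolding D_def
  by (intro continuous_on_diff continuous_on_mult continuous_on_power bounded_bilinear.continuous_on[OF bounded_bilinear_inner] cont)
 moreover have "0 < D u" if "u : S" for u
 proof -
  obtain p x y e where u: "u = (p, x, y, e)" by (cases u)
  have p: "p = 0" and uV: "(0, x, y, e) : V" and m: "inner x x + inner y y = 1"
   using that p0[of p x y e] unfolding S_def M_def XYE u by auto
  have "(x, y) ~= (0, 0)" using m by auto
  then have "inner x x * inner y y ~= (inner x y)\<^sup>2" using neg uV by blast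
  moreover have "(inner x y)\<^sup>2 <= inner x x * inner y y" by (rule Cauchy_Schwarz_ineq)
  ultimately show ?thesis by (simp add: D_def XYE u)
 qed
 ultimately obtain c where c: "c > 0" "!!u. u : S ==> c <= D u" using positive_min[of S D] by blast
 define B where "B = 1 + 36 * (A * A * A) / c"
 have B1: "1 <= B" using c A1 by (simp add: B_def)
 have bd: "N1 d h <= real (d + 4) ^ 2 * (2 * 1 * (1 + B + (1 + 9 * (A * A) * (1 + B))))"
  if h: "h : nexp d ` V" "N2 d h <= K * N1 d h" for h
 proof -
  obtain u where u: "u : V" "h = nexp d u" using h(1) by blast
  obtain p x y e where uu: "u = (p, x, y, e)" by (cases u)
  have p: "p = 0" using p0 u(1) uu by blast
  define \<mu> where "\<mu> = inner x x + inner y y"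
  have \<mu>0: "0 <= inner x x" "0 <= inner y y" by simp_all
  have xy: "\<bar>inner x y\<bar> <= \<mu>"
  proof -
   have "0 <= inner (x + y) (x + y)" "0 <= inner (x - y) (x - y)" by (rule inner_ge_zero)+
   then show ?thesis unfolding \<mu>_def inner_lin_simps using inner_commute[of x y] \<mu>0 by linarith
  qed
  have fb: "\<bar>fcoord z k\<bar> <= 1 + inner z z" for z k
  proof -
   have "0 <= (norm z - 1)\<^sup>2" by simp
   then have "2 * norm z <= 1 + inner z z" by (simp add: dot_square_norm power2_eq_square algebra_simps)
   then show ?thesis using abs_fcoord_le[of z k] norm_ge_zero[of z] by linarith
  qed
  define T where "T = 1 + \<mu> + \<bar>e\<bar>"
  have T1: "1 <= T" using \<mu>0 by (simp add: T_def \<mu>_def)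
  have N: "N1 d h <= real (d + 4) ^ 2 * (2 * 1 * T)" unfolding u(2) uu p
  proof (rule nexp_N1_le[OF T1])
   show "\<bar>fcoord x k\<bar> <= 1 * T" "\<bar>fcoord y k\<bar> <= 1 * T" for k
    using fb[of x k] fb[of y k] \<mu>0 unfolding T_def \<mu>_def mult_1 by linarith+
   have "\<bar>e - inner x y / 2\<bar> <= T" "\<bar>- e - inner x y / 2\<bar> <= T" using xy \<mu>0 unfolding T_def \<mu>_def by argo+
   then show "\<bar>e - inner x y / 2 - 0 * inner y y / 6\<bar> <= 1 * T" "\<bar>- e - inner x y / 2 + 0 * inner y y / 6\<bar> <= 1 * T"
    by simp_all
  qed (use \<mu>0 xy in \<open>simp_all add: T_def \<mu>_def\<close>)
  have "K * N1 d h <= K * (real (d + 4) ^ 2 * (2 * 1 * T))" using N K(1) by (intro mult_left_mono) auto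
  then have NA: "N2 d h <= A * T" using h(2) by (simp add: A_def mult.assoc)
  have D0: "0 <= D u" using Cauchy_Schwarz_ineq[of x y] by (simp add: D_def XYE uu)
  have id: "(e - inner x y / 2) * (- e - inner x y / 2) - (- inner x x / 2) * (- inner y y / 2) = - (e\<^sup>2 + D u / 4)"
   unfolding D_def XYE uu by (simp add: power2_eq_square field_simps)
  have mn: "e\<^sup>2 + D u / 4 <= N2 d h"
   using corner_minor_le_N2[of e x y 0 d] D0 id unfolding u(2) uu p by simp
  have e2: "e\<^sup>2 <= 2 * A * (1 + \<mu>) + A * A"
  proof -
   have "0 <= (A - \<bar>e\<bar>)\<^sup>2" by simp
   then have "2 * (A * \<bar>e\<bar>) <= A * A + e\<^sup>2" by (simp add: power2_eq_square algebra_simps)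
   then show ?thesis using mn NA D0 unfolding T_def by (simp add: algebra_simps)
  qed
  have AA: "A <= A * A" using A1 mult_left_mono[of 1 A A] by simp
  have e3: "e\<^sup>2 <= 3 * (A * A) * (1 + \<mu>)"
  proof -
   have "2 * A * (1 + \<mu>) <= 2 * (A * A) * (1 + \<mu>)" using AA \<mu>0 by (intro mult_right_mono) (auto simp: \<mu>_def)
   moreover have "A * A * 1 <= A * A * (1 + \<mu>)" using \<mu>0 A1 by (intro mult_left_mono) (auto simp: \<mu>_def)
   ultimately show ?thesis using e2 by (simp add: algebra_simps)
  qed
  have ea: "\<bar>e\<bar> <= 1 + e\<^sup>2"
  proof -
   have "0 <= (\<bar>e\<bar> - 1)\<^sup>2" by simp
   then have "2 * \<bar>e\<bar> <= 1 + e\<^sup>2" by (simp add: power2_eq_square algebra_simps)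
   then show ?thesis using abs_ge_zero[of e] by linarith
  qed
  have \<mu>B: "\<mu> <= B"
  proof (cases "\<mu> <= 1")
   case False
   then have m1: "1 <= \<mu>" by simp
   define s where "s = sqrt \<mu>"
   have s: "s * s = \<mu>" "1 <= s" using m1 by (simp_all add: s_def)
   have e6: "e\<^sup>2 <= 6 * (A * A) * \<mu>"
   proof -
    have "3 * (A * A) * (1 + \<mu>) <= 3 * (A * A) * (2 * \<mu>)" using m1 A1 by (intro mult_left_mono) auto
    then show ?thesis using e3 by linarith
   qed
   have "\<bar>e\<bar> <= 3 * A * s"
   proof (rule power2_le_imp_le)
    have "6 * (A * A) * \<mu> <= 9 * (A * A) * \<mu>" using m1 by (intro mult_right_mono) auto
    moreover have "(3 * A * s)\<^sup>2 = 9 * (A * A) * (s * s)" by (simp add: power2_eq_square)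
    ultimately show "\<bar>e\<bar>\<^sup>2 <= (3 * A * s)\<^sup>2" using e6 unfolding s(1) by simp
   qed (use A1 s in simp)
   then have es: "\<bar>1 / s * e\<bar> <= 3 * A" using s \<open>\<bar>e\<bar> <= 3 * A * s\<close> by (simp add: abs_mult divide_le_eq)
   have "inner x x / \<mu> + inner y y / \<mu> = 1" using m1 by (simp add: \<mu>_def flip: add_divide_distrib)
   then have "(1 / s) *\<^sub>R u : S"
    unfolding S_def using subspace_scale[OF V(1) u(1), of "1 / s"] es s
    by (simp add: M_def XYE uu)
   then have "c <= D ((1 / s) *\<^sub>R u)" by (rule c(2))
   also have "D ((1 / s) *\<^sub>R u) = D u / (\<mu> * \<mu>)"
    using s unfolding D_def XYE uu s(1)[symmetric] by (simp add: power2_eq_square diff_divide_distrib)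
   finally have cD: "c * (\<mu> * \<mu>) <= D u" using m1 by (simp add: le_divide_eq)
   have "\<bar>e\<bar> <= 7 * (A * A) * \<mu>"
   proof -
    have "1 * 1 <= A * A * \<mu>" using A1 m1 AA by (intro mult_mono) linarith+
    then show ?thesis using ea e6 by linarith
   qed
   then have "T <= 9 * (A * A) * \<mu>"
   proof -
    have "1 * \<mu> <= A * A * \<mu>" using A1 m1 AA by (intro mult_right_mono) linarith+
    then show ?thesis using \<open>\<bar>e\<bar> <= 7 * (A * A) * \<mu>\<close> m1 unfolding T_def by linarith
   qed
   then have "A * T <= A * (9 * (A * A) * \<mu>)" using A1 by (intro mult_left_mono) auto
   then have "A * T <= 9 * (A * A * A * \<mu>)" by (simp add: algebra_simps)
   then have "D u <= 36 * (A * A * A * \<mu>)" using mn NA zero_le_power2[of e] by linarith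
   then have "(c * \<mu>) * \<mu> <= (36 * (A * A * A)) * \<mu>" using cD by (simp add: algebra_simps)
   then have "c * \<mu> <= 36 * (A * A * A)" using m1 by (simp add: mult_le_cancel_right)
   then have "\<mu> <= 36 * (A * A * A) / c" using c(1) by (simp add: le_divide_eq mult.commute)
   then show ?thesis by (simp add: B_def)
  qed (use B1 in simp)
  have "3 * (A * A) * (1 + \<mu>) <= 9 * (A * A) * (1 + B)" using \<mu>B \<mu>0 A1 by (intro mult_mono) (auto simp: \<mu>_def)
  then have "T <= 1 + B + (1 + 9 * (A * A) * (1 + B))" using e3 ea \<mu>B unfolding T_def by linarith
  then have "real (d + 4) ^ 2 * (2 * 1 * T) <= real (d + 4) ^ 2 * (2 * 1 * (1 + B + (1 + 9 * (A * A) * (1 + B))))"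
   by (intro mult_left_mono) auto
  then show ?thesis using N by linarith
 qed
 show False by (rule wall_contra[OF K(2,1) bd])
qed

text \<open>On this line N1 has order at most t^4 while the corner minor is -t^6 / 144 (1/36 - 1/48
  = 1/144), so the ratio of N2 to N1 is unbounded.\<close>

lemma line_not_cds:
 assumes "!!h. h : H ==> \<exists>t. h = nexp d (t, 0, t *\<^sub>R ax 0, 0)" shows "\<not> wall1 d H"
proof
 assume "wall1 d H"
 then obtain K where K: "1 <= K" "!!t. 1 <= t ==> \<exists>h\<in>H. t <= K * N1 d h & N2 d h <= K * N1 d h"
  unfolding wall1_def by blast
 define A where "A = real (d + 4) ^ 2 * (2 * 1)"
 have "1 <= real (d + 4) ^ 2" by (rule one_le_power) linarith
 then have A1: "1 <= A" unfolding A_def by linarith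
 define B where "B = 1 + 288 * (K * A)"
 have B1: "1 <= B" using K A1 by (simp add: B_def)
 have bd: "N1 d h <= A * (1 + B * B)" if h: "h : H" "N2 d h <= K * N1 d h" for h
 proof -
  obtain t where t: "h = nexp d (t, 0, t *\<^sub>R ax 0, 0)" using assms[OF h(1)] by blast
  have ii: "inner (t *\<^sub>R ax 0) (t *\<^sub>R ax 0) = t * t" "inner 0 (t *\<^sub>R ax 0) = 0" "inner (0::fsv) 0 = 0" by simp_all
  define s where "s = t * t"
  have s0: "0 <= s" by (simp add: s_def)
  define T where "T = 1 + s * s"
  have T1: "1 <= T" by (simp add: T_def)
  have sT: "s <= T" unfolding T_def using zero_le_power2[of "s - 1"] s0 by (simp add: power2_eq_square algebra_simps)
  have tT: "\<bar>t\<bar> <= T"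
  proof -
   have "2 * \<bar>t\<bar> <= 1 + s" using zero_le_power2[of "\<bar>t\<bar> - 1"] by (simp add: s_def power2_eq_square algebra_simps)
   then show ?thesis using sT T1 by linarith
  qed
  have t3: "\<bar>t * s\<bar> <= T"
  proof -
   have "0 <= (\<bar>t\<bar> - \<bar>t * s\<bar>)\<^sup>2" by simp
   have "2 * \<bar>t * s\<bar> <= s + s * s" using zero_le_power2[of "\<bar>t\<bar> - \<bar>t * \<bar>t\<bar>\<bar>"]
    by (simp add: s_def power2_eq_square algebra_simps abs_mult)
   then show ?thesis using sT T1 unfolding T_def by linarith
  qed
  have N: "N1 d h <= A * T" unfolding t A_def
  proof -
   have "N1 d (nexp d (t, 0, t *\<^sub>R ax 0, 0)) <= real (d + 4) ^ 2 * (2 * 1 * T)"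
   proof (rule nexp_N1_le[OF T1], unfold ii s_def[symmetric])
    show "\<bar>t * fcoord (t *\<^sub>R ax 0) k\<bar> <= 1 * T" "\<bar>fcoord (t *\<^sub>R ax 0) k\<bar> <= 1 * T" for k
     using sT tT T1 s0 by (auto simp flip: s_def)
    show "\<bar>0 - 0 / 2 - t * s / 6\<bar> <= 1 * T" "\<bar>- 0 - 0 / 2 + t * s / 6\<bar> <= 1 * T" using t3 by simp_all
    have "t\<^sup>2 = s" by (simp add: s_def power2_eq_square)
    then show "\<bar>- t * 0 - 0 / 2 + t\<^sup>2 * s / 24\<bar> <= 1 * T" using s0 by (simp add: T_def)
   qed (use sT tT T1 in simp_all)
   then show "N1 d (nexp d (t, 0, t *\<^sub>R ax 0, 0)) <= real (d + 4) ^ 2 * (2 * 1) * T" by (simp only: mult.assoc)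
  qed
  have "s ^ 3 / 144 <= N2 d h"
  proof -
   have "(0 - 0 / 2 - t * s / 6) * (- 0 - 0 / 2 + t * s / 6) - (- t * 0 - 0 / 2 + t\<^sup>2 * s / 24) * (- s / 2) = - (s ^ 3 / 144)"
    by (simp add: s_def power2_eq_square power3_eq_cube field_simps)
   then show ?thesis
    using corner_minor_le_N2[of 0 0 "t *\<^sub>R ax 0" t d] s0 unfolding t ii s_def[symmetric] by simp
  qed
  also have "N2 d h <= K * (A * T)" using order_trans[OF h(2) mult_left_mono[OF N, of K]] K(1) by simp
  finally have s3: "s ^ 3 <= 144 * (K * A * T)" by simp
  have "s <= B"
  proof (cases "s <= 1")
   case False
   then have "1 * 1 <= s * s" by (intro mult_mono) auto
   then have "T <= 2 * (s * s)" by (simp add: T_def)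
   then have "144 * (K * A * T) <= 144 * (K * A * (2 * (s * s)))" using K A1 by (intro mult_left_mono) auto
   then have "s * (s * s) <= (288 * (K * A)) * (s * s)" using s3 by (simp add: power3_eq_cube algebra_simps)
   then have "s <= 288 * (K * A)" using False by (simp add: mult_le_cancel_right)
   then show ?thesis by (simp add: B_def)
  qed (use B1 in simp)
  then have "T <= 1 + B * B" unfolding T_def using s0 by (simp add: mult_mono)
  then have "A * T <= A * (1 + B * B)" using A1 by (intro mult_left_mono) auto
  then show ?thesis using N by linarith
 qed
 show False by (rule wall_contra[OF K(2,1) bd])
qed

text \<open>Second vectors equal to 0 make a line a degenerate plane, so the plane machinery applies
  to it.\<close>

lemma eqp_line:
 assumes "x : Rd d" "y : Rd d" "y ~= 0" shows "eqp d (1, x, y, e) 0 (1, 0, ax 0, 0) 0"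
proof -
 have yy: "inner y y ~= 0" using assms by simp
 obtain R where R: "rot d R" "R y = norm y *\<^sub>R ax 0" by (rule frame1[OF assms(2)])
 define e1 where "e1 = e + inner x x / 2"
 have 1: "Ad (0, 0, x, 0) (1, x, y, e) = (1, 0, y, e1)" "Ad w 0 = 0" for w
  using Ad_linear[of w 0 0 0 0] by (simp_all add: Ad_simps e1_def)
 have 2: "Ad (0, (e1 / inner y y) *\<^sub>R y, 0, 0) (1, 0, y, e1) = (1, 0, y, 0)" using yy by (simp add: Ad_simps)
 have "eqp d (1, x, y, e) 0 (1, 0, y, e1) 0" using eqp_Ad[of "(0, 0, x, 0)" d "(1, x, y, e)" 0] assms by (simp add: 1)
 moreover have "eqp d (1, 0, y, e1) 0 (1, 0, y, 0) 0"
  using eqp_Ad[of "(0, (e1 / inner y y) *\<^sub>R y, 0, 0)" d "(1, 0, y, e1)" 0] assms by (simp add: 1 2)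
 moreover have "eqp d (1, 0, y, 0) 0 (1, 0, norm y *\<^sub>R ax 0, 0) 0"
  using rot_eqpD[OF R(1), of 0 y 0 0 1 0 0 0] assms by (simp add: R rot_zero[OF R(1)] zero_prod_def)
 moreover have "eqp d (1, 0, norm y *\<^sub>R ax 0, 0) 0 (1, 0, ax 0, 0) 0"
  using eqp_glm[of "1 / norm y" "1 / norm y" 0 0 1 0 d 0 "norm y *\<^sub>R ax 0" 0 0 0 0] assms by (simp add: zero_prod_def)
 ultimately show ?thesis by (blast intro: eqp_trans)
qed

text \<open>A second direction of V can be taken with first coordinate 0, hence with y = 0. Its
  bracket with u lies on the last axis: if it is nonzero or x' = 0, this axis is in V and
  \<open>good_phi_eta\<close> applies, otherwise \<open>good_phi_x\<close>. Without a second
  direction V is a line, which \<open>line_not_cds\<close> excludes.\<close>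

lemma caseB:
 assumes H: "cds d (nexp d ` V)" and N: "V \<subseteq> Nd d"
  and y0: "!!x y e. (0, x, y, e) : V ==> y = 0" and u: "(p, x, y, e) : V" "y ~= 0"
 shows "good d (nexp d ` V)"
proof -
 note V = cds_linear[OF H N]
 have p: "p ~= 0" using y0[of x y e] u by metis
 define x1 where "x1 = (1 / p) *\<^sub>R x"
 define y1 where "y1 = (1 / p) *\<^sub>R y"
 define e1 where "e1 = (1 / p) * e"
 have u1: "(1, x1, y1, e1) : V" "y1 ~= 0"
  using subspace_scale[OF V(1) u(1), of "1 / p"] p u(2) by (simp_all add: x1_def y1_def e1_def)
 have R: "x1 : Rd d" "y1 : Rd d" using u1(1) N by auto
 have eta: "good d (nexp d ` V)" if "(0, 0, 0, c) : V" "c ~= 0" for c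
 proof -
  have "(0, 0, 0, 1) : V" using subspace_scale[OF V(1) that(1), of "1 / c"] that(2) by simp
  then show ?thesis by (rule good_sub[OF V(1) _ u1(1) good_phi_eta[OF R u1(2)]])
 qed
 show ?thesis
 proof (cases "\<exists>x' y' e'. (0, x', y', e') : V & (x', e') ~= (0, 0)")
  case True
  then obtain x' y' e' where z: "(0, x', y', e') : V" "(x', e') ~= (0, 0)" by blast
  have y': "y' = 0" by (rule y0[OF z(1)])
  have nb: "(0, 0, 0, inner x' y1) : V" using V(2)[OF u1(1) z(1)] unfolding y' by simp
  consider "inner x' y1 ~= 0" | "x' = 0" | "inner x' y1 = 0" "x' ~= 0" by blast
  then show ?thesis
  proof cases
   case 1 then show ?thesis by (rule eta[OF nb])
  next
   case 2 then show ?thesis using eta[of e'] z y' by simp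
  next
   case 3
   have "x' : Rd d" using z(1) N by auto
   then show ?thesis
    using good_sub[OF V(1) z(1)[unfolded y'] u1(1)] good_phi_x[OF R u1(2) _ 3(2,1)] by blast
  qed
 next
  case False
  have line: "V = sp (1, x1, y1, e1) 0"
  proof
   show "V \<subseteq> sp (1, x1, y1, e1) 0"
   proof
    fix v assume v: "v : V"
    obtain q a b f where vq: "v = (q, a, b, f)" by (cases v)
    have "v - q *\<^sub>R (1, x1, y1, e1) : V" by (intro subspace_diff subspace_scale V(1) v u1(1))
    then have w: "(0, a - q *\<^sub>R x1, b - q *\<^sub>R y1, f - q * e1) : V" by (simp add: vq)
    then have "a - q *\<^sub>R x1 = 0" "f - q * e1 = 0" using False by blast+
    moreover have "b - q *\<^sub>R y1 = 0" by (rule y0[OF w])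
    ultimately have "v = q *\<^sub>R (1, x1, y1, e1)" by (simp add: vq)
    then show "v : sp (1, x1, y1, e1) 0" by (simp only: sp_mem1)
   qed
   show "sp (1, x1, y1, e1) 0 \<subseteq> V" by (rule sp_least[OF V(1) u1(1) subspace_0[OF V(1)]])
  qed
  obtain g where g: "g : O2 d" "cj d g (nexp d ` V) = nexp d ` sp (1, 0, ax 0, 0) 0"
   using eqp_cj[OF eqp_line[OF R u1(2)]] unfolding line by blast
  have "cds d (nexp d ` sp (1, 0, ax 0, 0) 0)"
   using cds_cj[OF H g(1)] unfolding g(2) .
  moreover have "\<not> wall1 d (nexp d ` sp (1, 0, ax 0, 0) 0)"
   by (rule line_not_cds) (auto simp: sp_def)
  ultimately show ?thesis using cds_walls by blast
 qed
qed

text \<open>The bracket of the given element with (0, x, y, e) is a multiple by inner z y of the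
  last axis. If nonzero, \<open>good_x_eta\<close> applies, if zero, \<open>good_x_y\<close>; when y
  vanishes throughout, \<open>caseC\<close> does.\<close>

lemma caseD_normal:
 assumes H: "cds d (nexp d ` V)" and N: "V \<subseteq> Nd d"
  and p0: "!!p x y e. (p, x, y, e) : V ==> p = 0" and z: "(0, z, 0, 0) : V" "z ~= 0"
 shows "good d (nexp d ` V)"
proof -
 note V = cds_linear[OF H N]
 have zR: "z : Rd d" using z(1) N by auto
 have eta: "good d (nexp d ` V)" if "(0, 0, 0, c) : V" "c ~= 0" for c
 proof -
  have "(0, 0, 0, 1) : V" using subspace_scale[OF V(1) that(1), of "1 / c"] that(2) by simp
  then show ?thesis by (rule good_sub[OF V(1) z(1) _ good_x_eta[OF zR z(2)]])
 qed
 show ?thesis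
 proof (cases "\<exists>x y e. (0, x, y, e) : V & y ~= 0")
  case True
  then obtain x y e where v: "(0, x, y, e) : V" "y ~= 0" by blast
  have "x : Rd d" "y : Rd d" using v(1) N by auto
  moreover have "(0, 0, 0, inner z y) : V"
   using subspace_neg[OF V(1) V(2)[OF z(1) v(1)]] by simp
  ultimately show ?thesis
   using eta[of "inner z y"] good_sub[OF V(1) z(1) v(1)] good_x_y[OF _ _ v(2) zR z(2)] by blast
 next
  case False
  then have "y = 0" if "(p, x, y, e) : V" for p x y e using that p0[OF that] by blast
  then show ?thesis using caseC[OF V(1) N V(3)] cds_walls[OF H] by blast
 qed
qed

lemma gram_singular:
 assumes "inner x x * inner y y = (inner x y)\<^sup>2"
 obtains \<alpha> \<beta> and z :: fsv where "x = \<alpha> *\<^sub>R z" "y = \<beta> *\<^sub>R z"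
proof (cases "x = 0")
 case True
 then show ?thesis using that[of 0 y 1] by simp
next
 case False
 define c where "c = inner x y / inner x x"
 have xx: "inner x x ~= 0" using False by simp
 have "inner x x * inner (y - c *\<^sub>R x) (y - c *\<^sub>R x) = inner x x * inner y y - (inner x y)\<^sup>2"
  using xx unfolding inner_lin_simps by (simp add: c_def inner_commute[of y x] power2_eq_square field_simps)
 then have "y - c *\<^sub>R x = 0" using assms xx by simp
 then show ?thesis using that[of 1 x c] by simp
qed

text \<open>In the element from \<open>rank_one_element\<close> x and y are multiples \<alpha> z and
  \<beta> z of one vector. The Levi element with rows (\<alpha>, \<beta>) and (-\<beta>, \<alpha>)
  makes its y zero, and conjugation along z removes its last coordinate; then
  \<open>caseD_normal\<close> applies.\<close>

lemma caseD:
 assumes H: "cds d (nexp d ` V)" and N: "V \<subseteq> Nd d"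
  and p0: "!!p x y e. (p, x, y, e) : V ==> p = 0"
 shows "good d (nexp d ` V)"
proof -
 note V = cds_linear[OF H N]
 obtain x y e where u: "(0, x, y, e) : V" "(x, y) ~= (0, 0)" "inner x x * inner y y = (inner x y)\<^sup>2"
 proof -
  have "\<exists>x y e. (0, x, y, e) : V & (x, y) ~= (0, 0) & inner x x * inner y y = (inner x y)\<^sup>2"
   by (rule rank_one_element[OF V(1) N V(3) _ cds_walls(1)[OF H]]) (rule p0)
  then show ?thesis using that by blast
 qed
 have R: "x : Rd d" "y : Rd d" using u(1) N by auto
 obtain \<alpha> \<beta> z where z: "x = \<alpha> *\<^sub>R z" "y = \<beta> *\<^sub>R z" by (rule gram_singular[OF u(3)])
 have z0: "z ~= 0" and ab: "\<alpha> * \<alpha> + \<beta> * \<beta> ~= 0" using u(2) z by (auto simp: sum_squares_eq_zero_iff)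
 define f :: "nil => nil" where "f u = (0, \<alpha> *\<^sub>R fst (snd u) + \<beta> *\<^sub>R fst (snd (snd u)),
   (- \<beta>) *\<^sub>R fst (snd u) + \<alpha> *\<^sub>R fst (snd (snd u)), (\<alpha> * \<alpha> - \<beta> * (- \<beta>)) * snd (snd (snd u)))" for u
 have D: "\<alpha> * \<alpha> - \<beta> * (- \<beta>) ~= 0" using ab by simp
 have fe: "glm d \<alpha> \<beta> (- \<beta>) \<alpha> * nexp d v = nexp d (f v) * glm d \<alpha> \<beta> (- \<beta>) \<alpha>" if "v : V" for v
 proof -
  obtain q a b g where v: "v = (q, a, b, g)" by (cases v)
  have q: "q = 0" using p0 that v by blast
  show ?thesis using nexp_glm[OF D, of 0 d a b g] unfolding v q f_def by simp
 qed
 define z' where "z' = (\<alpha> * \<alpha> + \<beta> * \<beta>) *\<^sub>R z"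
 define e' where "e' = (\<alpha> * \<alpha> - \<beta> * (- \<beta>)) * e"
 have z': "z' ~= 0" using z0 ab by (simp add: z'_def)
 have fu: "f (0, x, y, e) = (0, z', 0, e')"
  unfolding f_def z z'_def e'_def by (simp add: algebra_simps)
 define w :: nil where "w = (0, 0, - (e' / inner z' z') *\<^sub>R z', 0)"
 have z'R: "z' : Rd d"
 proof (cases "x = 0")
  case True
  have "y ~= 0" using u(2) True by simp
  then have "z = (1 / \<beta>) *\<^sub>R y" using z by auto
  then show ?thesis using R by (simp add: z'_def)
 next
  case False
  then have "z = (1 / \<alpha>) *\<^sub>R x" using z by auto
  then show ?thesis using R by (simp add: z'_def)
 qed
 have wN: "w : Nd d" using z'R by (simp add: w_def)
 have fN: "f v : Nd d" if "v : V" for v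
  using that N by (cases v) (auto simp: f_def)
 have we: "nexp d w * nexp d v = nexp d (Ad w v) * nexp d w" if "v : f ` V" for v
  using that fN by (intro nexp_Ad wN) blast
 note O = glm_O2[OF D, of d] nexp_O2[OF wN]
 let ?W = "Ad w ` f ` V"
 show ?thesis
 proof (rule good_step[OF O(1) fe], assumption, rule good_step[OF O(2) we], assumption, rule caseD_normal)
  show "cds d (nexp d ` ?W)"
   by (rule cds_step[OF O(2) we], assumption, rule cds_step[OF O(1) fe], assumption, rule H)
  show "?W \<subseteq> Nd d" using fN Ad_Nd[OF wN] by blast
  show "p = 0" if "(p, x, y, e) : ?W" for p x y e
  proof -
   obtain v where "v : V" "(p, x, y, e) = Ad w (f v)" using \<open>(p, x, y, e) : ?W\<close> by blast
   then show ?thesis unfolding f_def w_def Ad_simps by simp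
  qed
  have "Ad w (f (0, x, y, e)) = (0, z', 0, 0)"
   unfolding fu w_def using z' by (simp add: Ad_simps)
  then show "(0, z', 0, 0) : ?W" using u(1) by (metis image_eqI)
  show "z' ~= 0" by (rule z')
 qed
qed

theorem cds_contains_standard:
 assumes H: "cds d (nexp d ` V)" and N: "V \<subseteq> Nd d"
 shows "good d (nexp d ` V)"
proof -
 note V = cds_linear[OF H N]
 consider (A) p x y e x' y' e' where "(p, x, y, e) : V" "p ~= 0" "(0, x', y', e') : V" "y' ~= 0"
  | (C) "!!p x y e. (p, x, y, e) : V ==> y = 0" | (D) "!!p x y e. (p, x, y, e) : V ==> p = 0"
  | (B) p x y e where "!!x y e. (0, x, y, e) : V ==> y = 0" "(p, x, y, e) : V" "y ~= 0"
  by blast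
 then show ?thesis
 proof cases
  case A then show ?thesis using caseA[OF V(1) N V(2)] by blast
 next
  case B then show ?thesis using caseB[OF H N] by blast
 next
  case C then show ?thesis using caseC[OF V(1) N V(3)] cds_walls[OF H] by blast
 next
  case D then show ?thesis using caseD[OF H N] by blast
 qed
qed

section \<open>Conjugation invariants and minimality\<close>

text \<open>A cubic polynomial in h = \<open>nexp d u\<close>, since multiples of u correspond to
  powers of h; an isometry that conjugates h conjugates it as well.\<close>

definition LC :: "nat => real => real => real => real => nil => real mat" where
 "LC d a b c e u = a \<cdot>\<^sub>m nexp d (3 *\<^sub>R u) + (b \<cdot>\<^sub>m nexp d (2 *\<^sub>R u) + (c \<cdot>\<^sub>m nexp d u + e \<cdot>\<^sub>m 1\<^sub>m (d + 4)))"

lemma LC_carrier [simp]: "LC d a b c e u : Mat d"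
 by (simp add: LC_def)

lemma LC_index:
 "i < d + 4 ==> j < d + 4 ==> LC d a b c e u $$ (i, j) =
   a * nexp d (3 *\<^sub>R u) $$ (i, j) + (b * nexp d (2 *\<^sub>R u) $$ (i, j) + (c * nexp d u $$ (i, j) + e * (if i = j then 1 else 0)))"
 by (simp add: LC_def)

lemma nexp_conj_mult:
 assumes g: "g : O2 d" and N: "u : Nd d" "u' : Nd d" "v : Nd d" "v' : Nd d"
  and e: "g * nexp d u = nexp d u' * g" "g * nexp d v = nexp d v' * g"
 shows "g * nexp d (nmul u v) = nexp d (nmul u' v') * g"
proof -
 note gc = O2_carrier[OF g]
 have "g * nexp d (nmul u v) = (g * nexp d u) * nexp d v"
  unfolding nexp_mult[OF N(1,3), symmetric] by (rule assoc_mult_mat[OF gc nexp_carrier nexp_carrier, symmetric])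
 also have "\<dots> = nexp d u' * (g * nexp d v)" unfolding e(1) by (rule assoc_mult_mat[OF nexp_carrier gc nexp_carrier])
 also have "\<dots> = nexp d (nmul u' v') * g"
  unfolding e(2) nexp_mult[OF N(2,4), symmetric] by (rule assoc_mult_mat[OF nexp_carrier nexp_carrier gc, symmetric])
 finally show ?thesis .
qed

lemma LC_conj:
 assumes g: "g : O2 d" and N: "u : Nd d" "u' : Nd d" and e: "g * nexp d u = nexp d u' * g"
 shows "g * LC d a b c f u = LC d a b c f u' * g"
proof -
 note gc = O2_carrier[OF g]
 have m: "nmul w w = 2 *\<^sub>R w" "nmul (2 *\<^sub>R w) w = 3 *\<^sub>R w" for w :: nil
  using nmul_scaleR[of 1 w 1] nmul_scaleR[of 2 w 1] by simp_all
 have N2: "2 *\<^sub>R u : Nd d" "2 *\<^sub>R u' : Nd d" by (intro subspace_scale subspace_Nd N)+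
 have e2: "g * nexp d (2 *\<^sub>R u) = nexp d (2 *\<^sub>R u') * g" using nexp_conj_mult[OF g N N e e] unfolding m .
 have e3: "g * nexp d (3 *\<^sub>R u) = nexp d (3 *\<^sub>R u') * g" using nexp_conj_mult[OF g N2 N e2 e] unfolding m .
 show ?thesis
 proof (rule eq_matI)
  fix i j assume "i < dim_row (LC d a b c f u' * g)" "j < dim_col (LC d a b c f u' * g)"
  then have i: "i < d + 4" and j: "j < d + 4" using gc by (auto simp: LC_def)
  have l: "(g * LC d a b c f u) $$ (i, j) = a * (g * nexp d (3 *\<^sub>R u)) $$ (i, j) + (b * (g * nexp d (2 *\<^sub>R u)) $$ (i, j)
    + (c * (g * nexp d u) $$ (i, j) + f * g $$ (i, j)))"
  proof -
   have "(\<Sum>k<d + 4. g $$ (i, k) * (if k = j then 1 else 0)) = g $$ (i, j)" using sum_delta_lessThan(4)[OF j] .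
   then show ?thesis
    unfolding index_mult_sum[OF gc LC_carrier i j] index_mult_sum[OF gc nexp_carrier i j]
    by (simp add: LC_index j algebra_simps sum.distrib flip: sum_distrib_left)
  qed
  have r: "(LC d a b c f u' * g) $$ (i, j) = a * (nexp d (3 *\<^sub>R u') * g) $$ (i, j) + (b * (nexp d (2 *\<^sub>R u') * g) $$ (i, j)
    + (c * (nexp d u' * g) $$ (i, j) + f * g $$ (i, j)))"
  proof -
   have "(\<Sum>k<d + 4. (if i = k then 1 else 0) * g $$ (k, j)) = g $$ (i, j)" using sum_delta_lessThan(1)[OF i] .
   then show ?thesis
    unfolding index_mult_sum[OF LC_carrier gc i j] index_mult_sum[OF nexp_carrier gc i j]
    by (simp add: LC_index i algebra_simps sum.distrib flip: sum_distrib_left)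
  qed
  show "(g * LC d a b c f u) $$ (i, j) = (LC d a b c f u' * g) $$ (i, j)" unfolding l r e e2 e3 ..
 qed (use gc in \<open>auto simp: LC_def\<close>)
qed

definition zmat :: "nat => real mat => bool" where
 "zmat d A \<longleftrightarrow> (\<forall>i<d + 4. \<forall>j<d + 4. A $$ (i, j) = 0)"

text \<open>
 With \<open>Z = h - 1\<close> for \<open>h = nexp d u\<close>, powers of \<open>Z\<close> are finite differences of \<open>k \<mapsto> nexp d (k *\<^sub>R u)\<close>. Hence \<open>sq\<close>, \<open>cb\<close>
 and \<open>rk\<close> express \<open>Z\<^sup>2 = 0\<close>, \<open>Z\<^sup>3 = 0\<close> and \<open>rank Z\<^sup>2 <= 1\<close>.
\<close>

definition sq :: "nat => nil => bool" where "sq d u \<longleftrightarrow> zmat d (LC d 0 1 (- 2) 1 u)"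
definition cb :: "nat => nil => bool" where "cb d u \<longleftrightarrow> zmat d (LC d 1 (- 3) 3 (- 1) u)"
definition rk :: "nat => nil => bool" where "rk d u \<longleftrightarrow> N2 d (LC d 0 1 (- 2) 1 u) = 0"

lemma zmat_conj:
 assumes g: "g : O2 d" and A: "A : Mat d" "B : Mat d"
  and e: "g * A = B * g" and z: "zmat d A"
 shows "zmat d B"
 unfolding zmat_def
proof (intro allI impI)
 fix i j assume i: "i < d + 4" and j: "j < d + 4"
 have z: "(g * A) $$ (i, k) = 0" if "k < d + 4" for k
  unfolding index_mult_sum[OF O2_carrier[OF g] A(1) i that] using z that by (simp add: zmat_def)
 have "B $$ (i, j) = (g * A * finv d g) $$ (i, j)" unfolding e O2_cancel(3)[OF g A(2)] ..
 also have "\<dots> = 0" unfolding index_mult_sum[OF mult_carrier_mat[OF O2_carrier[OF g] A(1)] finv_carrier i j] by (simp add: z del: index_mult_mat(1))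
 finally show "B $$ (i, j) = 0" .
qed

lemma conj_invariants:
 assumes g: "g : O2 d" and N: "u : Nd d" "u' : Nd d" and e: "g * nexp d u = nexp d u' * g"
 shows "sq d u ==> sq d u'" "cb d u ==> cb d u'" "rk d u ==> rk d u'"
proof -
 show "sq d u ==> sq d u'" unfolding sq_def by (rule zmat_conj[OF g LC_carrier LC_carrier LC_conj[OF g N e]])
 show "cb d u ==> cb d u'" unfolding cb_def by (rule zmat_conj[OF g LC_carrier LC_carrier LC_conj[OF g N e]])
 show "rk d u ==> rk d u'" unfolding rk_def
 proof -
  let ?A = "LC d 0 1 (- 2) 1 u" and ?B = "LC d 0 1 (- 2) 1 u'"
  assume z: "N2 d ?A = 0"
  have "?B = g * ?A * finv d g" unfolding LC_conj[OF g N e] O2_cancel(3)[OF g LC_carrier] ..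
  then have "N2 d ?B <= N2 d (g * ?A) * N2 d (finv d g)"
   using N2_mult[OF mult_carrier_mat[OF O2_carrier[OF g] LC_carrier] finv_carrier] by metis
  also have "\<dots> <= (N2 d g * N2 d ?A) * N2 d (finv d g)"
   by (intro mult_right_mono N2_mult O2_carrier[OF g] LC_carrier) simp
  finally show "N2 d ?B = 0" using z N2_nonneg[of d ?B] by simp
 qed
qed

lemma conj_invariants_iff:
 assumes g: "g : O2 d" and N: "u : Nd d" "u' : Nd d" and e: "g * nexp d u = nexp d u' * g"
 shows "sq d u \<longleftrightarrow> sq d u'" "cb d u \<longleftrightarrow> cb d u'" "rk d u \<longleftrightarrow> rk d u'"
proof -
 note gc = O2_carrier[OF g]
 have "nexp d u * finv d g = (finv d g * (nexp d u' * g)) * finv d g" unfolding e[symmetric] O2_cancel(1)[OF g nexp_carrier] ..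
 also have "\<dots> = finv d g * ((nexp d u' * g) * finv d g)"
  by (rule assoc_mult_mat[OF finv_carrier mult_carrier_mat[OF nexp_carrier gc] finv_carrier])
 also have "\<dots> = finv d g * nexp d u'" unfolding O2_cancel(3)[OF g nexp_carrier] ..
 finally have e': "finv d g * nexp d u' = nexp d u * finv d g" by (rule sym)
 note 1 = conj_invariants[OF g N e] and 2 = conj_invariants[OF O2_finv[OF g] N(2,1) e']
 show "sq d u \<longleftrightarrow> sq d u'" "cb d u \<longleftrightarrow> cb d u'" "rk d u \<longleftrightarrow> rk d u'" using 1 2 by blast+
qed

text \<open>The entries of (h - 1)^2. The coefficient 7 / 12 is (2^4 - 2) / 24, from the quartic
  term of the corner.\<close>

lemma LC2_index:
 fixes p e :: real and x y :: fsv and d :: nat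
 defines "A \<equiv> LC d 0 1 (- 2) 1 (p, x, y, e)"
 shows "A $$ (0, d + 2) = - inner x y - p * inner y y" "A $$ (0, d + 3) = - 2 * p * e - inner x x + 7 / 12 * (p\<^sup>2 * inner y y)"
  "A $$ (1, d + 2) = - inner y y" "A $$ (1, d + 3) = p * inner y y - inner x y"
  "k < d ==> A $$ (0, k + 2) = p * fcoord y k" "k < d ==> A $$ (k + 2, d + 3) = p * fcoord y k"
  "A $$ (0, 0) = 0" "A $$ (0, 1) = 0" "A $$ (1, 0) = 0" "A $$ (1, 1) = 0" "k < d ==> A $$ (1, k + 2) = 0"
  "k < d ==> A $$ (k + 2, 0) = 0" "k < d ==> A $$ (k + 2, 1) = 0" "k < d ==> l < d ==> A $$ (k + 2, l + 2) = 0"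
  "k < d ==> A $$ (k + 2, d + 2) = 0" "A $$ (d + 2, 0) = 0" "A $$ (d + 2, 1) = 0" "k < d ==> A $$ (d + 2, k + 2) = 0"
  "A $$ (d + 2, d + 2) = 0" "A $$ (d + 2, d + 3) = 0" "A $$ (d + 3, 0) = 0" "A $$ (d + 3, 1) = 0"
  "k < d ==> A $$ (d + 3, k + 2) = 0" "A $$ (d + 3, d + 2) = 0" "A $$ (d + 3, d + 3) = 0"
 unfolding A_def by (simp_all add: LC_index nexp_index inner_lin_simps field_simps power2_eq_square)

lemma sq_iff: "sq d (p, x, y, e) \<longleftrightarrow> y = 0 & 2 * p * e + inner x x = 0"
proof
 assume s: "sq d (p, x, y, e)"
 have z: "LC d 0 1 (- 2) 1 (p, x, y, e) $$ (i, j) = 0" if "i < d + 4" "j < d + 4" for i j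
  using s that unfolding sq_def zmat_def by blast
 have "y = 0" using z[of 1 "d + 2"] by (simp add: LC2_index)
 then show "y = 0 & 2 * p * e + inner x x = 0" using z[of 0 "d + 3"] by (simp add: LC2_index)
next
 assume h: "y = 0 & 2 * p * e + inner x x = 0"
 show "sq d (p, x, y, e)" unfolding sq_def zmat_def
 proof (intro allI impI)
  fix i j assume i: "i < d + 4" and j: "j < d + 4"
  show "LC d 0 1 (- 2) 1 (p, x, y, e) $$ (i, j) = 0"
   by (cases rule: index_cases[OF i]; cases rule: index_cases[OF j]; simp only: LC2_index; use h in simp)
 qed
qed

lemma cb_iff: "cb d (p, x, y, e) \<longleftrightarrow> p = 0 | y = 0"
proof
 assume s: "cb d (p, x, y, e)"
 have z: "LC d 1 (- 3) 3 (- 1) (p, x, y, e) $$ (i, j) = 0" if "i < d + 4" "j < d + 4" for i j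
  using s that unfolding cb_def zmat_def by blast
 have "LC d 1 (- 3) 3 (- 1) (p, x, y, e) $$ (0, d + 2) = - p * inner y y"
  by (simp add: LC_index nexp_index inner_lin_simps field_simps)
 then show "p = 0 | y = 0" using z[of 0 "d + 2"] by simp
next
 assume h: "p = 0 | y = 0"
 show "cb d (p, x, y, e)" unfolding cb_def zmat_def
 proof (intro allI impI)
  fix i j assume i: "i < d + 4" and j: "j < d + 4"
  show "LC d 1 (- 3) 3 (- 1) (p, x, y, e) $$ (i, j) = 0"
  proof (cases "p = 0")
   case True
   show ?thesis unfolding True
    by (cases rule: index_cases[OF i]; cases rule: index_cases[OF j]; simp add: LC_index nexp_index inner_lin_simps)
  next
   case False
   then have y: "y = 0" using h by simp
   show ?thesis unfolding y
    by (cases rule: index_cases[OF i]; cases rule: index_cases[OF j]; simp add: LC_index nexp_index inner_lin_simps)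
  qed
 qed
qed

text \<open>When p or y vanishes, (h - 1)^2 is supported on rows 0, 1 and columns d + 2, d + 3, so
  one determinant decides; the term with p * e drops out of it because p or y is 0.\<close>

lemma rk_iff:
 assumes "p = 0 | y = 0" shows "rk d (p, x, y, e) \<longleftrightarrow> inner x x * inner y y = (inner x y)\<^sup>2"
proof
 let ?A = "LC d 0 1 (- 2) 1 (p, x, y, e)"
 assume r: "rk d (p, x, y, e)"
 show "inner x x * inner y y = (inner x y)\<^sup>2"
  using mnr_le_N2[of 0 d 1 "d + 2" "d + 3" ?A] r assms unfolding rk_def
  by (auto simp: LC2_index power2_eq_square algebra_simps)
next
 let ?A = "LC d 0 1 (- 2) 1 (p, x, y, e)"
 assume s: "inner x x * inner y y = (inner x y)\<^sup>2"
 obtain c \<alpha> \<beta> where c: "inner x y = c * \<alpha> * \<beta>" "2 * p * e + inner x x = c * \<alpha> * \<alpha>" "inner y y = c * \<beta> * \<beta>"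
 proof (cases "y = 0")
  case True
  then show ?thesis using that[of "2 * p * e + inner x x" 1 0] by simp
 next
  case False
  obtain \<alpha> \<beta> z where "x = \<alpha> *\<^sub>R z" "y = \<beta> *\<^sub>R z" by (rule gram_singular[OF s])
  then show ?thesis using that[of "inner z z" \<alpha> \<beta>] False assms by (simp add: mult.commute mult.left_commute)
 qed
 define P where "P i = (if i = 0 then \<alpha> else if i = 1 then \<beta> else 0)" for i :: nat
 define Q where "Q j = (if j = d + 2 then - c * \<beta> else if j = d + 3 then - c * \<alpha> else 0)" for j
 have py: "p *\<^sub>R y = 0" "p * inner y y = 0" using assms by auto
 have pk: "p * fcoord y k = 0" for k using assms by auto
 have A: "?A $$ (i, j) = P i * Q j" if i: "i < d + 4" and j: "j < d + 4" for i j
 proof -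
  have c': "- 2 * p * e - inner x x = - (c * \<alpha> * \<alpha>)" using c(2) by linarith
  have py2: "p\<^sup>2 * inner y y = 0" using py(2) by (simp add: power2_eq_square)
  have pyc: "p * (c * \<beta> * \<beta>) = 0" "p\<^sup>2 * (c * \<beta> * \<beta>) = 0" using py(2) py2 unfolding c(3) by simp_all
  show ?thesis
   by (cases rule: index_cases[OF i]; cases rule: index_cases[OF j]; simp only: LC2_index pk c c' pyc; simp add: P_def Q_def)
 qed
 have "N2 d ?A <= real (d + 4) ^ 4 * 0"
  by (rule N2_le) (simp add: A)
 then show "rk d (p, x, y, e)" unfolding rk_def using N2_nonneg[of d ?A] by simp
qed

section \<open>Telling the six planes apart\<close>

lemma ty1_E: "u : ty1 \<epsilon> ==> (!!p e. u = (p, 0, (\<epsilon> * p) *\<^sub>R ax 0, e) ==> P) ==> P"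
 by (cases u) (auto simp: ty1_iff)

lemma ty2_E: "u : ty2 \<epsilon> ==> (!!p s. u = (p, s *\<^sub>R ax 0, (\<epsilon> * p) *\<^sub>R ax 1, 0) ==> P) ==> P"
 by (cases u) (metis ty2_iff)

lemma ty3_E: "u : ty3 \<epsilon> ==> (!!s r. u = (0, s *\<^sub>R ax 0 + (\<epsilon> * r) *\<^sub>R ax 2, r *\<^sub>R ax 1, 0) ==> P) ==> P"
 by (cases u) (metis ty3_iff)

lemma ty_I:
 "(p, 0, (\<epsilon> * p) *\<^sub>R ax 0, e) : ty1 \<epsilon>" "(p, s *\<^sub>R ax 0, (\<epsilon> * p) *\<^sub>R ax 1, 0) : ty2 \<epsilon>"
 "(0, s *\<^sub>R ax 0 + (\<epsilon> * r) *\<^sub>R ax 2, r *\<^sub>R ax 1, 0) : ty3 \<epsilon>"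
 by (simp_all add: ty1_iff ty2_iff ty3_iff)

text \<open>A decision tree. The first entry singles out \<open>ty1 1\<close> and
  \<open>ty2 1\<close>; the second separates these two, and \<open>ty3\<close> from
  \<open>ty1 0\<close> and \<open>ty2 0\<close>; the third separates \<open>ty1 0\<close> from
  \<open>ty2 0\<close>, the fourth \<open>ty3 0\<close> from \<open>ty3 1\<close>.\<close>

definition iv :: "nat => nil set => bool \<times> bool \<times> bool \<times> bool" where
 "iv d T = ((\<forall>u\<in>T. cb d u), (\<exists>u\<in>T. u ~= 0 & sq d u), (\<exists>u\<in>T. \<exists>v\<in>T. sq d u & sq d v & \<not> sq d (u + v)),
   (\<exists>u\<in>T. \<exists>v\<in>T. rk d u & rk d v & \<not> rk d (u + v)))"

lemma iv1: "fst (iv d (ty1 0))" "fst (iv d (ty2 0))" "fst (iv d (ty3 \<epsilon>))" "\<not> fst (iv d (ty1 1))" "\<not> fst (iv d (ty2 1))"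
proof -
 show "fst (iv d (ty1 0))" "fst (iv d (ty2 0))" "fst (iv d (ty3 \<epsilon>))"
  unfolding iv_def fst_conv by (intro ballI; elim ty1_E ty2_E ty3_E; simp add: cb_iff)+
 have "\<not> cb d (1, 0, (1 * 1) *\<^sub>R ax 0, 0)" "\<not> cb d (1, 0 *\<^sub>R ax 0, (1 * 1) *\<^sub>R ax 1, 0)" by (simp_all add: cb_iff)
 then show "\<not> fst (iv d (ty1 1))" "\<not> fst (iv d (ty2 1))"
  unfolding iv_def fst_conv using ty_I(1)[of 1 1 0] ty_I(2)[of 1 0 1] by blast+
qed

lemma iv2: "fst (snd (iv d (ty1 \<epsilon>)))" "fst (snd (iv d (ty2 0)))" "\<not> fst (snd (iv d (ty2 1)))" "\<not> fst (snd (iv d (ty3 \<epsilon>)))"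
proof -
 have "sq d (0, 0, (\<epsilon> * 0) *\<^sub>R ax 0, 1)" "(0, 0, (\<epsilon> * 0) *\<^sub>R ax 0, 1) ~= (0 :: nil)" "sq d (1, 0 *\<^sub>R ax 0, (0 * 1) *\<^sub>R ax 1, 0)"
  "(1, 0 *\<^sub>R ax 0, (0 * 1) *\<^sub>R ax 1, 0) ~= (0 :: nil)"
  by (simp_all add: sq_iff zero_prod_def)
 then show "fst (snd (iv d (ty1 \<epsilon>)))" "fst (snd (iv d (ty2 0)))"
  unfolding iv_def fst_conv snd_conv using ty_I(1)[of 0 \<epsilon> 1] ty_I(2)[of 1 0 0] by blast+
 have "u = 0" if "sq d u" "u : ty2 1" for u
  using that(2,1) by (elim ty2_E) (auto simp: sq_iff zero_prod_def)
 moreover have "u = 0" if "sq d u" "u : ty3 \<epsilon>" for u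
  using that(2,1) by (elim ty3_E) (auto simp: sq_iff zero_prod_def)
 ultimately show "\<not> fst (snd (iv d (ty2 1)))" "\<not> fst (snd (iv d (ty3 \<epsilon>)))"
  unfolding iv_def fst_conv snd_conv by blast+
qed

lemma iv3: "fst (snd (snd (iv d (ty1 0))))" "\<not> fst (snd (snd (iv d (ty2 0))))"
proof -
 have "sq d (1, 0, (0 * 1) *\<^sub>R ax 0, 0)" "sq d (0, 0, (0 * 0) *\<^sub>R ax 0, 1)" "\<not> sq d ((1, 0, (0 * 1) *\<^sub>R ax 0, 0) + (0, 0, (0 * 0) *\<^sub>R ax 0, 1))"
  by (simp_all add: sq_iff)
 then show "fst (snd (snd (iv d (ty1 0))))"
  unfolding iv_def fst_conv snd_conv using ty_I(1)[of 1 0 0] ty_I(1)[of 0 0 1] by blast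
 have "sq d (u + v)" if "sq d u" "sq d v" "u : ty2 0" "v : ty2 0" for u v
  using that(3,4,1,2) by (elim ty2_E) (simp add: sq_iff)
 then show "\<not> fst (snd (snd (iv d (ty2 0))))" unfolding iv_def fst_conv snd_conv by blast
qed

lemma iv4: "snd (snd (snd (iv d (ty3 0))))" "\<not> snd (snd (snd (iv d (ty3 1))))"
proof -
 have "rk d (0, 1 *\<^sub>R ax 0 + (0 * 0) *\<^sub>R ax 2, 0 *\<^sub>R ax 1, 0)" "rk d (0, 0 *\<^sub>R ax 0 + (0 * 1) *\<^sub>R ax 2, 1 *\<^sub>R ax 1, 0)"
  "\<not> rk d ((0, 1 *\<^sub>R ax 0 + (0 * 0) *\<^sub>R ax 2, 0 *\<^sub>R ax 1, 0) + (0, 0 *\<^sub>R ax 0 + (0 * 1) *\<^sub>R ax 2, 1 *\<^sub>R ax 1, 0))"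
  by (simp_all add: rk_iff)
 then show "snd (snd (snd (iv d (ty3 0))))"
  unfolding iv_def snd_conv using ty_I(3)[of 1 0 0] ty_I(3)[of 0 0 1] by blast
 have r: "r = 0" if "rk d (0, s *\<^sub>R ax 0 + (1 * r) *\<^sub>R ax 2, r *\<^sub>R ax 1, 0)" for s r
 proof -
  have "(s * s + r * r) * (r * r) = 0" using that by (simp add: rk_iff inner_lin_simps)
  then show ?thesis by (auto simp: sum_squares_eq_zero_iff)
 qed
 have "rk d (u + v)" if uv: "rk d u" "rk d v" "u : ty3 1" "v : ty3 1" for u v
 proof -
  obtain s1 r1 where u: "u = (0, s1 *\<^sub>R ax 0 + (1 * r1) *\<^sub>R ax 2, r1 *\<^sub>R ax 1, 0)" using uv(3) by (rule ty3_E)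
  obtain s2 r2 where v: "v = (0, s2 *\<^sub>R ax 0 + (1 * r2) *\<^sub>R ax 2, r2 *\<^sub>R ax 1, 0)" using uv(4) by (rule ty3_E)
  have "r1 = 0" "r2 = 0" by (rule r[OF uv(1)[unfolded u]], rule r[OF uv(2)[unfolded v]])
  then show ?thesis unfolding u v by (simp add: rk_iff)
 qed
 then show "\<not> snd (snd (snd (iv d (ty3 1))))" unfolding iv_def snd_conv by blast
qed

lemma iv_ty_inj:
 assumes "T : {ty1 0, ty1 1, ty2 0, ty2 1, ty3 0, ty3 1}" "T' : {ty1 0, ty1 1, ty2 0, ty2 1, ty3 0, ty3 1}"
  "iv d T = iv d T'"
 shows "T = T'"
 using assms(1,2) iv1[of d] iv2[of d] iv3[of d] iv4[of d] unfolding insert_iff empty_iff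
 by (elim disjE FalseE) (simp_all only: assms(3)[symmetric], (metis assms(3))+)

lemma Std_D: "T : Std d ==> T : {ty1 0, ty1 1, ty2 0, ty2 1, ty3 0, ty3 1}"
 unfolding Std_def by (auto split: if_splits)

lemma Std_cases:
 assumes "T : Std d"
 obtains "T = ty1 0" | "T = ty1 1" | "T = ty2 0" | "T = ty2 1" "2 <= d" | "T = ty3 0" "2 <= d" | "T = ty3 1" "3 <= d"
 using assms unfolding Std_def by (auto split: if_splits)

lemma Std_props:
 assumes d: "1 <= d" and T: "T : Std d"
 shows "cds d (nexp d ` T)" "T \<subseteq> Nd d"
proof -
 show "cds d (nexp d ` T)"
  using T by (cases rule: Std_cases) (use d in \<open>simp_all add: cds_ty1_0 cds_ty1_1 cds_ty2_0 cds_ty2_1 cds_ty3\<close>)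
 show "T \<subseteq> Nd d"
  using T by (cases rule: Std_cases) (use d in \<open>simp_all add: ty_Nd\<close>)
qed

text \<open>Each plane contains two nonzero elements that differ in a scale-invariant property. For
  \<open>rk\<close> scale invariance is only shown where \<open>cb\<close> holds, hence the extra
  conjunct in the third alternative.\<close>

lemma Std_mixed:
 assumes "T : Std d"
 shows "(\<exists>a\<in>T. \<exists>b\<in>T. a ~= 0 & sq d a & \<not> sq d b) | (\<exists>a\<in>T. \<exists>b\<in>T. a ~= 0 & cb d a & \<not> cb d b) |
  (\<forall>a\<in>T. cb d a) & (\<exists>a\<in>T. \<exists>b\<in>T. a ~= 0 & rk d a & \<not> rk d b)"
proof -
 have t1: "(0, 0, 0, 1) : ty1 \<epsilon>" "(1, 0, (\<epsilon> * 1) *\<^sub>R ax 0, 1) : ty1 \<epsilon>" for \<epsilon>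
  using ty_I(1)[of 0 \<epsilon> 1] ty_I(1)[of 1 \<epsilon> 1] by simp_all
 have "sq d (0, 0, 0, 1)" "(0, 0, 0, 1) ~= (0::nil)" "\<not> sq d (1, 0, (\<epsilon> * 1) *\<^sub>R ax 0, 1)" for \<epsilon>
  by (simp_all add: sq_iff zero_prod_def)
 then have 1: "\<exists>a\<in>ty1 \<epsilon>. \<exists>b\<in>ty1 \<epsilon>. a ~= 0 & sq d a & \<not> sq d b" for \<epsilon> using t1 by blast
 have t2: "(1, 0, 0, 0) : ty2 0" "(0, ax 0, 0, 0) : ty2 \<epsilon>" "(1, 0 *\<^sub>R ax 0, (1 * 1) *\<^sub>R ax 1, 0) : ty2 1" for \<epsilon>
  using ty_I(2)[of 1 0 0] ty_I(2)[of 0 1 \<epsilon>] ty_I(2)[of 1 0 1] by simp_all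
 have "sq d (1, 0, 0, 0)" "(1, 0, 0, 0) ~= (0::nil)" "\<not> sq d (0, ax 0, 0, 0)" by (simp_all add: sq_iff zero_prod_def)
 then have 2: "\<exists>a\<in>ty2 0. \<exists>b\<in>ty2 0. a ~= 0 & sq d a & \<not> sq d b" using t2 by blast
 have n0: "(0, ax 0, 0, 0) ~= (0::nil)" by (simp add: zero_prod_def)
 have "cb d (0, ax 0, 0, 0)" "\<not> cb d (1, 0 *\<^sub>R ax 0, (1 * 1) *\<^sub>R ax 1, 0)" by (simp_all add: cb_iff)
 then have 3: "\<exists>a\<in>ty2 1. \<exists>b\<in>ty2 1. a ~= 0 & cb d a & \<not> cb d b" using t2 n0 by blast
 have cb: "\<forall>w\<in>ty3 \<epsilon>. cb d w" for \<epsilon> using iv1(3)[of d \<epsilon>] unfolding iv_def by simp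
 have t3: "(0, ax 0, 0, 0) : ty3 \<epsilon>" "(0, 1 *\<^sub>R ax 0 + (\<epsilon> * 1) *\<^sub>R ax 2, 1 *\<^sub>R ax 1, 0) : ty3 \<epsilon>" for \<epsilon>
  using ty_I(3)[of 1 \<epsilon> 0] ty_I(3)[of 1 \<epsilon> 1] by simp_all
 have "rk d (0, ax 0, 0, 0)" by (simp add: rk_iff)
 moreover have "\<not> rk d (0, 1 *\<^sub>R ax 0 + (\<epsilon> * 1) *\<^sub>R ax 2, 1 *\<^sub>R ax 1, 0)" for \<epsilon>
 proof -
  have "0 < 1 + \<epsilon> * \<epsilon>" by (simp add: add_pos_nonneg)
  then show ?thesis by (simp add: rk_iff inner_lin_simps)
 qed
 ultimately have 4: "\<exists>a\<in>ty3 \<epsilon>. \<exists>b\<in>ty3 \<epsilon>. a ~= 0 & rk d a & \<not> rk d b" for \<epsilon> using t3 n0 by blast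
 from assms show ?thesis
  by (cases rule: Std_cases) (use 1 2 3 4 cb in blast)+
qed

lemma homogeneous:
 assumes "t ~= 0"
 shows "sq d (t *\<^sub>R w) \<longleftrightarrow> sq d w" "cb d (t *\<^sub>R w) \<longleftrightarrow> cb d w" "cb d w ==> rk d (t *\<^sub>R w) \<longleftrightarrow> rk d w"
proof -
 obtain p x y e where w: "w = (p, x, y, e)" by (cases w)
 have "2 * (t * p) * (t * e) + inner (t *\<^sub>R x) (t *\<^sub>R x) = t * t * (2 * p * e + inner x x)" by (simp add: algebra_simps)
 then show "sq d (t *\<^sub>R w) \<longleftrightarrow> sq d w" using assms unfolding w scaleR_Pair real_scaleR_def sq_iff by auto
 show "cb d (t *\<^sub>R w) \<longleftrightarrow> cb d w" using assms by (simp add: w cb_iff)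
 assume "cb d w"
 then have c: "p = 0 | y = 0" by (simp add: w cb_iff)
 have c': "t * p = 0 | t *\<^sub>R y = 0" using c by auto
 have "inner (t *\<^sub>R x) (t *\<^sub>R x) * inner (t *\<^sub>R y) (t *\<^sub>R y) - (inner (t *\<^sub>R x) (t *\<^sub>R y))\<^sup>2
   = t ^ 4 * (inner x x * inner y y - (inner x y)\<^sup>2)" by (simp add: power2_eq_square power4_eq_xxxx algebra_simps)
 then have "inner (t *\<^sub>R x) (t *\<^sub>R x) * inner (t *\<^sub>R y) (t *\<^sub>R y) = (inner (t *\<^sub>R x) (t *\<^sub>R y))\<^sup>2 \<longleftrightarrow>
   inner x x * inner y y = (inner x y)\<^sup>2"
  using assms by (metis mult_eq_0_iff power_not_zero right_minus_eq)
 then show "rk d (t *\<^sub>R w) \<longleftrightarrow> rk d w"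
  unfolding w scaleR_Pair real_scaleR_def rk_iff[OF c'] rk_iff[OF c] .
qed

lemma zero_invariants: "sq d 0" "cb d 0" "rk d 0"
 by (simp_all add: zero_prod_def sq_iff cb_iff rk_iff)

text \<open>A conjugation into a line would send the two elements of \<open>Std_mixed\<close> to
  nonzero multiples of one vector, where the invariants agree by \<open>homogeneous\<close>.\<close>

lemma line_not_good:
 assumes w: "w : Nd d" and V: "V \<subseteq> range (%t. t *\<^sub>R w)" and d: "1 <= d"
 shows "\<not> good d (nexp d ` V)"
proof
 assume "good d (nexp d ` V)"
 then obtain g T where g: "g : O2 d" "T : Std d" "cj d g (nexp d ` T) \<subseteq> nexp d ` V" unfolding good_def by blast
 have TN: "T \<subseteq> Nd d" by (rule Std_props(2)[OF d g(2)])
 have f: "\<exists>t. g * nexp d a = nexp d (t *\<^sub>R w) * g & (a ~= 0 --> t ~= 0)" if a: "a : T" for a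
 proof -
  have "g * nexp d a * finv d g : nexp d ` V" using g(3) a unfolding cj_def by blast
  then obtain t where t: "g * nexp d a * finv d g = nexp d (t *\<^sub>R w)" using V by blast
  have e: "g * nexp d a = nexp d (t *\<^sub>R w) * g"
   unfolding t[symmetric] by (rule O2_cancel(4)[OF g(1) mult_carrier_mat[OF O2_carrier[OF g(1)] nexp_carrier], symmetric])
  have "a = 0" if "t = 0"
  proof -
   have "g * nexp d a = g" unfolding e that using O2_carrier[OF g(1)] by simp
   then have "finv d g * (g * nexp d a) = finv d g * g" by simp
   then have "nexp d a = nexp d 0" using O2_cancel(1)[OF g(1) nexp_carrier] O2_left[OF g(1)] by simp
   then show ?thesis using a TN by (intro nexp_inject[of a d 0]) auto
  qed
  then show ?thesis using e by blast
 qed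
 have tw: "t *\<^sub>R w : Nd d" for t by (rule subspace_scale[OF subspace_Nd w])
 have inv: "(sq d a \<longleftrightarrow> sq d (t *\<^sub>R w)) & (cb d a \<longleftrightarrow> cb d (t *\<^sub>R w)) & (rk d a \<longleftrightarrow> rk d (t *\<^sub>R w))"
  if a: "a : T" and e: "g * nexp d a = nexp d (t *\<^sub>R w) * g" for a t
  using conj_invariants_iff[OF g(1) subsetD[OF TN a] tw e] by blast
 have key: False if ab: "a : T" "b : T" "a ~= 0" "b ~= 0"
  and Q: "sq d a & \<not> sq d b | cb d a & \<not> cb d b | cb d a & rk d a & \<not> rk d b" for a b
 proof -
  obtain t where t: "g * nexp d a = nexp d (t *\<^sub>R w) * g" "t ~= 0" using f[OF ab(1)] ab(3) by blast
  obtain s where s: "g * nexp d b = nexp d (s *\<^sub>R w) * g" "s ~= 0" using f[OF ab(2)] ab(4) by blast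
  show False using Q inv[OF ab(1) t(1)] inv[OF ab(2) s(1)] homogeneous[OF t(2), of d w] homogeneous[OF s(2), of d w] by blast
 qed
 have nz: "b ~= 0" if "\<not> sq d b | \<not> cb d b | \<not> rk d b" for b using that zero_invariants by blast
 show False using Std_mixed[OF g(2)] key nz by blast
qed

lemma subspace_of_plane:
 fixes V :: "'a::real_vector set"
 assumes V: "subspace V" "!!w. w : V ==> \<exists>\<alpha> \<beta>. w = \<alpha> *\<^sub>R a + \<beta> *\<^sub>R b" and n: "\<not> (a : V & b : V)"
 shows "\<exists>v\<in>V. V \<subseteq> range (%t. t *\<^sub>R v)"
proof (cases "V \<subseteq> {0}")
 case True
 then show ?thesis using subspace_0[OF V(1)] by (intro bexI[of _ 0]) simp_all
next
 case False
 then obtain v where v: "v : V" "v ~= 0" by blast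
 obtain \<alpha> \<beta> where v1: "v = \<alpha> *\<^sub>R a + \<beta> *\<^sub>R b" using V(2)[OF v(1)] by blast
 have "w : range (%t. t *\<^sub>R v)" if w: "w : V" for w
 proof -
  obtain \<gamma> \<delta> where w1: "w = \<gamma> *\<^sub>R a + \<delta> *\<^sub>R b" using V(2)[OF w] by blast
  let ?D = "\<alpha> * \<delta> - \<beta> * \<gamma>"
  show ?thesis
  proof (cases "?D = 0")
   case True
   have "\<alpha> ~= 0 | \<beta> ~= 0" using v(2) v1 by auto
   then have "\<exists>t. \<gamma> = t * \<alpha> & \<delta> = t * \<beta>"
   proof
    assume "\<alpha> ~= 0"
    then show ?thesis using True by (intro exI[of _ "\<gamma> / \<alpha>"]) (simp add: field_simps)
   next
    assume "\<beta> ~= 0"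
    then show ?thesis using True by (intro exI[of _ "\<delta> / \<beta>"]) (simp add: field_simps)
   qed
   then obtain t where "\<gamma> = t * \<alpha>" "\<delta> = t * \<beta>" by blast
   then have "w = t *\<^sub>R v" unfolding w1 v1 by (simp add: scaleR_add_right)
   then show ?thesis by blast
  next
   case False
   have D: "?D *\<^sub>R a = \<delta> *\<^sub>R v - \<beta> *\<^sub>R w" "?D *\<^sub>R b = \<alpha> *\<^sub>R w - \<gamma> *\<^sub>R v"
    unfolding v1 w1 by (simp_all add: algebra_simps)
   have "?D *\<^sub>R a : V" "?D *\<^sub>R b : V" unfolding D by (intro subspace_diff subspace_scale V(1) v(1) w)+
   from subspace_scale[OF V(1) this(1), of "1 / ?D"] subspace_scale[OF V(1) this(2), of "1 / ?D"]
   have "a : V" "b : V" using False by simp_all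
   then show ?thesis using n by blast
  qed
 qed
 then show ?thesis using v(1) by blast
qed

lemma Std_plane:
 assumes "T : Std d" shows "\<exists>a b. T = sp a b"
 using Std_D[OF assms] unfolding insert_iff empty_iff ty1_def ty2_def ty3_def
 by (elim disjE FalseE) (rule exI, rule exI, assumption)+

text \<open>A proper subspace of a plane lies in a line, and by \<open>line_not_good\<close> this
  contradicts \<open>cds_contains_standard\<close>.\<close>

lemma standard_minimal:
 assumes d: "1 <= d" and T: "T : Std d" and H: "cds d H'" "H' \<subseteq> nexp d ` T"
 shows "H' = nexp d ` T"
proof -
 note TN = Std_props(2)[OF d T]
 define V where "V = {u \<in> T. nexp d u : H'}"
 have HV: "H' = nexp d ` V"
 proof (intro subset_antisym subsetI)
  fix A assume A: "A : H'"
  then obtain u where "u : T" "A = nexp d u" using H(2) by blast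
  then show "A : nexp d ` V" using A by (intro image_eqI[of _ _ u]) (simp_all add: V_def)
 next
  fix A assume "A : nexp d ` V"
  then show "A : H'" unfolding V_def by (elim imageE CollectE conjE) (simp only:)
 qed
 have VT: "V \<subseteq> T" unfolding V_def by (rule Collect_restrict)
 note VN = subset_trans[OF VT TN]
 note L = cds_linear[OF H(1)[unfolded HV] VN]
 have G: "good d (nexp d ` V)" by (rule cds_contains_standard[OF H(1)[unfolded HV] VN])
 obtain a b where ab: "T = sp a b" using Std_plane[OF T] by (elim exE)
 have "a : V & b : V"
 proof (rule ccontr)
  assume n: "\<not> (a : V & b : V)"
  have e: "\<exists>\<alpha> \<beta>. w = \<alpha> *\<^sub>R a + \<beta> *\<^sub>R b" if "w : V" for w
   using subsetD[OF VT that] unfolding ab sp_def by (elim CollectE exE conjE) (intro exI)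
  have "\<exists>v\<in>V. V \<subseteq> range (%t. t *\<^sub>R v)" by (rule subspace_of_plane[OF L(1) _ n]) (rule e)
  then obtain v where v: "v : V" "V \<subseteq> range (%t. t *\<^sub>R v)" by (elim bexE)
  show False using line_not_good[OF subsetD[OF VN v(1)] v(2) d] G by (rule notE)
 qed
 then have "T \<subseteq> V" unfolding ab by (intro sp_least[OF L(1)]) (elim conjE, assumption)+
 then have "V = T" using VT by (intro subset_antisym)
 then show ?thesis unfolding HV by (simp only:)
qed

section \<open>Minimality and conjugacy inside SO(2, n)\<close>

lemma cj_subset_finv:
 assumes g: "g : O2 d" and T: "T \<subseteq> Mat d" and S: "S \<subseteq> cj d g T"
 shows "cj d (finv d g) S \<subseteq> T"
 using cj_mono[OF S, of d "finv d g"] unfolding cj_finv(1)[OF g T] .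

lemma cds_carrier_mat: "cds d H ==> H \<subseteq> Mat d"
 unfolding cartan_decomposition_subgroup_def by (rule subset_trans[OF subgroup.subset carrier_SO2_mat]) (rule conjunct1)

lemma minimal_conj_standard:
 assumes d: "1 <= d" and g: "g : O2 d" and T: "T : Std d"
 shows "minimal_cds (d + 2) (cj d g (nexp d ` T))"
 unfolding minimal_cds_def
proof (intro conjI notI)
 show "cds d (cj d g (nexp d ` T))"
  by (rule cds_cj[OF Std_props(1)[OF d T] g])
 assume "\<exists>H'. cds d H' & H' \<subset> cj d g (nexp d ` T)"
 then obtain H' where H': "cds d H'" "H' \<subset> cj d g (nexp d ` T)" by blast
 note Hm = cds_carrier_mat[OF H'(1)]
 have "cj d (finv d g) H' \<subseteq> nexp d ` T"
  by (rule cj_subset_finv[OF g nexp_image_mat psubset_imp_subset[OF H'(2)]])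
 then have "cj d (finv d g) H' = nexp d ` T"
  by (rule standard_minimal[OF d T cds_cj[OF H'(1) O2_finv[OF g]]])
 then have "cj d g (cj d (finv d g) H') = cj d g (nexp d ` T)" by (rule arg_cong)
 then have eq: "cj d g (nexp d ` T) = H'" unfolding cj_finv(2)[OF g Hm] by (rule sym)
 show False using H'(2) unfolding eq by (rule less_irrefl[THEN notE])
qed

lemma rflm_ax0: assumes "1 <= d" shows "rflm d (ax 0) = rf d"
 unfolding rf_def by (rule eq_matI) (use assms in \<open>auto simp: rflm_def diagm_def\<close>)

text \<open>The reflection along \<open>ax 0\<close> preserves every standard plane except
  \<open>ty1 1\<close>, where it changes the sign of y. There it is combined with the negative of
  the identity on the four isotropic coordinates, which has determinant 1 and restores the
  sign.\<close>

lemma standard_reflection: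
 assumes d: "1 <= d" and T: "T : Std d"
 obtains r where "r : O2 d" "det r = - 1" "cj d r (nexp d ` T) = nexp d ` T"
proof -
 define r0 where "r0 = rflm d (ax 0)"
 have r0: "r0 : O2 d" "det r0 = - 1"
  unfolding r0_def rflm_ax0[OF d] by (rule rf_O2[OF d], rule det_rf[OF d])
 define f :: "nil => nil" where "f u = (fst u, rfl (ax 0) (fst (snd u)), rfl (ax 0) (fst (snd (snd u))), snd (snd (snd u)))" for u
 define f' :: "nil => nil" where "f' u = (fst u, - fst (snd u), - fst (snd (snd u)), snd (snd (snd u)))" for u
 note TN = Std_props(2)[OF d T]
 have fe: "r0 * nexp d u = nexp d (f u) * r0" if "u : T" for u
  using that TN d by (cases u) (auto simp: f_def r0_def intro!: nexp_rfl)
 let ?m = "glm d (- 1) 0 0 (- 1)"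
 have m: "?m : O2 d" by (rule glm_O2) simp
 have me: "?m * nexp d u = nexp d (f' u) * ?m" for u
  using nexp_glm[of "- 1" "- 1" 0 0 _ d] by (cases u) (simp add: f'_def)
 have dm: "det ?m = 1"
 proof -
  have "?m = dg d (- 1) (- 1)" by (rule eq_matI) (auto simp: glm_def dg_def diagm_def)
  then show ?thesis by (simp add: det_dg)
 qed
 have add: "rfl w (a + b) = rfl w a + rfl w b" for w a b
  using rfl_linear[of w 1 a 1 b] by simp
 have axr: "rfl (ax 0) (ax 1) = ax 1" "rfl (ax 0) (ax 2) = ax 2" "rfl (ax 0) (ax 0) = - ax 0"
  by (simp_all add: rfl_def scaleR_2)
 have mn: "rfl (ax 0) (- a) = - rfl (ax 0) a" for a using rfl_scaleR[of "ax 0" "- 1" a] by simp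
 note R = add axr rfl_scaleR mn
 have f1: "f (p, 0, c *\<^sub>R ax 0, e) = (p, 0, (- c) *\<^sub>R ax 0, e)" for p c e
  unfolding f_def fst_conv snd_conv rfl_scaleR axr rfl_zero by simp
 have f2: "f (p, s *\<^sub>R ax 0 + c *\<^sub>R ax 2, r *\<^sub>R ax 1, e) = (p, (- s) *\<^sub>R ax 0 + c *\<^sub>R ax 2, r *\<^sub>R ax 1, e)" for p s c r e
  unfolding f_def fst_conv snd_conv add rfl_scaleR axr by simp
 have f3: "f (p, s *\<^sub>R ax 0, r *\<^sub>R ax 1, e) = (p, (- s) *\<^sub>R ax 0, r *\<^sub>R ax 1, e)" for p s r e
  using f2[of p s 0 r e] by simp
 have f4: "f' (p, 0, c *\<^sub>R ax 0, e) = (p, 0, (- c) *\<^sub>R ax 0, e)" for p c e by (simp add: f'_def)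
 have I: "F ` T = T" if "!!u. u : T ==> F u : T" "!!u. u : T ==> F (F u) = u" for F :: "nil => nil"
 proof (intro subset_antisym subsetI)
  show "u : T" if "u : F ` T" for u using that \<open>!!u. u : T ==> F u : T\<close> by blast
  show "u : F ` T" if "u : T" for u
   by (rule image_eqI[of _ _ "F u"]) (simp_all add: that \<open>!!u. u : T ==> F u : T\<close> \<open>!!u. u : T ==> F (F u) = u\<close>)
 qed
 have c1: "cj d r0 (nexp d ` T) = nexp d ` f ` T" by (rule cj_nexp_image[OF r0(1) fe])
 have c2: "cj d ?m (nexp d ` f ` T) = nexp d ` f' ` f ` T" by (rule cj_nexp_image[OF m me])
 show ?thesis
 proof (cases "T = ty1 1")
  case True
  have "(%u. f' (f u)) ` T = T"
  proof (rule I)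
   fix u assume "u : T"
   then obtain p e where u: "u = (p, 0, (1 * p) *\<^sub>R ax 0, e)" unfolding True by (rule ty1_E)
   show "f' (f u) : T" "f' (f (f' (f u))) = u" unfolding u f1 f4 True minus_minus by (rule ty_I(1), rule refl)
  qed
  moreover have "cj d (?m * r0) (nexp d ` T) = nexp d ` f' ` f ` T"
   by (simp only: cj_cj[OF m r0(1) nexp_image_mat, symmetric] c1 c2)
  ultimately have "cj d (?m * r0) (nexp d ` T) = nexp d ` T" by (simp only: image_image)
  moreover have "det (?m * r0) = - 1" using r0 dm det_mult[OF O2_carrier[OF m] O2_carrier[OF r0(1)]] by simp
  ultimately show ?thesis using that O2_mult[OF m r0(1)] by blast
 next
  case False
  have "f ` T = T"
  proof (rule I)
   fix u assume u: "u : T"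
   have t1: "f u : ty1 0 & f (f u) = u" if h: "u : ty1 0"
   proof -
    obtain p e where u: "u = (p, 0, (0 * p) *\<^sub>R ax 0, e)" using h by (rule ty1_E)
    have "f u = u" unfolding u f1 by simp
    then show ?thesis using h by simp
   qed
   have t2: "f u : ty2 \<epsilon> & f (f u) = u" if h: "u : ty2 \<epsilon>" for \<epsilon>
   proof -
    obtain p s where u: "u = (p, s *\<^sub>R ax 0, (\<epsilon> * p) *\<^sub>R ax 1, 0)" using h by (rule ty2_E)
    show ?thesis unfolding u f3 minus_minus by (rule conjI[OF ty_I(2) refl])
   qed
   have t3: "f u : ty3 \<epsilon> & f (f u) = u" if h: "u : ty3 \<epsilon>" for \<epsilon>
   proof -
    obtain s r where u: "u = (0, s *\<^sub>R ax 0 + (\<epsilon> * r) *\<^sub>R ax 2, r *\<^sub>R ax 1, 0)" using h by (rule ty3_E)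
    show ?thesis unfolding u f2 minus_minus by (rule conjI[OF ty_I(3) refl])
   qed
   have "T = ty1 0 | T = ty2 0 | T = ty2 1 | T = ty3 0 | T = ty3 1" using Std_D[OF T] False by blast
   then have "f u : T & f (f u) = u" using u t1 t2[of 0] t2[of 1] t3[of 0] t3[of 1] by (elim disjE) (simp_all only:)
   then show "f u : T" "f (f u) = u" by (rule conjunct1, rule conjunct2)
  qed
  then have "cj d r0 (nexp d ` T) = nexp d ` T" using c1 by simp
  then show ?thesis using that r0 by blast
 qed
qed

lemma SO2_conj_standard:
 assumes d: "1 <= d" and T: "T : Std d" and g: "g : O2 d"
 obtains g' where "g' : carrier (SO d)" "cj d g' (nexp d ` T) = cj d g (nexp d ` T)"
proof (cases "det g = 1")
 case True
 then show ?thesis using that[of g] carrier_SO2_I[OF g] by blast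
next
 case False
 then have dg: "det g = - 1" using det_O2[OF g] by blast
 obtain r where r: "r : O2 d" "det r = - 1" "cj d r (nexp d ` T) = nexp d ` T" by (rule standard_reflection[OF d T])
 have "det (g * r) = 1" using dg r det_mult[OF O2_carrier[OF g] O2_carrier[OF r(1)]] by simp
 then show ?thesis using that[OF carrier_SO2_I[OF O2_mult[OF g r(1)]]] cj_cj[OF g r(1) nexp_image_mat, of T] r(3) by simp
qed

lemma conj_subgroups_iff:
 assumes H: "H \<subseteq> Mat d"
 shows "conj_subgroups (d + 2) H K \<longleftrightarrow> (\<exists>g\<in>carrier (SO d). K = cj d g H)"
proof -
 have "g <#\<^bsub>SO d\<^esub> (H #>\<^bsub>SO d\<^esub> inv\<^bsub>SO d\<^esub> g) = cj d g H" if g: "g : carrier (SO d)" for g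
 proof -
  have gc: "g : Mat d" using g carrier_SO2_mat by blast
  have "g * (A * finv d g) = g * A * finv d g" if "A : H" for A
   using assoc_mult_mat[OF gc _ finv_carrier, of A] H that by auto
  then show ?thesis unfolding l_coset_def r_coset_def cj_def inv_SO2[OF g] SO2_mult by auto
 qed
 then show ?thesis unfolding conj_subgroups_def by auto
qed

text \<open>The conjugate of a standard plane inside \<open>H\<close> is itself a
  Cartan-decomposition subgroup, so by minimality it is all of \<open>H\<close>. The conjugating
  isometry is then replaced by one of determinant 1.\<close>

lemma minimal_cds_in_N_standard:
 assumes d: "1 <= d" and H: "H : minimal_cds_in_N (d + 2)"
 obtains g T where "g : carrier (SO d)" "T : Std d" "H = cj d g (nexp d ` T)"
proof -
 have cds: "cds d H" and mn: "!!H'. cds d H' ==> \<not> H' \<subset> H"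
  and HN: "H \<subseteq> nexp d ` Nd d"
  using H unfolding minimal_cds_in_N_def minimal_cds_def unipotent_N_eq by blast+
 define V where "V = {u \<in> Nd d. nexp d u : H}"
 have HV: "H = nexp d ` V" and VN: "V \<subseteq> Nd d" using HN unfolding V_def by blast+
 have "good d H" using cds_contains_standard[OF cds[unfolded HV] VN] unfolding HV .
 then obtain h T where h: "h : O2 d" "T : Std d" "cj d h (nexp d ` T) \<subseteq> H" unfolding good_def by blast
 have e: "cj d h (nexp d ` T) = H" using mn[OF cds_cj[OF Std_props(1)[OF d h(2)] h(1)]] h(3) by blast
 obtain g where "g : carrier (SO d)" "cj d g (nexp d ` T) = cj d h (nexp d ` T)" by (rule SO2_conj_standard[OF d h(2,1)])
 then show ?thesis using that[of g T] h(2) e by blast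
qed

lemma standard_in_minimal:
 assumes d: "1 <= d" and T: "T : Std d" shows "nexp d ` T : minimal_cds_in_N (d + 2)"
 using minimal_conj_standard[OF d O2_one T] Std_props(2)[OF d T]
 unfolding minimal_cds_in_N_def cj_one[OF nexp_image_mat] unipotent_N_eq by blast

lemma Std_abelian:
 assumes S: "S : Std d" "a : S" "b : S" shows "nmul a b = a + b & a + b : S"
proof -
 obtain \<epsilon> where "S = ty1 \<epsilon> | S = ty2 \<epsilon> | S = ty3 \<epsilon>" using Std_D[OF S(1)] by blast
 then have "nbr a b = 0 & a + b : S"
 proof (elim disjE)
  assume e: "S = ty1 \<epsilon>" show ?thesis using S(2,3) unfolding e by (intro conjI ty_nbr(1) subspace_add ty_subspace(1))
 next
  assume e: "S = ty2 \<epsilon>" show ?thesis using S(2,3) unfolding e by (intro conjI ty_nbr(2) subspace_add ty_subspace(2))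
 next
  assume e: "S = ty3 \<epsilon>" show ?thesis using S(2,3) unfolding e by (intro conjI ty_nbr(3) subspace_add ty_subspace(3))
 qed
 then show ?thesis using nmul_commuting by blast
qed

text \<open>Transports the third and fourth entry of \<open>iv\<close> along the relation of being
  conjugate by a fixed isometry.\<close>

lemma additive_transfer:
 fixes A B :: "'a::plus set"
 assumes ex: "\<exists>a\<in>A. \<exists>a'\<in>A. Q a & Q a' & \<not> Q (a + a')" and R1: "!!a. a : A ==> \<exists>b\<in>B. R a b"
  and R2: "!!a b a' b'. a : A ==> b : B ==> R a b ==> a' : A ==> b' : B ==> R a' b' ==>
    a + a' : A & b + b' : B & R (a + a') (b + b')"
  and Q: "!!a b. a : A ==> b : B ==> R a b ==> Q a = Q b"
 shows "\<exists>b\<in>B. \<exists>b'\<in>B. Q b & Q b' & \<not> Q (b + b')"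
proof -
 obtain a a' where a: "a : A" "a' : A" "Q a" "Q a'" "\<not> Q (a + a')" using ex by blast
 obtain b where b: "b : B" "R a b" using R1[OF a(1)] by blast
 obtain b' where b': "b' : B" "R a' b'" using R1[OF a(2)] by blast
 note s = R2[OF a(1) b a(2) b']
 show ?thesis
 proof (intro bexI conjI)
  show "Q b" using Q[OF a(1) b] a(3) by simp
  show "Q b'" using Q[OF a(2) b'] a(4) by simp
  show "\<not> Q (b + b')" using Q[of "a + a'" "b + b'"] s a(5) by simp
 qed (fact b b')+
qed

lemma iv_sel:
 "fst (iv d T) \<longleftrightarrow> (\<forall>u\<in>T. cb d u)" "fst (snd (iv d T)) \<longleftrightarrow> (\<exists>u\<in>T. u ~= 0 & sq d u)"
 "fst (snd (snd (iv d T))) \<longleftrightarrow> (\<exists>u\<in>T. \<exists>v\<in>T. sq d u & sq d v & \<not> sq d (u + v))"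
 "snd (snd (snd (iv d T))) \<longleftrightarrow> (\<exists>u\<in>T. \<exists>v\<in>T. rk d u & rk d v & \<not> rk d (u + v))"
 unfolding iv_def fst_conv snd_conv by (rule refl)+

text \<open>Conjugation matches the elements of the two planes and respects \<open>sq\<close>,
  \<open>cb\<close> and \<open>rk\<close>. It also respects sums, because in an abelian plane the
  exponential of a sum is a product. Hence all entries of \<open>iv\<close> agree.\<close>

lemma standard_not_conj:
 assumes d: "1 <= d" and T: "T : Std d" "T' : Std d" and g: "g : O2 d" and e: "cj d g (nexp d ` T) = nexp d ` T'"
 shows "T = T'"
proof (rule iv_ty_inj[OF Std_D[OF T(1)] Std_D[OF T(2)], of d])
 have imp: "(fst (iv d A) --> fst (iv d B)) & (fst (snd (iv d A)) --> fst (snd (iv d B))) &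
   (fst (snd (snd (iv d A))) --> fst (snd (snd (iv d B)))) & (snd (snd (snd (iv d A))) --> snd (snd (snd (iv d B))))"
  if AB: "A : Std d" "B : Std d" and h: "h : O2 d" "cj d h (nexp d ` A) = nexp d ` B" for A B h
 proof -
  note N = Std_props(2)[OF d AB(1)] Std_props(2)[OF d AB(2)]
  have el: "h * nexp d a = nexp d b * h" if "h * nexp d a * finv d h = nexp d b" for a b
   unfolding that[symmetric] by (rule O2_cancel(4)[OF h(1) mult_carrier_mat[OF O2_carrier[OF h(1)] nexp_carrier], symmetric])
  have fwd: "\<exists>b\<in>B. h * nexp d a = nexp d b * h" if "a : A" for a
  proof -
   have "h * nexp d a * finv d h : nexp d ` B" using that unfolding h(2)[symmetric] cj_def by blast
   then show ?thesis using el by blast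
  qed
  have bwd: "\<exists>a\<in>A. h * nexp d a = nexp d b * h" if "b : B" for b
  proof -
   have "nexp d b : cj d h (nexp d ` A)" using that unfolding h(2) by blast
   then obtain a where "a : A" "h * nexp d a * finv d h = nexp d b" unfolding cj_def by auto
   then show ?thesis using el by blast
  qed
  have inv: "sq d a \<longleftrightarrow> sq d b" "cb d a \<longleftrightarrow> cb d b" "rk d a \<longleftrightarrow> rk d b"
   if "a : A" "b : B" "h * nexp d a = nexp d b * h" for a b
   using conj_invariants_iff[OF h(1) subsetD[OF N(1) that(1)] subsetD[OF N(2) that(2)] that(3)] by blast+
  have sum: "h * nexp d (a + a') = nexp d (b + b') * h"
   if "a : A" "b : B" "h * nexp d a = nexp d b * h" "a' : A" "b' : B" "h * nexp d a' = nexp d b' * h" for a b a' b'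
  proof -
   have m: "nmul a a' = a + a'" "nmul b b' = b + b'"
    using Std_abelian[OF AB(1) that(1,4)] Std_abelian[OF AB(2) that(2,5)] by blast+
   show ?thesis
    using nexp_conj_mult[OF h(1) subsetD[OF N(1) that(1)] subsetD[OF N(2) that(2)] subsetD[OF N(1) that(4)] subsetD[OF N(2) that(5)] that(3,6)]
    unfolding m .
  qed
  have nz: "b ~= 0" if "a : A" "b : B" "h * nexp d a = nexp d b * h" "a ~= 0" for a b
  proof
   assume "b = 0"
   then have "h * nexp d a = h" using that(3) O2_carrier[OF h(1)] by simp
   then have "finv d h * (h * nexp d a) = finv d h * h" by simp
   then have "nexp d a = nexp d 0" using O2_cancel(1)[OF h(1) nexp_carrier] O2_left[OF h(1)] by simp
   then show False using that(1,4) N(1) nexp_inject[of a d 0] by auto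
  qed
  have 1: "\<forall>b\<in>B. cb d b" if "\<forall>a\<in>A. cb d a" using that bwd inv(2) by blast
  have 2: "\<exists>b\<in>B. b ~= 0 & sq d b" if ex: "\<exists>a\<in>A. a ~= 0 & sq d a"
  proof -
   obtain a where a: "a : A" "a ~= 0" "sq d a" using ex by (elim bexE conjE)
   obtain b where b: "b : B" "h * nexp d a = nexp d b * h" using fwd[OF a(1)] by blast
   show ?thesis using b(1) nz[OF a(1) b a(2)] inv(1)[OF a(1) b] a(3) by blast
  qed
  define R where "R a b \<longleftrightarrow> h * nexp d a = nexp d b * h" for a b
  have R1: "\<exists>b\<in>B. R a b" if "a : A" for a unfolding R_def by (rule fwd[OF that])
  have R2: "a + a' : A & b + b' : B & R (a + a') (b + b')"
   if r: "a : A" "b : B" "R a b" "a' : A" "b' : B" "R a' b'" for a b a' b'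
  proof (intro conjI)
   show "a + a' : A" using Std_abelian[OF AB(1) r(1,4)] by (rule conjunct2)
   show "b + b' : B" using Std_abelian[OF AB(2) r(2,5)] by (rule conjunct2)
   show "R (a + a') (b + b')" using r(3,6) unfolding R_def by (rule sum[OF r(1,2) _ r(4,5)])
  qed
  have i1: "sq d a = sq d b" if "a : A" "b : B" "R a b" for a b by (rule inv(1)[OF that(1,2) that(3)[unfolded R_def]])
  have i3: "rk d a = rk d b" if "a : A" "b : B" "R a b" for a b by (rule inv(3)[OF that(1,2) that(3)[unfolded R_def]])
  show ?thesis unfolding iv_sel
  proof (intro conjI impI, goal_cases)
   case 1 show ?case by (rule \<open>\<forall>a\<in>A. cb d a ==> \<forall>b\<in>B. cb d b\<close>[OF 1])
  next
   case 2 show ?case by (rule \<open>\<exists>a\<in>A. a ~= 0 & sq d a ==> \<exists>b\<in>B. b ~= 0 & sq d b\<close>[OF 2])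
  next
   case 3 show ?case by (rule additive_transfer[where R = R and Q = "sq d", OF 3 R1 R2 i1])
  next
   case 4 show ?case by (rule additive_transfer[where R = R and Q = "rk d", OF 4 R1 R2 i3])
  qed
 qed
 \<comment> \<open>The inverse isometry gives the implications in the other direction.\<close>
 have e': "cj d (finv d g) (nexp d ` T') = nexp d ` T" unfolding e[symmetric] by (rule cj_finv(1)[OF g nexp_image_mat])
 show "iv d T = iv d T'"
  using imp[OF T g e] imp[OF T(2,1) O2_finv[OF g] e'] by (intro prod_eqI) satx+
qed

section \<open>Lie algebras\<close>

definition nilX :: "nat => nil => real mat" where
 "nilX d u = (case u of (p, x, y, e) => nil_mat (d + 2) p (vec d (fcoord x)) (vec d (fcoord y)) e)"

lemma nilX_carrier [simp]: "nilX d u : Mat d"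
proof -
 obtain p x y e where u: "u = (p, x, y, e)" by (cases u)
 have e: "d + 2 + 2 = d + 4" by simp
 show ?thesis unfolding nilX_def u prod.case nil_mat_def e by (rule mat_carrier)
qed

lemma nilX_dim [simp]: "dim_row (nilX d u) = d + 4" "dim_col (nilX d u) = d + 4"
 by (rule carrier_matD[OF nilX_carrier])+

lemma nilX_index:
 fixes p e :: real and x y :: fsv and d :: nat
 defines "h \<equiv> nilX d (p, x, y, e)"
 shows "h $$ (0, 0) = 0" "h $$ (0, 1) = p" "h $$ (0, d + 2) = e" "h $$ (0, d + 3) = 0"
  "h $$ (1, 0) = 0" "h $$ (1, 1) = 0" "h $$ (1, d + 2) = 0" "h $$ (1, d + 3) = - e"
  "h $$ (d + 2, 0) = 0" "h $$ (d + 2, 1) = 0" "h $$ (d + 2, d + 2) = 0" "h $$ (d + 2, d + 3) = - p"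
  "h $$ (d + 3, 0) = 0" "h $$ (d + 3, 1) = 0" "h $$ (d + 3, d + 2) = 0" "h $$ (d + 3, d + 3) = 0"
  "k < d ==> h $$ (0, k + 2) = fcoord x k" "k < d ==> h $$ (1, k + 2) = fcoord y k"
  "k < d ==> h $$ (d + 2, k + 2) = 0" "k < d ==> h $$ (d + 3, k + 2) = 0"
  "k < d ==> h $$ (k + 2, 0) = 0" "k < d ==> h $$ (k + 2, 1) = 0"
  "k < d ==> h $$ (k + 2, d + 2) = - fcoord y k" "k < d ==> h $$ (k + 2, d + 3) = - fcoord x k"
  "k < d ==> l < d ==> h $$ (k + 2, l + 2) = 0"
 unfolding h_def nilX_def nil_mat_def by auto

lemma nilX_scaleR: "nilX d (t *\<^sub>R u) = t \<cdot>\<^sub>m nilX d u"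
proof (rule eq_matI)
 obtain p x y e where u: "u = (p, x, y, e)" by (cases u)
 fix i j assume "i < dim_row (t \<cdot>\<^sub>m nilX d u)" "j < dim_col (t \<cdot>\<^sub>m nilX d u)"
 then have i: "i < d + 4" and j: "j < d + 4" by simp_all
 have e: "(t \<cdot>\<^sub>m nilX d u) $$ (i, j) = t * nilX d u $$ (i, j)" using i j by simp
 show "nilX d (t *\<^sub>R u) $$ (i, j) = (t \<cdot>\<^sub>m nilX d u) $$ (i, j)"
  unfolding e u scaleR_Pair
  by (cases rule: index_cases[OF i]; cases rule: index_cases[OF j]) (simp_all add: nilX_index)
qed simp_all

text \<open>The common shape of the powers from the second to the fourth. When the middle part of
  row 0 is a multiple of y, a further factor preserves the shape.\<close>

definition ut :: "nat => (nat => real) => (nat => real) => real => real => real => real => real mat" where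
 "ut d f g a b c q = mat (d + 4) (d + 4) (%(i, j).
   if i = 0 then (if j = d + 3 then b else if j = d + 2 then a else if 2 <= j then f (j - 2) else 0)
   else if i = 1 then (if j = d + 3 then q else if j = d + 2 then c else 0)
   else if i < d + 2 & j = d + 3 then g (i - 2) else 0)"

lemma ut_carrier [simp]: "ut d f g a b c q : Mat d"
 by (simp add: ut_def)

lemma ut_mult_nilX:
 assumes x: "x : Rd d" and y: "y : Rd d"
 shows "ut d (%k. r * fcoord y k) g a b c q * nilX d (p, x, y, e)
  = ut d (%_. 0) (%_. 0) (- r * inner y y) (- r * inner y x - p * a) 0 (- p * c)"
proof (rule eq_matI)
 let ?A = "ut d (%k. r * fcoord y k) g a b c q" and ?R = "ut d (%_. 0) (%_. 0) (- r * inner y y) (- r * inner y x - p * a) 0 (- p * c)"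
 fix i j assume "i < dim_row ?R" "j < dim_col ?R"
 then have i: "i < d + 4" and j: "j < d + 4" by (simp_all add: ut_def)
 have s: "(\<Sum>k<d. r * fcoord y k * - fcoord z k) = - r * inner y z" for z
  unfolding inner_Rd[OF y] by (simp add: sum_distrib_left sum_negf mult.assoc)
 have S: "(\<Sum>k<d. ?A $$ (i, k + 2) * nilX d (p, x, y, e) $$ (k + 2, j)) =
   (if i = 0 then (if j = d + 2 then - r * inner y y else if j = d + 3 then - r * inner y x else 0) else 0)"
 proof (cases "i = 0")
  case True
  have "(\<Sum>k<d. ?A $$ (i, k + 2) * nilX d (p, x, y, e) $$ (k + 2, j)) = (\<Sum>k<d. r * fcoord y k * nilX d (p, x, y, e) $$ (k + 2, j))"
   by (rule sum.cong[OF refl]) (simp add: True ut_def)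
  also have "\<dots> = (if j = d + 2 then - r * inner y y else if j = d + 3 then - r * inner y x else 0)"
   by (cases rule: index_cases[OF j]) (simp_all add: nilX_index s del: mult_minus_right)
  finally show ?thesis using True by simp
 next
  case False
  then have "(\<Sum>k<d. ?A $$ (i, k + 2) * nilX d (p, x, y, e) $$ (k + 2, j)) = 0"
   by (intro sum.neutral ballI) (use i in \<open>simp add: ut_def\<close>)
  then show ?thesis using False by simp
 qed
 show "(?A * nilX d (p, x, y, e)) $$ (i, j) = ?R $$ (i, j)"
  unfolding index_mult_sum[OF ut_carrier nilX_carrier i j] sum_split S
  by (cases rule: index_cases[OF i]; cases rule: index_cases[OF j]) (simp_all add: ut_def nilX_index)
qed (simp_all add: ut_def)

lemma nilX_square:
 assumes x: "x : Rd d" and y: "y : Rd d"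
 shows "nilX d (p, x, y, e) * nilX d (p, x, y, e)
  = ut d (%k. p * fcoord y k) (%k. p * fcoord y k) (- inner x y) (- 2 * p * e - inner x x) (- inner y y) (- inner x y)"
  (is "?X * ?X = ?R")
proof (rule eq_matI)
 fix i j assume "i < dim_row ?R" "j < dim_col ?R"
 then have i: "i < d + 4" and j: "j < d + 4" by (simp_all add: ut_def)
 have s: "(\<Sum>k<d. fcoord a k * - fcoord z k) = - inner a z" if "a : Rd d" for a z
  unfolding inner_Rd[OF that] by (simp add: sum_negf)
 have ic: "inner y x = inner x y" by (rule inner_commute)
 have S: "(\<Sum>k<d. ?X $$ (i, k + 2) * ?X $$ (k + 2, j)) =
   (if i = 0 then (if j = d + 2 then - inner x y else if j = d + 3 then - inner x x else 0)
    else if i = 1 then (if j = d + 2 then - inner y y else if j = d + 3 then - inner x y else 0) else 0)"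
  by (cases rule: index_cases[OF i]; cases rule: index_cases[OF j])
   (simp_all add: nilX_index s[OF x] s[OF y] ic del: mult_minus_right)
 show "(?X * ?X) $$ (i, j) = ?R $$ (i, j)"
  unfolding index_mult_sum[OF nilX_carrier nilX_carrier i j] sum_split S
  by (cases rule: index_cases[OF i]; cases rule: index_cases[OF j]) (simp_all add: ut_def nilX_index)
qed (simp_all add: ut_def)

lemma sum_fact_5:
 fixes h :: "nat => real"
 shows "(\<Sum>k<5. h k / fact k) = h 0 + h 1 + h 2 / 2 + h 3 / 6 + h 4 / 24"
proof -
 have "{..<5::nat} = {0, 1, 2, 3, 4}" by auto
 moreover have "fact 2 = (2::real)" "fact 3 = (6::real)" "fact 4 = (24::real)" by (simp_all add: fact_numeral)
 ultimately show ?thesis by simp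
qed

lemma pow_mat_numerals:
 "X ^\<^sub>m 2 = X ^\<^sub>m 1 * X" "X ^\<^sub>m 3 = X ^\<^sub>m 2 * X" "X ^\<^sub>m 4 = X ^\<^sub>m 3 * X" "X ^\<^sub>m 5 = X ^\<^sub>m 4 * X"
proof -
 have n: "(2::nat) = Suc 1" "(3::nat) = Suc 2" "(4::nat) = Suc 3" "(5::nat) = Suc 4" by simp_all
 show "X ^\<^sub>m 2 = X ^\<^sub>m 1 * X" by (subst n(1)) (rule pow_mat.simps(2))
 show "X ^\<^sub>m 3 = X ^\<^sub>m 2 * X" by (subst n(2)) (rule pow_mat.simps(2))
 show "X ^\<^sub>m 4 = X ^\<^sub>m 3 * X" by (subst n(3)) (rule pow_mat.simps(2))
 show "X ^\<^sub>m 5 = X ^\<^sub>m 4 * X" by (subst n(4)) (rule pow_mat.simps(2))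
qed

text \<open>The fifth power vanishes, so the series consists of five terms.\<close>

lemma mat_exp_nilX:
 assumes u: "u : Nd d" shows "mat_exp (nilX d u) = nexp d u"
proof (rule eq_matI)
 obtain p x y e where uu: "u = (p, x, y, e)" by (cases u)
 have R: "x : Rd d" "y : Rd d" using u by (simp_all add: uu)
 let ?X = "nilX d u"
 have P1: "?X ^\<^sub>m 1 = ?X"
  unfolding One_nat_def pow_mat.simps nilX_dim by (rule left_mult_one_mat[OF nilX_carrier])
 have P2: "?X ^\<^sub>m 2 = ut d (%k. p * fcoord y k) (%k. p * fcoord y k) (- inner x y) (- 2 * p * e - inner x x) (- inner y y) (- inner x y)"
  unfolding pow_mat_numerals(1) P1 unfolding uu by (rule nilX_square[OF R])
 have P3: "?X ^\<^sub>m 3 = ut d (%_. 0) (%_. 0) (- p * inner y y) 0 0 (p * inner y y)"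
 proof -
  have a: "- p * inner y x - p * (- inner x y) = 0" "- p * (- inner y y) = p * inner y y" by (simp_all add: inner_commute)
  show ?thesis unfolding pow_mat_numerals(2) P2 unfolding uu ut_mult_nilX[OF R] a ..
 qed
 have z: "ut d (%_. 0) g a b c q * nilX d (p, x, y, e) = ut d (%_. 0) (%_. 0) 0 (- p * a) 0 (- p * c)" for g a b c q
 proof -
  have "(%k. 0 * fcoord y k) = (%_. 0)" by simp
  then show ?thesis using ut_mult_nilX[OF R, of 0 g a b c q p e] by (simp only: mult_zero_left minus_zero diff_0)
   (simp only: mult_minus_left)
 qed
 have P4: "?X ^\<^sub>m 4 = ut d (%_. 0) (%_. 0) 0 (p * (p * inner y y)) 0 0"
 proof -
  have a: "- p * (- p * inner y y) = p * (p * inner y y)" "- p * 0 = 0" by simp_all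
  show ?thesis unfolding pow_mat_numerals(3) P3 unfolding uu z a ..
 qed
 have zz: "- p * 0 = 0" by simp
 have Pz: "?X ^\<^sub>m (k + 5) = ut d (%_. 0) (%_. 0) 0 0 0 0" for k
 proof (induction k)
  case 0
  show ?case unfolding add_0 pow_mat_numerals(4) P4 unfolding uu z zz ..
 next
  case (Suc k)
  show ?case unfolding add_Suc pow_mat.simps Suc unfolding uu z zz ..
 qed
 fix i j assume "i < dim_row (nexp d u)" "j < dim_col (nexp d u)"
 then have i: "i < d + 4" and j: "j < d + 4" by simp_all
 have z5: "(?X ^\<^sub>m k) $$ (i, j) = 0" if "k \<notin> {..<5}" for k
 proof -
  have k: "k = (k - 5) + 5" using that by simp
  show ?thesis by (subst k, subst Pz) (use i j in \<open>simp add: ut_def\<close>)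
 qed
 note dm = nilX_dim[of d u]
 have "mat_exp ?X $$ (i, j) = (\<Sum>k. (?X ^\<^sub>m k) $$ (i, j) / fact k)"
  unfolding mat_exp_def using i j dm by simp
 also have "\<dots> = (\<Sum>k<5. (?X ^\<^sub>m k) $$ (i, j) / fact k)"
 proof (rule suminf_finite)
  show "(?X ^\<^sub>m k) $$ (i, j) / fact k = 0" if "k \<notin> {..<5}" for k unfolding z5[OF that] by (rule div_0)
 qed simp
 also have "\<dots> = (?X ^\<^sub>m 0) $$ (i, j) + (?X ^\<^sub>m 1) $$ (i, j) + (?X ^\<^sub>m 2) $$ (i, j) / 2 + (?X ^\<^sub>m 3) $$ (i, j) / 6 + (?X ^\<^sub>m 4) $$ (i, j) / 24"
  by (rule sum_fact_5)
 also have "\<dots> = nexp d u $$ (i, j)"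
  unfolding P1 P2 P3 P4 pow_mat.simps nilX_dim unfolding uu
  by (cases rule: index_cases[OF i]; cases rule: index_cases[OF j])
   (simp_all add: nexp_index nilX_index ut_def power2_eq_square add_divide_distrib diff_divide_distrib)
 finally show "mat_exp ?X $$ (i, j) = nexp d u $$ (i, j)" .
qed (simp_all add: mat_exp_def)

section \<open>The exponential of an arbitrary matrix\<close>

lemma pow_entry_bound:
 assumes X: "X : carrier_mat m m" and M: "!!i j. i < m ==> j < m ==> \<bar>X $$ (i, j)\<bar> <= M" "0 <= M"
  and ij: "i < m" "j < m"
 shows "\<bar>(X ^\<^sub>m k) $$ (i, j)\<bar> <= (1 + real m * M) ^ k"
 using ij
proof (induction k arbitrary: i j)
 case 0
 then show ?case using X by simp
next
 case (Suc k)
 have "\<bar>(X ^\<^sub>m Suc k) $$ (i, j)\<bar> = \<bar>\<Sum>l<m. (X ^\<^sub>m k) $$ (i, l) * X $$ (l, j)\<bar>"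
  using index_mult_sum[OF pow_carrier_mat[OF X] X Suc.prems, of k] by simp
 also have "\<dots> <= real m * ((1 + real m * M) ^ k * M)"
  by (rule abs_mult_sum_le) (use Suc M in auto)
 also have "\<dots> <= (1 + real m * M) ^ Suc k" using M(2) by (simp add: algebra_simps)
 finally show ?case .
qed

lemma mat_entry_bound:
 fixes X :: "real mat"
 shows "\<exists>M\<ge>0. \<forall>i<m. \<forall>j<m. \<bar>X $$ (i, j)\<bar> <= M"
proof (intro exI conjI allI impI)
 let ?M = "\<Sum>i<m. \<Sum>j<m. \<bar>X $$ (i, j)\<bar>"
 show "0 <= ?M" by (intro sum_nonneg) simp
 fix i j assume ij: "i < m" "j < m"
 have "\<bar>X $$ (i, j)\<bar> <= (\<Sum>j<m. \<bar>X $$ (i, j)\<bar>)" using ij by (intro member_le_sum) auto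
 also have "\<dots> <= ?M" using ij by (intro member_le_sum[of i "{..<m}" "%i. \<Sum>j<m. \<bar>X $$ (i, j)\<bar>"]) (auto intro: sum_nonneg)
 finally show "\<bar>X $$ (i, j)\<bar> <= ?M" .
qed

lemma summable_exp_entries:
 fixes X :: "real mat"
 assumes X: "X : carrier_mat m m" and ij: "i < m" "j < m"
 shows "summable (%k. (X ^\<^sub>m k) $$ (i, j) / fact k)"
proof -
 obtain M where M0: "0 <= M" "\<forall>i<m. \<forall>j<m. \<bar>X $$ (i, j)\<bar> <= M" using mat_entry_bound[of m X] by blast
 have M: "0 <= M" "!!i j. i < m ==> j < m ==> \<bar>X $$ (i, j)\<bar> <= M" using M0 by blast+
 have "summable (%k. (1 + real m * M) ^ k / fact k)"
  using summable_exp[of "1 + real m * M"] by (simp add: field_simps)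
 then show ?thesis
  by (rule summable_comparison_test') (use pow_entry_bound[OF X M(2,1) ij] in \<open>simp add: divide_right_mono\<close>)
qed

lemma mat_exp_index:
 fixes X :: "real mat"
 assumes "X : carrier_mat m m" "i < m" "j < m"
 shows "mat_exp X $$ (i, j) = (\<Sum>k. (X ^\<^sub>m k) $$ (i, j) / fact k)"
 using assms unfolding mat_exp_def by auto

lemma mat_exp_carrier [simp]: "X : carrier_mat m m ==> mat_exp X : carrier_mat m m"
 unfolding mat_exp_def by auto

text \<open>An entry of a conjugate is a fixed finite linear combination of entries, so conjugation
  passes through the series.\<close>

lemma mat_exp_conj:
 assumes g: "g : O2 d" and X: "X : Mat d"
 shows "mat_exp (g * X * finv d g) = g * mat_exp X * finv d g"
proof (rule eq_matI)
 let ?m = "d + 4"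
 note gc = O2_carrier[OF g]
 have Y: "g * X * finv d g : carrier_mat ?m ?m" using mult_carrier_mat[OF mult_carrier_mat[OF gc X] finv_carrier] .
 have P: "(g * X * finv d g) ^\<^sub>m k = g * X ^\<^sub>m k * finv d g" for k
 proof (induction k)
  case 0
  have "dim_row (g * X * finv d g) = ?m" by (rule carrier_matD(1)[OF Y])
  then show ?case using X O2_right[OF g] gc by (simp add: right_mult_one_mat[OF gc])
 next
  case (Suc k)
  show ?case using cj_elem_hom[OF g pow_carrier_mat[OF X] X, of k] by (simp add: Suc)
 qed
 fix i j assume "i < dim_row (g * mat_exp X * finv d g)" "j < dim_col (g * mat_exp X * finv d g)"
 then have i: "i < ?m" and j: "j < ?m" using gc by auto
 have e: "(g * A * finv d g) $$ (i, j) = (\<Sum>l<?m. \<Sum>q<?m. g $$ (i, q) * finv d g $$ (l, j) * A $$ (q, l))"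
  if A: "A : carrier_mat ?m ?m" for A
  unfolding index_mult_sum[OF mult_carrier_mat[OF gc A] finv_carrier i j]
 proof (rule sum.cong[OF refl])
  fix l assume "l : {..<?m}"
  then have l: "l < ?m" by simp
  show "(g * A) $$ (i, l) * finv d g $$ (l, j) = (\<Sum>q<?m. g $$ (i, q) * finv d g $$ (l, j) * A $$ (q, l))"
   unfolding index_mult_sum[OF gc A i l] sum_distrib_right by (rule sum.cong[OF refl]) (simp only: mult_ac)
 qed
 have s: "(%k. (X ^\<^sub>m k) $$ (q, l) / fact k) sums (mat_exp X $$ (q, l))" if "q < ?m" "l < ?m" for q l
  unfolding mat_exp_index[OF X that] by (rule summable_sums[OF summable_exp_entries[OF X that]])
 have "(%k. \<Sum>l<?m. \<Sum>q<?m. g $$ (i, q) * finv d g $$ (l, j) * ((X ^\<^sub>m k) $$ (q, l) / fact k))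
   sums (\<Sum>l<?m. \<Sum>q<?m. g $$ (i, q) * finv d g $$ (l, j) * mat_exp X $$ (q, l))"
  by (intro sums_sum sums_mult s) (simp_all only: lessThan_iff)
 moreover have "(\<Sum>l<?m. \<Sum>q<?m. g $$ (i, q) * finv d g $$ (l, j) * ((X ^\<^sub>m k) $$ (q, l) / fact k))
   = ((g * X * finv d g) ^\<^sub>m k) $$ (i, j) / fact k" for k
  unfolding P e[OF pow_carrier_mat[OF X]] sum_divide_distrib times_divide_eq_right ..
 ultimately have "mat_exp (g * X * finv d g) $$ (i, j) = (\<Sum>l<?m. \<Sum>q<?m. g $$ (i, q) * finv d g $$ (l, j) * mat_exp X $$ (q, l))"
  unfolding mat_exp_index[OF Y i j] by (simp only: sums_iff)
 also have "\<dots> = (g * mat_exp X * finv d g) $$ (i, j)" by (rule e[symmetric]) (simp add: X)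
 finally show "mat_exp (g * X * finv d g) $$ (i, j) = (g * mat_exp X * finv d g) $$ (i, j)" .
qed (use O2_carrier[OF g] in \<open>simp_all add: mat_exp_def\<close>)

section \<open>Lie algebras of conjugates and of the standard planes\<close>

lemma lie_algebra_iff:
 "X : lie_algebra (d + 2) S \<longleftrightarrow> X : Mat d & (\<forall>t. mat_exp (t \<cdot>\<^sub>m X) : S)"
proof -
 have e: "d + 2 + 2 = d + 4" by simp
 show ?thesis unfolding lie_algebra_def e by (simp only: mem_Collect_eq)
qed

lemma lie_algebra_cj_sub:
 assumes g: "g : O2 d" and X: "X : lie_algebra (d + 2) S"
 shows "g * X * finv d g : lie_algebra (d + 2) (cj d g S)"
proof -
 note gc = O2_carrier[OF g]
 have Xc: "X : Mat d" and XS: "!!t. mat_exp (t \<cdot>\<^sub>m X) : S"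
  using X unfolding lie_algebra_iff by blast+
 have Y: "g * X * finv d g : Mat d" using mult_carrier_mat[OF mult_carrier_mat[OF gc Xc] finv_carrier] .
 have "t \<cdot>\<^sub>m (g * X * finv d g) = g * (t \<cdot>\<^sub>m X) * finv d g" for t
  using mult_smult_assoc_mat[OF mult_carrier_mat[OF gc Xc] finv_carrier[of d g], of t] mult_smult_distrib[OF gc Xc, of t] by simp
 then have "mat_exp (t \<cdot>\<^sub>m (g * X * finv d g)) = g * mat_exp (t \<cdot>\<^sub>m X) * finv d g" for t
  using mat_exp_conj[OF g smult_carrier_mat[OF Xc], of t] by (simp only:)
 then have "mat_exp (t \<cdot>\<^sub>m (g * X * finv d g)) : cj d g S" for t
  unfolding cj_def by (rule image_eqI[OF _ XS])
 then show ?thesis unfolding lie_algebra_iff using Y by blast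
qed

lemma lie_algebra_cj:
 assumes g: "g : O2 d" and S: "S \<subseteq> Mat d"
 shows "lie_algebra (d + 2) (cj d g S) = cj d g (lie_algebra (d + 2) S)"
proof
 have sub: "cj d h (lie_algebra (d + 2) R) \<subseteq> lie_algebra (d + 2) (cj d h R)" if "h : O2 d" for h R
  using lie_algebra_cj_sub[OF that] unfolding cj_def by (rule image_subsetI)
 show "cj d g (lie_algebra (d + 2) S) \<subseteq> lie_algebra (d + 2) (cj d g S)" by (rule sub[OF g])
 have c: "lie_algebra (d + 2) R \<subseteq> Mat d" for R using lie_algebra_iff by blast
 have "cj d (finv d g) (lie_algebra (d + 2) (cj d g S)) \<subseteq> lie_algebra (d + 2) S"
  using sub[OF O2_finv[OF g], of "cj d g S"] unfolding cj_finv(1)[OF g S] .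
 then show "lie_algebra (d + 2) (cj d g S) \<subseteq> cj d g (lie_algebra (d + 2) S)"
  using cj_mono[of "cj d (finv d g) (lie_algebra (d + 2) (cj d g S))" "lie_algebra (d + 2) S" d g]
  unfolding cj_finv(2)[OF g c] by blast
qed

lemma smult_pow_index:
 fixes X :: "real mat"
 assumes X: "X : carrier_mat m m" and ij: "i < m" "j < m"
 shows "((t \<cdot>\<^sub>m X) ^\<^sub>m k) $$ (i, j) = (X ^\<^sub>m k) $$ (i, j) * t ^ k"
 using ij
proof (induction k arbitrary: i j)
 case 0
 then show ?case using X by simp
next
 case (Suc k)
 have tX: "t \<cdot>\<^sub>m X : carrier_mat m m" using X by simp
 have "((t \<cdot>\<^sub>m X) ^\<^sub>m Suc k) $$ (i, j) = (\<Sum>l<m. ((t \<cdot>\<^sub>m X) ^\<^sub>m k) $$ (i, l) * (t \<cdot>\<^sub>m X) $$ (l, j))"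
  using index_mult_sum[OF pow_carrier_mat[OF tX] tX Suc.prems, of k] by simp
 also have "\<dots> = (\<Sum>l<m. (X ^\<^sub>m k) $$ (i, l) * X $$ (l, j) * t ^ Suc k)"
  by (rule sum.cong[OF refl]) (use Suc X in simp)
 also have "\<dots> = (X ^\<^sub>m Suc k) $$ (i, j) * t ^ Suc k"
  using index_mult_sum[OF pow_carrier_mat[OF X] X Suc.prems, of k] by (simp add: sum_distrib_right)
 finally show ?case .
qed

lemma mat_exp_diff_quotient:
 fixes X :: "real mat"
 assumes X: "X : carrier_mat m m" and ij: "i < m" "j < m"
 shows "((%t. (mat_exp (t \<cdot>\<^sub>m X) $$ (i, j) - (if i = j then 1 else 0)) / t) \<longlongrightarrow> X $$ (i, j)) (at 0)"
proof -
 define c where "c k = (X ^\<^sub>m k) $$ (i, j) / fact k" for k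
 have tX: "t \<cdot>\<^sub>m X : carrier_mat m m" for t using X by simp
 have e: "((t \<cdot>\<^sub>m X) ^\<^sub>m k) $$ (i, j) / fact k = c k * t ^ k" for t k
  unfolding smult_pow_index[OF X ij] c_def by simp
 have sm: "summable (%k. c k * t ^ k)" for t using summable_exp_entries[OF tX ij, of t] unfolding e .
 have F: "mat_exp (t \<cdot>\<^sub>m X) $$ (i, j) = (\<Sum>k. c k * t ^ k)" for t unfolding mat_exp_index[OF tX ij] e ..
 have "((%t. \<Sum>k. c k * t ^ k) has_field_derivative (\<Sum>k. diffs c k * 0 ^ k)) (at 0)"
  by (rule termdiffs_strong_converges_everywhere) (rule sm)
 moreover have "(\<Sum>k. diffs c k * 0 ^ k) = X $$ (i, j)"
  unfolding powser_zero diffs_def c_def using X by simp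
 moreover have "(\<Sum>k. c k * 0 ^ k) = (if i = j then 1 else 0)"
  unfolding powser_zero c_def using X ij by simp
 ultimately show ?thesis unfolding F has_field_derivative_iff by simp
qed

text \<open>Nothing is known about how the chosen exponent \<open>u t\<close> depends on t. The
  difference quotients at 0 of the entries of exp(t X) give limits for the coordinates divided by t,
  one after the other, since products of two such coordinates are o(t). The limit of u t / t lies in
  the closed subspace \<open>T\<close>, and its matrix is X.\<close>

lemma lie_algebra_plane_sub:
 assumes T: "T \<subseteq> Nd d" "subspace T" "closed T" and X: "X : lie_algebra (d + 2) (nexp d ` T)"
 shows "X : nilX d ` T"
proof -
 have Xc: "X : Mat d" and XT: "!!t. mat_exp (t \<cdot>\<^sub>m X) : nexp d ` T"
  using X unfolding lie_algebra_iff by blast+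
 have "\<forall>t. \<exists>u. u : T & mat_exp (t \<cdot>\<^sub>m X) = nexp d u" using XT by blast
 then obtain u where uT: "!!t. u t : T" and ue: "!!t. mat_exp (t \<cdot>\<^sub>m X) = nexp d (u t)" by metis
 define p where "p t = fst (u t)" for t
 define x where "x t = fst (snd (u t))" for t
 define y where "y t = fst (snd (snd (u t)))" for t
 define e where "e t = snd (snd (snd (u t)))" for t
 have uu: "u t = (p t, x t, y t, e t)" for t by (simp add: p_def x_def y_def e_def)
 have R: "x t : Rd d" "y t : Rd d" for t using subsetD[OF T(1) uT[of t]] unfolding uu by simp_all
 have L: "((%t. (nexp d (p t, x t, y t, e t) $$ (i, j) - (if i = j then 1 else 0)) / t) \<longlongrightarrow> X $$ (i, j)) (at 0)"
  if "i < d + 4" "j < d + 4" for i j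
  using mat_exp_diff_quotient[OF Xc that] unfolding ue uu .
 have small: "(f \<longlongrightarrow> 0) (at 0)" if "((%t. f t / t) \<longlongrightarrow> a) (at 0)" for f :: "real => real" and a
 proof -
  have "((%t. f t / t * t) \<longlongrightarrow> a * 0) (at 0)" by (intro tendsto_mult that tendsto_ident_at)
  then have "((%t. f t / t * t) \<longlongrightarrow> 0) (at 0)" by simp
  then show ?thesis by (rule Lim_transform_eventually) (auto simp: eventually_at_filter)
 qed
 have prod: "((%t. f t * g t / t) \<longlongrightarrow> 0) (at 0)"
  if "((%t. f t / t) \<longlongrightarrow> a) (at 0)" "((%t. g t / t) \<longlongrightarrow> b) (at 0)" for f g :: "real => real" and a b
  using tendsto_mult[OF that(1) small[OF that(2)]] by simp
 have lp: "((%t. p t / t) \<longlongrightarrow> X $$ (0, 1)) (at 0)" using L[of 0 1] by (simp add: nexp_index)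
 have ly: "((%t. fcoord (y t) k / t) \<longlongrightarrow> X $$ (1, k + 2)) (at 0)" if "k < d" for k
  using L[of 1 "k + 2"] that by (simp add: nexp_index)
 have lx: "((%t. fcoord (x t) k / t) \<longlongrightarrow> X $$ (0, k + 2)) (at 0)" if "k < d" for k
 proof -
  have "((%t. (fcoord (x t) k + p t * fcoord (y t) k / 2) / t) \<longlongrightarrow> X $$ (0, k + 2)) (at 0)"
   using L[of 0 "k + 2"] that by (simp add: nexp_index)
  from tendsto_diff[OF this tendsto_mult[OF tendsto_const[of "1 / 2"] prod[OF lp ly[OF that]]]]
  show ?thesis by (simp add: diff_divide_distrib[symmetric] add_divide_distrib)
 qed
 have sums: "((%t. inner (a t) (b t) / t) \<longlongrightarrow> 0) (at 0)"
  if "!!t. a t : Rd d" "!!k. k < d ==> ((%t. fcoord (a t) k / t) \<longlongrightarrow> A k) (at 0)"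
   "!!k. k < d ==> ((%t. fcoord (b t) k / t) \<longlongrightarrow> B k) (at 0)" for a b A B
 proof -
  have "((%t. \<Sum>k<d. fcoord (a t) k * fcoord (b t) k / t) \<longlongrightarrow> (\<Sum>k<d. 0)) (at 0)"
   by (intro tendsto_sum prod[OF that(2,3)]) simp_all
  then show ?thesis by (simp add: inner_Rd[OF that(1)] sum_divide_distrib)
 qed
 have ixy: "((%t. inner (x t) (y t) / t) \<longlongrightarrow> 0) (at 0)" by (rule sums[OF R(1) lx ly])
 have ixx: "((%t. inner (x t) (x t) / t) \<longlongrightarrow> 0) (at 0)" by (rule sums[OF R(1) lx lx])
 have iyy: "((%t. inner (y t) (y t) / t) \<longlongrightarrow> 0) (at 0)" by (rule sums[OF R(2) ly ly])
 have py: "((%t. p t * inner (y t) (y t) / t) \<longlongrightarrow> 0) (at 0)" by (rule prod[OF lp iyy])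
 have ppy: "((%t. p t * (p t * inner (y t) (y t)) / t) \<longlongrightarrow> 0) (at 0)" by (rule prod[OF lp py])
 have le: "((%t. e t / t) \<longlongrightarrow> X $$ (0, d + 2)) (at 0)"
 proof -
  have "((%t. (e t - inner (x t) (y t) / 2 - p t * inner (y t) (y t) / 6) / t) \<longlongrightarrow> X $$ (0, d + 2)) (at 0)"
   using L[of 0 "d + 2"] by (simp add: nexp_index)
  from tendsto_add[OF this tendsto_add[OF tendsto_mult[OF tendsto_const[of "1 / 2"] ixy] tendsto_mult[OF tendsto_const[of "1 / 6"] py]]]
  show ?thesis by (simp add: diff_divide_distrib)
 qed
 define x' where "x' = (\<Sum>k<d. X $$ (0, k + 2) *\<^sub>R ax k)"
 define y' where "y' = (\<Sum>k<d. X $$ (1, k + 2) *\<^sub>R ax k)"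
 define u' where "u' = (X $$ (0, 1), x', y', X $$ (0, d + 2))"
 have f': "fcoord x' k = X $$ (0, k + 2)" "fcoord y' k = X $$ (1, k + 2)" if "k < d" for k
  unfolding x'_def y'_def using that sum_delta_lessThan(3)[OF that] by (simp_all add: if_distrib sum_delta_lessThan)
 have vec: "((%t. (1 / t) *\<^sub>R z t) \<longlongrightarrow> (\<Sum>k<d. Z k *\<^sub>R ax k)) (at 0)"
  if "!!t. z t : Rd d" "!!k. k < d ==> ((%t. fcoord (z t) k / t) \<longlongrightarrow> Z k) (at 0)" for z Z
 proof -
  have "((%t. \<Sum>k<d. (fcoord (z t) k / t) *\<^sub>R ax k) \<longlongrightarrow> (\<Sum>k<d. Z k *\<^sub>R ax k)) (at 0)"
   by (intro tendsto_sum tendsto_scaleR tendsto_const that(2)) simp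
  moreover have "(\<Sum>k<d. (fcoord (z t) k / t) *\<^sub>R ax k) = (1 / t) *\<^sub>R z t" for t
  proof -
   have "(1 / t) *\<^sub>R z t = (1 / t) *\<^sub>R (\<Sum>k<d. fcoord (z t) k *\<^sub>R ax k)" using Rd_expansion[OF that(1)[of t]] by (rule arg_cong)
   also have "\<dots> = (\<Sum>k<d. (fcoord (z t) k / t) *\<^sub>R ax k)" by (simp add: scaleR_sum_right)
   finally show ?thesis by (rule sym)
  qed
  ultimately show ?thesis by (simp only:)
 qed
 have "((%t. (p t / t, (1 / t) *\<^sub>R x t, (1 / t) *\<^sub>R y t, e t / t)) \<longlongrightarrow> u') (at 0)"
  unfolding u'_def x'_def y'_def by (intro tendsto_Pair lp le vec R lx ly)
 then have lu: "((%t. (1 / t) *\<^sub>R u t) \<longlongrightarrow> u') (at 0)" unfolding uu by simp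
 have "u' : T"
  by (rule Lim_in_closed_set[OF T(3) _ _ lu]) (simp_all add: subspace_scale[OF T(2) uT] always_eventually)
 moreover have "X = nilX d u'"
 proof (rule eq_matI)
  fix i j assume "i < dim_row (nilX d u')" "j < dim_col (nilX d u')"
  then have i: "i < d + 4" and j: "j < d + 4" by simp_all
  have fin: "X $$ (i, j) = a" if "((%t. (nexp d (p t, x t, y t, e t) $$ (i, j) - (if i = j then 1 else 0)) / t) \<longlongrightarrow> a) (at 0)" for a
   by (rule tendsto_unique[OF _ L[OF i j] that]) simp
  have m: "((%t. - (f t / t)) \<longlongrightarrow> - a) (at 0)" if "((%t. f t / t) \<longlongrightarrow> a) (at 0)" for f :: "real => real" and a
   using tendsto_minus[OF that] by simp
  have yx: "((%t. (p t * fcoord (y t) k / 2 - fcoord (x t) k) / t) \<longlongrightarrow> - X $$ (0, k + 2)) (at 0)" if "k < d" for k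
   using tendsto_diff[OF tendsto_mult[OF tendsto_const[of "1 / 2"] prod[OF lp ly[OF that]]] lx[OF that]]
   by (simp add: diff_divide_distrib)
  have c1: "((%t. (- (p t * e t) - inner (x t) (x t) / 2 + (p t)\<^sup>2 * inner (y t) (y t) / 24) / t) \<longlongrightarrow> 0) (at 0)"
   using tendsto_add[OF tendsto_add[OF tendsto_minus[OF prod[OF lp le]] tendsto_mult[OF tendsto_const[of "- (1 / 2)"] ixx]] tendsto_mult[OF tendsto_const[of "1 / 24"] ppy]]
   by (simp add: diff_divide_distrib add_divide_distrib power2_eq_square mult.assoc)
  have c2: "((%t. - (inner (y t) (y t)) / 2 / t) \<longlongrightarrow> 0) (at 0)"
   using tendsto_mult[OF tendsto_const[of "- (1 / 2)"] iyy] by simp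
  have c3: "((%t. (- e t - inner (x t) (y t) / 2 + p t * inner (y t) (y t) / 6) / t) \<longlongrightarrow> - X $$ (0, d + 2)) (at 0)"
   using tendsto_add[OF tendsto_add[OF tendsto_minus[OF le] tendsto_mult[OF tendsto_const[of "- (1 / 2)"] ixy]] tendsto_mult[OF tendsto_const[of "1 / 6"] py]]
   by (simp add: diff_divide_distrib add_divide_distrib)
  show "X $$ (i, j) = nilX d u' $$ (i, j)" unfolding u'_def
   by (cases rule: index_cases[OF i]; cases rule: index_cases[OF j]; (simp add: nilX_index f'; fail)?;
    rule fin; simp add: nexp_index nilX_index f' m[OF lp] m[OF ly] yx c1 c2[simplified] c3)
 qed (use Xc in auto)
 ultimately show ?thesis by blast
qed

lemma lie_algebra_standard:
 assumes d: "1 <= d" and T: "T : Std d"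
 shows "lie_algebra (d + 2) (nexp d ` T) = nilX d ` T"
proof
 note TN = Std_props(2)[OF d T]
 obtain \<epsilon> where "T = ty1 \<epsilon> | T = ty2 \<epsilon> | T = ty3 \<epsilon>" using Std_D[OF T] by blast
 then have S: "subspace T" "closed T" using ty_subspace ty_closed by blast+
 show "lie_algebra (d + 2) (nexp d ` T) \<subseteq> nilX d ` T"
  by (rule subsetI) (rule lie_algebra_plane_sub[OF TN S])
 show "nilX d ` T \<subseteq> lie_algebra (d + 2) (nexp d ` T)"
 proof (rule image_subsetI)
  fix u assume u: "u : T"
  have "mat_exp (t \<cdot>\<^sub>m nilX d u) = nexp d (t *\<^sub>R u)" for t
   unfolding nilX_scaleR[symmetric] by (rule mat_exp_nilX[OF subsetD[OF TN subspace_scale[OF S(1) u]]])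
  then show "nilX d u : lie_algebra (d + 2) (nexp d ` T)"
   unfolding lie_algebra_iff using subspace_scale[OF S(1) u] by simp
 qed
qed

lemma coords_eq: "coords (d + 2) a b c = vec d (fcoord (a *\<^sub>R ax 0 + b *\<^sub>R ax 1 + c *\<^sub>R ax 2))"
proof (rule eq_vecI)
 fix i assume "i < dim_vec (vec d (fcoord (a *\<^sub>R ax 0 + b *\<^sub>R ax 1 + c *\<^sub>R ax 2)))"
 then have i: "i < d" by simp
 consider "i = 0" | "i = 1" | "i = 2" | "3 <= i" by linarith
 then show "coords (d + 2) a b c $ i = vec d (fcoord (a *\<^sub>R ax 0 + b *\<^sub>R ax 1 + c *\<^sub>R ax 2)) $ i"
  by cases (use i in \<open>simp_all add: coords_def One_nat_def numeral_2_eq_2\<close>)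
qed (simp add: coords_def)

lemma type_eq:
 "type1 (d + 2) \<epsilon> = nilX d ` ty1 \<epsilon>" "type2 (d + 2) \<epsilon> = nilX d ` ty2 \<epsilon>" "type3 (d + 2) \<epsilon> = nilX d ` ty3 \<epsilon>"
proof -
 have n: "nil_mat (d + 2) p (coords (d + 2) a b c) (coords (d + 2) a' b' c') e =
   nilX d (p, a *\<^sub>R ax 0 + b *\<^sub>R ax 1 + c *\<^sub>R ax 2, a' *\<^sub>R ax 0 + b' *\<^sub>R ax 1 + c' *\<^sub>R ax 2, e)" for p a b c a' b' c' e
  unfolding nilX_def coords_eq by simp
 have 1: "nil_mat (d + 2) p (coords (d + 2) 0 0 0) (coords (d + 2) (\<epsilon> * p) 0 0) e = nilX d (p, 0, (\<epsilon> * p) *\<^sub>R ax 0, e)" for p e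
  unfolding n by simp
 have 2: "nil_mat (d + 2) p (coords (d + 2) s 0 0) (coords (d + 2) 0 (\<epsilon> * p) 0) 0 = nilX d (p, s *\<^sub>R ax 0, (\<epsilon> * p) *\<^sub>R ax 1, 0)" for p s
  unfolding n by simp
 have 3: "nil_mat (d + 2) 0 (coords (d + 2) s 0 (\<epsilon> * r)) (coords (d + 2) 0 r 0) 0 = nilX d (0, s *\<^sub>R ax 0 + (\<epsilon> * r) *\<^sub>R ax 2, r *\<^sub>R ax 1, 0)" for s r
  unfolding n by simp
 show "type1 (d + 2) \<epsilon> = nilX d ` ty1 \<epsilon>"
  unfolding type1_def 1 by (intro subset_antisym subsetI) (use ty_I(1) in blast, elim imageE ty1_E, blast)
 show "type2 (d + 2) \<epsilon> = nilX d ` ty2 \<epsilon>"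
  unfolding type2_def 2 by (intro subset_antisym subsetI) (use ty_I(2) in blast, elim imageE ty2_E, blast)
 show "type3 (d + 2) \<epsilon> = nilX d ` ty3 \<epsilon>"
  unfolding type3_def 3 by (intro subset_antisym subsetI) (use ty_I(3) in blast, elim imageE ty3_E, blast)
qed

text \<open>The coordinates of u from the fourth on vanish, so on the added indices the larger
  exponential is the identity. The number 5 is 3 + 2.\<close>

lemma SO2_embed_nexp:
 assumes d: "3 <= d" and u: "u : Nd 3" shows "SO2_embed 5 (d + 2) (nexp 3 u) = nexp d u"
proof (rule eq_matI)
 obtain p x y e where uu: "u = (p, x, y, e)" by (cases u)
 have z: "fcoord x k = 0" "fcoord y k = 0" if "3 <= k" for k using u that Rd_D unfolding uu by auto
 fix i j assume "i < dim_row (nexp d u)" "j < dim_col (nexp d u)"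
 then have i: "i < d + 4" and j: "j < d + 4" by simp_all
 have sh: "shrink_index 5 (d + 2) 0 = 0" "shrink_index 5 (d + 2) 1 = 1" "k < 3 ==> shrink_index 5 (d + 2) (k + 2) = k + 2"
  "shrink_index 5 (d + 2) (d + 2) = 3 + 2" "shrink_index 5 (d + 2) (d + 3) = 3 + 3" for k
  using d by (auto simp: shrink_index_def)
 have E: "SO2_embed 5 (d + 2) (nexp 3 u) $$ (i, j) = (if i : {5..<d + 2} | j : {5..<d + 2} then (if i = j then 1 else 0)
   else nexp 3 u $$ (shrink_index 5 (d + 2) i, shrink_index 5 (d + 2) j))"
  unfolding SO2_embed_def using i j by simp
 have far: "\<exists>k. a = k + 2 & 3 <= k & k < d" if "a : {5..<d + 2}" for a
  by (rule exI[of _ "a - 2"]) (use that in auto)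
 have near: "a = 0 | a = 1 | (\<exists>k. k < 3 & a = k + 2) | a = d + 2 | a = d + 3" if "a \<notin> {5..<d + 2}" "a < d + 4" for a
  using that by (cases rule: index_cases[OF that(2)]) auto
 have dk: "k < 3 ==> k < d" for k using d by simp
 show "SO2_embed 5 (d + 2) (nexp 3 u) $$ (i, j) = nexp d u $$ (i, j)"
 proof (cases "i : {5..<d + 2}")
  case True
  then obtain k where k: "i = k + 2" "3 <= k" "k < d" using far by blast
  have "nexp d u $$ (i, j) = (if i = j then 1 else 0)"
   unfolding uu k(1) by (cases rule: index_cases[OF j]) (use k in \<open>simp_all add: nexp_index z\<close>)
  then show ?thesis unfolding E using True by simp
 next
  case i': False
  show ?thesis
  proof (cases "j : {5..<d + 2}")
   case True
   then obtain k where k: "j = k + 2" "3 <= k" "k < d" using far by blast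
   have "nexp d u $$ (i, j) = (if i = j then 1 else 0)"
    unfolding uu k(1) by (cases rule: index_cases[OF i]) (use k in \<open>simp_all add: nexp_index z\<close>)
   then show ?thesis unfolding E using True by simp
  next
   case j': False
   have "nexp 3 u $$ (shrink_index 5 (d + 2) i, shrink_index 5 (d + 2) j) = nexp d u $$ (i, j)"
    using near[OF i' i] near[OF j' j] unfolding uu
    by (elim disjE exE conjE; simp only: sh nexp_index dk)
   then show ?thesis unfolding E by (simp only: i' j' if_False simp_thms)
  qed
 qed
qed (simp_all add: SO2_embed_def)

section \<open>Conjugacy classes\<close>

text \<open>The planes are distinct because \<open>iv\<close> separates them. The dimension argument
  0 is admissible since the criteria \<open>sq_iff\<close>, \<open>cb_iff\<close> and
  \<open>rk_iff\<close> hold for every d.\<close>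

lemma standard_card:
 "card (Std d) = (if 3 <= d then 6 else if 2 <= d then 5 else 3)"
proof -
 have contrast: "P a ==> \<not> P b ==> a ~= b" for P :: "nil set => bool" and a b by (rule notI) simp
 have n1: "ty1 0 ~= ty1 1" "ty1 0 ~= ty2 1" "ty2 0 ~= ty1 1" "ty2 0 ~= ty2 1" "ty3 \<epsilon> ~= ty1 1" "ty3 \<epsilon> ~= ty2 1" for \<epsilon>
  by (rule contrast[where P = "%T. fst (iv 0 T)"], rule iv1, rule iv1)+
 have n2: "ty1 1 ~= ty2 1" "ty1 0 ~= ty3 \<epsilon>" "ty2 0 ~= ty3 \<epsilon>" for \<epsilon>
  by (rule contrast[where P = "%T. fst (snd (iv 0 T))"], rule iv2, rule iv2)+
 have n3: "ty1 0 ~= ty2 0" by (rule contrast[where P = "%T. fst (snd (snd (iv 0 T)))"], rule iv3, rule iv3)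
 have n4: "ty3 0 ~= ty3 1" by (rule contrast[where P = "%T. snd (snd (snd (iv 0 T)))"], rule iv4, rule iv4)
 note n = n1 n2 n3 n4
 have i: "ty1 0 \<notin> {ty1 1, ty2 0, ty2 1, ty3 0, ty3 1}" "ty1 1 \<notin> {ty2 0, ty2 1, ty3 0, ty3 1}"
  "ty2 0 \<notin> {ty2 1, ty3 0, ty3 1}" "ty2 1 \<notin> {ty3 0, ty3 1}" "ty3 0 \<notin> {ty3 1}"
  by (simp_all only: insert_iff empty_iff n n[THEN not_sym] simp_thms)
 have "Std d = (if 3 <= d then {ty1 0, ty1 1, ty2 0, ty2 1, ty3 0, ty3 1} else if 2 <= d then {ty1 0, ty1 1, ty2 0, ty2 1, ty3 0} else {ty1 0, ty1 1, ty2 0})"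
  unfolding Std_def by (cases "3 <= d"; cases "2 <= d") auto
 moreover have "card {ty1 0, ty1 1, ty2 0, ty2 1, ty3 0, ty3 1} = 6" "card {ty1 0, ty1 1, ty2 0, ty2 1, ty3 0} = 5" "card {ty1 0, ty1 1, ty2 0} = 3"
  using i by (simp_all add: card_insert_if)
 ultimately show ?thesis by simp
qed

lemma minimal_carrier_mat: "H : minimal_cds_in_N (d + 2) ==> H \<subseteq> Mat d"
 unfolding minimal_cds_in_N_def minimal_cds_def mem_Collect_eq by (elim conjE, rule cds_carrier_mat)

lemma SO2_O2: "g : carrier (SO d) ==> g : O2 d"
 unfolding carrier_SO2 by (elim CollectE conjE)

lemma SO2_finv: "g : carrier (SO d) ==> finv d g : carrier (SO d)"
 using inv_SO2[of g d] group.inv_closed[OF group_SO2, of g d] by simp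

text \<open>Makes the class of a subgroup equal to the class of each of its conjugates, so that
  classes can be represented by standard planes.\<close>

lemma conj_trans_iff:
 assumes H: "H \<subseteq> Mat d" and g: "g : carrier (SO d)"
 shows "conj_subgroups (d + 2) (cj d g H) K \<longleftrightarrow> conj_subgroups (d + 2) H K"
proof -
 note gO = SO2_O2[OF g]
 have mult: "h * k : carrier (SO d)" if "h : carrier (SO d)" "k : carrier (SO d)" for h k
  using monoid.m_closed[OF group.is_monoid[OF group_SO2] that] by simp
 have step: "conj_subgroups (d + 2) S K" if S: "S \<subseteq> Mat d" and k: "k : carrier (SO d)"
  and c: "conj_subgroups (d + 2) (cj d k S) K" for S k
 proof -
  obtain h where h: "h : carrier (SO d)" "K = cj d h (cj d k S)"
   using c unfolding conj_subgroups_iff[OF cj_carrier_mat[OF SO2_O2[OF k] S]] by blast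
  have "K = cj d (h * k) S" unfolding h(2) by (rule cj_cj[OF SO2_O2[OF h(1)] SO2_O2[OF k] S])
  then show ?thesis unfolding conj_subgroups_iff[OF S] using mult[OF h(1) k] by blast
 qed
 have e: "cj d (finv d g) (cj d g H) = H" by (rule cj_finv(1)[OF gO H])
 show ?thesis
 proof
  assume "conj_subgroups (d + 2) (cj d g H) K"
  then show "conj_subgroups (d + 2) H K" by (rule step[OF H g])
 next
  assume "conj_subgroups (d + 2) H K"
  then have "conj_subgroups (d + 2) (cj d (finv d g) (cj d g H)) K" unfolding e .
  then show "conj_subgroups (d + 2) (cj d g H) K" by (rule step[OF cj_carrier_mat[OF gO H] SO2_finv[OF g]])
 qed
qed

text \<open>Sending a standard plane to the class of its exponential is onto by
  \<open>minimal_cds_in_N_standard\<close> and injective by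
  \<open>standard_not_conj\<close>.\<close>

lemma card_classes:
 assumes d: "1 <= d" shows "card (minimal_cds_classes (d + 2)) = card (Std d)"
proof -
 let ?M = "minimal_cds_in_N (d + 2)"
 define cl where "cl H = {K \<in> ?M. conj_subgroups (d + 2) H K}" for H
 have q: "minimal_cds_classes (d + 2) = cl ` ?M"
 proof -
  have "{(H, K). H : ?M & K : ?M & conj_subgroups (d + 2) H K} `` {H} = cl H" if "H : ?M" for H
   by (rule Set.set_eqI) (simp add: cl_def that)
  then show ?thesis unfolding minimal_cds_classes_def quotient_def UNION_singleton_eq_range by (rule image_cong[OF refl])
 qed
 have "cl ` ?M = (%T. cl (nexp d ` T)) ` Std d"
 proof (intro subset_antisym image_subsetI)
  fix H assume "H : ?M"
  then obtain g T where g: "g : carrier (SO d)" "T : Std d" "H = cj d g (nexp d ` T)"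
   by (rule minimal_cds_in_N_standard[OF d])
  have "cl H = cl (nexp d ` T)" unfolding cl_def g(3) conj_trans_iff[OF nexp_image_mat g(1)] ..
  then show "cl H : (%T. cl (nexp d ` T)) ` Std d" using g(2) by (rule image_eqI)
 next
  fix T assume "T : Std d"
  then show "cl (nexp d ` T) : cl ` ?M" by (intro imageI standard_in_minimal[OF d])
 qed
 moreover have "inj_on (%T. cl (nexp d ` T)) (Std d)"
 proof (rule inj_onI)
  fix T T' assume T: "T : Std d" "T' : Std d" and e: "cl (nexp d ` T) = cl (nexp d ` T')"
  have one: "1\<^sub>m (d + 4) : carrier (SO d)" by (rule carrier_SO2_I[OF O2_one]) simp
  have "nexp d ` T' : cl (nexp d ` T')"
   unfolding cl_def conj_subgroups_iff[OF nexp_image_mat] mem_Collect_eq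
   by (intro conjI standard_in_minimal[OF d T(2)] bexI[OF _ one]) (simp only: cj_one[OF nexp_image_mat])
  then have "nexp d ` T' : cl (nexp d ` T)" unfolding e .
  then have "conj_subgroups (d + 2) (nexp d ` T) (nexp d ` T')" unfolding cl_def by (elim CollectE conjE)
  then obtain g where "g : carrier (SO d)" "nexp d ` T' = cj d g (nexp d ` T)"
   unfolding conj_subgroups_iff[OF nexp_image_mat] by (elim bexE)
  then show "T = T'" by (intro standard_not_conj[OF d T SO2_O2]) (assumption, rule sym)
 qed
 ultimately show ?thesis unfolding q by (simp only: card_image)
qed

lemma conj_subalgebras_cj:
 assumes g: "g : carrier (SO d)" shows "conj_subalgebras (d + 2) U (cj d g U)"
 unfolding conj_subalgebras_def cj_def by (rule bexI[OF _ g]) (simp only: inv_SO2[OF g])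

lemma minimal_lie_algebra:
 assumes d: "1 <= d" and H: "H : minimal_cds_in_N (d + 2)"
 obtains T where "T : Std d" "conj_subalgebras (d + 2) (lie_algebra (d + 2) H) (nilX d ` T)"
  "conj_subgroups (d + 2) H (nexp d ` T)"
proof -
 obtain g T where g: "g : carrier (SO d)" "T : Std d" "H = cj d g (nexp d ` T)"
  by (rule minimal_cds_in_N_standard[OF d H])
 note gi = SO2_finv[OF g(1)]
 have e: "cj d (finv d g) H = nexp d ` T" unfolding g(3) by (rule cj_finv(1)[OF SO2_O2[OF g(1)] nexp_image_mat])
 have "cj d (finv d g) (lie_algebra (d + 2) H) = nilX d ` T"
  unfolding lie_algebra_cj[OF SO2_O2[OF gi] minimal_carrier_mat[OF H], symmetric] e by (rule lie_algebra_standard[OF d g(2)])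
 then have "conj_subalgebras (d + 2) (lie_algebra (d + 2) H) (nilX d ` T)"
  using conj_subalgebras_cj[OF gi, of "lie_algebra (d + 2) H"] by (simp only:)
 moreover have "conj_subgroups (d + 2) H (nexp d ` T)"
  unfolding conj_subgroups_iff[OF minimal_carrier_mat[OF H]] using e[symmetric] gi by (rule bexI)
 ultimately show ?thesis by (rule that[OF g(2)])
qed

lemma standard_types:
 "T : Std d ==> nilX m ` T : {type1 (m + 2) 0, type1 (m + 2) 1, type2 (m + 2) 0} \<union>
   (if 2 <= d then {type2 (m + 2) 1, type3 (m + 2) 0} else {}) \<union> (if 3 <= d then {type3 (m + 2) 1} else {})"
 unfolding type_eq by (erule Std_cases) (simp_all only: insert_iff Un_iff if_True simp_thms)

lemma classification_large:
 assumes n: "5 <= n"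
 shows "card (minimal_cds_classes n) = 6 &
    (\<forall>H\<in>minimal_cds_in_N n.
      \<exists>K. subgroup K (SO2 5) & conj_subgroups n H (SO2_embed 5 n ` K) &
        (\<exists>U\<in>{type1 5 0, type1 5 1, type2 5 0, type2 5 1, type3 5 0, type3 5 1}.
         conj_subalgebras 5 (lie_algebra 5 K) U))"
proof -
 obtain d where nd: "n = d + 2" "3 <= d"
 proof
  show "n = (n - 2) + 2" "3 <= n - 2" using n by simp_all
 qed
 have d: "1 <= d" using nd(2) by simp
 have five: "(5::nat) = 3 + 2" by simp
 have "\<exists>K. subgroup K (SO2 5) & conj_subgroups (d + 2) H (SO2_embed 5 (d + 2) ` K) &
        (\<exists>U\<in>{type1 5 0, type1 5 1, type2 5 0, type2 5 1, type3 5 0, type3 5 1}.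
         conj_subalgebras 5 (lie_algebra 5 K) U)"
  if H: "H : minimal_cds_in_N (d + 2)" for H
 proof -
  obtain T where T: "T : Std d" "conj_subgroups (d + 2) H (nexp d ` T)" by (rule minimal_lie_algebra[OF d H])
  \<comment> \<open>All six planes already use at most three coordinates, and \<open>Std d\<close>
    is the same set for every d >= 3; so the plane can be exponentiated in SO(2, 5).\<close>
  have T3: "T : Std 3" using T(1) nd(2) unfolding Std_def by simp
  have d3: "1 <= (3::nat)" by simp
  note P = Std_props[OF d3 T3]
  have sg: "subgroup (nexp 3 ` T) (SO2 5)"
   using P(1) unfolding cartan_decomposition_subgroup_def five by blast
  have emb: "SO2_embed 5 (d + 2) ` nexp 3 ` T = nexp d ` T"
   unfolding image_image by (intro image_cong refl SO2_embed_nexp[OF nd(2)] subsetD[OF P(2)])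
  have one: "1\<^sub>m (3 + 4) : carrier (SO2 (3 + 2))" by (rule carrier_SO2_I[OF O2_one]) simp
  have c: "cj 3 (1\<^sub>m (3 + 4)) (nilX 3 ` T) = nilX 3 ` T" by (rule cj_one) (intro image_subsetI nilX_carrier)
  have "conj_subalgebras (3 + 2) (lie_algebra (3 + 2) (nexp 3 ` T)) (nilX 3 ` T)"
   using conj_subalgebras_cj[OF one, of "nilX 3 ` T"] unfolding c lie_algebra_standard[OF d3 T3] .
  then have lie: "conj_subalgebras 5 (lie_algebra 5 (nexp 3 ` T)) (nilX 3 ` T)" unfolding five .
  have U: "nilX 3 ` T : {type1 5 0, type1 5 1, type2 5 0, type2 5 1, type3 5 0, type3 5 1}"
   using standard_types[OF T3, of 3] by (simp add: disj_assoc) satx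
  show ?thesis
  proof (intro exI[of _ "nexp 3 ` T"] conjI sg)
   show "conj_subgroups (d + 2) H (SO2_embed 5 (d + 2) ` nexp 3 ` T)" unfolding emb by (rule T(2))
   show "\<exists>U\<in>{type1 5 0, type1 5 1, type2 5 0, type2 5 1, type3 5 0, type3 5 1}. conj_subalgebras 5 (lie_algebra 5 (nexp 3 ` T)) U"
    by (rule bexI[where x = "nilX 3 ` T"]) (rule lie, rule U)
  qed
 qed
 then show ?thesis unfolding nd(1) using card_classes[OF d] standard_card[of d] nd(2) by simp
qed

lemma classification_4:
 "card (minimal_cds_classes 4) = 5 & (\<forall>H\<in>minimal_cds_in_N 4.
   \<exists>U\<in>{type1 4 0, type1 4 1, type2 4 0, type2 4 1, type3 4 0}. conj_subalgebras 4 (lie_algebra 4 H) U)"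
proof -
 have four: "(4::nat) = 2 + 2" by simp
 have d: "1 <= (2::nat)" by simp
 have "\<exists>U\<in>{type1 (2 + 2) 0, type1 (2 + 2) 1, type2 (2 + 2) 0, type2 (2 + 2) 1, type3 (2 + 2) 0}. conj_subalgebras (2 + 2) (lie_algebra (2 + 2) H) U"
  if H: "H : minimal_cds_in_N (2 + 2)" for H
 proof -
  obtain T where T: "T : Std 2" "conj_subalgebras (2 + 2) (lie_algebra (2 + 2) H) (nilX 2 ` T)" by (rule minimal_lie_algebra[OF d H])
  have "nilX 2 ` T : {type1 (2 + 2) 0, type1 (2 + 2) 1, type2 (2 + 2) 0, type2 (2 + 2) 1, type3 (2 + 2) 0}"
   using standard_types[OF T(1), of 2] by (simp add: disj_assoc) satx
  then show ?thesis using T(2) by (rule bexI[rotated])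
 qed
 moreover have "card (minimal_cds_classes (2 + 2)) = 5" unfolding card_classes[OF d] standard_card by simp
 ultimately show ?thesis unfolding four by blast
qed

lemma classification_3:
 "card (minimal_cds_classes 3) = 3 & (\<forall>H\<in>minimal_cds_in_N 3.
   \<exists>U\<in>{type1 3 0, type1 3 1, type2 3 0}. conj_subalgebras 3 (lie_algebra 3 H) U)"
proof -
 have three: "(3::nat) = 1 + 2" by simp
 have d: "1 <= (1::nat)" by simp
 have "\<exists>U\<in>{type1 (1 + 2) 0, type1 (1 + 2) 1, type2 (1 + 2) 0}. conj_subalgebras (1 + 2) (lie_algebra (1 + 2) H) U"
  if H: "H : minimal_cds_in_N (1 + 2)" for H
 proof -
  obtain T where T: "T : Std 1" "conj_subalgebras (1 + 2) (lie_algebra (1 + 2) H) (nilX 1 ` T)" by (rule minimal_lie_algebra[OF d H])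
  have "nilX 1 ` T : {type1 (1 + 2) 0, type1 (1 + 2) 1, type2 (1 + 2) 0}"
   using standard_types[OF T(1), of 1] by (simp add: disj_assoc)
  then show ?thesis using T(2) by (rule bexI[rotated])
 qed
 moreover have "card (minimal_cds_classes (1 + 2)) = 3" unfolding card_classes[OF d] standard_card by simp
 ultimately show ?thesis unfolding three by blast
qed

theorem theorem1p14:
  shows
    "(\<forall>n\<ge>5.
        card (minimal_cds_classes n) = 6 \<and>
        (\<forall>H\<in>minimal_cds_in_N n.
           \<exists>K. subgroup K (SO2 5) \<and> conj_subgroups n H (SO2_embed 5 n ` K) \<and>
               (\<exists>U\<in>{type1 5 0, type1 5 1, type2 5 0, type2 5 1, type3 5 0, type3 5 1}.
                  conj_subalgebras 5 (lie_algebra 5 K) U)))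
     \<and> (card (minimal_cds_classes 4) = 5 \<and>
        (\<forall>H\<in>minimal_cds_in_N 4.
           \<exists>U\<in>{type1 4 0, type1 4 1, type2 4 0, type2 4 1, type3 4 0}.
             conj_subalgebras 4 (lie_algebra 4 H) U))
     \<and> (card (minimal_cds_classes 3) = 3 \<and>
        (\<forall>H\<in>minimal_cds_in_N 3.
           \<exists>U\<in>{type1 3 0, type1 3 1, type2 3 0}.
             conj_subalgebras 3 (lie_algebra 3 H) U))"
  by (rule conjI[OF _ conjI[OF classification_4 classification_3]]) (intro allI impI classification_large)

end
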